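(* Let $L\in\mathbb{Z}^d$, $L\neq\mathbf 0$, let $A\in\mathbb{Z}^{d\times d}$ be a dilation matrix with determinant $2$, and let $\varphi_j,\psi_j$, $j\in\mathbb{N}\cup\{0\}$, be the functions constructed from $A$, $L$ and the sequences $\nu_j$ as described in the context. Then the set $$\Psi=\{\varphi_0\}\cup\{\psi_j(\cdot-A^{-j}k):\ j\in\mathbb{N}\cup\{0\},\ k\in\mathcal{L}_j\},$$ where $\mathcal{L}_j$ is a full collection of coset representatives of $\mathbb{Z}^d/A^j\mathbb{Z}^d$, forms a Parseval frame of $L_2(\mathbb{T}^d)$, and the following equalities hold true: $$\lim_{j\to\infty}\mathrm{UP}_L^{\mathbb{T}^d}(\varphi_j)=\frac14,\qquad \lim_{j\to\infty}\mathrm{UP}_L^{\mathbb{T}^d}(\psi_j)=\frac14\,\frac{(d+2)(d^2-2d+4)}{d^3}.$$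
   Context: $\mathbb{T}^d=\mathbb{R}^d/\mathbb{Z}^d$; $\langle\cdot,\cdot\rangle$ and $\|\cdot\|$ on $\mathbb{R}^d$ are the Euclidean inner product and norm. For $f\in L_2(\mathbb{T}^d)$, $\widehat f(k)=\int_{\mathbb{T}^d}f(x)e^{-2\pi i\langle k,x\rangle}dx$, $k\in\mathbb{Z}^d$. A sequence $(f_n)$ in a separable Hilbert space $H$ is a Parseval frame for $H$ if $\sum_n|\langle f,f_n\rangle|^2=\|f\|^2$ for all $f\in H$. Directional uncertainty product: put $\mathcal{A}_Lf(x)=e^{2\pi i\langle L,x\rangle}f(x)$ and $\mathcal{B}_Lf(x)=\frac{i}{2\pi}\sum_{n=1}^dL_n\frac{\partial f}{\partial x_n}(x)$. For $f\in H^1(\mathbb{T}^d)=\{f\in L_2(\mathbb{T}^d):\sum_{k\in\mathbb{Z}^d}\|k\|^2|\widehat f(k)|^2<\infty\}$ with $\langle\mathcal{A}_Lf,f\rangle\neq0$, $$\mathrm{UP}^{\mathbb{T}^d}_L(f)=\frac{1}{\|L\|^4}\left(\frac{\|f\|_{\mathbb{T}^d}^4}{|\langle\mathcal{A}_Lf,f\rangle|^2}-1\right)\left(\frac{\|\mathcal{B}_Lf\|_{\mathbb{T}^d}^2}{\|f\|_{\mathbb{T}^d}^2}-\frac{|\langle\mathcal{B}_Lf,f\rangle|^2}{\|f\|_{\mathbb{T}^d}^4}\right),$$ where $\|\cdot\|_{\mathbb{T}^d}$ and $\langle\cdot,\cdot\rangle$ are here the norm and inner product of $L_2(\mathbb{T}^d)$.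 Construction. A dilation matrix is an integer matrix all of whose eigenvalues are greater than $1$ in modulus. Since $\det A=2$, a full collection of coset representatives of $\mathbb{Z}^d/A\mathbb{Z}^d$ consists of two elements; denote this collection by $\{0,k_0\}$. Put $B=A^{\mathrm T}$, $$\mathrm{int}(K_j)=\mathbb{Z}^d\cap B^j(-1/2,1/2)^d,\qquad \overline{K}_j=\mathbb{Z}^d\cap B^j[-1/2,1/2]^d,$$ and $f_j(k)=\exp\left(-\frac{\|L\|^2\|k\|^2}{j(j-1)}\right)$ for $j\ge2$, with $f_1(0)=1$ (for $j=1$ only the value at $k=0$ is used). Let $\nu_j$, $j\ge1$, be the $B^j$-periodic sequence on $\mathbb{Z}^d$ (that is, $\nu_j(k+B^jp)=\nu_j(k)$ for all $k,p\in\mathbb{Z}^d$) defined by $$\nu_j(k)=\begin{cases}f_j(k),& k\in\mathrm{int}(K_{j-1}),\\ \left(1-f_j^2(k-B^{j-1}k_0)\right)^{1/2},& k-B^{j-1}k_0\in\mathrm{int}(K_{j-1}),\\ 1/\sqrt2,& k\in\overline{K}_{j-1}\setminus\mathrm{int}(K_{j-1}).\end{cases}$$ Define $\xi_j\in L_2(\mathbb{T}^d)$ by its Fourier coefficients $\widehat{\xi_j}(k)=\prod_{r=j+1}^\infty\nu_r(k)$ (the product converges; a product equal to zero is regarded as convergent). The scaling masks $\mu_j$, scaling functions $\varphi_j$, wavelet masks $\lambda_j$ and wavelet functions $\psi_j$ are defined by $$\mu_j(k)=\sqrt2\,\nu_j(k),\qquad \widehat{\varphi_j}(k)=2^{-j/2}\widehat{\xi_j}(k),$$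 $$\lambda_j(k)=e^{2\pi i\langle k_0,B^{-j}k\rangle}\mu_j(k+B^{j-1}k_0),\qquad \widehat{\psi_j}(k)=\lambda_{j+1}(k)\,\widehat{\varphi}_{j+1}(k).$$
   Formalization: The value 1/√2 of ν_j is also prescribed where k−B^{j−1}k_0 lies in K̄_{j−1} minus int(K_{j−1}), since the displayed cases can leave ν_j undefined there; k_0 for which the displayed equations for ν_j are contradictory (k_0 in BZ^d) are excluded. *)

theory Defs
  imports "HOL-Analysis.Analysis"
begin

section \<open>Integer vectors and matrices\<close>

definition rvec :: "int^'d \<Rightarrow> real^'d" where
  "rvec k = (\<chi> i. real_of_int (k $ i))"

text \<open>The type class operation \<open>^\<close> is componentwise on matrices, hence a separate power.\<close>

definition matpow :: "'a::semiring_1^'d^'d \<Rightarrow> nat \<Rightarrow> 'a^'d^'d" where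
  "matpow M j = (((**) M) ^^ j) (mat 1)"

definition rmatpow :: "int^'d^'d \<Rightarrow> nat \<Rightarrow> real^'d^'d" where
  "rmatpow M j = map_matrix real_of_int (matpow M j)"

definition dilation_matrix :: "int^'d^'d \<Rightarrow> bool" where
  "dilation_matrix M \<longleftrightarrow>
     (\<forall>z v. v \<noteq> 0 \<and> map_matrix complex_of_int M *v v = z *s v \<longrightarrow> cmod z > 1)"

text \<open>\<open>R\<close> contains exactly one representative of each coset of \<open>M \<int>\<^sup>d\<close> in \<open>\<int>\<^sup>d\<close>.\<close>

definition coset_reps :: "int^'d^'d \<Rightarrow> (int^'d) set \<Rightarrow> bool" where
  "coset_reps M R \<longleftrightarrow> (\<forall>k. \<exists>!r. r \<in> R \<and> (\<exists>p. k - r = M *v p))"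

section \<open>The space \<open>L\<^sub>2\<close> of the torus\<close>

text \<open>Functions on the torus are \<open>\<int>\<^sup>d\<close>-periodic functions on \<open>\<real>\<^sup>d\<close>, integrated over the unit
  cube. Elements of \<open>L\<^sub>2\<close> are represented by functions, not by almost-everywhere classes.\<close>

definition torus :: "(real^'d) measure" where
  "torus = lebesgue_on (cbox 0 1)"

definition periodic :: "(real^'d \<Rightarrow> complex) \<Rightarrow> bool" where
  "periodic f \<longleftrightarrow> (\<forall>x k. f (x + rvec k) = f x)"

definition L2T :: "(real^'d \<Rightarrow> complex) set" where
  "L2T = {f. periodic f \<and> f \<in> borel_measurable torus
             \<and> integrable torus (\<lambda>x. (cmod (f x))\<^sup>2)}"

definition innerT :: "(real^'d \<Rightarrow> complex) \<Rightarrow> (real^'d \<Rightarrow> complex) \<Rightarrow> complex" where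
  "innerT f g = integral\<^sup>L torus (\<lambda>x. f x * cnj (g x))"

definition normT :: "(real^'d \<Rightarrow> complex) \<Rightarrow> real" where
  "normT f = sqrt (integral\<^sup>L torus (\<lambda>x. (cmod (f x))\<^sup>2))"

definition fcoeff :: "(real^'d \<Rightarrow> complex) \<Rightarrow> int^'d \<Rightarrow> complex" where
  "fcoeff f k = integral\<^sup>L torus (\<lambda>x. f x * exp (- 2 * of_real pi * \<i> * of_real (rvec k \<bullet> x)))"

definition H1T :: "(real^'d \<Rightarrow> complex) set" where
  "H1T = {f \<in> L2T. (\<lambda>k. (norm (rvec k))\<^sup>2 * (cmod (fcoeff f k))\<^sup>2) summable_on UNIV}"

definition parseval_frame :: "'i set \<Rightarrow> ('i \<Rightarrow> real^'d \<Rightarrow> complex) \<Rightarrow> bool" where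
  "parseval_frame I F \<longleftrightarrow>
     (\<forall>i\<in>I. F i \<in> L2T) \<and>
     (\<forall>f\<in>L2T. ((\<lambda>i. (cmod (innerT f (F i)))\<^sup>2) has_sum (normT f)\<^sup>2) I)"

section \<open>The directional uncertainty product\<close>

definition pdiff :: "'d \<Rightarrow> (real^'d \<Rightarrow> complex) \<Rightarrow> real^'d \<Rightarrow> complex" where
  "pdiff n h x = frechet_derivative h (at x) (axis n 1)"

text \<open>\<open>h\<close> is \<open>C\<^sup>\<infinity>\<close> iff all its iterated partial derivatives are (Frechet) differentiable.\<close>

definition smooth :: "(real^'d \<Rightarrow> complex) \<Rightarrow> bool" where
  "smooth h \<longleftrightarrow> (\<forall>ns. foldr pdiff ns h differentiable_on UNIV)"

definition weak_pderiv :: "'d \<Rightarrow> (real^'d \<Rightarrow> complex) \<Rightarrow> (real^'d \<Rightarrow> complex) \<Rightarrow> bool" where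
  "weak_pderiv n f g \<longleftrightarrow> g \<in> L2T \<and>
     (\<forall>h. periodic h \<and> smooth h \<longrightarrow>
        integral\<^sup>L torus (\<lambda>x. f x * pdiff n h x) = - integral\<^sup>L torus (\<lambda>x. g x * h x))"

text \<open>Functions in \<open>H1T\<close> need not be differentiable pointwise, so the derivatives in
  \<open>opB\<close> are weak ones. They are determined up to null sets, and below they occur only
  under integrals.\<close>

definition pderivT :: "'d \<Rightarrow> (real^'d \<Rightarrow> complex) \<Rightarrow> real^'d \<Rightarrow> complex" where
  "pderivT n f = (SOME g. weak_pderiv n f g)"

definition opA :: "int^'d \<Rightarrow> (real^'d \<Rightarrow> complex) \<Rightarrow> real^'d \<Rightarrow> complex" where
  "opA L f x = exp (2 * of_real pi * \<i> * of_real (rvec L \<bullet> x)) * f x"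

definition opB :: "int^'d \<Rightarrow> (real^'d \<Rightarrow> complex) \<Rightarrow> real^'d \<Rightarrow> complex" where
  "opB L f x = \<i> / (2 * of_real pi) * (\<Sum>n\<in>UNIV. of_int (L $ n) * pderivT n f x)"

definition UP_domain :: "int^'d \<Rightarrow> (real^'d \<Rightarrow> complex) set" where
  "UP_domain L = {f \<in> H1T. innerT (opA L f) f \<noteq> 0}"

definition UP :: "int^'d \<Rightarrow> (real^'d \<Rightarrow> complex) \<Rightarrow> real" where
  "UP L f = 1 / norm (rvec L) ^ 4
     * (normT f ^ 4 / (cmod (innerT (opA L f) f))\<^sup>2 - 1)
     * ((normT (opB L f))\<^sup>2 / (normT f)\<^sup>2 - (cmod (innerT (opB L f) f))\<^sup>2 / normT f ^ 4)"

section \<open>Scaling sequences, masks and wavelets\<close>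

text \<open>Throughout, \<open>B\<close> is the transpose of the dilation matrix.\<close>

definition intK :: "int^'d^'d \<Rightarrow> nat \<Rightarrow> (int^'d) set" where
  "intK B j = {k. rvec k \<in> (\<lambda>x. rmatpow B j *v x) ` box (\<chi> i. -1/2) (\<chi> i. 1/2)}"

definition clK :: "int^'d^'d \<Rightarrow> nat \<Rightarrow> (int^'d) set" where
  "clK B j = {k. rvec k \<in> (\<lambda>x. rmatpow B j *v x) ` cbox (\<chi> i. -1/2) (\<chi> i. 1/2)}"

text \<open>Only the value at \<open>k = 0\<close> is relevant for \<open>j = 1\<close>, since \<open>intK B 0 = {0}\<close>.\<close>

definition fseq :: "int^'d \<Rightarrow> nat \<Rightarrow> int^'d \<Rightarrow> real" where
  "fseq L j k = (if j \<le> 1 then 1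
     else exp (- ((norm (rvec L))\<^sup>2 * (norm (rvec k))\<^sup>2) / (real j * (real j - 1))))"

text \<open>\<open>\<nu>\<close> is characterised by its defining equations. The value \<open>1/\<surd>2\<close> is prescribed on the
  boundary of both cells, the one at \<open>0\<close> and the one at \<open>B\<^sup>j\<^sup>-\<^sup>1 k\<^sub>0\<close>. If some difference of
  adjacent lattice points lies in \<open>B \<int>\<^sup>d\<close>, then a common boundary point of two cells centred
  in \<open>B\<^sup>j\<^sup>-\<^sup>1 k\<^sub>0 + B\<^sup>j \<int>\<^sup>d\<close> need not be congruent to a boundary point of the cell at \<open>0\<close>; with
  the last clause the equations determine \<open>\<nu> j\<close> everywhere. They are contradictory unless
  \<open>k\<^sub>0 \<notin> B \<int>\<^sup>d\<close> (consider \<open>j = 1\<close>), and consistent otherwise.\<close>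

definition scaling_seq ::
    "int^'d^'d \<Rightarrow> int^'d \<Rightarrow> int^'d \<Rightarrow> (nat \<Rightarrow> int^'d \<Rightarrow> real) \<Rightarrow> bool" where
  "scaling_seq B L k0 \<nu> \<longleftrightarrow> (\<forall>j\<ge>1.
     (\<forall>k p. \<nu> j (k + matpow B j *v p) = \<nu> j k) \<and>
     (\<forall>k \<in> intK B (j - 1). \<nu> j k = fseq L j k) \<and>
     (\<forall>k. k - matpow B (j - 1) *v k0 \<in> intK B (j - 1) \<longrightarrow>
        \<nu> j k = sqrt (1 - (fseq L j (k - matpow B (j - 1) *v k0))\<^sup>2)) \<and>
     (\<forall>k \<in> clK B (j - 1) - intK B (j - 1). \<nu> j k = 1 / sqrt 2) \<and>
     (\<forall>k. k - matpow B (j - 1) *v k0 \<in> clK B (j - 1) - intK B (j - 1) \<longrightarrow>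
        \<nu> j k = 1 / sqrt 2))"

text \<open>A limit of partial products rather than \<open>prodinf\<close>, because products with value \<open>0\<close>
  count as convergent.\<close>

definition xi_hat :: "(nat \<Rightarrow> int^'d \<Rightarrow> real) \<Rightarrow> nat \<Rightarrow> int^'d \<Rightarrow> real" where
  "xi_hat \<nu> j k = lim (\<lambda>N. \<Prod>r = j + 1..N. \<nu> r k)"

definition scaling_mask :: "(nat \<Rightarrow> int^'d \<Rightarrow> real) \<Rightarrow> nat \<Rightarrow> int^'d \<Rightarrow> real" where
  "scaling_mask \<nu> j k = sqrt 2 * \<nu> j k"

definition wavelet_mask ::
    "int^'d^'d \<Rightarrow> int^'d \<Rightarrow> (nat \<Rightarrow> int^'d \<Rightarrow> real) \<Rightarrow> nat \<Rightarrow> int^'d \<Rightarrow> complex" where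
  "wavelet_mask B k0 \<nu> j k =
     exp (2 * of_real pi * \<i> * of_real (rvec k0 \<bullet> (matrix_inv (rmatpow B j) *v rvec k)))
     * of_real (scaling_mask \<nu> j (k + matpow B (j - 1) *v k0))"

definition scaling_functions ::
    "(nat \<Rightarrow> int^'d \<Rightarrow> real) \<Rightarrow> (nat \<Rightarrow> real^'d \<Rightarrow> complex) \<Rightarrow> bool" where
  "scaling_functions \<nu> \<phi> \<longleftrightarrow> (\<forall>j. \<phi> j \<in> L2T \<and>
     (\<forall>k. fcoeff (\<phi> j) k = of_real (2 powr (- real j / 2) * xi_hat \<nu> j k)))"

definition wavelet_functions ::
    "int^'d^'d \<Rightarrow> int^'d \<Rightarrow> (nat \<Rightarrow> int^'d \<Rightarrow> real) \<Rightarrow> (nat \<Rightarrow> real^'d \<Rightarrow> complex)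
     \<Rightarrow> (nat \<Rightarrow> real^'d \<Rightarrow> complex) \<Rightarrow> bool" where
  "wavelet_functions B k0 \<nu> \<phi> \<psi> \<longleftrightarrow> (\<forall>j. \<psi> j \<in> L2T \<and>
     (\<forall>k. fcoeff (\<psi> j) k = wavelet_mask B k0 \<nu> (j + 1) k * fcoeff (\<phi> (j + 1)) k))"

text \<open>The system \<open>\<Psi>\<close> as an indexed family: \<open>None\<close> stands for \<open>\<phi>\<^sub>0\<close>, and \<open>Some (j, k)\<close> for
  the shift of \<open>\<psi>\<^sub>j\<close> by \<open>A\<^sup>-\<^sup>j k\<close>.\<close>

definition Psi_index :: "(nat \<Rightarrow> (int^'d) set) \<Rightarrow> (nat \<times> (int^'d)) option set" where
  "Psi_index R = insert None (Some ` (SIGMA j:UNIV. R j))"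

fun Psi_family ::
    "int^'d^'d \<Rightarrow> (nat \<Rightarrow> real^'d \<Rightarrow> complex) \<Rightarrow> (nat \<Rightarrow> real^'d \<Rightarrow> complex)
     \<Rightarrow> (nat \<times> (int^'d)) option \<Rightarrow> real^'d \<Rightarrow> complex" where
  "Psi_family A \<phi> \<psi> None = \<phi> 0"
| "Psi_family A \<phi> \<psi> (Some (j, k)) = (\<lambda>x. \<psi> j (x - matrix_inv (rmatpow A j) *v rvec k))"

end

theory Submission
  imports Defs "HOL-Computational_Algebra.Fundamental_Theorem_Algebra"
begin

text \<open>
  Write \<open>c\<close> for the Fourier coefficients of \<open>f\<close> and \<open>E\<^sub>j = \<Sum>\<^sub>m |\<Sum>\<^sub>n c(n) \<xi>\<^sub>j(n)|\<^sup>2\<close>, where \<open>m\<close> runs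
  over representatives of \<open>\<int>\<^sup>d / B\<^sup>j \<int>\<^sup>d\<close> and \<open>n\<close> over the coset of \<open>m\<close>. Since \<open>\<nu>\<close> has period \<open>B\<^sup>j\<close>
  and \<open>\<nu>(m)\<^sup>2 + \<nu>(m + B\<^sup>j\<^sup>-\<^sup>1 k\<^sub>0)\<^sup>2 = 1\<close>, passing from the level \<open>j + 1\<close> to the level \<open>j\<close> is a
  rotation in each pair of cosets: one component belongs to \<open>E\<^sub>j\<close>, the other one, by orthogonality
  of the characters of \<open>\<int>\<^sup>d / A\<^sup>j \<int>\<^sup>d\<close>, to the shifts of \<open>\<psi>\<^sub>j\<close>. The energies telescope, and
  \<open>E\<^sub>j\<close> tends to the squared norm of \<open>f\<close>.

  For the uncertainty products, \<open>\<Sum> r(k) r(k - L) = \<Sum> r(k)\<^sup>2 - 1/2 \<Sum> (r(k) - r(k - L))\<^sup>2\<close> expresses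
  the first factor through differences of neighbouring coefficients. Because
  \<open>1/(r (r - 1))\<close> telescopes, the coefficients of \<open>\<phi>\<^sub>j\<close> are \<open>exp (- \<parallel>L\<parallel>\<^sup>2 \<parallel>k\<parallel>\<^sup>2 / j)\<close> up to
  \<open>\<parallel>k\<parallel>\<close> of order \<open>j\<close> and exponentially small beyond. After the scaling \<open>y = \<parallel>L\<parallel> k / \<surd>j\<close>
  all sums become Riemann sums, with limit profile \<open>exp (- \<parallel>y\<parallel>\<^sup>2)\<close> for \<open>\<phi>\<^sub>j\<close> and
  \<open>\<parallel>y\<parallel> exp (- \<parallel>y\<parallel>\<^sup>2)\<close> for \<open>\<psi>\<^sub>j\<close>, and the limits are ratios of Gaussian moments.
\<close>

text \<open>Shifts of the wavelets live on cosets of \<open>A\<close>, Fourier coefficients on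
  cosets of \<open>B\<close>, and \<open>k0\<close> must represent the nontrivial coset of both. For
  \<open>B\<close> this is forced by the equations for \<open>\<nu>\<close> at level 1; the
  character values 1 and -1 at \<open>k0\<close> then carry index two over from \<open>A\<close> to
  \<open>B\<close>. The Gaussian form of the coefficients holds only on the cells, so the expansion
  must be quantitative: the cell of level r contains a ball of radius c (r + 1). Linear growth is
  enough because the profile has length scale \<surd>j only, so that frequencies of norm at least of
  order j are exponentially negligible. The first factor of the uncertainty product vanishes like
  1/j while the second grows like j. Bounds on the coefficients alone therefore do not suffice:
  their differences over \<open>L\<close> need a bound that carries a factor \<open>s n\<close> of
  order 1/\<surd>j uniformly in k, also across the edge of the Gaussian region. This requirement
  shapes the estimates for the profiles. Gaussian moments enter only through ratios of consecutive
  even ones.\<close>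

lemma matpow_0 [simp]: "matpow M 0 = mat 1"
  by (simp add: matpow_def)

lemma matpow_Suc: "matpow M (Suc j) = M ** matpow M j"
  by (simp add: matpow_def)

lemma matpow_Suc_right: "matpow M (Suc j) = matpow M j ** M"
  by (induction j) (simp_all add: matpow_Suc matrix_mul_assoc)

lemma transpose_matpow:
  fixes M :: "'a::comm_semiring_1^'d^'d"
  shows "transpose (matpow M j) = matpow (transpose M) j"
  by (induction j) (simp_all add: matpow_Suc_right matrix_transpose_mul transpose_mat,
      simp add: matpow_Suc flip: matpow_Suc_right)

lemma matpow_mult_vec_Suc: "matpow M (Suc j) *v x = M *v (matpow M j *v x)"
  by (simp add: matpow_Suc matrix_vector_mul_assoc)

lemma matpow_mult_vec_Suc_right: "matpow M (Suc j) *v x = matpow M j *v (M *v x)"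
  by (simp add: matpow_Suc_right matrix_vector_mul_assoc)

lemma rmatpow_0 [simp]: "rmatpow M 0 = mat 1"
  by (simp add: rmatpow_def map_matrix_def mat_def vec_eq_iff)

lemma map_matrix_of_int_mult:
  fixes M N :: "int^'d^'d"
  shows "map_matrix (of_int :: int \<Rightarrow> 'a::ring_1) (M ** N) = map_matrix of_int M ** map_matrix of_int N"
  by (simp add: map_matrix_def matrix_matrix_mult_def vec_eq_iff)

lemma rmatpow_Suc: "rmatpow M (Suc j) = map_matrix real_of_int M ** rmatpow M j"
  by (simp add: rmatpow_def matpow_Suc map_matrix_of_int_mult)

lemma transpose_rmatpow: "transpose (rmatpow M j) = rmatpow (transpose M) j"
proof -
  have "transpose (rmatpow M j) = map_matrix real_of_int (transpose (matpow M j))"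
    by (simp add: rmatpow_def map_matrix_def transpose_def vec_eq_iff)
  then show ?thesis by (simp add: rmatpow_def transpose_matpow)
qed

lemma rvec_mult: "rvec (M *v k) = map_matrix real_of_int M *v rvec k"
  by (simp add: rvec_def map_matrix_def matrix_vector_mult_def vec_eq_iff)

lemma rvec_matpow: "rvec (matpow M j *v k) = rmatpow M j *v rvec k"
  by (simp add: rmatpow_def rvec_mult)

lemma rvec_add: "rvec (k + l) = rvec k + rvec l" and rvec_diff: "rvec (k - l) = rvec k - rvec l"
  and rvec_minus: "rvec (- k) = - rvec k" and rvec_0 [simp]: "rvec 0 = 0"
  by (simp_all add: rvec_def vec_eq_iff)

lemma rvec_inject [simp]: "rvec k = rvec l \<longleftrightarrow> k = l"
  by (simp add: rvec_def vec_eq_iff)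

section \<open>Dilation matrices\<close>

text \<open>Geometric decay of the orbit of a single vector. Rate and constant are existential and
  depend on the vector, so each step of the induction over polynomial factors may enlarge
  them.\<close>

definition decays :: "complex^'d^'d \<Rightarrow> complex^'d \<Rightarrow> bool" where
  "decays N v \<longleftrightarrow> (\<exists>C \<rho>. 0 < \<rho> \<and> \<rho> < 1 \<and> (\<forall>r. norm (matpow N r *v v) \<le> C * \<rho> ^ r))"

lemma norm_smult_complex_vec: "norm (z *s (v :: complex^'d)) = cmod z * norm v"
  unfolding norm_vec_def L2_set_def
  by (simp add: norm_mult power_mult_distrib real_sqrt_mult flip: sum_distrib_left)

text \<open>With w = N v - z v one has N^(r+1) v = z N^r v + N^r w, a scalar recurrence with
  geometrically small forcing. A rate \<open>\<sigma>\<close> strictly above both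
  \<open>\<rho>\<close> and |z| avoids the polynomial factor that would appear if the two
  agreed.\<close>

lemma decays_recurrence:
  assumes "cmod z < 1" and dec: "decays N (N *v v - z *s v)"
  shows "decays N v"
proof -
  obtain C \<rho> where r: "0 < \<rho>" "\<rho> < 1"
    and C: "\<And>r. norm (matpow N r *v (N *v v - z *s v)) \<le> C * \<rho> ^ r"
    using dec unfolding decays_def by blast
  obtain \<sigma> where s: "max \<rho> (cmod z) < \<sigma>" "\<sigma> < 1"
    using r assms(1) dense[of "max \<rho> (cmod z)" 1] by auto
  have C0: "0 \<le> C" using order_trans[OF norm_ge_zero C[of 0]] by simp
  \<comment> \<open>The second entry gives \<open>C \<le> K * (\<sigma> - cmod z)\<close>, which is
    what the induction step consumes; the first serves r = 0.\<close>
  define K where "K = max (norm v) (C / (\<sigma> - cmod z))"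
  have K1: "C \<le> K * (\<sigma> - cmod z)"
  proof -
    have "C / (\<sigma> - cmod z) \<le> K" by (simp add: K_def)
    then show ?thesis using s by (simp add: pos_divide_le_eq)
  qed
  have s0: "0 < \<sigma>" using s r by auto
  have "norm (matpow N r *v v) \<le> K * \<sigma> ^ r" for r
  proof (induction r)
    case 0 then show ?case by (simp add: K_def)
  next
    case (Suc r)
    have "matpow N (Suc r) *v v = z *s (matpow N r *v v) + matpow N r *v (N *v v - z *s v)"
      by (simp add: matpow_mult_vec_Suc_right matrix_vector_mult_diff_distrib matrix_vector_mult_scaleR vector_scalar_commute)
    then have "norm (matpow N (Suc r) *v v) \<le> cmod z * norm (matpow N r *v v) + C * \<rho> ^ r"
      using norm_triangle_ineq C[of r] norm_smult_complex_vec by (smt (verit))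
    also have "\<dots> \<le> cmod z * (K * \<sigma> ^ r) + C * \<sigma> ^ r"
      using Suc s r C0 by (intro add_mono mult_left_mono power_mono) auto
    also have "\<dots> \<le> cmod z * (K * \<sigma> ^ r) + (K * (\<sigma> - cmod z)) * \<sigma> ^ r"
      by (rule add_left_mono, rule mult_right_mono[OF K1]) (use s0 in auto)
    also have "\<dots> = K * \<sigma> ^ Suc r" by (simp add: algebra_simps)
    finally show ?case .
  qed
  then show ?thesis unfolding decays_def using s s0 by blast
qed

lemma matpow_commute_vec:
  assumes "N ** P = P ** N"
  shows "matpow N r *v (P *v x) = P *v (matpow N r *v x)"
  by (induction r) (simp_all add: matpow_mult_vec_Suc, metis assms matrix_vector_mul_assoc)

lemma norm_matrix_vector_le:
  fixes P :: "complex^'d^'d"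
  shows "norm (P *v x) \<le> (\<Sum>i\<in>UNIV. \<Sum>j\<in>UNIV. cmod (P $ i $ j)) * norm x"
proof -
  have "norm (P *v x) \<le> (\<Sum>i\<in>UNIV. cmod ((P *v x) $ i))"
    by (simp add: norm_vec_def L2_set_le_sum)
  also have "\<dots> \<le> (\<Sum>i\<in>UNIV. \<Sum>j\<in>UNIV. cmod (P $ i $ j) * norm x)"
    unfolding matrix_vector_mult_def
    by (auto intro!: sum_mono order_trans[OF norm_sum] simp: norm_mult mult_left_mono Finite_Cartesian_Product.norm_nth_le)
  finally show ?thesis by (simp add: sum_distrib_right)
qed

text \<open>Needed for the resolvent (N - z)^(-1), which commutes with N.\<close>

lemma decays_matrix:
  assumes "N ** P = P ** N" "decays N x"
  shows "decays N (P *v x)"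
proof -
  obtain C \<rho> where r: "0 < \<rho>" "\<rho> < 1" and C: "\<And>r. norm (matpow N r *v x) \<le> C * \<rho> ^ r"
    using assms(2) unfolding decays_def by blast
  let ?K = "\<Sum>i\<in>UNIV. \<Sum>j\<in>UNIV. cmod (P $ i $ j)"
  have "norm (matpow N r *v (P *v x)) \<le> (?K * C) * \<rho> ^ r" for r
  proof -
    have "norm (matpow N r *v (P *v x)) \<le> ?K * norm (matpow N r *v x)"
      by (simp add: matpow_commute_vec[OF assms(1)] norm_matrix_vector_le)
    also have "\<dots> \<le> ?K * (C * \<rho> ^ r)"
      by (intro mult_left_mono C sum_nonneg) auto
    finally show ?thesis by (simp add: mult.assoc)
  qed
  then show ?thesis using r unfolding decays_def by blast
qed

lemma minus_mat_mult_vec: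
  fixes X :: "'a::comm_ring_1^'d^'d"
  shows "(X - mat z) *v x = X *v x - z *s x"
  by (simp add: matrix_vector_mult_diff_rdistrib)
    (simp add: mat_def matrix_vector_mult_def vec_eq_iff if_distrib[of "\<lambda>a. a * _"] cong: if_cong)

text \<open>This is p(N) v by Horner's scheme. On vectors a linear factor stays visible: removing
  \<open>[:-z, 1:]\<close> from the polynomial replaces v by N v - z v.\<close>

definition poly_mv :: "complex^'d^'d \<Rightarrow> complex poly \<Rightarrow> complex^'d \<Rightarrow> complex^'d" where
  "poly_mv N p v = fold_coeffs (\<lambda>a y. a *s v + N *v y) p 0"

lemma poly_mv_0 [simp]: "poly_mv N 0 v = 0"
  by (simp add: poly_mv_def)

lemma poly_mv_pCons [simp]: "poly_mv N (pCons a p) v = a *s v + N *v poly_mv N p v"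
  by (cases "p = 0 \<and> a = 0") (auto simp: poly_mv_def)

lemma poly_mv_linear:
  "poly_mv N p (N *v v - z *s v) = N *v poly_mv N p v - z *s poly_mv N p v"
proof (induction p)
  case (pCons a p)
  show ?case unfolding poly_mv_pCons pCons.IH
    by (simp add: matrix_vector_right_distrib matrix_vector_mult_diff_distrib vector_scalar_commute
      vector_ssub_ldistrib vector_add_ldistrib vector_smult_assoc mult.commute)
qed simp

lemma poly_mv_add: "poly_mv N (p + q) v = poly_mv N p v + poly_mv N q v"
  by (induction p q rule: poly_induct2) (simp_all add: matrix_vector_right_distrib vector_sadd_rdistrib)

lemma poly_mv_smult: "poly_mv N (smult c p) v = c *s poly_mv N p v"
  by (induction p) (simp_all add: vector_add_ldistrib vector_scalar_commute)

lemma poly_mv_linear_factor: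
  "poly_mv N ([:-z, 1:] * q) v = poly_mv N q (N *v v - z *s v)"
proof -
  have "[:-z, 1:] * q = smult (-z) q + pCons 0 q" by simp
  then show ?thesis unfolding poly_mv_linear by (simp only: poly_mv_add poly_mv_smult) simp
qed

text \<open>A linear factor \<open>[:-z, 1:]\<close> of the annihilating polynomial is removed by the recurrence
  \<open>N v = z v + w\<close> if \<open>|z| < 1\<close>, and by inverting \<open>N - z\<close> otherwise. This replaces the
  Jordan normal form.\<close>

lemma decays_annihilated:
  fixes N :: "complex^'d^'d"
  assumes eig: "\<And>z v. v \<noteq> 0 \<Longrightarrow> N *v v = z *s v \<Longrightarrow> cmod z < 1"
  shows "p \<noteq> 0 \<Longrightarrow> poly_mv N p v = 0 \<Longrightarrow> decays N v"
proof (induction "degree p" arbitrary: p v)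
  case 0
  then obtain a where p: "p = [:a:]" using degree_eq_zeroE by metis
  then have "a \<noteq> 0" "v = 0" using 0 by auto
  then show ?case unfolding decays_def by (intro exI[of _ 1] exI[of _ "1/2"]) auto
next
  case (Suc n)
  have "\<not> constant (poly p)" using Suc.hyps(2) by (simp add: constant_degree)
  then obtain z where "poly p z = 0" using fundamental_theorem_of_algebra by blast
  then obtain q where p: "p = [:-z, 1:] * q" by (auto simp: poly_eq_0_iff_dvd)
  have q0: "q \<noteq> 0" using Suc.prems p by auto
  have dq: "n = degree q" using Suc.hyps(2) q0 degree_mult_eq[of "[:-z, 1:]" q] unfolding p by simp
  let ?w = "N *v v - z *s v"
  have w: "decays N ?w" using Suc.hyps(1)[OF dq q0] Suc.prems(2) unfolding p poly_mv_linear_factor by blast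
  show ?case
  proof (cases "cmod z < 1")
    case True then show ?thesis using decays_recurrence w by blast
  next
    case False
    let ?P = "N - mat z"
    note P = minus_mat_mult_vec[of N z]
    have "inj ((*v) ?P)"
    proof (rule injI)
      fix x y assume "?P *v x = ?P *v y"
      then have "N *v (x - y) = z *s (x - y)"
        unfolding P by (simp add: matrix_vector_mult_diff_distrib vector_ssub_ldistrib algebra_simps)
      then show "x = y" using eig[of "x - y" z] False by fastforce
    qed
    then obtain Q where Q: "Q ** ?P = mat 1" using matrix_left_invertible_injective by blast
    then have Q': "?P ** Q = mat 1" using matrix_left_right_inverse by blast
    have NP: "N ** ?P = ?P ** N"
      unfolding matrix_eq
      by (simp add: P matrix_vector_mult_diff_distrib vector_scalar_commute flip: matrix_vector_mul_assoc)
    have "N ** Q = Q ** ?P ** N ** Q" by (simp add: Q)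
    also have "\<dots> = Q ** (N ** ?P) ** Q" by (metis NP matrix_mul_assoc)
    also have "\<dots> = Q ** N" by (metis Q' matrix_mul_assoc matrix_mul_rid)
    finally have NQ: "N ** Q = Q ** N" .
    have "Q *v ?w = v" unfolding P[symmetric] by (simp add: matrix_vector_mul_assoc Q)
    then show ?thesis using decays_matrix[OF NQ w] by simp
  qed
qed

text \<open>The d + 1 vectors v, N v, ..., N^d v are dependent in dimension d. Dependence is a
  property of sets, so a repetition among them is treated apart: it yields a difference of two
  monomials.\<close>

lemma exists_annihilating_poly:
  fixes N :: "complex^'d^'d"
  shows "\<exists>p. p \<noteq> 0 \<and> poly_mv N p v = 0"
proof -
  have mv: "poly_mv N (monom c i) v = c *s (matpow N i *v v)" for c i
    by (induction i) (simp_all add: monom_0 monom_Suc matpow_mult_vec_Suc vector_scalar_commute)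
  have sm: "poly_mv N (\<Sum>i\<in>I. p i) v = (\<Sum>i\<in>I. poly_mv N (p i) v)" for I :: "nat set" and p
    by (induction I rule: infinite_finite_induct) (simp_all add: poly_mv_add)
  let ?f = "\<lambda>i. matpow N i *v v"
  let ?I = "{..CARD('d)}"
  show ?thesis
  proof (cases "inj_on ?f ?I")
    case True
    have "vec.dependent (?f ` ?I)"
      by (rule vec.dependent_biggerset_general)
        (use True dim_subset_UNIV_cart_gen[of "?f ` ?I"] in \<open>auto simp: card_image\<close>)
    then obtain u where u: "\<exists>x\<in>?f ` ?I. u x \<noteq> 0" "(\<Sum>x\<in>?f ` ?I. u x *s x) = 0"
      using vec.dependent_finite[of "?f ` ?I"] by auto
    define p where "p = (\<Sum>i\<in>?I. monom (u (?f i)) i)"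
    have "poly_mv N p v = 0"
      using u(2) unfolding p_def sm mv by (simp add: sum.reindex[OF True])
    moreover obtain i where "i \<in> ?I" "u (?f i) \<noteq> 0" using u(1) by auto
    then have "coeff p i \<noteq> 0" unfolding p_def by (simp add: coeff_sum)
    then have "p \<noteq> 0" by auto
    ultimately show ?thesis by blast
  next
    case False
    then obtain i k where ik: "i \<noteq> k" "?f i = ?f k" unfolding inj_on_def by blast
    have "poly_mv N (monom 1 i + monom (-1) k) v = 0"
      unfolding poly_mv_add mv by (simp add: ik)
    moreover have "coeff (monom (1::complex) i + monom (-1) k) i = 1" using ik by simp
    then have "monom (1::complex) i + monom (-1) k \<noteq> 0" by (metis coeff_0 zero_neq_one)
    ultimately show ?thesis by blast
  qed
qed

text \<open>An eigenvalue is a zero of det (M - z), and this determinant is unchanged by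
  transposition.\<close>

lemma dilation_matrix_transpose:
  fixes M :: "int^'d^'d"
  assumes "dilation_matrix M" shows "dilation_matrix (transpose M)"
  unfolding dilation_matrix_def
proof (intro allI impI)
  fix z and v :: "complex^'d"
  let ?N = "map_matrix complex_of_int M"
  let ?T = "map_matrix complex_of_int (transpose M)"
  have T: "?T - mat z = transpose (?N - mat z)"
    by (simp add: map_matrix_def transpose_def mat_def vec_eq_iff)
  note P = minus_mat_mult_vec
  assume v: "v \<noteq> 0 \<and> ?T *v v = z *s v"
  then have "\<not> inj ((*v) (?T - mat z))"
    unfolding inj_def by (metis P right_minus_eq matrix_vector_mult_0_right)
  then have "det (?T - mat z) = 0"
    using matrix_left_invertible_injective invertible_left_inverse invertible_det_nz by metis
  then have "det (?N - mat z) = 0" unfolding T det_transpose .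
  then have "\<not> inj ((*v) (?N - mat z))"
    using matrix_left_invertible_injective invertible_left_inverse invertible_det_nz by metis
  then obtain x y where xy: "x \<noteq> y" "(?N - mat z) *v x = (?N - mat z) *v y" unfolding inj_def by blast
  then have "?N *v (x - y) = z *s (x - y)"
    unfolding P by (simp add: matrix_vector_mult_diff_distrib vector_ssub_ldistrib algebra_simps)
  then show "cmod z > 1" using assms xy(1) unfolding dilation_matrix_def by (metis right_minus_eq)
qed

text \<open>The complex inverse N has its eigenvalues inside the unit disc, so N^r e decays
  geometrically for each coordinate vector e and (r + 1) |N^r e| stays bounded. The true growth of
  the inscribed ball is faster, but the linear scale is the one on which the Gaussian formula for
  the coefficients is applied later.\<close>

lemma dilation_matrix_expansion:
  fixes M :: "int^'d^'d"
  assumes "dilation_matrix M"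
  obtains c where "c > 0" "\<And>r x. norm x < c * (real r + 1) \<Longrightarrow>
     \<exists>y \<in> box (\<chi> i. -1/2) (\<chi> i. 1/2). x = rmatpow M r *v y"
proof -
  let ?M = "map_matrix complex_of_int M"
  have "inj ((*v) ?M)"
  proof (rule injI)
    fix x y assume "?M *v x = ?M *v y"
    then have "?M *v (x - y) = 0 *s (x - y)" by (simp add: matrix_vector_mult_diff_distrib)
    then show "x = y" using assms unfolding dilation_matrix_def
      by (metis norm_zero not_one_less_zero right_minus_eq)
  qed
  then obtain N where N: "N ** ?M = mat 1" using matrix_left_invertible_injective by blast
  then have N': "?M ** N = mat 1" using matrix_left_right_inverse by blast
  have eig: "cmod z < 1" if "v \<noteq> 0" "N *v v = z *s v" for z v
  proof -
    have v: "v = z *s (?M *v v)"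
      by (metis N' matrix_vector_mul_assoc matrix_vector_mul_lid that(2) vector_scalar_commute)
    then have z: "z \<noteq> 0" using that(1) by auto
    then have "?M *v v = (1/z) *s v" by (subst (2) v) simp
    then have "cmod (1/z) > 1" using assms that(1) unfolding dilation_matrix_def by blast
    then show ?thesis using z by (simp add: norm_divide field_simps)
  qed
  have dec: "decays N v" for v
    using exists_annihilating_poly[of N v] decays_annihilated[of N _ v] eig by blast
  have "\<exists>K. \<forall>r. (real r + 1) * norm (matpow N r *v v) \<le> K" for v
  proof -
    obtain C \<rho> where r: "0 < \<rho>" "\<rho> < 1" and C: "\<And>r. norm (matpow N r *v v) \<le> C * \<rho> ^ r"
      using dec unfolding decays_def by blast
    have C0: "0 \<le> C" using order_trans[OF norm_ge_zero C[of 0]] by simp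
    have "(\<lambda>r. real r * \<rho> ^ r) \<longlonglongrightarrow> 0" using powser_times_n_limit_0[of \<rho>] r by simp
    then have "Bseq (\<lambda>r. real r * \<rho> ^ r)" by (metis convergent_def convergent_imp_Bseq)
    then obtain D where D: "\<And>r. norm (real r * \<rho> ^ r) \<le> D" unfolding Bseq_def by blast
    have "(real r + 1) * norm (matpow N r *v v) \<le> C * (D + 1)" for r
    proof -
      have "(real r + 1) * norm (matpow N r *v v) \<le> (real r + 1) * (C * \<rho> ^ r)"
        by (intro mult_left_mono C) auto
      also have "\<dots> = C * (real r * \<rho> ^ r + \<rho> ^ r)" by (simp add: algebra_simps)
      also have "\<dots> \<le> C * (D + 1)"
        using D[of r] r C0 power_le_one[of \<rho> r] by (intro mult_left_mono add_mono) auto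
      finally show ?thesis .
    qed
    then show ?thesis by blast
  qed
  then obtain K where K: "\<And>v r. (real r + 1) * norm (matpow N r *v v) \<le> K v" by metis
  have K0: "0 \<le> K v" for v using K[of 0 v] norm_ge_zero[of "matpow N 0 *v v"] by (simp del: norm_ge_zero)
  define T where "T = (\<Sum>i\<in>UNIV. K (axis i 1 :: complex^'d))"
  have T0: "0 \<le> T" unfolding T_def by (simp add: sum_nonneg K0)
  \<comment> \<open>Chosen so that \<open>c * T\<close> is strictly below 1/2, which puts the
    preimage into the open box.\<close>
  define c where "c = 1 / (2 * T + 2)"
  have c: "c > 0" "c * T < 1/2" using T0 by (auto simp: c_def field_simps)
  have MN: "matpow ?M r *v (matpow N r *v x) = x" for r x
  proof (induction r arbitrary: x)
    case (Suc r)
    show ?case unfolding matpow_mult_vec_Suc_right[of ?M] matpow_mult_vec_Suc[of N]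
      by (simp add: Suc N' matrix_vector_mul_assoc[of ?M N])
  qed simp
  have pw: "map_matrix complex_of_int (matpow M r) = matpow ?M r" for r
    by (induction r) (simp_all add: matpow_Suc map_matrix_of_int_mult, simp add: map_matrix_def mat_def vec_eq_iff)
  show ?thesis
  proof (rule that[OF c(1)])
    fix r and x :: "real^'d" assume x: "norm x < c * (real r + 1)"
    \<comment> \<open>Eigenvalues are complex, so the preimage is computed in complex coordinates.
      Since the matrix is real, the real part of that preimage is again a preimage of the real
      vector.\<close>
    define xc :: "complex^'d" where "xc = (\<chi> i. of_real (x $ i))"
    define yc where "yc = matpow N r *v xc"
    define y :: "real^'d" where "y = (\<chi> i. Re (yc $ i))"
    have "matpow ?M r *v yc = xc" unfolding yc_def MN ..
    then have "Re ((matpow ?M r *v yc) $ i) = x $ i" for i by (simp add: xc_def)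
    then have "x = rmatpow M r *v y"
      unfolding vec_eq_iff rmatpow_def pw[symmetric] by (simp add: map_matrix_def matrix_vector_mult_def y_def)
    moreover have y2: "norm yc < 1/2"
    proof -
      have "xc = (\<Sum>i\<in>UNIV. of_real (x $ i) *s axis i 1)"
        unfolding xc_def by (simp add: vec_eq_iff axis_def if_distrib[of "\<lambda>a. _ * a"] cong: if_cong)
      then have "yc = (\<Sum>i\<in>UNIV. of_real (x $ i) *s (matpow N r *v axis i 1))"
        unfolding yc_def by (simp add: vec.linear_sum[OF matrix_vector_mul_linear_gen] vector_scalar_commute)
      then have "norm yc \<le> (\<Sum>i\<in>UNIV. norm (of_real (x $ i) *s (matpow N r *v axis i 1)))"
        by (simp add: norm_sum)
      also have "\<dots> \<le> (\<Sum>i\<in>UNIV. norm x * (K (axis i 1) / (real r + 1)))"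
        unfolding norm_smult_complex_vec
      proof (intro sum_mono mult_mono)
        fix i show "norm (matpow N r *v axis i 1) \<le> K (axis i 1) / (real r + 1)"
          using K[of r "axis i 1"] by (simp add: pos_le_divide_eq mult.commute)
        show "cmod (of_real (x $ i)) \<le> norm x" using Finite_Cartesian_Product.norm_nth_le[of x i] by simp
      qed auto
      also have "\<dots> = norm x / (real r + 1) * T" by (simp add: T_def sum_distrib_left sum_divide_distrib)
      also have "\<dots> \<le> c * T"
        using x T0 by (intro mult_right_mono) (auto simp: pos_divide_le_eq)
      finally show ?thesis using c by linarith
    qed
    have "-1/2 < y $ i \<and> y $ i < 1/2" for i
      using Finite_Cartesian_Product.norm_nth_le[of yc i] abs_Re_le_cmod[of "yc $ i"] y2
      unfolding y_def vec_lambda_beta by linarith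
    then have "y \<in> box (\<chi> i. -1/2) (\<chi> i. 1/2)" unfolding mem_box_cart by simp
    ultimately show "\<exists>y \<in> box (\<chi> i. -1/2) (\<chi> i. 1/2). x = rmatpow M r *v y" by blast
  qed
qed

text \<open>Surjectivity is enough, and every vector is a multiple of one in the ball reached by the
  expansion.\<close>

lemma invertible_rmatpow:
  assumes "dilation_matrix M" shows "invertible (rmatpow M j)"
proof -
  obtain c where c: "c > 0" "\<And>r x. norm x < c * (real r + 1) \<Longrightarrow>
     \<exists>y \<in> box (\<chi> i. -1/2) (\<chi> i. 1/2). x = rmatpow M r *v y"
    using dilation_matrix_expansion[OF assms] by blast
  have "surj ((*v) (rmatpow M j))"
  proof (rule surjI)
    fix x :: "real^'a"
    define t where "t = c / (norm x + 1)"
    have n1: "norm x + 1 > 0" using norm_ge_zero[of x] by linarith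
    then have t: "t > 0" using c by (simp add: t_def)
    have "norm (t *\<^sub>R x) < c"
      using c n1 by (simp add: t_def field_simps)
    also have "c \<le> c * (real j + 1)" using c by simp
    finally obtain y where "t *\<^sub>R x = rmatpow M j *v y" using c(2) by blast
    then have "rmatpow M j *v ((1/t) *\<^sub>R y) = x" using t
      by (metis divide_self_if less_numeral_extra(3) matrix_vector_mult_scaleR mult.commute scaleR_one scaleR_scaleR times_divide_eq_right mult_1_right)
    then show "rmatpow M j *v (SOME y. rmatpow M j *v y = x) = x" by (rule someI)
  qed
  then show ?thesis using matrix_right_invertible_surjective invertible_right_inverse by metis
qed

section \<open>Characters and cosets\<close>

definition unit_exp :: "real \<Rightarrow> complex" where
  "unit_exp x = cis (2 * pi * x)"

lemma exp_unit_exp: "exp (2 * of_real pi * \<i> * of_real x) = unit_exp x"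
  by (simp add: unit_exp_def cis_conv_exp mult_ac)

lemma exp_unit_exp_minus: "exp (- 2 * of_real pi * \<i> * of_real x) = unit_exp (- x)"
  by (simp add: unit_exp_def cis_conv_exp mult_ac)

lemma unit_exp_add: "unit_exp (x + y) = unit_exp x * unit_exp y"
  by (simp add: unit_exp_def cis_mult distrib_left)

lemma unit_exp_0 [simp]: "unit_exp 0 = 1" by (simp add: unit_exp_def)

lemma norm_unit_exp [simp]: "cmod (unit_exp x) = 1" by (simp add: unit_exp_def)

lemma unit_exp_nonzero [simp]: "unit_exp x \<noteq> 0" by (simp add: unit_exp_def)

lemma cnj_unit_exp: "cnj (unit_exp x) = unit_exp (- x)" by (simp add: unit_exp_def cis_cnj)

lemma unit_exp_eq_1_iff: "unit_exp x = 1 \<longleftrightarrow> x \<in> \<int>"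
proof
  assume "unit_exp x = 1"
  then obtain n where "2 * pi * x = of_int n * (2 * pi)"
    by (auto simp: unit_exp_def cis_conv_exp exp_eq_1)
  then have "x = of_int n" by simp
  then show "x \<in> \<int>" by simp
qed (simp add: unit_exp_def cis_multiple_2pi)

lemma inner_rvec_Ints: "rvec k \<bullet> rvec l \<in> \<int>"
  by (auto simp: rvec_def inner_vec_def intro!: Ints_sum)

lemma range_mult_vec_add: "x \<in> range ((*v) M) \<Longrightarrow> y \<in> range ((*v) M) \<Longrightarrow> x + y \<in> range ((*v) M)"
  by (auto simp: matrix_vector_right_distrib[symmetric])

lemma range_mult_vec_diff:
  fixes M :: "'a::ring_1^'d^'e"
  shows "x \<in> range ((*v) M) \<Longrightarrow> y \<in> range ((*v) M) \<Longrightarrow> x - y \<in> range ((*v) M)"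
  by (auto simp: matrix_vector_mult_diff_distrib[symmetric])

lemma range_mult_vec_0 [simp]: "0 \<in> range ((*v) M)"
  by (metis matrix_vector_mult_0_right rangeI)

lemma coset_reps_range: "coset_reps M R \<longleftrightarrow> (\<forall>k. \<exists>!r. r \<in> R \<and> k - r \<in> range ((*v) M))"
  unfolding coset_reps_def image_def by simp

lemma coset_reps_ex: "coset_reps M R \<Longrightarrow> \<exists>r\<in>R. k - r \<in> range ((*v) M)"
  unfolding coset_reps_range by blast

lemma coset_reps_unique:
  assumes "coset_reps M R" "r \<in> R" "r' \<in> R" "r - r' \<in> range ((*v) M)" shows "r = r'"
proof -
  have "\<exists>!s. s \<in> R \<and> r - s \<in> range ((*v) M)" using assms(1) unfolding coset_reps_range by blast
  moreover have "r - r \<in> range ((*v) M)" by simp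
  ultimately show ?thesis using assms(2-4) by blast
qed

text \<open>Lets arbitrary systems of representatives inherit finiteness and cardinality from the
  explicit ones built from digits.\<close>

lemma coset_reps_bij:
  fixes M :: "int^'d^'d"
  assumes R: "coset_reps M R" and S: "coset_reps M S"
  obtains f where "bij_betw f R S" "\<And>r. r \<in> R \<Longrightarrow> r - f r \<in> range ((*v) M)"
proof -
  obtain f where f: "\<And>r. f r \<in> S" "\<And>r. r - f r \<in> range ((*v) M)"
    using coset_reps_ex[OF S] by metis
  have "bij_betw f R S"
  proof (rule bij_betwI')
    fix x y assume "x \<in> R" "y \<in> R"
    moreover have "f x = f y \<Longrightarrow> x - y \<in> range ((*v) M)"
      using range_mult_vec_diff[OF f(2)[of x] f(2)[of y]] by simp
    ultimately show "(f x = f y) = (x = y)" using coset_reps_unique[OF R] by blast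
  next
    fix s assume s: "s \<in> S"
    obtain r where r: "r \<in> R" "s - r \<in> range ((*v) M)" using coset_reps_ex[OF R] by blast
    have "s - f r \<in> range ((*v) M)" using range_mult_vec_add[OF r(2) f(2)[of r]] by simp
    then show "\<exists>r\<in>R. s = f r" using coset_reps_unique[OF S s f(1)] r by blast
  qed (use f in auto)
  then show thesis using that f by blast
qed

text \<open>Digit expansions to the matrix base \<open>M\<close> with digits 0 and \<open>t\<close>.
  The recursion appends the most significant digit, which matches the passage from level j to level
  j + 1 in the energies.\<close>

fun power_reps :: "int^'d^'d \<Rightarrow> int^'d \<Rightarrow> nat \<Rightarrow> (int^'d) set" where
  "power_reps M t 0 = {0}"
| "power_reps M t (Suc j) = (\<lambda>(r, s). r + matpow M j *v s) ` (power_reps M t j \<times> {0, t})"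

lemma finite_power_reps [simp]: "finite (power_reps M t j)"
  by (induction j) auto

lemma inj_matpow:
  assumes "dilation_matrix M" shows "inj ((*v) (matpow M j) :: int^'d \<Rightarrow> int^'d)"
proof (rule injI)
  fix x y assume "matpow M j *v x = matpow M j *v y"
  then have "rmatpow M j *v rvec x = rmatpow M j *v rvec y" unfolding rvec_matpow[symmetric] by simp
  then have "rvec x = rvec y"
    using invertible_rmatpow[OF assms, of j] by (metis inj_matrix_vector_mult injD)
  then show "x = y" by simp
qed

lemma range_matpow_Suc_subset: "range ((*v) (matpow M (Suc j))) \<subseteq> range ((*v) (matpow M j))"
  by (auto simp: matpow_mult_vec_Suc_right)

text \<open>Existence is division with remainder: a representative modulo M^j leaves a quotient
  whose class modulo M is the next digit. For uniqueness the lower digits agree by reduction modulo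
  M^j, and injectivity of M^j then cancels it from the rest.\<close>

lemma power_reps:
  fixes M :: "int^'d^'d"
  assumes M: "dilation_matrix M" and R: "coset_reps M {0, t}"
  shows "coset_reps (matpow M j) (power_reps M t j)"
proof (induction j)
  case 0 show ?case by (simp add: coset_reps_range)
next
  case (Suc j)
  show ?case unfolding coset_reps_range
  proof (intro allI ex_ex1I)
    fix k
    obtain r where r: "r \<in> power_reps M t j" "k - r \<in> range ((*v) (matpow M j))"
      using coset_reps_ex[OF Suc] by blast
    then obtain q where q: "k - r = matpow M j *v q" by blast
    obtain s where s: "s \<in> {0, t}" "q - s \<in> range ((*v) M)" using coset_reps_ex[OF R] by blast
    then obtain p where p: "q - s = M *v p" by blast
    have "k - (r + matpow M j *v s) = matpow M j *v (q - s)"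
      using q by (simp add: matrix_vector_mult_diff_distrib algebra_simps)
    then have "k - (r + matpow M j *v s) = matpow M (Suc j) *v p"
      by (simp add: p matpow_mult_vec_Suc_right)
    then show "\<exists>r'. r' \<in> power_reps M t (Suc j) \<and> k - r' \<in> range ((*v) (matpow M (Suc j)))"
      using r(1) s(1) by (intro exI[of _ "r + matpow M j *v s"]) force
  next
    fix k x y
    assume xa: "x \<in> power_reps M t (Suc j) \<and> k - x \<in> range ((*v) (matpow M (Suc j)))"
      and ya: "y \<in> power_reps M t (Suc j) \<and> k - y \<in> range ((*v) (matpow M (Suc j)))"
    have "\<And>z. z \<in> power_reps M t (Suc j) \<Longrightarrow>
      \<exists>r s. z = r + matpow M j *v s \<and> r \<in> power_reps M t j \<and> s \<in> {0, t}" by auto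
    then obtain r s r' s' where x: "x = r + matpow M j *v s" "r \<in> power_reps M t j" "s \<in> {0, t}"
      and y: "y = r' + matpow M j *v s'" "r' \<in> power_reps M t j" "s' \<in> {0, t}"
      using xa ya by meson
    from xa ya have "k - x \<in> range ((*v) (matpow M (Suc j)))" "k - y \<in> range ((*v) (matpow M (Suc j)))"
      by blast+
    then have "(k - y) - (k - x) \<in> range ((*v) (matpow M (Suc j)))" by (metis range_mult_vec_diff)
    then have xy: "x - y \<in> range ((*v) (matpow M (Suc j)))" by simp
    have "x - y \<in> range ((*v) (matpow M j))" using xy range_matpow_Suc_subset by blast
    then have "(x - y) - matpow M j *v s + matpow M j *v s' \<in> range ((*v) (matpow M j))"
      by (metis range_mult_vec_add range_mult_vec_diff rangeI)
    then have "r - r' \<in> range ((*v) (matpow M j))" using x y by (simp add: algebra_simps)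
    then have rr: "r = r'" using coset_reps_unique[OF Suc] x y by blast
    obtain p where "x - y = matpow M j *v (M *v p)" using xy by (auto simp: matpow_mult_vec_Suc_right)
    then have "matpow M j *v (s - s') = matpow M j *v (M *v p)"
      using x y rr by (simp add: matrix_vector_mult_diff_distrib)
    then have "s - s' = M *v p" using inj_matpow[OF M] by (metis injD)
    then have "s = s'" using coset_reps_unique[OF R x(3) y(3)] by blast
    then show "x = y" using x y rr by simp
  qed
qed

lemma inj_on_power_reps_step:
  fixes M :: "int^'d^'d"
  assumes M: "dilation_matrix M" and R: "coset_reps M {0, t}"
  shows "inj_on (\<lambda>(r, s). r + matpow M j *v s) (power_reps M t j \<times> {0, t})"
proof (rule inj_onI, clarify)
  fix r s r' s' assume rs: "r \<in> power_reps M t j" "r' \<in> power_reps M t j"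
    and eq: "r + matpow M j *v s = r' + matpow M j *v s'"
  have "r - r' = matpow M j *v (s' - s)" using eq by (simp add: matrix_vector_mult_diff_distrib algebra_simps)
  then have "r = r'" using coset_reps_unique[OF power_reps[OF M R] rs] by blast
  then show "r = r' \<and> s = s'" using eq inj_matpow[OF M] by (metis add_left_cancel injD)
qed

lemma card_power_reps:
  fixes M :: "int^'d^'d"
  assumes M: "dilation_matrix M" and R: "coset_reps M {0, t}" and t: "t \<noteq> 0"
  shows "card (power_reps M t j) = 2 ^ j"
proof (induction j)
  case (Suc j)
  then show ?case using t by (simp add: card_image[OF inj_on_power_reps_step[OF M R]] card_cartesian_product)
qed simp

text \<open>The pair 0, \<open>k0\<close> is given as a system of representatives for
  \<open>A\<close> only. That \<open>k0\<close> also lies outside the image of \<open>B\<close>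
  comes from the equations for \<open>\<nu>\<close>, and index two of \<open>B\<close> is derived
  from both facts by characters.\<close>

locale dyadic_dilation =
  fixes A B :: "int^'d^'d" and k0 :: "int^'d"
  assumes dil: "dilation_matrix A" and repsA: "coset_reps A {0, k0}"
    and B_eq: "B = transpose A" and k0_notin: "k0 \<notin> range ((*v) B)"
begin

lemma dilB: "dilation_matrix B" unfolding B_eq using dil by (rule dilation_matrix_transpose)

definition pairing :: "nat \<Rightarrow> int^'d \<Rightarrow> int^'d \<Rightarrow> real" where
  "pairing j n k = rvec k \<bullet> (matrix_inv (rmatpow B j) *v rvec n)"

text \<open>The pairing exp (2 pi i <k, B^(-j) n>) of two finite groups: it depends on n modulo B^j
  and on k modulo A^j.\<close>

definition chi :: "nat \<Rightarrow> int^'d \<Rightarrow> int^'d \<Rightarrow> complex" where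
  "chi j n k = unit_exp (pairing j n k)"

lemma matrix_inv_rmatpow:
  assumes "dilation_matrix M"
  shows "rmatpow M j *v (matrix_inv (rmatpow M j) *v x) = x"
    and "matrix_inv (rmatpow M j) *v (rmatpow M j *v x) = x"
  using someI_ex[OF invertible_rmatpow[OF assms, of j, unfolded invertible_def]]
  by (simp_all add: matrix_vector_mul_assoc flip: matrix_inv_def)

lemma inner_transpose_mult: "(transpose N *v x) \<bullet> y = x \<bullet> (N *v y)" for N :: "real^'d^'d"
  by (metis dot_lmul_matrix transpose_matrix_vector)

lemma pairing_alt: "pairing j n k = rvec n \<bullet> (matrix_inv (rmatpow A j) *v rvec k)"
proof -
  let ?u = "matrix_inv (rmatpow A j) *v rvec k" and ?w = "matrix_inv (rmatpow B j) *v rvec n"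
  have "rvec n \<bullet> ?u = (transpose (rmatpow A j) *v ?w) \<bullet> ?u"
    unfolding transpose_rmatpow B_eq[symmetric] matrix_inv_rmatpow(1)[OF dilB] ..
  also have "\<dots> = ?w \<bullet> rvec k" unfolding inner_transpose_mult matrix_inv_rmatpow(1)[OF dil] ..
  finally show ?thesis by (simp add: pairing_def inner_commute)
qed

lemma chi_add1: "chi j (n + n') k = chi j n k * chi j n' k"
  by (simp add: chi_def pairing_def rvec_add matrix_vector_right_distrib inner_add_right unit_exp_add)

lemma chi_add2: "chi j n (k + k') = chi j n k * chi j n k'"
  by (simp add: chi_def pairing_def rvec_add inner_add_left unit_exp_add)

lemma matrix_vector_mult_minus: "M *v (- x) = - (M *v x)" for M :: "real^'d^'d"
  using matrix_vector_mult_diff_distrib[of M 0 x] by simp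

lemma chi_minus1: "chi j (- n) k = cnj (chi j n k)"
  by (simp add: chi_def pairing_def rvec_minus cnj_unit_exp matrix_vector_mult_minus)

lemma norm_chi [simp]: "cmod (chi j n k) = 1" by (simp add: chi_def)

lemma chi_matpow1: "n \<in> range ((*v) (matpow B j)) \<Longrightarrow> chi j n k = 1"
  by (auto simp: chi_def pairing_def rvec_matpow matrix_inv_rmatpow dilB unit_exp_eq_1_iff inner_rvec_Ints)

lemma chi_matpow2: "k \<in> range ((*v) (matpow A j)) \<Longrightarrow> chi j n k = 1"
  by (auto simp: chi_def pairing_alt rvec_matpow matrix_inv_rmatpow dil unit_exp_eq_1_iff inner_rvec_Ints)

text \<open>Testing with the coordinate vectors shows that all coordinates of B^(-j) n are
  integers.\<close>

lemma chi_trivial: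
  assumes "\<And>k. chi j n k = 1" shows "n \<in> range ((*v) (matpow B j))"
proof -
  let ?w = "matrix_inv (rmatpow B j) *v rvec n"
  have "?w $ i \<in> \<int>" for i
  proof -
    have "rvec (axis i 1) \<bullet> ?w \<in> \<int>"
      using assms[of "axis i 1"] by (simp add: chi_def pairing_def unit_exp_eq_1_iff)
    moreover have "rvec (axis i 1) = axis i 1" by (simp add: rvec_def axis_def vec_eq_iff)
    ultimately show ?thesis by (metis cart_eq_inner_axis inner_commute)
  qed
  then have w: "rvec (\<chi> i. \<lfloor>?w $ i\<rfloor>) = ?w" by (simp add: rvec_def vec_eq_iff)
  then have "rvec n = rvec (matpow B j *v (\<chi> i. \<lfloor>?w $ i\<rfloor>))"
    by (simp add: rvec_matpow matrix_inv_rmatpow dilB)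
  then show ?thesis by (metis rangeI rvec_inject)
qed

lemma matpow_1: "matpow M (Suc 0) = M" by (simp add: matpow_Suc)

text \<open>Twice \<open>k0\<close> lies in the image of \<open>A\<close>, so the value is a square
  root of 1. If it were 1, the character would be trivial on both cosets of \<open>A\<close>, and n
  would lie in the image of \<open>B\<close>. Membership in the image of \<open>B\<close> is thus a
  sign, multiplicative in n, and this gives \<open>k0_double\<close> and
  \<open>range_B_cases\<close>.\<close>

lemma chi_k0_cases: "chi 1 n k0 = (if n \<in> range ((*v) B) then 1 else -1)"
proof (cases "n \<in> range ((*v) B)")
  case True then show ?thesis using chi_matpow1[of n 1] by (simp add: matpow_1)
next
  case False
  have c: "chi 1 n k = 1" if "k \<in> range ((*v) A)" for k
    using that chi_matpow2[of k 1] by (simp add: matpow_1)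
  have r: "k \<in> range ((*v) A) \<or> k - k0 \<in> range ((*v) A)" for k
    using coset_reps_ex[OF repsA, of k] by auto
  have "k0 + k0 \<in> range ((*v) A)"
    using r[of "k0 + k0"] range_mult_vec_add[of k0 A k0] by auto
  then have sq: "(chi 1 n k0)\<^sup>2 = 1" using c chi_add2 by (metis power2_eq_square)
  have "chi 1 n k0 \<noteq> 1"
  proof
    assume 1: "chi 1 n k0 = 1"
    have "chi 1 n k = 1" for k
      using r[of k] c[of k] c[of "k - k0"] chi_add2[of 1 n "k - k0" k0] 1 by auto
    then show False using chi_trivial[of 1 n] False by (simp add: matpow_1)
  qed
  then show ?thesis using sq False by (simp add: power2_eq_1_iff)
qed

lemma k0_double: "k0 + k0 \<in> range ((*v) B)"
  using chi_k0_cases[of "k0 + k0"] chi_k0_cases[of k0] k0_notin chi_add1[of 1 k0 k0 k0]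
  by (auto split: if_splits)

lemma range_B_cases: "n \<in> range ((*v) B) \<or> n - k0 \<in> range ((*v) B)"
proof (rule disjCI)
  assume n: "n - k0 \<notin> range ((*v) B)"
  show "n \<in> range ((*v) B)"
    using chi_add1[of 1 "n - k0" k0 k0] chi_k0_cases[of n] chi_k0_cases[of "n - k0"] chi_k0_cases[of k0] k0_notin n
    by (auto split: if_splits)
qed

lemma k0_nonzero: "k0 \<noteq> 0" using k0_notin by auto

lemma repsB: "coset_reps B {0, k0}"
  unfolding coset_reps_range
proof (intro allI ex_ex1I)
  fix k show "\<exists>r. r \<in> {0, k0} \<and> k - r \<in> range ((*v) B)" using range_B_cases[of k] by auto
next
  fix k r s assume "r \<in> {0, k0} \<and> k - r \<in> range ((*v) B)" "s \<in> {0, k0} \<and> k - s \<in> range ((*v) B)"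
  then have "r \<in> {0,k0}" "s \<in> {0,k0}" "s - r \<in> range ((*v) B)" "r - s \<in> range ((*v) B)"
    using range_mult_vec_diff[of "k - r" B "k - s"] range_mult_vec_diff[of "k - s" B "k - r"] by auto
  then show "r = s" using k0_notin by auto
qed

lemma card_reps:
  assumes "coset_reps (matpow A j) R" shows "finite R" "card R = 2 ^ j"
proof -
  obtain f where "bij_betw f R (power_reps A k0 j)"
    using coset_reps_bij[OF assms power_reps[OF dil repsA, of j]] by blast
  then show "finite R" "card R = 2 ^ j"
    using bij_betw_finite[of f R] bij_betw_same_card[of f R] card_power_reps[OF dil repsA k0_nonzero, of j] by auto
qed

text \<open>Translation by a vector \<open>k1\<close> with nontrivial character value permutes the
  representatives, after reduction modulo A^j, and multiplies the sum by that value.\<close>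

lemma chi_orthogonality:
  assumes R: "coset_reps (matpow A j) R"
  shows "(\<Sum>k\<in>R. chi j n k) = (if n \<in> range ((*v) (matpow B j)) then 2 ^ j else 0)"
proof (cases "n \<in> range ((*v) (matpow B j))")
  case True then show ?thesis by (simp add: chi_matpow1 card_reps[OF R])
next
  case False
  then obtain k1 where k1: "chi j n k1 \<noteq> 1" using chi_trivial by blast
  obtain f where f: "\<And>k. f k \<in> R" "\<And>k. k + k1 - f k \<in> range ((*v) (matpow A j))"
  proof -
    have "\<forall>k. \<exists>r. r \<in> R \<and> k + k1 - r \<in> range ((*v) (matpow A j))"
      using coset_reps_ex[OF R] by blast
    then show ?thesis using that by metis
  qed
  have cf: "chi j n (f k) = chi j n k1 * chi j n k" for k
    using chi_add2[of j n "f k" "k + k1 - f k"] chi_matpow2[OF f(2)[of k], of n] chi_add2[of j n k k1] by (simp add: mult.commute)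
  have inj: "inj_on f R"
  proof (rule inj_onI)
    fix x y assume xy: "x \<in> R" "y \<in> R" "f x = f y"
    have "(x + k1 - f x) - (y + k1 - f y) \<in> range ((*v) (matpow A j))" by (intro range_mult_vec_diff f)
    then show "x = y" using coset_reps_unique[OF R] xy by simp
  qed
  have "f ` R = R" using inj f(1) card_reps(1)[OF R] by (simp add: endo_inj_surj image_subset_iff)
  then have "(\<Sum>k\<in>R. chi j n k) = (\<Sum>k\<in>R. chi j n (f k))"
    using sum.reindex[OF inj, of "chi j n"] by simp
  also have "\<dots> = chi j n k1 * (\<Sum>k\<in>R. chi j n k)" by (simp add: cf sum_distrib_left)
  finally show ?thesis using k1 False by simp
qed

end

section \<open>The scaling sequences\<close>

lemma intK_0: "intK B 0 = {0}"
proof -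
  have "k = 0" if "rvec k \<in> box (\<chi> i. -1/2) (\<chi> i. 1/2)" for k :: "int^'d"
  proof -
    have "-1 < k $ i \<and> k $ i < 1" for i using that[unfolded mem_box_cart, rule_format, of i] by (simp add: rvec_def)
    then have "k $ i = 0" for i by (smt (verit))
    then show ?thesis by (simp add: vec_eq_iff)
  qed
  moreover have "rvec 0 \<in> box (\<chi> i. -1/2) (\<chi> i. 1/2)" by (simp add: mem_box_cart)
  ultimately show ?thesis by (auto simp: intK_def)
qed

text \<open>At level 1 the prescribed values at 0 and at \<open>k0\<close> are 1 and 0; if
  \<open>k0\<close> were a period, they would have to agree.\<close>

lemma scaling_seq_k0_notin:
  assumes "scaling_seq B L k0 \<nu>" shows "k0 \<notin> range ((*v) B)"
proof
  assume "k0 \<in> range ((*v) B)"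
  then obtain p where p: "k0 = B *v p" by blast
  have s: "(\<forall>k p. \<nu> 1 (k + matpow B 1 *v p) = \<nu> 1 k) \<and>
     (\<forall>k \<in> intK B 0. \<nu> 1 k = fseq L 1 k) \<and>
     (\<forall>k. k - matpow B 0 *v k0 \<in> intK B 0 \<longrightarrow>
        \<nu> 1 k = sqrt (1 - (fseq L 1 (k - matpow B 0 *v k0))\<^sup>2))"
    using assms unfolding scaling_seq_def by (metis diff_self_eq_0 le_refl)
  have "\<nu> 1 (0 + matpow B 1 *v p) = \<nu> 1 0" using s by blast
  moreover have "matpow B 1 *v p = k0" by (simp add: p matpow_Suc)
  ultimately have "\<nu> 1 k0 = \<nu> 1 0" by simp
  moreover have "\<nu> 1 0 = 1" using s by (simp add: intK_0 fseq_def)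
  moreover have "\<nu> 1 k0 = 0" using s by (simp add: intK_0 fseq_def)
  ultimately show False by simp
qed

locale scaling_sequences = dyadic_dilation +
  fixes L :: "int^'a" and \<nu> :: "nat \<Rightarrow> int^'a \<Rightarrow> real"
  assumes L_nonzero: "L \<noteq> 0" and sc: "scaling_seq B L k0 \<nu>"
begin

lemma nu_periodic: "j \<ge> 1 \<Longrightarrow> p \<in> range ((*v) (matpow B j)) \<Longrightarrow> \<nu> j (k + p) = \<nu> j k"
  using sc unfolding scaling_seq_def by blast

lemma nu_int: "k \<in> intK B j \<Longrightarrow> \<nu> (Suc j) k = fseq L (Suc j) k"
  using sc unfolding scaling_seq_def by (metis diff_Suc_1 le_add1 plus_1_eq_Suc)

lemma nu_shift: "k \<in> intK B j \<Longrightarrow> \<nu> (Suc j) (k + matpow B j *v k0) = sqrt (1 - (fseq L (Suc j) k)\<^sup>2)"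
proof -
  assume k: "k \<in> intK B j"
  have "\<forall>k. k - matpow B j *v k0 \<in> intK B j \<longrightarrow>
        \<nu> (Suc j) k = sqrt (1 - (fseq L (Suc j) (k - matpow B j *v k0))\<^sup>2)"
    using sc unfolding scaling_seq_def by (metis diff_Suc_1 le_add1 plus_1_eq_Suc)
  from this[rule_format, of "k + matpow B j *v k0"] k show ?thesis by simp
qed

lemma nu_boundary: "k \<in> clK B j - intK B j \<Longrightarrow> \<nu> (Suc j) k = 1 / sqrt 2"
  using sc unfolding scaling_seq_def by (metis diff_Suc_1 le_add1 plus_1_eq_Suc)

lemma nu_boundary_shift:
  assumes k: "k \<in> clK B j - intK B j" shows "\<nu> (Suc j) (k + matpow B j *v k0) = 1 / sqrt 2"
proof -
  have "\<forall>k. k - matpow B j *v k0 \<in> clK B j - intK B j \<longrightarrow> \<nu> (Suc j) k = 1 / sqrt 2"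
    using sc unfolding scaling_seq_def by (metis diff_Suc_1 le_add1 plus_1_eq_Suc)
  from this[rule_format, of "k + matpow B j *v k0"] k show ?thesis by simp
qed

text \<open>Rounding the coordinates of B^(-j) k to nearest integers leaves a remainder in the
  closed box.\<close>

lemma clK_cover: "\<exists>e z. e \<in> clK B j \<and> k = e + matpow B j *v z"
proof -
  define y where "y = matrix_inv (rmatpow B j) *v rvec k"
  define z :: "int^'a" where "z = (\<chi> i. round (y $ i))"
  have "\<bar>y $ i - of_int (z $ i)\<bar> \<le> 1/2" for i
    using of_int_round_abs_le[of "y $ i"] by (simp add: z_def abs_minus_commute)
  then have "- (1/2) \<le> y $ i - of_int (z $ i) \<and> y $ i - of_int (z $ i) \<le> 1/2" for i
    by (metis abs_le_iff minus_le_iff)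
  then have "y - rvec z \<in> cbox (\<chi> i. -1/2) (\<chi> i. 1/2)"
    by (simp add: mem_box_cart rvec_def)
  moreover have "rvec (k - matpow B j *v z) = rmatpow B j *v (y - rvec z)"
    by (simp add: rvec_diff rvec_matpow y_def matrix_vector_mult_diff_distrib matrix_inv_rmatpow[OF dilB])
  ultimately have "k - matpow B j *v z \<in> clK B j" unfolding clK_def by blast
  then show ?thesis by (metis diff_add_cancel)
qed

lemma fseq_bounds: "0 < fseq L j k" "fseq L j k \<le> 1"
proof -
  show "0 < fseq L j k" by (simp add: fseq_def)
  show "fseq L j k \<le> 1"
  proof (cases "j \<le> 1")
    case False
    then have "0 \<le> real j * (real j - 1)" by simp
    then show ?thesis using False by (simp add: fseq_def)
  qed (simp add: fseq_def)
qed

lemma matpow_k0_double: "matpow B j *v k0 + matpow B j *v k0 \<in> range ((*v) (matpow B (Suc j)))"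
proof -
  obtain p where "k0 + k0 = B *v p" using k0_double by blast
  then have "matpow B j *v (k0 + k0) = matpow B (Suc j) *v p" by (simp add: matpow_mult_vec_Suc_right)
  then show ?thesis by (metis matrix_vector_right_distrib rangeI)
qed

text \<open>Reduce k to a point e of the closed cell by some B^j z. The class of z modulo
  \<open>B\<close> decides whether k is congruent to e or to e + B^j k0 modulo B^(j+1); the second
  case exchanges the two terms because twice B^j k0 is a period. Inside the cell the identity is
  built into the definition, on its boundary it reads 1/2 + 1/2 = 1.\<close>

lemma nu_pair:
  "0 \<le> \<nu> (Suc j) k \<and> (\<nu> (Suc j) k)\<^sup>2 + (\<nu> (Suc j) (k + matpow B j *v k0))\<^sup>2 = 1"
proof -
  let ?t = "matpow B j *v k0"
  obtain e z where e: "e \<in> clK B j" and k: "k = e + matpow B j *v z" using clK_cover by blast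
  have e1: "0 \<le> \<nu> (Suc j) e \<and> 0 \<le> \<nu> (Suc j) (e + ?t) \<and> (\<nu> (Suc j) e)\<^sup>2 + (\<nu> (Suc j) (e + ?t))\<^sup>2 = 1"
  proof (cases "e \<in> intK B j")
    case True
    then show ?thesis using fseq_bounds[of "Suc j" e]
      by (simp add: nu_int nu_shift power_le_one abs_square_le_1)
  next
    case False
    then show ?thesis using e by (simp add: nu_boundary nu_boundary_shift power_divide)
  qed
  have per: "\<nu> (Suc j) (x + matpow B (Suc j) *v p) = \<nu> (Suc j) x" for x p
    by (rule nu_periodic) auto
  from range_B_cases[of z] show ?thesis
  proof
    assume "z \<in> range ((*v) B)"
    then obtain p where "z = B *v p" by blast
    then have k': "k = e + matpow B (Suc j) *v p" by (simp add: k matpow_mult_vec_Suc_right)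
    have "k + ?t = (e + ?t) + matpow B (Suc j) *v p" by (simp add: k')
    then show ?thesis using e1 by (simp only: per k')
  next
    assume "z - k0 \<in> range ((*v) B)"
    then obtain p where "z - k0 = B *v p" by blast
    then have z: "z = k0 + B *v p" by (simp add: algebra_simps)
    have k': "k = (e + ?t) + matpow B (Suc j) *v p"
      by (simp add: k z matrix_vector_right_distrib matpow_mult_vec_Suc_right)
    obtain q where q: "?t + ?t = matpow B (Suc j) *v q" using matpow_k0_double by blast
    have "k + ?t = e + matpow B (Suc j) *v (q + p)"
      by (simp add: k' matrix_vector_right_distrib flip: q)
    then have "\<nu> (Suc j) (k + ?t) = \<nu> (Suc j) e" by (simp only: per)
    moreover have "\<nu> (Suc j) k = \<nu> (Suc j) (e + ?t)" by (simp only: k' per)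
    ultimately show ?thesis using e1 by auto
  qed
qed

lemma nu_bounds: "j \<ge> 1 \<Longrightarrow> 0 \<le> \<nu> j k" "j \<ge> 1 \<Longrightarrow> \<nu> j k \<le> 1"
proof -
  have "0 \<le> \<nu> (Suc i) k \<and> \<nu> (Suc i) k \<le> 1" for i
  proof -
    have "(\<nu> (Suc i) k)\<^sup>2 \<le> 1" using nu_pair[of i k] zero_le_power2[of "\<nu> (Suc i) (k + matpow B i *v k0)"] by linarith
    then have "\<bar>\<nu> (Suc i) k\<bar> \<le> 1" by (simp only: abs_square_le_1)
    then show ?thesis using nu_pair[of i k] by simp
  qed
  then show "j \<ge> 1 \<Longrightarrow> 0 \<le> \<nu> j k" "j \<ge> 1 \<Longrightarrow> \<nu> j k \<le> 1" by (metis Suc_le_D One_nat_def)+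
qed

definition partial :: "nat \<Rightarrow> int^'a \<Rightarrow> nat \<Rightarrow> real" where
  "partial j k N = (\<Prod>r = j + 1..N. \<nu> r k)"

lemma partial_bounds: "0 \<le> partial j k N" "partial j k N \<le> 1"
  unfolding partial_def by (auto intro!: prod_nonneg prod_le_1 simp: nu_bounds)

text \<open>All factors lie in [0, 1], so the partial products decrease; the limit 0 is covered by
  the same argument.\<close>

lemma partial_tendsto: "partial j k \<longlonglongrightarrow> xi_hat \<nu> j k"
proof -
  have "decseq (partial j k)"
  proof (rule decseq_SucI)
    fix N show "partial j k (Suc N) \<le> partial j k N"
    proof (cases "Suc N \<ge> j + 1")
      case True
      then show ?thesis unfolding partial_def
        using partial_bounds[of j k N, unfolded partial_def] nu_bounds[of "Suc N" k]
        by (simp add: prod.nat_ivl_Suc' mult_right_le_one_le)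
    qed (simp add: partial_def)
  qed
  then obtain l where "partial j k \<longlonglongrightarrow> l" using decseq_convergent[of _ 0] partial_bounds(1) by metis
  then show ?thesis unfolding xi_hat_def partial_def[symmetric] by (metis limI)
qed

lemma xi_bounds: "0 \<le> xi_hat \<nu> j k" "xi_hat \<nu> j k \<le> 1"
  using LIMSEQ_le_const[OF partial_tendsto] LIMSEQ_le_const2[OF partial_tendsto] partial_bounds by blast+

lemma xi_Suc: "xi_hat \<nu> j k = \<nu> (Suc j) k * xi_hat \<nu> (Suc j) k"
proof (rule LIMSEQ_unique[OF partial_tendsto])
  have "(\<lambda>N. \<nu> (Suc j) k * partial (Suc j) k N) \<longlonglongrightarrow> \<nu> (Suc j) k * xi_hat \<nu> (Suc j) k"
    by (intro tendsto_intros partial_tendsto)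
  moreover have "\<forall>\<^sub>F N in sequentially. \<nu> (Suc j) k * partial (Suc j) k N = partial j k N"
    using eventually_ge_at_top[of "Suc j"]
  proof eventually_elim
    case (elim N)
    then have "{j+1..N} = insert (Suc j) {Suc j + 1..N}" by auto
    then show ?case by (simp add: partial_def)
  qed
  ultimately show "partial j k \<longlonglongrightarrow> \<nu> (Suc j) k * xi_hat \<nu> (Suc j) k"
    by (rule Lim_transform_eventually)
qed

lemma xi_mono: "i \<le> j \<Longrightarrow> xi_hat \<nu> i k \<le> xi_hat \<nu> j k"
proof (induction j rule: dec_induct)
  case (step n)
  have "xi_hat \<nu> n k \<le> xi_hat \<nu> (Suc n) k"
    using xi_bounds[of "Suc n" k] nu_bounds[of "Suc n" k] by (simp add: xi_Suc[of n] mult_left_le_one_le)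
  then show ?case using step by linarith
qed simp

abbreviation \<Lambda> :: real where "\<Lambda> \<equiv> (norm (rvec L))\<^sup>2"

lemma Lambda_pos: "\<Lambda> > 0"
  using L_nonzero by (metis norm_eq_zero not_less power_zero_numeral rvec_0 rvec_inject zero_less_power2)

text \<open>The factor of index r + 1 is read off in the cell of level r and contributes the
  exponent 1/r - 1/(r + 1). Hence all cells from level j on are involved, and the exponents add up
  to 1/j.\<close>

lemma xi_eq_gauss:
  assumes j: "j \<ge> 1" and int: "\<And>r. r \<ge> j \<Longrightarrow> k \<in> intK B r"
  shows "xi_hat \<nu> j k = exp (- (\<Lambda> * (norm (rvec k))\<^sup>2) / real j)"
proof (rule LIMSEQ_unique[OF partial_tendsto])
  let ?q = "\<Lambda> * (norm (rvec k))\<^sup>2"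
  have p: "partial j k (j + n) = exp (- ?q * (1 / real j - 1 / real (j + n)))" for n
  proof (induction n)
    case (Suc n)
    have "\<nu> (Suc (j + n)) k = exp (- ?q / (real (Suc (j + n)) * real (j + n)))"
      using nu_int[OF int[of "j + n"]] j by (simp add: fseq_def)
    also have "\<dots> = exp (- ?q * (1 / real (j + n) - 1 / real (Suc (j + n))))"
      using j by (simp add: field_simps)
    finally have n: "\<nu> (Suc (j + n)) k = exp (- ?q * (1 / real (j + n) - 1 / real (Suc (j + n))))" .
    have "partial j k (j + Suc n) = partial j k (j + n) * \<nu> (Suc (j + n)) k"
      by (simp add: partial_def)
    also have "\<dots> = exp (- ?q * (1 / real j - 1 / real (j + Suc n)))"
      unfolding Suc n exp_add[symmetric] by (simp add: algebra_simps)
    finally show ?case .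
  qed (simp add: partial_def)
  have "(\<lambda>n. exp (- ?q * (1 / real j - 1 / real (n + j)))) \<longlonglongrightarrow> exp (- ?q * (1 / real j - 0))"
    by (intro tendsto_intros LIMSEQ_ignore_initial_segment lim_1_over_n)
  then have "(\<lambda>n. partial j k (n + j)) \<longlonglongrightarrow> exp (- ?q * (1 / real j - 0))"
    using p by (simp add: add.commute)
  then show "partial j k \<longlonglongrightarrow> exp (- ?q / real j)" by (auto dest: LIMSEQ_offset)
qed

text \<open>For the last bound: \<open>xi_hat\<close> increases with the level, so it may be
  estimated at the first level whose Gaussian formula covers k. That level is about norm k / c, and
  there the exponent is at least \<Lambda> c norm k.\<close>

lemma xi_asymptotics:
  obtains c where "c > 0"
    "\<And>j k. norm (rvec k) < c * (real j + 1) \<Longrightarrow> k \<in> intK B j"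
    "\<And>j k. j \<ge> 1 \<Longrightarrow> norm (rvec k) < c * (real j + 1) \<Longrightarrow>
        xi_hat \<nu> j k = exp (- (\<Lambda> * (norm (rvec k))\<^sup>2) / real j)"
    "\<And>j k. norm (rvec k) \<ge> c * (real j + 1) \<Longrightarrow> xi_hat \<nu> j k \<le> exp (- (\<Lambda> * c * norm (rvec k)))"
proof -
  obtain c where c: "c > 0" and e: "\<And>r x. norm x < c * (real r + 1) \<Longrightarrow>
     \<exists>y \<in> box (\<chi> i. -1/2) (\<chi> i. 1/2). x = rmatpow B r *v y"
    using dilation_matrix_expansion[OF dilB] by blast
  have int: "k \<in> intK B j" if "norm (rvec k) < c * (real j + 1)" for j k
    using e[OF that] unfolding intK_def by blast
  have g: "xi_hat \<nu> j k = exp (- (\<Lambda> * (norm (rvec k))\<^sup>2) / real j)"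
    if "j \<ge> 1" "norm (rvec k) < c * (real j + 1)" for j k
  proof (rule xi_eq_gauss[OF that(1)])
    fix r assume "r \<ge> j"
    then have "c * (real j + 1) \<le> c * (real r + 1)" using c by simp
    then show "k \<in> intK B r" using that(2) int[of k r] by linarith
  qed
  have b: "xi_hat \<nu> j k \<le> exp (- (\<Lambda> * c * norm (rvec k)))" if "norm (rvec k) \<ge> c * (real j + 1)" for j k
  proof -
    define r where "r = nat \<lfloor>norm (rvec k) / c\<rfloor>"
    have nc: "norm (rvec k) / c \<ge> real j + 1" using that c by (simp add: pos_le_divide_eq mult.commute)
    have r1: "real r \<le> norm (rvec k) / c" "norm (rvec k) / c < real r + 1"
      using nc unfolding r_def by linarith+
    have rj: "r \<ge> j + 1" using nc by (simp add: r_def le_nat_floor)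
    have "xi_hat \<nu> j k \<le> xi_hat \<nu> r k" using rj by (intro xi_mono) simp
    also have "\<dots> = exp (- (\<Lambda> * (norm (rvec k))\<^sup>2) / real r)"
      using rj r1(2) c by (intro g) (auto simp: pos_divide_less_eq mult.commute)
    also have "\<dots> \<le> exp (- (\<Lambda> * c * norm (rvec k)))"
    proof -
      have "c * real r \<le> norm (rvec k)" using r1 c by (simp add: pos_le_divide_eq mult.commute)
      then have "(\<Lambda> * norm (rvec k)) * (c * real r) \<le> (\<Lambda> * norm (rvec k)) * norm (rvec k)"
        by (intro mult_left_mono) auto
      then have "\<Lambda> * c * norm (rvec k) \<le> \<Lambda> * (norm (rvec k))\<^sup>2 / real r"
        using rj by (simp add: pos_le_divide_eq power2_eq_square mult_ac)
      then show ?thesis by simp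
    qed
    finally show ?thesis .
  qed
  show thesis using that[OF c int g b] .
qed

end

section \<open>Fourier series on the torus\<close>

lemma space_torus [simp]: "space torus = cbox 0 1"
  by (simp add: torus_def)

lemma emeasure_torus: "emeasure (torus :: (real^'d) measure) (space torus) = 1"
proof -
  have "measure lborel (cbox (0::real^'d) 1) = 1" 
  proof -
    have "0 \<in> cbox (0::real^'d) 1" by (simp add: mem_box_cart)
    then show ?thesis by (subst content_cbox_cart) auto
  qed
  moreover have "emeasure (torus :: (real^'d) measure) (space torus) = emeasure lborel (cbox (0::real^'d) 1)"
    unfolding space_torus unfolding torus_def by (subst emeasure_restrict_space) auto
  moreover have "emeasure lborel (cbox (0::real^'d) 1) \<noteq> top"
    using emeasure_lborel_cbox_finite[of "0::real^'d" 1] by (simp add: less_top)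
  ultimately show ?thesis using emeasure_eq_ennreal_measure[of lborel "cbox (0::real^'d) 1"] by simp
qed

lemma finite_measure_torus: "finite_measure (torus :: (real^'d) measure)"
  by (rule finite_measureI) (simp add: emeasure_torus del: space_torus)

lemma measure_torus [simp]: "measure torus (cbox 0 (1 :: real^'d)) = 1"
  using emeasure_torus[where 'd='d] by (simp add: finite_measure.emeasure_eq_measure[OF finite_measure_torus])

lemma integrable_torus_const [simp]: "integrable torus (\<lambda>x :: real^'d. c :: 'b::{banach, second_countable_topology})"
  by (rule finite_measure.integrable_const[OF finite_measure_torus])

lemma continuous_measurable_torus:
  fixes f :: "real^'d \<Rightarrow> 'b::{banach, second_countable_topology}"
  assumes "continuous_on UNIV f" shows "f \<in> borel_measurable torus"
proof -
  have "f \<in> borel_measurable lborel" using borel_measurable_continuous_onI[OF assms] by simp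
  then have "f \<in> borel_measurable lebesgue" by (rule measurable_completion)
  then show ?thesis unfolding torus_def by (rule measurable_restrict_space1)
qed

lemma continuous_integrable_torus:
  fixes f :: "real^'d \<Rightarrow> 'b::{banach, second_countable_topology}"
  assumes "continuous_on UNIV f" shows "integrable torus f"
proof -
  have "bounded (f ` cbox 0 1)"
    using assms compact_continuous_image[OF continuous_on_subset[OF assms] compact_cbox] compact_imp_bounded by blast
  then obtain B where "\<And>x. x \<in> cbox 0 1 \<Longrightarrow> norm (f x) \<le> B" by (auto simp: bounded_iff)
  then show ?thesis
    by (intro finite_measure.integrable_const_bound[OF finite_measure_torus, of _ B] AE_I2 continuous_measurable_torus assms) auto
qed

lemma integrable_torus_iff: "integrable torus f \<longleftrightarrow> integrable lebesgue (\<lambda>x. indicator (cbox 0 1) x *\<^sub>R f x)"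
  for f :: "real^'d \<Rightarrow> 'b::{banach, second_countable_topology}"
  unfolding torus_def by (subst integrable_restrict_space) auto

lemma integral_torus_eq: "integral\<^sup>L torus f = integral\<^sup>L lebesgue (\<lambda>x. indicator (cbox 0 1) x *\<^sub>R f x)"
  for f :: "real^'d \<Rightarrow> 'b::{banach, second_countable_topology}"
  unfolding torus_def by (subst integral_restrict_space) auto

lemma measurable_torus_iff: "f \<in> borel_measurable torus \<longleftrightarrow> (\<lambda>x. indicator (cbox 0 1) x *\<^sub>R f x) \<in> borel_measurable lebesgue"
  for f :: "real^'d \<Rightarrow> 'b::real_normed_vector"
  unfolding torus_def by (subst borel_measurable_restrict_space_iff) auto

lemma distr_lebesgue_shift: "distr lebesgue lebesgue (\<lambda>x. x + a) = (lebesgue :: (real^'d) measure)"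
  and measurable_lebesgue_shift: "(\<lambda>x. x + a) \<in> (lebesgue :: (real^'d) measure) \<rightarrow>\<^sub>M lebesgue"
  using lebesgue_affine_euclidean[of "\<lambda>_. 1" a] lebesgue_affine_measurable[of "\<lambda>_. 1" a]
  by (simp_all add: euclidean_representation density_1 add.commute)

lemma integrable_lebesgue_shift:
  fixes f :: "real^'d \<Rightarrow> 'b::{banach, second_countable_topology}"
  assumes "integrable lebesgue f"
  shows "integrable lebesgue (\<lambda>x. f (x + a))"
    and "integral\<^sup>L lebesgue (\<lambda>x. f (x + a)) = integral\<^sup>L lebesgue f"
  using integrable_distr[OF measurable_lebesgue_shift[of a], of f] assms
    integral_distr[OF measurable_lebesgue_shift[of a], of f]
  by (simp_all add: distr_lebesgue_shift borel_measurable_integrable)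

text \<open>Shift invariance is an additive property of \<open>a\<close>; it suffices to check \<open>0 \<le> t < 1\<close> along one axis,
  where the shifted cube is cut by a hyperplane into two pieces.\<close>

definition shiftable :: "real^'d \<Rightarrow> bool" where
  "shiftable a \<longleftrightarrow> (\<forall>f :: real^'d \<Rightarrow> complex. periodic f \<longrightarrow>
     (f \<in> borel_measurable torus \<longrightarrow> (\<lambda>x. f (x + a)) \<in> borel_measurable torus) \<and>
     (integrable torus f \<longrightarrow> integrable torus (\<lambda>x. f (x + a)) \<and>
        integral\<^sup>L torus (\<lambda>x. f (x + a)) = integral\<^sup>L torus f))"

lemma AE_hyperplane: "AE x in lebesgue. x $ n \<noteq> (c::real)" for n :: "'d::finite"
proof -
  have "negligible {x :: real^'d. x \<bullet> axis n 1 = c}"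
    using negligible_standard_hyperplane[of "axis n 1 :: real^'d" c] by (auto simp: Basis_vec_def)
  then show ?thesis
    by (intro AE_I'[of "{x. x $ n = c}"]) (auto simp: negligible_iff_null_sets cart_eq_inner_axis)
qed

lemma periodic_shift: "periodic f \<Longrightarrow> periodic (\<lambda>x. f (x + a))"
  unfolding periodic_def by (metis add.commute add.left_commute)

lemma periodicD: "periodic f \<Longrightarrow> f (x + rvec k) = f x"
  unfolding periodic_def by blast

lemma rvec_axis: "rvec (axis n m) = axis n (of_int m)"
  by (simp add: rvec_def axis_def vec_eq_iff)

lemma shiftable_axis_unit:
  assumes t: "0 \<le> t" "t < 1" shows "shiftable (axis n t :: real^'d)"
  unfolding shiftable_def
proof (intro allI impI conjI)
  fix f :: "real^'d \<Rightarrow> complex" assume per: "periodic f"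
  let ?K = "cbox 0 1 :: (real^'d) set"
  let ?u = "axis n t :: real^'d" and ?v = "axis n (t - 1) :: real^'d"
  let ?f = "\<lambda>x. indicator ?K x *\<^sub>R f x"
  \<comment> \<open>Half-open bounds are chosen so that \<open>dec\<close> holds at every point. The
    overlap at \<open>y $ n = t\<close> and the gap at \<open>y $ n = 0\<close> are null sets and
    are discarded only when the integrals are compared.\<close>
  let ?g1 = "\<lambda>y. indicator {y. y $ n \<ge> t} y *\<^sub>R ?f y" and ?g2 = "\<lambda>y. indicator {y. 0 < y $ n \<and> y $ n \<le> t} y *\<^sub>R ?f y"
  have fv: "f (x + ?v) = f (x + ?u)" for x
  proof -
    have "x + ?u = (x + ?v) + rvec (axis n 1)" unfolding rvec_axis by (simp add: axis_def vec_eq_iff)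
    then show ?thesis using periodicD[OF per] by metis
  qed
  have dec: "indicator ?K x *\<^sub>R f (x + ?u) = ?g1 (x + ?u) + ?g2 (x + ?v)" for x
  proof -
    have i1: "indicator {y. y $ n \<ge> t} (x + ?u) * indicator ?K (x + ?u) = (indicator {x. x $ n \<le> 1 - t} x * indicator ?K x :: real)"
      using t by (auto simp: indicator_def mem_box_cart axis_def) (smt (verit))+
    have i2: "indicator {y. 0 < y $ n \<and> y $ n \<le> t} (x + ?v) * indicator ?K (x + ?v) = (indicator {x. x $ n > 1 - t} x * indicator ?K x :: real)"
      using t by (auto simp: indicator_def mem_box_cart axis_def) (smt (verit))+
    have "?g1 (x + ?u) + ?g2 (x + ?v) = (indicator {x. x $ n \<le> 1 - t} x * indicator ?K x + indicator {x. x $ n > 1 - t} x * indicator ?K x :: real) *\<^sub>R f (x + ?u)"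
      unfolding scaleR_scaleR i1 i2 fv scaleR_add_left ..
    also have "(indicator {x. x $ n \<le> 1 - t} x * indicator ?K x + indicator {x. x $ n > 1 - t} x * indicator ?K x :: real) = indicator ?K x"
      by (auto simp: indicator_def)
    finally show ?thesis ..
  qed
  have sl: "{y::real^'d. y $ n \<ge> t} \<in> sets lebesgue" "{y::real^'d. 0 < y $ n \<and> y $ n \<le> t} \<in> sets lebesgue"
  proof -
    have "{y::real^'d. y $ n \<ge> t} \<in> sets borel" "{y::real^'d. 0 < y $ n \<and> y $ n \<le> t} \<in> sets borel" by measurable
    then show "{y::real^'d. y $ n \<ge> t} \<in> sets lebesgue" "{y::real^'d. 0 < y $ n \<and> y $ n \<le> t} \<in> sets lebesgue" by auto
  qed
  {
    assume "f \<in> borel_measurable torus"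
    then have m: "?f \<in> borel_measurable lebesgue" by (simp only: measurable_torus_iff)
    have sh: "(\<lambda>x. g (x + a)) \<in> borel_measurable lebesgue" if "g \<in> borel_measurable lebesgue" for g :: "real^'d \<Rightarrow> complex" and a
      using measurable_comp[OF measurable_lebesgue_shift[of a] that] by (simp add: comp_def)
    have "?g1 \<in> borel_measurable lebesgue" "?g2 \<in> borel_measurable lebesgue"
      by (intro borel_measurable_scaleR[OF _ m] borel_measurable_indicator sl)+
    then have "(\<lambda>x. ?g1 (x + ?u) + ?g2 (x + ?v)) \<in> borel_measurable lebesgue"
      by (intro borel_measurable_add sh)
    then show "(\<lambda>x. f (x + ?u)) \<in> borel_measurable torus" unfolding measurable_torus_iff dec .
  }
  {
    assume "integrable torus f"
    then have i: "integrable lebesgue ?f" by (simp only: integrable_torus_iff)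
    have ig: "integrable lebesgue ?g1" "integrable lebesgue ?g2"
      by (intro integrable_mult_indicator[OF _ i] sl)+
    note s1 = integrable_lebesgue_shift[OF ig(1), of ?u] and s2 = integrable_lebesgue_shift[OF ig(2), of ?v]
    show "integrable torus (\<lambda>x. f (x + ?u))" unfolding integrable_torus_iff dec by (intro Bochner_Integration.integrable_add s1 s2)
    have "integral\<^sup>L torus (\<lambda>x. f (x + ?u)) = integral\<^sup>L lebesgue ?g1 + integral\<^sup>L lebesgue ?g2"
      unfolding integral_torus_eq dec Bochner_Integration.integral_add[OF s1(1) s2(1)] s1(2) s2(2) ..
    also have "\<dots> = integral\<^sup>L lebesgue (\<lambda>x. ?g1 x + ?g2 x)"
      by (rule Bochner_Integration.integral_add[symmetric, OF ig])
    also have "\<dots> = integral\<^sup>L lebesgue ?f"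
    proof (rule integral_cong_AE)
      show "AE x in lebesgue. ?g1 x + ?g2 x = ?f x"
        using AE_hyperplane[of n t] AE_hyperplane[of n 0]
      proof eventually_elim
        case (elim x)
        show ?case
        proof (cases "x \<in> ?K")
          case True
          then have "0 \<le> x $ n" by (simp add: mem_box_cart)
          then show ?thesis using elim t by (auto simp: indicator_def)
        qed simp
      qed
    qed (use ig i in \<open>auto intro!: borel_measurable_integrable Bochner_Integration.integrable_add\<close>)
    finally show "integral\<^sup>L torus (\<lambda>x. f (x + ?u)) = integral\<^sup>L torus f" unfolding integral_torus_eq .
  }
qed

lemma shiftable_add: "shiftable a \<Longrightarrow> shiftable b \<Longrightarrow> shiftable (a + b)"
proof -
  assume a: "shiftable a" and b: "shiftable b"
  show "shiftable (a + b)" unfolding shiftable_def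
  proof (intro allI impI)
    fix f :: "real^'a \<Rightarrow> complex" assume p: "periodic f"
    have "(\<lambda>x. f (x + (a + b))) = (\<lambda>x. (\<lambda>y. f (y + b)) (x + a))" by (simp add: add.assoc)
    then show "(f \<in> borel_measurable torus \<longrightarrow> (\<lambda>x. f (x + (a + b))) \<in> borel_measurable torus) \<and>
         (integrable torus f \<longrightarrow> integrable torus (\<lambda>x. f (x + (a + b))) \<and>
            integral\<^sup>L torus (\<lambda>x. f (x + (a + b))) = integral\<^sup>L torus f)"
      using a[unfolded shiftable_def, rule_format, OF periodic_shift[OF p, of b]]
        b[unfolded shiftable_def, rule_format, OF p] by (simp only:) metis
  qed
qed

lemma shiftable: "shiftable (a :: real^'d)"
proof -
  have ax: "shiftable (axis n s :: real^'d)" for n s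
  proof -
    have f: "shiftable (axis n (frac s) :: real^'d)" by (rule shiftable_axis_unit) (auto simp: frac_lt_1)
    have "axis n s = axis n (frac s) + rvec (axis n \<lfloor>s\<rfloor>)"
      unfolding rvec_axis by (simp add: frac_def axis_def vec_eq_iff)
    then have "h (x + axis n s) = h (x + axis n (frac s))" if "periodic h" for h :: "real^'d \<Rightarrow> complex" and x
      using periodicD[OF that] by (metis add.assoc)
    then have "(\<lambda>x. h (x + axis n s)) = (\<lambda>x. h (x + axis n (frac s)))" if "periodic h" for h :: "real^'d \<Rightarrow> complex"
      using that by blast
    then show ?thesis using f unfolding shiftable_def by (metis (no_types, lifting))
  qed
  have "shiftable (\<Sum>n\<in>S. axis n (a $ n) :: real^'d)" if "finite S" for S
    using that
  proof induction
    case empty show ?case by (simp add: shiftable_def)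
  next
    case (insert n S) then show ?case by (simp add: shiftable_add ax)
  qed
  from this[of UNIV] have "shiftable (\<Sum>n\<in>UNIV. axis n (a $ n) :: real^'d)" by simp
  moreover have "(\<Sum>n\<in>UNIV. axis n (a $ n)) = a" by (simp add: vec_eq_iff axis_def)
  ultimately show ?thesis by simp
qed

lemma torus_shift:
  fixes f :: "real^'d \<Rightarrow> complex"
  assumes "periodic f"
  shows "f \<in> borel_measurable torus \<Longrightarrow> (\<lambda>x. f (x + a)) \<in> borel_measurable torus"
    and "integrable torus f \<Longrightarrow> integrable torus (\<lambda>x. f (x + a))"
    and "integrable torus f \<Longrightarrow> integral\<^sup>L torus (\<lambda>x. f (x + a)) = integral\<^sup>L torus f"
  using shiftable[of a] assms unfolding shiftable_def by blast+

section \<open>Exponentials and trigonometric polynomials\<close>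

definition wave :: "int^'d \<Rightarrow> real^'d \<Rightarrow> complex" where
  "wave k x = unit_exp (rvec k \<bullet> x)"

lemma wave_add: "wave (k + l) x = wave k x * wave l x"
  by (simp add: wave_def rvec_add inner_add_left unit_exp_add)

lemma wave_shift: "wave k (x + a) = wave k x * wave k a"
  by (simp add: wave_def inner_add_right unit_exp_add)

lemma cnj_wave: "cnj (wave k x) = wave (- k) x"
  by (simp add: wave_def rvec_minus cnj_unit_exp)

lemma norm_wave [simp]: "cmod (wave k x) = 1" by (simp add: wave_def)

lemma wave_0 [simp]: "wave 0 x = 1" by (simp add: wave_def)

lemma periodic_wave: "periodic (wave k)"
  by (simp add: periodic_def wave_shift) (simp add: wave_def unit_exp_eq_1_iff[THEN iffD2] inner_rvec_Ints)

lemma continuous_wave: "continuous_on S (wave k)"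
  unfolding wave_def unit_exp_def cis_conv_exp by (intro continuous_intros)

text \<open>A shift by half a period along an axis on which k has a nonzero entry reverses the sign
  of the wave but preserves its integral.\<close>

lemma integral_wave: "integral\<^sup>L torus (wave k) = (if k = 0 then 1 else 0)"
proof (cases "k = 0")
  case True
  then have "wave k = (\<lambda>x. 1)" by auto
  then show ?thesis using True by simp
next
  case False
  then obtain i where i: "k $ i \<noteq> 0" by (auto simp: vec_eq_iff)
  define a :: "real^'a" where "a = axis i (1 / (2 * of_int (k $ i)))"
  have "rvec k \<bullet> a = 1/2" using i by (simp add: a_def inner_axis rvec_def)
  then have "2 * pi * (rvec k \<bullet> a) = pi" by simp
  then have a: "wave k a = -1" unfolding wave_def unit_exp_def by (simp only: cis_pi)
  have "integral\<^sup>L torus (wave k) = integral\<^sup>L torus (\<lambda>x. wave k (x + a))"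
    by (rule torus_shift(3)[symmetric, OF periodic_wave]) (intro continuous_integrable_torus continuous_wave)
  also have "\<dots> = - integral\<^sup>L torus (wave k)" by (simp add: wave_shift a)
  finally show ?thesis using False by simp
qed

lemma fcoeff_wave: "fcoeff f k = integral\<^sup>L torus (\<lambda>x. f x * cnj (wave k x))"
  unfolding fcoeff_def exp_unit_exp_minus wave_def cnj_unit_exp ..

inductive trig_poly :: "(real^'d \<Rightarrow> complex) \<Rightarrow> bool" where
  trig_poly_wave: "trig_poly (\<lambda>x. c * wave k x)"
| trig_poly_add: "trig_poly f \<Longrightarrow> trig_poly g \<Longrightarrow> trig_poly (\<lambda>x. f x + g x)"

lemma trig_poly_const: "trig_poly (\<lambda>x. c)"
  using trig_poly_wave[of c 0] by simp

lemma trig_poly_mult: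
  assumes "trig_poly f" "trig_poly g" shows "trig_poly (\<lambda>x. f x * g x)"
  using assms(1)
proof induction
  case (trig_poly_wave c k)
  show ?case using assms(2)
  proof induction
    case (trig_poly_wave d l)
    show ?case using trig_poly.trig_poly_wave[of "c * d" "k + l"] by (simp add: wave_add mult_ac)
  next
    case (trig_poly_add f g) then show ?case using trig_poly.trig_poly_add by (simp add: distrib_left)
  qed
next
  case (trig_poly_add f g) then show ?case using trig_poly.trig_poly_add by (simp add: distrib_right)
qed

lemma trig_poly_sum: "(\<And>i. i \<in> I \<Longrightarrow> trig_poly (f i)) \<Longrightarrow> trig_poly (\<lambda>x. \<Sum>i\<in>I. f i x)"
  by (induction I rule: infinite_finite_induct) (auto intro: trig_poly_const trig_poly_add)

lemma trig_poly_eq_sum: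
  assumes "trig_poly f" shows "\<exists>K a. finite K \<and> f = (\<lambda>x. \<Sum>k\<in>K. a k * wave k x)"
  using assms
proof induction
  case (trig_poly_wave c k) show ?case by (intro exI[of _ "{k}"] exI[of _ "\<lambda>_. c"]) auto
next
  case (trig_poly_add f g)
  then obtain K a M b where f: "finite K" "f = (\<lambda>x. \<Sum>k\<in>K. a k * wave k x)"
    and g: "finite M" "g = (\<lambda>x. \<Sum>k\<in>M. b k * wave k x)" by blast
  have "f x = (\<Sum>k\<in>K \<union> M. (if k \<in> K then a k else 0) * wave k x)" for x
    unfolding f(2) using f(1) g(1) by (intro sum.mono_neutral_cong_left) auto
  moreover have "g x = (\<Sum>k\<in>K \<union> M. (if k \<in> M then b k else 0) * wave k x)" for x
    unfolding g(2) using f(1) g(1) by (intro sum.mono_neutral_cong_left) auto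
  ultimately have "(\<lambda>x. f x + g x) = (\<lambda>x. \<Sum>k\<in>K \<union> M. ((if k \<in> K then a k else 0) + (if k \<in> M then b k else 0)) * wave k x)"
    by (simp add: distrib_right sum.distrib)
  then show ?case using f(1) g(1) by (intro exI[of _ "K \<union> M"] exI) auto
qed

lemma continuous_trig_poly: "trig_poly f \<Longrightarrow> continuous_on S f"
  by (induction rule: trig_poly.induct) (intro continuous_intros continuous_wave | assumption)+

text \<open>Square integrability without periodicity: the truncated and cut-off functions in the
  density argument need not be periodic.\<close>

definition sq_integrable :: "(real^'d \<Rightarrow> complex) \<Rightarrow> bool" where
  "sq_integrable f \<longleftrightarrow> f \<in> borel_measurable torus \<and> integrable torus (\<lambda>x. (cmod (f x))\<^sup>2)"

lemma L2T_sq_integrable: "f \<in> L2T \<longleftrightarrow> periodic f \<and> sq_integrable f"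
  by (auto simp: L2T_def sq_integrable_def)

lemma norm_add_sq_le: "(norm (a + b))\<^sup>2 \<le> 2 * (norm a)\<^sup>2 + 2 * (norm (b :: 'a::real_normed_vector))\<^sup>2"
proof -
  have "(norm (a + b))\<^sup>2 \<le> (norm a + norm b)\<^sup>2" by (intro power_mono norm_triangle_ineq) auto
  also have "\<dots> \<le> 2 * (norm a)\<^sup>2 + 2 * (norm b)\<^sup>2"
    using sum_squares_bound[of "norm a" "norm b"] by (simp add: power2_sum)
  finally show ?thesis .
qed

lemma sq_integrable_measurable: "sq_integrable f \<Longrightarrow> f \<in> borel_measurable torus"
  and sq_integrable_integrable: "sq_integrable f \<Longrightarrow> integrable torus (\<lambda>x. (cmod (f x))\<^sup>2)"
  by (simp_all add: sq_integrable_def)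

lemma sq_integrable_bound:
  assumes "f \<in> borel_measurable torus" "integrable torus g" "\<And>x. x \<in> cbox 0 1 \<Longrightarrow> (cmod (f x))\<^sup>2 \<le> g x"
  shows "sq_integrable f"
proof -
  have [measurable]: "f \<in> borel_measurable torus" by fact
  have "AE x in torus. norm ((cmod (f x))\<^sup>2) \<le> norm (g x)"
    by (rule AE_I2) (use assms(3) in \<open>fastforce\<close>)
  then show ?thesis unfolding sq_integrable_def using assms(1,2)
    by (auto intro!: Bochner_Integration.integrable_bound[OF assms(2)])
qed

lemma sq_integrable_add: assumes f: "sq_integrable f" and g: "sq_integrable g" shows "sq_integrable (\<lambda>x. f x + g x)"
proof (rule sq_integrable_bound)
  show "integrable torus (\<lambda>x. 2 * (cmod (f x))\<^sup>2 + 2 * (cmod (g x))\<^sup>2)"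
    using f g by (auto simp: sq_integrable_def)
  show "(\<lambda>x. f x + g x) \<in> borel_measurable torus" using f g by (auto simp: sq_integrable_def)
qed (rule norm_add_sq_le)

lemma sq_integrable_cmult: "sq_integrable f \<Longrightarrow> sq_integrable (\<lambda>x. c * f x)"
  by (auto simp: sq_integrable_def norm_mult power_mult_distrib)

lemma sq_integrable_uminus: "sq_integrable f \<Longrightarrow> sq_integrable (\<lambda>x. - f x)"
  by (auto simp: sq_integrable_def)

lemma sq_integrable_diff: "sq_integrable f \<Longrightarrow> sq_integrable g \<Longrightarrow> sq_integrable (\<lambda>x. f x - g x)"
  using sq_integrable_add[of f "\<lambda>x. - g x"] by (simp add: sq_integrable_uminus)

lemma sq_integrable_continuous: "continuous_on UNIV f \<Longrightarrow> sq_integrable f"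
  unfolding sq_integrable_def by (intro conjI continuous_measurable_torus continuous_integrable_torus continuous_intros)

lemma sq_integrable_bounded:
  assumes "f \<in> borel_measurable torus" "\<And>x. x \<in> cbox 0 1 \<Longrightarrow> cmod (f x) \<le> M" shows "sq_integrable f"
  by (rule sq_integrable_bound[OF assms(1), of "\<lambda>_. M\<^sup>2"]) (auto intro!: power_mono assms)

lemma sq_integrable_trig_poly: "trig_poly p \<Longrightarrow> sq_integrable p"
  by (intro sq_integrable_continuous continuous_trig_poly)

lemma sq_integrable_wave: "sq_integrable (wave k)" by (intro sq_integrable_continuous continuous_wave)

lemma measurable_cnj: "g \<in> borel_measurable M \<Longrightarrow> (\<lambda>x. cnj (g x)) \<in> borel_measurable M"
  by (rule borel_measurable_continuous_on[of cnj]) (intro continuous_intros)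

section \<open>Density of trigonometric polynomials\<close>

definition approximable :: "(real^'d \<Rightarrow> complex) \<Rightarrow> bool" where
  "approximable f \<longleftrightarrow> (\<forall>e>0. \<exists>p. trig_poly p \<and> integral\<^sup>L torus (\<lambda>x. (cmod (f x - p x))\<^sup>2) < e)"

lemma approximable_limit:
  assumes f: "sq_integrable f" and g: "\<And>n. sq_integrable (g n)" and app: "\<And>n. approximable (g n)"
    and lim: "(\<lambda>n. integral\<^sup>L torus (\<lambda>x. (cmod (f x - g n x))\<^sup>2)) \<longlonglongrightarrow> 0"
  shows "approximable f"
  unfolding approximable_def
proof (intro allI impI)
  fix e :: real assume e: "e > 0"
  have "\<forall>\<^sub>F n in sequentially. integral\<^sup>L torus (\<lambda>x. (cmod (f x - g n x))\<^sup>2) < e / 4"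
    using lim e by (intro order_tendstoD(2)[OF lim]) auto
  then obtain n where n: "integral\<^sup>L torus (\<lambda>x. (cmod (f x - g n x))\<^sup>2) < e / 4"
    by (auto simp: eventually_sequentially)
  obtain p where p: "trig_poly p" "integral\<^sup>L torus (\<lambda>x. (cmod (g n x - p x))\<^sup>2) < e / 4"
    using app[of n, unfolded approximable_def, rule_format, of "e / 4"] e by auto
  have i: "integrable torus (\<lambda>x. (cmod (f x - g n x))\<^sup>2)" "integrable torus (\<lambda>x. (cmod (g n x - p x))\<^sup>2)"
     "integrable torus (\<lambda>x. (cmod (f x - p x))\<^sup>2)"
    by (intro sq_integrable_integrable sq_integrable_diff f g sq_integrable_trig_poly[OF p(1)])+
  have "integral\<^sup>L torus (\<lambda>x. (cmod (f x - p x))\<^sup>2)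
     \<le> integral\<^sup>L torus (\<lambda>x. 2 * (cmod (f x - g n x))\<^sup>2 + 2 * (cmod (g n x - p x))\<^sup>2)"
  proof (rule integral_mono)
    fix x show "(cmod (f x - p x))\<^sup>2 \<le> 2 * (cmod (f x - g n x))\<^sup>2 + 2 * (cmod (g n x - p x))\<^sup>2"
      using norm_add_sq_le[of "f x - g n x" "g n x - p x"] by simp
  qed (use i in auto)
  also have "\<dots> = 2 * integral\<^sup>L torus (\<lambda>x. (cmod (f x - g n x))\<^sup>2) + 2 * integral\<^sup>L torus (\<lambda>x. (cmod (g n x - p x))\<^sup>2)"
    using i by simp
  also have "\<dots> < e" using n p(2) by simp
  finally show "\<exists>p. trig_poly p \<and> integral\<^sup>L torus (\<lambda>x. (cmod (f x - p x))\<^sup>2) < e" using p(1) by blast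
qed

text \<open>The map of the cube onto the compact set on which Stone--Weierstrass is applied; real polynomials
  in the coordinates of \<open>embed x\<close> are trigonometric polynomials in \<open>x\<close>.\<close>

definition embed :: "real^'d \<Rightarrow> complex^'d" where
  "embed x = (\<chi> i. unit_exp (x $ i))"

lemma embed_wave: "embed x $ i = wave (axis i 1) x"
  by (simp add: embed_def wave_def rvec_axis inner_axis')

lemma continuous_embed: "continuous_on S embed"
  unfolding embed_def unit_exp_def cis_conv_exp by (intro continuous_intros)

text \<open>Coordinates with equal image differ by an integer, and two numbers in [0, 1] at a
  nonzero integer distance are 0 and 1. A function that vanishes off the open cube therefore
  descends to the image of \<open>embed\<close>.\<close>

lemma embed_eq_boundary:
  assumes "embed x = embed y" "x \<noteq> y" "x \<in> cbox 0 1" "y \<in> cbox 0 1"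
  shows "x \<notin> box 0 1"
proof -
  obtain i where i: "x $ i \<noteq> y $ i" using assms(2) by (auto simp: vec_eq_iff)
  have "unit_exp (x $ i) = unit_exp (y $ i)" using assms(1) by (simp add: embed_def vec_eq_iff)
  then have "unit_exp (x $ i - y $ i) = 1" using unit_exp_add[of "x $ i - y $ i" "y $ i"] by simp
  then obtain n where n: "x $ i - y $ i = of_int n" unfolding unit_exp_eq_1_iff by (auto elim: Ints_cases)
  have "0 \<le> x $ i" "x $ i \<le> 1" "0 \<le> y $ i" "y $ i \<le> 1" using assms(3,4) by (auto simp: mem_box_cart)
  moreover have "n \<noteq> 0" using n i by auto
  then have "1 \<le> n \<or> n \<le> -1" by linarith
  then have "1 \<le> real_of_int n \<or> real_of_int n \<le> -1" by (metis of_int_1 of_int_le_iff of_int_minus)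
  ultimately have "x $ i = 0 \<or> x $ i = 1" using n by linarith
  moreover have "x \<in> box 0 1 \<Longrightarrow> 0 < x $ i \<and> x $ i < 1" by (simp add: mem_box_cart)
  ultimately show ?thesis by auto
qed

text \<open>The real and imaginary part of each coordinate of \<open>embed x\<close> are
  combinations of the two waves with frequencies e and - e, for e the coordinate vector, and a real
  linear functional is a combination of these parts.\<close>

lemma trig_poly_real_polynomial:
  assumes "real_polynomial_function q" shows "trig_poly (\<lambda>x. of_real (q (embed x)))"
  using assms
proof induction
  case (linear f)
  have f: "f z = (\<Sum>i\<in>UNIV. Re (z $ i) * f (axis i 1) + Im (z $ i) * f (axis i \<i>))" for z
  proof -
    interpret bounded_linear f by fact
    have "z = (\<Sum>i\<in>UNIV. Re (z $ i) *\<^sub>R axis i 1 + Im (z $ i) *\<^sub>R axis i \<i>)"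
      by (simp add: vec_eq_iff axis_def if_distrib[of "\<lambda>a. _ *\<^sub>R a"] sum.distrib cong: if_cong)
         (simp add: complex_eq_iff)
    then have "f z = f (\<Sum>i\<in>UNIV. Re (z $ i) *\<^sub>R axis i 1 + Im (z $ i) *\<^sub>R axis i \<i>)" by (rule arg_cong)
    also have "\<dots> = (\<Sum>i\<in>UNIV. Re (z $ i) * f (axis i 1) + Im (z $ i) * f (axis i \<i>))"
      by (simp add: sum add scaleR)
    finally show ?thesis .
  qed
  have re: "of_real (Re (embed x $ i)) = (1/2) * wave (axis i 1) x + (1/2) * wave (- axis i 1) x" for x :: "real^'a" and i
    unfolding embed_wave cnj_wave[symmetric] by (simp add: complex_eq_iff)
  have im: "of_real (Im (embed x $ i)) = (-\<i>/2) * wave (axis i 1) x + (\<i>/2) * wave (- axis i 1) x" for x :: "real^'a" and i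
    unfolding embed_wave cnj_wave[symmetric] by (simp add: complex_eq_iff)
  have "(\<lambda>x. of_real (f (embed x))) = (\<lambda>x. \<Sum>i\<in>UNIV.
      ((1/2) * wave (axis i 1) x + (1/2) * wave (- axis i 1) x) * of_real (f (axis i 1)) +
      ((-\<i>/2) * wave (axis i 1) x + (\<i>/2) * wave (- axis i 1) x) * of_real (f (axis i \<i>)))"
    by (rule ext, subst f) (simp only: of_real_sum of_real_add of_real_mult re im)
  then show ?case by (simp only:) (intro trig_poly_sum trig_poly_add trig_poly_mult trig_poly_const trig_poly_wave)
next
  case (const c) show ?case by (rule trig_poly_const)
next
  case (add f g) then show ?case using trig_poly_add by simp
next
  case (mult f g) then show ?case using trig_poly_mult by simp
qed

text \<open>The function is transported to the compact image of the cube, approximated there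
  uniformly by a polynomial, and pulled back. Vanishing off the open cube replaces
  periodicity.\<close>

lemma approximable_continuous:
  fixes g :: "real^'d \<Rightarrow> complex"
  assumes g: "continuous_on UNIV g" and z: "\<And>x. x \<notin> box 0 1 \<Longrightarrow> g x = 0"
  shows "approximable g"
  unfolding approximable_def
proof (intro allI impI)
  fix e :: real assume e: "e > 0"
  let ?K = "cbox 0 1 :: (real^'d) set"
  define F where "F w = g (SOME x. x \<in> ?K \<and> embed x = w)" for w
  have F: "F (embed x) = g x" if x: "x \<in> ?K" for x
  proof -
    let ?y = "SOME y. y \<in> ?K \<and> embed y = embed x"
    have y: "?y \<in> ?K \<and> embed ?y = embed x" by (rule someI[of _ x]) (use x in auto)
    then have "?y \<noteq> x \<Longrightarrow> ?y \<notin> box 0 1 \<and> x \<notin> box 0 1"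
      using embed_eq_boundary[of ?y x] embed_eq_boundary[of x ?y] x by auto
    then have "g ?y = g x" using z[of ?y] z[of x] by (cases "?y = x") simp_all
    then show ?thesis by (simp only: F_def)
  qed
  have com: "compact (embed ` ?K)" by (intro compact_continuous_image continuous_embed compact_cbox)
  \<comment> \<open>The image carries the quotient topology: preimages of closed sets under
    \<open>F\<close> are images of compact sets.\<close>
  have "continuous_on (embed ` ?K) F"
  proof (subst continuous_on_closed_vimage[OF compact_imp_closed[OF com]], intro allI impI)
    fix C :: "complex set" assume C: "closed C"
    have "F -` C \<inter> embed ` ?K = embed ` (?K \<inter> g -` C)" using F by auto
    moreover have "compact (?K \<inter> g -` C)"
      by (rule compact_Int_closed[OF compact_cbox closed_vimage[OF C g]])
    ultimately show "closed (F -` C \<inter> embed ` ?K)"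
      by (simp add: compact_imp_closed compact_continuous_image continuous_embed)
  qed
  then obtain q where q: "polynomial_function q" "\<And>w. w \<in> embed ` ?K \<Longrightarrow> norm (F w - q w) < sqrt (e / 2)"
    using Stone_Weierstrass_polynomial_function[OF com, of F "sqrt (e / 2)"] e by auto
  let ?p = "\<lambda>x. q (embed x)"
  have p: "trig_poly ?p"
  proof -
    have "real_polynomial_function (Re \<circ> q)" "real_polynomial_function (Im \<circ> q)"
      using q(1) unfolding polynomial_function_def by (auto simp: bounded_linear_Re bounded_linear_Im)
    then have "trig_poly (\<lambda>x. of_real ((Re \<circ> q) (embed x)) + \<i> * of_real ((Im \<circ> q) (embed x)))"
      by (intro trig_poly_add trig_poly_mult[OF trig_poly_const] trig_poly_real_polynomial)
    then show ?thesis by (simp add: complex_eq[symmetric])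
  qed
  have "integral\<^sup>L torus (\<lambda>x. (cmod (g x - ?p x))\<^sup>2) \<le> integral\<^sup>L torus (\<lambda>x :: real^'d. e / 2)"
  proof (rule integral_mono)
    fix x :: "real^'d" assume "x \<in> space torus"
    then have "cmod (g x - ?p x) < sqrt (e / 2)" using q(2)[of "embed x"] F[of x] by auto
    then have "(cmod (g x - ?p x))\<^sup>2 \<le> (sqrt (e / 2))\<^sup>2" by (intro power_mono) auto
    then show "(cmod (g x - ?p x))\<^sup>2 \<le> e / 2" using e by simp
  qed (auto intro!: sq_integrable_integrable sq_integrable_diff sq_integrable_trig_poly[OF p] sq_integrable_continuous[OF g])
  also have "\<dots> < e" using e by simp
  finally show "\<exists>p. trig_poly p \<and> integral\<^sup>L torus (\<lambda>x. (cmod (g x - p x))\<^sup>2) < e" using p by blast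
qed

lemma AE_torus_interior: "AE x in torus. x \<in> box (0 :: real^'d) 1"
proof -
  have "AE x in lebesgue. \<forall>n. x $ n \<noteq> 0 \<and> (x :: real^'d) $ n \<noteq> 1"
    by (intro AE_all_countable[THEN iffD2] allI AE_conjI AE_hyperplane)
  then have "AE x in lebesgue. x \<in> cbox (0 :: real^'d) 1 \<longrightarrow> x \<in> box 0 1"
    by eventually_elim (auto simp: mem_box_cart order.strict_iff_order)
  then show ?thesis unfolding torus_def by (subst AE_restrict_space_iff) auto
qed

text \<open>Measurability supplies continuous functions converging almost everywhere. They are
  retracted to the disc of radius \<open>M\<close>, for domination, and damped to 0 at the boundary
  of the cube, so that the continuous case applies; neither operation changes the limit in the
  interior.\<close>

lemma approximable_bounded:
  fixes f :: "real^'d \<Rightarrow> complex"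
  assumes f: "f \<in> borel_measurable torus" and M: "\<And>x. x \<in> cbox 0 1 \<Longrightarrow> cmod (f x) \<le> M" "M > 0"
  shows "approximable f"
proof -
  let ?K = "cbox 0 1 :: (real^'d) set"
  let ?f = "\<lambda>x. indicator ?K x *\<^sub>R f x"
  have "?f measurable_on UNIV"
    using f unfolding measurable_torus_iff by (rule lebesgue_measurable_imp_measurable_on) simp
  then obtain N h where N: "negligible N" and h: "\<And>n. continuous_on UNIV (h n)"
    and lim: "\<And>x. x \<notin> N \<Longrightarrow> (\<lambda>n. h n x) \<longlonglongrightarrow> ?f x"
    unfolding measurable_on_def by auto
  define clamp where "clamp w = (M / max M (cmod w)) *\<^sub>R w" for w :: complex
  have clamp_le: "cmod (clamp w) \<le> M" for w
    using M(2) by (auto simp: clamp_def max_def field_simps)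
  have clamp_id: "clamp w = w" if "cmod w \<le> M" for w using that M(2) by (simp add: clamp_def)
  have clamp_cont: "continuous_on S clamp" for S
    unfolding clamp_def using M(2) by (intro continuous_intros) auto
  define cut where "cut n x = min 1 (real n * infdist x (- box 0 1))" for n and x :: "real^'d"
  have cut_cont: "continuous_on UNIV (cut n)" for n
    unfolding cut_def by (intro continuous_intros)
  have cut_bd: "0 \<le> cut n x" "cut n x \<le> 1" for n x
    by (auto simp: cut_def infdist_nonneg)
  define g where "g n x = cut n x *\<^sub>R clamp (h n x)" for n x
  have g_cont: "continuous_on UNIV (g n)" for n unfolding g_def
    by (intro continuous_intros cut_cont continuous_on_compose2[OF clamp_cont[of UNIV] h]) auto
  have g_zero: "g n x = 0" if "x \<notin> box 0 1" for n x
    using that by (simp add: g_def cut_def infdist_zero)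
  have g_le: "cmod (g n x) \<le> M" for n x
    using cut_bd[of n x] clamp_le[of "h n x"] mult_mono[of "cut n x" 1 "cmod (clamp (h n x))" M] by (simp add: g_def)
  have fsq: "sq_integrable f" by (rule sq_integrable_bounded[OF f M(1)])
  have "AE x in torus. x \<notin> N"
  proof -
    have "AE x in lebesgue. x \<notin> N" using N by (intro AE_not_in) (simp add: negligible_iff_null_sets)
    then show ?thesis unfolding torus_def by (subst AE_restrict_space_iff) auto
  qed
  then have glim: "AE x in torus. (\<lambda>n. g n x) \<longlonglongrightarrow> f x"
    using AE_torus_interior
  proof eventually_elim
    case (elim x)
    have xK: "x \<in> ?K" using elim(2) box_subset_cbox by blast
    have "(\<lambda>n. clamp (h n x)) \<longlonglongrightarrow> clamp (?f x)"
      using clamp_cont[of UNIV] lim[OF elim(1)] continuous_on_tendsto_compose[of UNIV clamp] by auto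
    then have c: "(\<lambda>n. clamp (h n x)) \<longlonglongrightarrow> f x" using xK M(1)[OF xK] by (simp add: clamp_id)
    have "(1 :: real^'d) \<in> - box 0 1" by (simp add: mem_box_cart)
    then have i: "infdist x (- box 0 1) > 0"
      using elim(2) infdist_pos_not_in_closed[of "- box 0 1" x] by (auto simp: closed_Compl)
    have "\<forall>\<^sub>F n in sequentially. cut n x = 1"
    proof -
      obtain m :: nat where m: "1 / infdist x (- box 0 1) < real m" using reals_Archimedean2 by blast
      show ?thesis using eventually_ge_at_top[of m]
      proof eventually_elim
        case (elim n)
        then have "1 \<le> real n * infdist x (- box 0 1)"
          using m i by (smt (verit) mult_right_mono of_nat_le_iff pos_divide_less_eq)
        then show ?case by (simp add: cut_def)
      qed
    qed
    then have "(\<lambda>n. cut n x) \<longlonglongrightarrow> 1" by (rule tendsto_eventually)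
    then show ?case unfolding g_def using tendsto_scaleR[OF _ c] by fastforce
  qed
  have fgm: "(\<lambda>x. (cmod (f x - g n x))\<^sup>2) \<in> borel_measurable torus" for n
    using f continuous_measurable_torus[OF g_cont] by measurable
  show ?thesis
  proof (rule approximable_limit[OF fsq sq_integrable_continuous[OF g_cont] approximable_continuous[OF g_cont g_zero]])
    have "(\<lambda>n. integral\<^sup>L torus (\<lambda>x. (cmod (f x - g n x))\<^sup>2)) \<longlonglongrightarrow> integral\<^sup>L torus (\<lambda>x :: real^'d. 0)"
    proof (rule integral_dominated_convergence[where w = "\<lambda>_. (2 * M)\<^sup>2"])
      show "AE x in torus. (\<lambda>n. (cmod (f x - g n x))\<^sup>2) \<longlonglongrightarrow> 0"
        using glim
      proof eventually_elim
        case (elim x)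
        have "(\<lambda>n. (cmod (f x - g n x))\<^sup>2) \<longlonglongrightarrow> (cmod (f x - f x))\<^sup>2" by (intro tendsto_intros elim)
        then show ?case by simp
      qed
      show "AE x in torus. norm ((cmod (f x - g n x))\<^sup>2) \<le> (2 * M)\<^sup>2" for n
      proof (rule AE_I2)
        fix x :: "real^'d" assume "x \<in> space torus"
        then have "cmod (f x - g n x) \<le> 2 * M"
          using norm_triangle_ineq4[of "f x" "g n x"] M(1)[of x] g_le[of n x] by simp
        then have "(cmod (f x - g n x))\<^sup>2 \<le> (2 * M)\<^sup>2" by (intro power_mono) auto
        then show "norm ((cmod (f x - g n x))\<^sup>2) \<le> (2 * M)\<^sup>2" by (simp only: real_norm_def abs_power2)
      qed
    qed (use fgm in auto)
    then show "(\<lambda>n. integral\<^sup>L torus (\<lambda>x. (cmod (f x - g n x))\<^sup>2)) \<longlonglongrightarrow> 0" by simp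
  qed
qed

lemma approximable_sq_integrable:
  fixes f :: "real^'d \<Rightarrow> complex"
  assumes f: "sq_integrable f" shows "approximable f"
proof -
  define g where "g n x = (if cmod (f x) \<le> real (Suc n) then f x else 0)" for n x
  have fm[measurable]: "f \<in> borel_measurable torus" using f by (rule sq_integrable_measurable)
  have gm[measurable]: "g n \<in> borel_measurable torus" for n unfolding g_def by measurable
  have gb: "cmod (g n x) \<le> real (Suc n)" for n x by (simp add: g_def)
  show ?thesis
  proof (rule approximable_limit[OF f sq_integrable_bounded[OF gm gb] approximable_bounded[OF gm gb]])
    have "(\<lambda>n. integral\<^sup>L torus (\<lambda>x. (cmod (f x - g n x))\<^sup>2)) \<longlonglongrightarrow> integral\<^sup>L torus (\<lambda>x :: real^'d. 0)"
    proof (rule integral_dominated_convergence[where w = "\<lambda>x. (cmod (f x))\<^sup>2"])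
      show "integrable torus (\<lambda>x. (cmod (f x))\<^sup>2)" using f by (rule sq_integrable_integrable)
      show "AE x in torus. (\<lambda>n. (cmod (f x - g n x))\<^sup>2) \<longlonglongrightarrow> 0"
      proof (rule AE_I2)
        fix x :: "real^'d"
        obtain m :: nat where "cmod (f x) < real m" using reals_Archimedean2 by blast
        then have "\<forall>\<^sub>F n in sequentially. (cmod (f x - g n x))\<^sup>2 = 0"
          by (intro eventually_mono[OF eventually_ge_at_top[of m]]) (simp add: g_def)
        then show "(\<lambda>n. (cmod (f x - g n x))\<^sup>2) \<longlonglongrightarrow> 0" by (rule tendsto_eventually)
      qed
      show "AE x in torus. norm ((cmod (f x - g n x))\<^sup>2) \<le> (cmod (f x))\<^sup>2" for n
        by (rule AE_I2) (simp add: g_def)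
    qed auto
    then show "(\<lambda>n. integral\<^sup>L torus (\<lambda>x. (cmod (f x - g n x))\<^sup>2)) \<longlonglongrightarrow> 0" by simp
  qed auto
qed

section \<open>Inner products and Parseval's identity\<close>

lemma integrable_sq_integrable_mult:
  assumes "sq_integrable f" "sq_integrable g" shows "integrable torus (\<lambda>x. f x * cnj (g x))"
proof -
  have [measurable]: "f \<in> borel_measurable torus" "g \<in> borel_measurable torus"
    using assms by (auto intro: sq_integrable_measurable)
  show ?thesis
  proof (rule Bochner_Integration.integrable_bound)
    show "integrable torus (\<lambda>x. (cmod (f x))\<^sup>2 + (cmod (g x))\<^sup>2)"
      using assms by (auto intro: sq_integrable_integrable)
    show "AE x in torus. norm (f x * cnj (g x)) \<le> norm ((cmod (f x))\<^sup>2 + (cmod (g x))\<^sup>2)"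
    proof (rule AE_I2)
      fix x
      have "cmod (f x) * cmod (g x) \<le> (cmod (f x))\<^sup>2 + (cmod (g x))\<^sup>2"
        using sum_squares_bound[of "cmod (f x)" "cmod (g x)"] zero_le_power2[of "cmod (f x)"] zero_le_power2[of "cmod (g x)"] by linarith
      then show "norm (f x * cnj (g x)) \<le> norm ((cmod (f x))\<^sup>2 + (cmod (g x))\<^sup>2)" by (simp add: norm_mult)
    qed
    show "(\<lambda>x. f x * cnj (g x)) \<in> borel_measurable torus"
      by (intro borel_measurable_times measurable_cnj sq_integrable_measurable assms)
  qed
qed

lemma innerT_self: "sq_integrable f \<Longrightarrow> innerT f f = of_real ((normT f)\<^sup>2)"
proof -
  assume f: "sq_integrable f"
  have "innerT f f = integral\<^sup>L torus (\<lambda>x. of_real ((cmod (f x))\<^sup>2) :: complex)"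
    unfolding innerT_def by (simp add: complex_norm_square del: of_real_power)
  also have "\<dots> = of_real (integral\<^sup>L torus (\<lambda>x. (cmod (f x))\<^sup>2))" by (rule integral_complex_of_real)
  finally show ?thesis by (simp add: normT_def)
qed

lemma normT_sq: "(normT f)\<^sup>2 = integral\<^sup>L torus (\<lambda>x. (cmod (f x))\<^sup>2)"
  by (simp add: normT_def)

lemma innerT_diff_left: "sq_integrable f \<Longrightarrow> sq_integrable g \<Longrightarrow> sq_integrable h \<Longrightarrow> innerT (\<lambda>x. f x - g x) h = innerT f h - innerT g h"
  unfolding innerT_def by (simp add: left_diff_distrib integrable_sq_integrable_mult)

lemma innerT_add_left: "sq_integrable f \<Longrightarrow> sq_integrable g \<Longrightarrow> sq_integrable h \<Longrightarrow> innerT (\<lambda>x. f x + g x) h = innerT f h + innerT g h"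
  unfolding innerT_def by (simp add: distrib_right integrable_sq_integrable_mult)

lemma innerT_cmult_left: "innerT (\<lambda>x. c * f x) h = c * innerT f h"
  unfolding innerT_def by (simp add: mult.assoc)

lemma innerT_cnj: "innerT g f = cnj (innerT f g)"
proof -
  have "cnj (innerT f g) = integral\<^sup>L torus (\<lambda>x. cnj (f x * cnj (g x)))" unfolding innerT_def by (simp only: Bochner_Integration.integral_cnj)
  then show ?thesis by (simp add: innerT_def mult.commute)
qed

lemma sq_integrable_wave_sum: "sq_integrable (\<lambda>x. \<Sum>k\<in>K. a k * wave k x)"
  by (intro sq_integrable_trig_poly trig_poly_sum trig_poly_wave)

lemma innerT_wave_sum: "sq_integrable f \<Longrightarrow> innerT (\<lambda>x. \<Sum>k\<in>K. a k * wave k x) f = (\<Sum>k\<in>K. a k * cnj (fcoeff f k))"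
proof (induction K rule: infinite_finite_induct)
  case (insert k K)
  have "innerT (\<lambda>x. \<Sum>k\<in>insert k K. a k * wave k x) f = innerT (\<lambda>x. a k * wave k x + (\<Sum>k\<in>K. a k * wave k x)) f"
    using insert by simp
  also have "\<dots> = a k * innerT (wave k) f + innerT (\<lambda>x. \<Sum>k\<in>K. a k * wave k x) f"
    using insert.prems by (simp add: innerT_add_left sq_integrable_cmult sq_integrable_wave sq_integrable_wave_sum innerT_cmult_left)
  also have "innerT (wave k) f = cnj (fcoeff f k)"
    unfolding innerT_cnj[of "wave k" f] by (simp add: innerT_def fcoeff_wave)
  finally show ?case using insert by simp
qed (simp_all add: innerT_def)

lemma fcoeff_wave_sum: "finite K \<Longrightarrow> fcoeff (\<lambda>x. \<Sum>k\<in>K. a k * wave k x) l = (if l \<in> K then a l else 0)"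
proof -
  assume K: "finite K"
  have f: "fcoeff (wave l) k = (if k = l then 1 else 0)" for k l :: "int^'a"
  proof -
    have "fcoeff (wave l) k = integral\<^sup>L torus (wave (l - k))"
      unfolding fcoeff_wave cnj_wave by (simp flip: wave_add)
    then show ?thesis by (simp add: integral_wave)
  qed
  have "fcoeff (\<lambda>x. \<Sum>k\<in>K. a k * wave k x) l = innerT (\<lambda>x. \<Sum>k\<in>K. a k * wave k x) (wave l)"
    by (simp add: fcoeff_wave innerT_def)
  also have "\<dots> = (\<Sum>k\<in>K. a k * cnj (fcoeff (wave l) k))" by (rule innerT_wave_sum[OF sq_integrable_wave])
  also have "\<dots> = (\<Sum>k\<in>K. if k = l then a l else 0)" by (intro sum.cong) (auto simp: f)
  finally show ?thesis using K by simp
qed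

text \<open>Kept for arbitrary \<open>a\<close>: the Fourier coefficients themselves give Bessel's
  inequality, while the coefficients of an approximating polynomial show that the Fourier sum over
  the same frequencies is at least as close.\<close>

lemma bessel_identity:
  assumes f: "sq_integrable f" and K: "finite K"
  shows "(normT (\<lambda>x. f x - (\<Sum>k\<in>K. a k * wave k x)))\<^sup>2
    = (normT f)\<^sup>2 - (\<Sum>k\<in>K. (cmod (fcoeff f k))\<^sup>2) + (\<Sum>k\<in>K. (cmod (a k - fcoeff f k))\<^sup>2)"
proof -
  let ?p = "\<lambda>x. \<Sum>k\<in>K. a k * wave k x"
  let ?g = "\<lambda>x. f x - ?p x"
  have g: "sq_integrable ?g" using f by (intro sq_integrable_diff sq_integrable_wave_sum)
  have pf: "innerT ?p f = (\<Sum>k\<in>K. a k * cnj (fcoeff f k))" by (rule innerT_wave_sum[OF f])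
  have pp: "innerT ?p ?p = (\<Sum>k\<in>K. a k * cnj (a k))"
    unfolding innerT_wave_sum[OF sq_integrable_wave_sum] by (intro sum.cong) (auto simp: fcoeff_wave_sum K)
  have "innerT ?g ?g = innerT f ?g - innerT ?p ?g" by (rule innerT_diff_left[OF f sq_integrable_wave_sum g])
  also have "innerT f ?g = cnj (innerT ?g f)" by (rule innerT_cnj)
  also have "innerT ?g f = innerT f f - innerT ?p f" by (rule innerT_diff_left[OF f sq_integrable_wave_sum f])
  also have "innerT ?p ?g = cnj (innerT ?g ?p)" by (rule innerT_cnj)
  also have "innerT ?g ?p = innerT f ?p - innerT ?p ?p" by (rule innerT_diff_left[OF f sq_integrable_wave_sum sq_integrable_wave_sum])
  also have "innerT f ?p = cnj (innerT ?p f)" by (rule innerT_cnj)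
  finally have "innerT ?g ?g = cnj (innerT f f) - cnj (innerT ?p f) - innerT ?p f + cnj (innerT ?p ?p)" by simp
  also have "\<dots> = of_real ((normT f)\<^sup>2) + (\<Sum>k\<in>K. - (cnj (a k) * fcoeff f k) - a k * cnj (fcoeff f k) + cnj (a k) * a k)"
    unfolding innerT_self[OF f] pf pp by (simp add: sum_subtractf sum.distrib sum_negf)
  also have "(\<Sum>k\<in>K. - (cnj (a k) * fcoeff f k) - a k * cnj (fcoeff f k) + cnj (a k) * a k)
     = (\<Sum>k\<in>K. of_real ((cmod (a k - fcoeff f k))\<^sup>2 - (cmod (fcoeff f k))\<^sup>2))"
    by (intro sum.cong refl) (simp add: complex_norm_square algebra_simps del: of_real_power)
  finally have "innerT ?g ?g = of_real ((normT f)\<^sup>2 + (\<Sum>k\<in>K. (cmod (a k - fcoeff f k))\<^sup>2 - (cmod (fcoeff f k))\<^sup>2))" by simp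
  then show ?thesis unfolding innerT_self[OF g] of_real_eq_iff by (simp add: sum_subtractf)
qed

theorem parseval:
  fixes f :: "real^'d \<Rightarrow> complex"
  assumes f: "sq_integrable f" shows "((\<lambda>k. (cmod (fcoeff f k))\<^sup>2) has_sum (normT f)\<^sup>2) UNIV"
proof -
  let ?c = "\<lambda>k. (cmod (fcoeff f k))\<^sup>2"
  have le: "sum ?c K \<le> (normT f)\<^sup>2" if "finite K" for K
    using bessel_identity[OF f that, of "fcoeff f"] zero_le_power2[of "normT (\<lambda>x. f x - (\<Sum>k\<in>K. fcoeff f k * wave k x))"] by simp
  have s: "?c summable_on UNIV"
    by (rule nonneg_bounded_partial_sums_imp_summable_on[of _ _ "(normT f)\<^sup>2"])
      (auto simp: le eventually_finite_subsets_at_top_weakI)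
  have "infsum ?c UNIV \<le> (normT f)\<^sup>2" by (rule infsum_le_finite_sums[OF s le])
  moreover have "(normT f)\<^sup>2 \<le> infsum ?c UNIV"
  proof (rule field_le_epsilon)
    fix e :: real assume "e > 0"
    then obtain p where p: "trig_poly p" "integral\<^sup>L torus (\<lambda>x. (cmod (f x - p x))\<^sup>2) < e"
      using approximable_sq_integrable[OF f] unfolding approximable_def by blast
    obtain K a where K: "finite K" "p = (\<lambda>x. \<Sum>k\<in>K. a k * wave k x)" using trig_poly_eq_sum[OF p(1)] by blast
    have 1: "(normT f)\<^sup>2 - sum ?c K \<le> (normT (\<lambda>x. f x - p x))\<^sup>2"
      unfolding K(2) bessel_identity[OF f K(1)] by (simp add: sum_nonneg)
    have 2: "(normT (\<lambda>x. f x - p x))\<^sup>2 \<le> e" using p(2) by (simp add: normT_sq)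
    have 3: "sum ?c K \<le> infsum ?c UNIV" using s K(1) by (intro finite_sum_le_infsum) auto
    show "(normT f)\<^sup>2 \<le> infsum ?c UNIV + e" using 1 2 3 by linarith
  qed
  ultimately show ?thesis using has_sum_infsum[OF s] by simp
qed

lemma fcoeff_innerT: "fcoeff f k = innerT f (wave k)"
  by (simp add: fcoeff_wave innerT_def)

lemma fcoeff_add: "sq_integrable f \<Longrightarrow> sq_integrable g \<Longrightarrow> fcoeff (\<lambda>x. f x + g x) k = fcoeff f k + fcoeff g k"
  unfolding fcoeff_innerT by (rule innerT_add_left) (auto intro: sq_integrable_wave)

lemma fcoeff_cmult: "fcoeff (\<lambda>x. c * f x) k = c * fcoeff f k"
  unfolding fcoeff_innerT by (rule innerT_cmult_left)

lemma fcoeff_sum: "(\<And>i. i \<in> I \<Longrightarrow> sq_integrable (f i)) \<Longrightarrow> fcoeff (\<lambda>x. \<Sum>i\<in>I. f i x) k = (\<Sum>i\<in>I. fcoeff (f i) k) \<and> sq_integrable (\<lambda>x. \<Sum>i\<in>I. f i x)"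
proof (induction I rule: infinite_finite_induct)
  case (insert i I)
  then have "sq_integrable (f i)" "sq_integrable (\<lambda>x. \<Sum>i\<in>I. f i x)" "fcoeff (\<lambda>x. \<Sum>i\<in>I. f i x) k = (\<Sum>i\<in>I. fcoeff (f i) k)" by auto
  then show ?case using insert.hyps by (simp add: fcoeff_add sq_integrable_add)
qed (simp_all add: fcoeff_def sq_integrable_continuous)

text \<open>The explicit factors 1 and -1 keep all four terms in the form u + c v, to which
  Parseval's identity for f + c g applies verbatim.\<close>

lemma polarization:
  "u * cnj v = (of_real ((cmod (u + 1 * v))\<^sup>2) + (-1) * of_real ((cmod (u + (-1) * v))\<^sup>2)
     + \<i> * of_real ((cmod (u + \<i> * v))\<^sup>2) + (-\<i>) * of_real ((cmod (u + (-\<i>) * v))\<^sup>2)) * (1 / 4)"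
  unfolding cmod_power2 by (simp add: complex_eq_iff power2_eq_square algebra_simps)

theorem parseval_inner:
  assumes f: "sq_integrable f" and g: "sq_integrable g"
  shows "((\<lambda>k. fcoeff f k * cnj (fcoeff g k)) has_sum innerT f g) UNIV"
proof -
  have s: "sq_integrable (\<lambda>x. f x + c * g x)" for c using f g by (intro sq_integrable_add sq_integrable_cmult)
  define Q :: "complex \<Rightarrow> complex" where "Q c = of_real ((normT (\<lambda>x. f x + c * g x))\<^sup>2)" for c
  have Q: "((\<lambda>k. of_real ((cmod (fcoeff f k + c * fcoeff g k))\<^sup>2)) has_sum Q c) UNIV" for c
    unfolding Q_def using parseval[OF s[of c]] f g
    by (intro has_sum_of_real) (simp add: fcoeff_add fcoeff_cmult sq_integrable_cmult)
  have "((\<lambda>k. fcoeff f k * cnj (fcoeff g k)) has_sum ((Q 1 + (-1) * Q (-1) + \<i> * Q \<i> + (-\<i>) * Q (-\<i>)) * (1 / 4))) UNIV"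
    unfolding polarization[of "fcoeff f _"]
    by (intro has_sum_cmult_left has_sum_cmult_right has_sum_add Q)
  moreover have "innerT f g = (Q 1 + (-1) * Q (-1) + \<i> * Q \<i> + (-\<i>) * Q (-\<i>)) * (1 / 4)"
  proof -
    have i: "integrable torus (\<lambda>x. b * complex_of_real ((cmod (f x + c * g x))\<^sup>2))" 
      "integrable torus (\<lambda>x. complex_of_real ((cmod (f x + c * g x))\<^sup>2))" for b c
      using sq_integrable_integrable[OF s[of c]] by (simp_all only: complex_of_real_integrable_eq integrable_mult_right)
    have Qi: "Q c = integral\<^sup>L torus (\<lambda>x. complex_of_real ((cmod (f x + c * g x))\<^sup>2))" for c
      unfolding Q_def normT_sq by (simp only: integral_complex_of_real)
    have "innerT f g = integral\<^sup>L torus (\<lambda>x. (complex_of_real ((cmod (f x + 1 * g x))\<^sup>2) + (-1) * of_real ((cmod (f x + (-1) * g x))\<^sup>2)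
     + \<i> * of_real ((cmod (f x + \<i> * g x))\<^sup>2) + (-\<i>) * of_real ((cmod (f x + (-\<i>) * g x))\<^sup>2)) * (1 / 4))"
      unfolding innerT_def by (intro Bochner_Integration.integral_cong refl polarization)
    then show ?thesis
      by (simp only: Qi integral_mult_left_zero integral_mult_right_zero Bochner_Integration.integral_add
        Bochner_Integration.integrable_add i)
  qed
  ultimately show ?thesis by (simp only:)
qed

text \<open>The bilinear form of Parseval's identity, matching the pairing without conjugation in
  \<open>weak_pderiv\<close>.\<close>

lemma integral_mult_parseval:
  assumes f: "sq_integrable f" and g: "sq_integrable g"
  shows "((\<lambda>k. fcoeff f k * fcoeff g (- k)) has_sum integral\<^sup>L torus (\<lambda>x. f x * g x)) UNIV"
proof -
  have c: "sq_integrable (\<lambda>x. cnj (g x))" using g by (auto simp: sq_integrable_def measurable_cnj)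
  have "cnj (fcoeff (\<lambda>x. cnj (g x)) k) = fcoeff g (- k)" for k
    unfolding fcoeff_wave Bochner_Integration.integral_cnj[symmetric] by (simp add: cnj_wave)
  then show ?thesis using parseval_inner[OF f c] by (simp add: innerT_def)
qed

section \<open>Shifts, modulations and functions with prescribed coefficients\<close>

lemma periodic_comp: "periodic f \<Longrightarrow> periodic (\<lambda>x. F (f x))"
  by (simp add: periodic_def)

lemma periodic_mult: "periodic f \<Longrightarrow> periodic g \<Longrightarrow> periodic (\<lambda>x. f x * g x)"
  by (simp add: periodic_def)

lemma L2T_shift:
  assumes f: "f \<in> L2T" shows "(\<lambda>x. f (x + a)) \<in> L2T"
proof -
  have p: "periodic f" and s: "sq_integrable f" using f by (auto simp: L2T_sq_integrable)
  let ?g = "\<lambda>x. complex_of_real ((cmod (f x))\<^sup>2)"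
  have "integrable torus ?g" using sq_integrable_integrable[OF s] by (simp only: complex_of_real_integrable_eq)
  then have "integrable torus (\<lambda>x. ?g (x + a))" by (rule torus_shift(2)[OF periodic_comp[OF p]])
  then have "integrable torus (\<lambda>x. (cmod (f (x + a)))\<^sup>2)" by (simp only: complex_of_real_integrable_eq)
  then show ?thesis using torus_shift(1)[OF p sq_integrable_measurable[OF s]] periodic_shift[OF p] by (simp add: L2T_def)
qed

lemma sq_integrable_wave_mult: "sq_integrable f \<Longrightarrow> sq_integrable (\<lambda>x. wave k x * f x)"
  unfolding sq_integrable_def norm_mult norm_wave
  by (auto intro!: borel_measurable_times[OF continuous_measurable_torus[OF continuous_wave]])

lemma fcoeff_wave_mult: "fcoeff (\<lambda>x. wave l x * f x) k = fcoeff f (k - l)"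
proof -
  have "wave l x * f x * cnj (wave k x) = f x * cnj (wave (k - l) x)" for x
    using wave_add[of l "-k" x] by (simp add: cnj_wave mult_ac)
  then show ?thesis by (simp only: fcoeff_wave)
qed

lemma fcoeff_shift:
  assumes f: "f \<in> L2T" shows "fcoeff (\<lambda>x. f (x + a)) k = wave k a * fcoeff f k"
proof -
  have p: "periodic f" and s: "sq_integrable f" using f by (auto simp: L2T_sq_integrable)
  let ?g = "\<lambda>x. f x * cnj (wave k x)"
  have "periodic ?g" unfolding cnj_wave by (intro periodic_mult p periodic_wave)
  then have "integral\<^sup>L torus (\<lambda>x. ?g (x + a)) = integral\<^sup>L torus ?g"
    by (rule torus_shift(3)) (rule integrable_sq_integrable_mult[OF s sq_integrable_wave])
  moreover have "?g (x + a) = cnj (wave k a) * (f (x + a) * cnj (wave k x))" for x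
    by (simp add: wave_shift mult_ac)
  ultimately have "fcoeff f k = cnj (wave k a) * fcoeff (\<lambda>x. f (x + a)) k" by (simp add: fcoeff_wave)
  moreover have "wave k a * cnj (wave k a) = 1" by (simp add: complex_norm_square[symmetric])
  ultimately show ?thesis by (simp flip: mult.assoc)
qed

lemma opA_wave: "opA L f = (\<lambda>x. wave L x * f x)"
  by (rule ext) (simp only: opA_def exp_unit_exp wave_def)

lemma innerT_opA:
  assumes "sq_integrable f" shows "((\<lambda>k. fcoeff f (k - L) * cnj (fcoeff f k)) has_sum innerT (opA L f) f) UNIV"
  using parseval_inner[OF sq_integrable_wave_mult[OF assms] assms, of L] by (simp add: opA_wave fcoeff_wave_mult)

text \<open>Absolute summability makes the partial sums converge uniformly, so the sum is
  continuous, and each coefficient is off by at most the tail outside a finite set containing its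
  frequency. The result is applied to the coefficients of a derivative.\<close>

lemma fourier_series_exists:
  fixes a :: "int^'d \<Rightarrow> complex"
  assumes a: "(\<lambda>k. cmod (a k)) summable_on UNIV"
  shows "\<exists>g \<in> L2T. \<forall>k. fcoeff g k = a k"
proof -
  define g where "g x = infsum (\<lambda>k. a k * wave k x) UNIV" for x
  have su: "(\<lambda>k. a k * wave k x) summable_on S" for x S
    using summable_on_subset_banach[OF a, of S]
    by (rule_tac abs_summable_summable) (simp add: norm_mult)
  have suc: "(\<lambda>k. cmod (a k)) summable_on S" for S using summable_on_subset_banach[OF a] by simp
  have tail: "cmod (g x - (\<Sum>k\<in>K. a k * wave k x)) \<le> infsum (\<lambda>k. cmod (a k)) (- K)" if K: "finite K" for K x
  proof -
    have "g x = infsum (\<lambda>k. a k * wave k x) K + infsum (\<lambda>k. a k * wave k x) (- K)"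
      unfolding g_def using infsum_Un_disjoint[OF su[where S=K] su[where S="-K"]] by (simp add: Compl_partition)
    then have "cmod (g x - (\<Sum>k\<in>K. a k * wave k x)) = cmod (infsum (\<lambda>k. a k * wave k x) (- K))" using K by simp
    also have "\<dots> \<le> infsum (\<lambda>k. cmod (a k * wave k x)) (- K)"
      using suc by (intro norm_infsum_bound) (simp add: norm_mult)
    finally show ?thesis by (simp add: norm_mult)
  qed
  have small: "\<exists>K. finite K \<and> l \<in> K \<and> infsum (\<lambda>k. cmod (a k)) (- K) < e" if "e > 0" for e l
  proof -
    have h: "((\<lambda>k. cmod (a k)) has_sum infsum (\<lambda>k. cmod (a k)) UNIV) UNIV" using a by (rule has_sum_infsum)
    have "\<forall>\<^sub>F K in finite_subsets_at_top UNIV. dist (sum (\<lambda>k. cmod (a k)) K) (infsum (\<lambda>k. cmod (a k)) UNIV) < e"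
      using tendstoD[OF h[unfolded has_sum_def] that] .
    then obtain K0 where K0: "finite K0" "\<And>K. finite K \<Longrightarrow> K0 \<subseteq> K \<Longrightarrow> dist (sum (\<lambda>k. cmod (a k)) K) (infsum (\<lambda>k. cmod (a k)) UNIV) < e"
      unfolding eventually_finite_subsets_at_top by auto
    let ?K = "insert l K0"
    have "infsum (\<lambda>k. cmod (a k)) UNIV = infsum (\<lambda>k. cmod (a k)) ?K + infsum (\<lambda>k. cmod (a k)) (- ?K)"
      using infsum_Un_disjoint[OF suc[of ?K] suc[of "- ?K"]] by (simp add: Compl_partition)
    then have "infsum (\<lambda>k. cmod (a k)) (- ?K) < e"
      using K0(2)[OF _ subset_insertI, of l] K0(1) by (simp add: dist_real_def)
    then show ?thesis using K0(1) by blast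
  qed
  have cont: "continuous_on UNIV g"
  proof (rule continuous_onI)
    fix x :: "real^'d" and e :: real assume e: "e > 0"
    obtain K where K: "finite K" "infsum (\<lambda>k. cmod (a k)) (- K) < e / 3" using small[of "e/3" 0] e by auto
    let ?p = "\<lambda>x. \<Sum>k\<in>K. a k * wave k x"
    have "continuous_on UNIV ?p" by (intro continuous_trig_poly trig_poly_sum trig_poly_wave)
    then obtain d where d: "d > 0" "\<And>y. dist y x < d \<Longrightarrow> dist (?p y) (?p x) < e / 3"
    proof -
      assume c: "continuous_on UNIV ?p" and t: "\<And>d. 0 < d \<Longrightarrow> (\<And>y. dist y x < d \<Longrightarrow> dist (?p y) (?p x) < e / 3) \<Longrightarrow> thesis"
      have "e / 3 > 0" using e by simp
      then show thesis using c[unfolded continuous_on_iff, rule_format, OF UNIV_I, of "e / 3" x] t by blast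
    qed
    have "dist (g y) (g x) \<le> e" if "dist y x < d" for y
    proof -
      have "cmod (g y - g x) \<le> cmod (g y - ?p y) + cmod (?p y - ?p x) + cmod (g x - ?p x)"
        using norm_triangle_ineq4[of "g y - ?p y + (?p y - ?p x)" "g x - ?p x"] norm_triangle_ineq[of "g y - ?p y" "?p y - ?p x"] by simp
      then show ?thesis using tail[OF K(1), of y] tail[OF K(1), of x] K(2) d(2)[OF that] by (simp add: dist_norm)
    qed
    then show "\<exists>d>0. \<forall>x'\<in>UNIV. dist x' x < d \<longrightarrow> dist (g x') (g x) \<le> e" using d(1) by blast
  qed
  have "wave k (x + rvec l) = wave k x" for k l and x :: "real^'d" by (rule periodicD[OF periodic_wave])
  then have "periodic g" unfolding periodic_def g_def by simp
  then have gL: "g \<in> L2T" using sq_integrable_continuous[OF cont] by (simp add: L2T_sq_integrable)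
  have "fcoeff g l = a l" for l
  proof (rule ccontr)
    assume "fcoeff g l \<noteq> a l"
    then have e: "cmod (fcoeff g l - a l) > 0" by simp
    obtain K where K: "finite K" "l \<in> K" "infsum (\<lambda>k. cmod (a k)) (- K) < cmod (fcoeff g l - a l)" using small[OF e] by blast
    let ?p = "\<lambda>x. \<Sum>k\<in>K. a k * wave k x"
    let ?t = "infsum (\<lambda>k. cmod (a k)) (- K)"
    have sg: "sq_integrable g" "sq_integrable (\<lambda>x. g x - ?p x)" by (intro sq_integrable_diff sq_integrable_continuous[OF cont] sq_integrable_wave_sum)+
    have "fcoeff g l - a l = fcoeff g l - fcoeff ?p l" using K by (simp add: fcoeff_wave_sum)
    also have "\<dots> = innerT (\<lambda>x. g x - ?p x) (wave l)"
      unfolding fcoeff_innerT by (rule innerT_diff_left[symmetric, OF sg(1) sq_integrable_wave_sum sq_integrable_wave])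
    finally have "cmod (fcoeff g l - a l) = cmod (integral\<^sup>L torus (\<lambda>x. (g x - ?p x) * cnj (wave l x)))" by (simp add: innerT_def)
    also have "\<dots> \<le> integral\<^sup>L torus (\<lambda>x. cmod ((g x - ?p x) * cnj (wave l x)))" by (rule integral_norm_bound)
    also have "\<dots> \<le> integral\<^sup>L torus (\<lambda>x :: real^'d. ?t)"
      using tail[OF K(1)] integrable_norm[OF integrable_sq_integrable_mult[OF sg(2) sq_integrable_wave[of l]]]
      by (intro integral_mono) (auto simp: norm_mult)
    finally show False using K(3) by simp
  qed
  then show ?thesis using gL by blast
qed

section \<open>Weak derivatives\<close>

lemma has_derivative_wave: "((\<lambda>x. c * wave l x) has_derivative (\<lambda>v. c * (2 * of_real pi * \<i> * of_real (rvec l \<bullet> v)) * wave l x)) (at x)"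
proof -
  have "wave l = (\<lambda>x. exp (of_real (2 * pi * (rvec l \<bullet> x)) * \<i>))"
    by (rule ext) (simp add: wave_def unit_exp_def cis_conv_exp mult_ac)
  moreover have "((\<lambda>x. c * exp (of_real (2 * pi * (rvec l \<bullet> x)) * \<i>)) has_derivative
     (\<lambda>v. c * (exp (of_real (2 * pi * (rvec l \<bullet> x)) * \<i>) * (of_real (2 * pi * (rvec l \<bullet> v)) * \<i>)))) (at x)"
  proof (intro has_derivative_mult_right)
    have "((\<lambda>x. of_real (2 * pi * (rvec l \<bullet> x)) * \<i>) has_derivative (\<lambda>v. of_real (2 * pi * (rvec l \<bullet> v)) * \<i>)) (at x)"
      by (intro has_derivative_mult_left has_derivative_of_real has_derivative_mult_right
          bounded_linear_imp_has_derivative bounded_linear_inner_right)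
    then show "((\<lambda>x. exp (of_real (2 * pi * (rvec l \<bullet> x)) * \<i>)) has_derivative
       (\<lambda>v. exp (of_real (2 * pi * (rvec l \<bullet> x)) * \<i>) * (of_real (2 * pi * (rvec l \<bullet> v)) * \<i>))) (at x)"
      using DERIV_exp has_derivative_compose unfolding has_field_derivative_def by blast
  qed
  ultimately show ?thesis by (simp add: mult_ac)
qed

lemma pdiff_wave: "pdiff n (\<lambda>x. c * wave l x) = (\<lambda>x. (c * (2 * of_real pi * \<i> * of_int (l $ n))) * wave l x)"
proof
  fix x :: "real^'a"
  have "rvec l \<bullet> axis n 1 = of_int (l $ n)" by (simp add: rvec_def inner_axis)
  then show "pdiff n (\<lambda>x. c * wave l x) x = (c * (2 * of_real pi * \<i> * of_int (l $ n))) * wave l x"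
    unfolding pdiff_def frechet_derivative_at[OF has_derivative_wave, symmetric] by simp
qed

lemma pdiff_wave': "pdiff n (wave l) = (\<lambda>x. (2 * of_real pi * \<i> * of_int (l $ n)) * wave l x)"
  using pdiff_wave[of n 1 l] by simp

lemma smooth_wave: "smooth (wave l)"
  unfolding smooth_def
proof
  fix ns
  have "\<exists>c. foldr pdiff ns (wave l) = (\<lambda>x. c * wave l x)"
  proof (induction ns)
    case Nil show ?case by (intro exI[of _ 1]) simp
  next
    case (Cons n ns)
    then obtain c where "foldr pdiff ns (wave l) = (\<lambda>x. c * wave l x)" by blast
    then show ?case by (simp only: foldr.simps comp_apply pdiff_wave) blast
  qed
  then show "foldr pdiff ns (wave l) differentiable_on UNIV"
    using has_derivative_wave unfolding differentiable_on_def differentiable_def by fastforce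
qed

text \<open>Test against the wave of frequency - k. All weak derivatives thus share their
  coefficients, so the choice in \<open>pderivT\<close> does not influence norms and inner
  products.\<close>

lemma weak_pderiv_fcoeff:
  assumes "weak_pderiv n f g" shows "fcoeff g k = 2 * of_real pi * \<i> * of_int (k $ n) * fcoeff f k"
proof -
  have "integral\<^sup>L torus (\<lambda>x. f x * pdiff n (wave (- k)) x) = - integral\<^sup>L torus (\<lambda>x. g x * wave (- k) x)"
    using assms periodic_wave smooth_wave unfolding weak_pderiv_def by blast
  then have "- fcoeff g k = integral\<^sup>L torus (\<lambda>x. (2 * of_real pi * \<i> * of_int ((-k) $ n)) * (f x * wave (- k) x))"
    unfolding pdiff_wave' by (simp add: fcoeff_wave cnj_wave mult_ac)
  also have "\<dots> = (2 * of_real pi * \<i> * of_int ((-k) $ n)) * fcoeff f k"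
    by (simp only: integral_mult_right_zero fcoeff_wave cnj_wave)
  finally have "- fcoeff g k = - (2 * of_real pi * \<i> * of_int (k $ n) * fcoeff f k)" by simp
  then show ?thesis by (simp only: neg_equal_iff_equal)
qed

lemma smooth_pdiff: 
  assumes "smooth h" 
  shows "(h has_derivative frechet_derivative h (at x)) (at x)" "continuous_on UNIV (pdiff n h)" "continuous_on UNIV h"
proof -
  have d: "h differentiable_on UNIV" using assms[unfolded smooth_def, rule_format, of "[]"] by simp
  then show "(h has_derivative frechet_derivative h (at x)) (at x)" 
    by (simp add: differentiable_on_def frechet_derivative_works)
  show "continuous_on UNIV h" using d by (rule differentiable_imp_continuous_on)
  have "pdiff n h differentiable_on UNIV" using assms[unfolded smooth_def, rule_format, of "[n]"] by simp
  then show "continuous_on UNIV (pdiff n h)" by (rule differentiable_imp_continuous_on)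
qed

lemma pdiff_vector_derivative:
  assumes "smooth h"
  shows "((\<lambda>s. h (x + s *\<^sub>R axis n 1)) has_vector_derivative pdiff n h (x + s *\<^sub>R axis n 1)) (at s within S)"
proof -
  let ?y = "x + s *\<^sub>R axis n 1" let ?D = "frechet_derivative h (at ?y)"
  have D: "(h has_derivative ?D) (at ?y)" by (rule smooth_pdiff(1)[OF assms])
  have g: "((\<lambda>s. x + s *\<^sub>R axis n 1) has_derivative (\<lambda>t. t *\<^sub>R axis n 1)) (at s within S)"
    by (auto intro!: derivative_eq_intros)
  have "((\<lambda>s. h (x + s *\<^sub>R axis n 1)) has_derivative (\<lambda>t. ?D (t *\<^sub>R axis n 1))) (at s within S)"
    using has_derivative_compose[OF g D] by simp
  moreover have "?D (t *\<^sub>R axis n 1) = t *\<^sub>R ?D (axis n 1)" for t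
    using D by (simp add: has_derivative_linear linear_scale)
  ultimately show ?thesis unfolding has_vector_derivative_def pdiff_def by simp
qed

lemma vector_derivative_quotient:
  assumes "(f has_vector_derivative D) (at 0)"
  shows "((\<lambda>r. (f r - f 0) /\<^sub>R r) \<longlongrightarrow> D) (at 0)"
proof -
  have "((\<lambda>y. norm ((f y - f 0) - (y - 0) *\<^sub>R D) / norm (y - 0)) \<longlongrightarrow> 0) (at 0)"
    using assms unfolding has_vector_derivative_def has_derivative_iff_norm by blast
  moreover have "\<forall>\<^sub>F y in at 0. norm ((f y - f 0) - (y - 0) *\<^sub>R D) / norm (y - 0) = norm ((f y - f 0) /\<^sub>R y - D)"
    unfolding eventually_at_filter
  proof (rule always_eventually, intro allI impI)
    fix y :: real assume y: "y \<noteq> 0"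
    then have "(f y - f 0) /\<^sub>R y - D = inverse y *\<^sub>R ((f y - f 0) - (y - 0) *\<^sub>R D)" by (simp add: scaleR_diff_right)
    then show "norm ((f y - f 0) - (y - 0) *\<^sub>R D) / norm (y - 0) = norm ((f y - f 0) /\<^sub>R y - D)"
      by (simp only: norm_scaleR) (simp add: divide_inverse mult.commute)
  qed
  ultimately have "((\<lambda>y. norm ((f y - f 0) /\<^sub>R y - D)) \<longlongrightarrow> 0) (at 0)" by (rule Lim_transform_eventually)
  then show ?thesis by (simp add: LIM_zero_iff tendsto_norm_zero_iff)
qed

text \<open>Shifting multiplies a coefficient by a wave value, so difference quotients have explicit
  coefficients. Dominated convergence on one side and the derivative of the wave at 0 on the other
  give the formula; no boundary terms on the faces of the cube arise.\<close>

lemma fcoeff_pdiff: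
  fixes h :: "real^'d \<Rightarrow> complex"
  assumes p: "periodic h" and s: "smooth h"
  shows "fcoeff (pdiff n h) k = 2 * of_real pi * \<i> * of_int (k $ n) * fcoeff h k"
proof -
  let ?e = "axis n 1 :: real^'d"
  define t where "t m = 1 / real (Suc m)" for m
  have t: "0 < t m" "t m \<le> 1" for m by (auto simp: t_def)
  have t0: "t \<longlonglongrightarrow> 0" unfolding t_def using LIMSEQ_Suc[OF lim_1_over_n] by simp 
  have t_at: "filterlim t (at 0) sequentially"
    using t0 t(1) by (intro filterlim_atI) (auto simp: less_imp_neq[symmetric])
  define q where "q m x = (h (x + t m *\<^sub>R ?e) - h x) /\<^sub>R t m" for m x
  have hL: "h \<in> L2T" using p sq_integrable_continuous[OF smooth_pdiff(3)[OF s]] by (simp add: L2T_sq_integrable)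
  have hc: "continuous_on UNIV h" by (rule smooth_pdiff(3)[OF s])
  have qc: "continuous_on UNIV (q m)" for m
    unfolding q_def by (intro continuous_intros continuous_on_compose2[OF hc]) auto
  have pc: "continuous_on UNIV (pdiff n h)" by (rule smooth_pdiff(2)[OF s])
  \<comment> \<open>The larger cube is needed because x + r e may leave the unit cube;
    \<open>t m \<le> 1\<close> keeps it inside the larger one.\<close>
  have "bounded (pdiff n h ` cbox 0 2)"
    by (intro compact_imp_bounded compact_continuous_image continuous_on_subset[OF pc] compact_cbox) auto
  then obtain M where M: "\<And>x. x \<in> cbox 0 2 \<Longrightarrow> cmod (pdiff n h x) \<le> M" by (auto simp: bounded_iff)
  have qb: "cmod (q m x) \<le> M" if x: "x \<in> cbox 0 1" for m x
  proof -
    have "norm (h (x + t m *\<^sub>R ?e) - h (x + 0 *\<^sub>R ?e)) \<le> M * norm (t m - 0)"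
    proof (rule differentiable_bound[of "{0..t m}"])
      fix r assume r: "r \<in> {0..t m}"
      show "((\<lambda>s. h (x + s *\<^sub>R ?e)) has_derivative (\<lambda>a. a *\<^sub>R pdiff n h (x + r *\<^sub>R ?e))) (at r within {0..t m})"
        using pdiff_vector_derivative[OF s] unfolding has_vector_derivative_def .
      have "norm (pdiff n h (x + r *\<^sub>R ?e)) \<le> M"
      proof (rule M)
        show "x + r *\<^sub>R ?e \<in> cbox 0 2" using x r t(2)[of m]
          by (auto simp: mem_box_cart axis_def intro: add_nonneg_nonneg) (smt (verit))+
      qed
      then show "onorm (\<lambda>a. a *\<^sub>R pdiff n h (x + r *\<^sub>R ?e)) \<le> M"
        by (intro onorm_le) (simp add: mult.commute[of M] mult_left_mono)
    qed (use t[of m] in auto)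
    then show ?thesis using t[of m] unfolding q_def norm_scaleR by (simp add: field_simps)
  qed
  have lim: "(\<lambda>m. q m x) \<longlonglongrightarrow> pdiff n h x" for x
  proof -
    have "((\<lambda>s. h (x + s *\<^sub>R ?e)) has_vector_derivative pdiff n h (x + 0 *\<^sub>R ?e)) (at 0)"
      by (rule pdiff_vector_derivative[OF s])
    then have "((\<lambda>r. (h (x + r *\<^sub>R ?e) - h x) /\<^sub>R r) \<longlongrightarrow> pdiff n h x) (at 0)"
      using vector_derivative_quotient by fastforce
    then show ?thesis unfolding q_def by (rule filterlim_compose[OF _ t_at])
  qed
  have "(\<lambda>m. fcoeff (q m) k) \<longlonglongrightarrow> fcoeff (pdiff n h) k"
    unfolding fcoeff_wave
  proof (rule integral_dominated_convergence[where w = "\<lambda>_. M"])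
    show "AE x in torus. (\<lambda>m. q m x * cnj (wave k x)) \<longlonglongrightarrow> pdiff n h x * cnj (wave k x)"
      by (intro AE_I2 tendsto_intros lim)
    show "AE x in torus. norm (q m x * cnj (wave k x)) \<le> M" for m
      by (intro AE_I2) (simp add: norm_mult qb)
  qed (auto intro!: continuous_measurable_torus continuous_on_mult continuous_on_cnj qc pc continuous_wave)
  moreover have "fcoeff (q m) k = ((wave k (t m *\<^sub>R ?e) - 1) /\<^sub>R t m) * fcoeff h k" for m
  proof -
    have "q m = (\<lambda>x. of_real (1 / t m) * (h (x + t m *\<^sub>R ?e) + (-1) * h x))"
      by (rule ext) (simp add: q_def scaleR_conv_of_real divide_inverse)
    then have "fcoeff (q m) k = of_real (1 / t m) * (fcoeff (\<lambda>x. h (x + t m *\<^sub>R ?e)) k + (-1) * fcoeff h k)"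
      using L2T_shift[OF hL] hL by (simp only: fcoeff_cmult fcoeff_add sq_integrable_cmult L2T_sq_integrable)
    then show ?thesis
      by (simp only: fcoeff_shift[OF hL]) (simp add: scaleR_conv_of_real divide_inverse algebra_simps)
  qed
  moreover have "(\<lambda>m. ((wave k (t m *\<^sub>R ?e) - 1) /\<^sub>R t m) * fcoeff h k) \<longlonglongrightarrow> 2 * of_real pi * \<i> * of_int (k $ n) * fcoeff h k"
  proof -
    have "((\<lambda>s. wave k (0 + s *\<^sub>R ?e)) has_vector_derivative pdiff n (wave k) (0 + 0 *\<^sub>R ?e)) (at 0)"
      by (rule pdiff_vector_derivative[OF smooth_wave])
    moreover have "pdiff n (wave k) 0 = 2 * of_real pi * \<i> * of_int (k $ n)"
      unfolding pdiff_wave' by (simp add: wave_def)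
    moreover have "wave k 0 = 1" by (simp add: wave_def)
    ultimately have "((\<lambda>r. (wave k (r *\<^sub>R ?e) - 1) /\<^sub>R r) \<longlongrightarrow> 2 * of_real pi * \<i> * of_int (k $ n)) (at 0)"
      using vector_derivative_quotient by fastforce
    then show ?thesis by (intro tendsto_mult_right filterlim_compose[OF _ t_at])
  qed
  ultimately show ?thesis using LIMSEQ_unique by simp
qed

text \<open>The hypothesis makes the formally differentiated series absolutely convergent, which
  provides a candidate in \<open>L2T\<close>. Parseval's identity then turns the weak derivative
  relation into an identity between coefficients.\<close>

lemma weak_pderiv_exists:
  fixes f :: "real^'d \<Rightarrow> complex"
  assumes f: "sq_integrable f" and sm: "(\<lambda>k. norm (rvec k) * cmod (fcoeff f k)) summable_on UNIV"
  shows "\<exists>g. weak_pderiv n f g"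
proof -
  let ?a = "\<lambda>k. 2 * of_real pi * \<i> * of_int (k $ n) * fcoeff f k"
  have "(\<lambda>k. cmod (?a k)) summable_on UNIV"
  proof (rule summable_on_comparison_test)
    show "(\<lambda>k. (2 * pi) * (norm (rvec k) * cmod (fcoeff f k))) summable_on UNIV" using sm by (rule summable_on_cmult_right)
    fix k :: "int^'d"
    have "\<bar>real_of_int (k $ n)\<bar> \<le> norm (rvec k)" using component_le_norm_cart[of "rvec k" n] by (simp add: rvec_def)
    then show "cmod (?a k) \<le> (2 * pi) * (norm (rvec k) * cmod (fcoeff f k))" by (simp add: norm_mult mult_right_mono)
  qed auto
  then obtain g where g: "g \<in> L2T" "\<And>k. fcoeff g k = ?a k" using fourier_series_exists[of ?a] by blast
  have "integral\<^sup>L torus (\<lambda>x. f x * pdiff n h x) = - integral\<^sup>L torus (\<lambda>x. g x * h x)"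
    if h: "periodic h" "smooth h" for h
  proof -
    have sh: "sq_integrable h" "sq_integrable (pdiff n h)" using smooth_pdiff[OF h(2)] by (auto intro: sq_integrable_continuous)
    have "((\<lambda>k. fcoeff f k * fcoeff (pdiff n h) (- k)) has_sum integral\<^sup>L torus (\<lambda>x. f x * pdiff n h x)) UNIV"
      by (rule integral_mult_parseval[OF f sh(2)])
    moreover have "((\<lambda>k. - (fcoeff g k * fcoeff h (- k))) has_sum - integral\<^sup>L torus (\<lambda>x. g x * h x)) UNIV"
      using g(1) by (intro has_sum_uminusI integral_mult_parseval sh) (simp add: L2T_sq_integrable)
    moreover have "fcoeff f k * fcoeff (pdiff n h) (- k) = - (fcoeff g k * fcoeff h (- k))" for k
      by (simp add: fcoeff_pdiff[OF h] g(2))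
    ultimately show ?thesis by (metis (no_types, lifting) has_sum_cong has_sum_unique)
  qed
  then show ?thesis using g(1) unfolding weak_pderiv_def by blast
qed

text \<open>\<open>opB\<close> multiplies the coefficient at k by - <L, k>; the sign disappears
  because the first moment enters through its square. The summability hypothesis guarantees that the
  weak derivatives chosen by \<open>pderivT\<close> exist.\<close>

theorem UP_fourier:
  fixes f :: "real^'d \<Rightarrow> complex" and L :: "int^'d"
  assumes f: "f \<in> L2T" and sm: "(\<lambda>k. norm (rvec k) * cmod (fcoeff f k)) summable_on UNIV"
  defines "N \<equiv> infsum (\<lambda>k. (cmod (fcoeff f k))\<^sup>2) UNIV"
    and "a \<equiv> infsum (\<lambda>k. fcoeff f (k - L) * cnj (fcoeff f k)) UNIV"
    and "M1 \<equiv> infsum (\<lambda>k. (rvec L \<bullet> rvec k) * (cmod (fcoeff f k))\<^sup>2) UNIV"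
    and "M2 \<equiv> infsum (\<lambda>k. (rvec L \<bullet> rvec k)\<^sup>2 * (cmod (fcoeff f k))\<^sup>2) UNIV"
  shows "UP L f = 1 / norm (rvec L) ^ 4 * (N\<^sup>2 / (cmod a)\<^sup>2 - 1) * (M2 / N - M1\<^sup>2 / N\<^sup>2)"
    and "innerT (opA L f) f = a"
proof -
  have s: "sq_integrable f" using f by (simp add: L2T_sq_integrable)
  have N: "(normT f)\<^sup>2 = N" unfolding N_def using parseval[OF s] by (simp add: infsumI)
  have N4: "normT f ^ 4 = N\<^sup>2" unfolding N[symmetric] by (simp flip: power_mult)
  show A: "innerT (opA L f) f = a" unfolding a_def by (rule infsumI[OF innerT_opA[OF s], symmetric])
  have w: "weak_pderiv n f (pderivT n f)" for n
    unfolding pderivT_def using someI_ex[OF weak_pderiv_exists[OF s sm, of n]] .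
  have sp: "sq_integrable (pderivT n f)" for n using w[of n] by (simp add: weak_pderiv_def L2T_sq_integrable)
  let ?S = "\<lambda>x. \<Sum>n\<in>UNIV. of_int (L $ n) * pderivT n f x"
  have sS: "sq_integrable ?S" and cS: "fcoeff ?S k = (\<Sum>n\<in>UNIV. of_int (L $ n) * fcoeff (pderivT n f) k)" for k
    using fcoeff_sum[of UNIV "\<lambda>n x. of_int (L $ n) * pderivT n f x"] sp by (auto simp: sq_integrable_cmult fcoeff_cmult)
  have oB: "opB L f = (\<lambda>x. \<i> / (2 * of_real pi) * ?S x)" by (rule ext) (simp only: opB_def)
  have sB: "sq_integrable (opB L f)" unfolding oB by (intro sq_integrable_cmult sS)
  have cB: "fcoeff (opB L f) k = of_real (- (rvec L \<bullet> rvec k)) * fcoeff f k" for k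
  proof -
    have "fcoeff (opB L f) k = \<i> / (2 * of_real pi) * (\<Sum>n\<in>UNIV. of_int (L $ n) * (2 * of_real pi * \<i> * of_int (k $ n) * fcoeff f k))"
      unfolding oB fcoeff_cmult cS weak_pderiv_fcoeff[OF w] ..
    also have "\<dots> = (\<Sum>n\<in>UNIV. - (of_int (L $ n) * of_int (k $ n))) * fcoeff f k"
      by (simp add: sum_distrib_left sum_distrib_right field_simps)
    finally show ?thesis by (simp add: inner_vec_def rvec_def sum_negf)
  qed
  have M2: "(normT (opB L f))\<^sup>2 = M2"
  proof -
    have "((\<lambda>k. (rvec L \<bullet> rvec k)\<^sup>2 * (cmod (fcoeff f k))\<^sup>2) has_sum (normT (opB L f))\<^sup>2) UNIV"
      using parseval[OF sB] by (simp add: cB norm_mult power_mult_distrib)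
    then show ?thesis unfolding M2_def by (simp add: infsumI)
  qed
  have M1: "innerT (opB L f) f = - of_real M1"
  proof -
    have "((\<lambda>k. - of_real ((rvec L \<bullet> rvec k) * (cmod (fcoeff f k))\<^sup>2)) has_sum innerT (opB L f) f) UNIV"
      using parseval_inner[OF sB s] by (simp add: cB complex_norm_square mult_ac del: of_real_power)
    then have i: "((\<lambda>k. complex_of_real ((rvec L \<bullet> rvec k) * (cmod (fcoeff f k))\<^sup>2)) has_sum - innerT (opB L f) f) UNIV"
      by (subst (asm) has_sum_uminus)
    have r: "((\<lambda>k. ((rvec L \<bullet> rvec k) * (cmod (fcoeff f k))\<^sup>2)) has_sum Re (- innerT (opB L f) f)) UNIV"
      using has_sum_Re[OF i] by simp
    then have "M1 = Re (- innerT (opB L f) f)" unfolding M1_def by (rule infsumI)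
    moreover have "- innerT (opB L f) f = of_real (Re (- innerT (opB L f) f))"
      using has_sum_of_real[OF r, where 'a=complex] i has_sum_unique by blast
    ultimately show ?thesis by (metis minus_minus)
  qed
  show "UP L f = 1 / norm (rvec L) ^ 4 * (N\<^sup>2 / (cmod a)\<^sup>2 - 1) * (M2 / N - M1\<^sup>2 / N\<^sup>2)"
    unfolding UP_def N4 A N M2 M1 by (simp add: norm_minus_cancel)
qed

section \<open>The Parseval frame property\<close>

definition sq_summable :: "(int^'d \<Rightarrow> complex) \<Rightarrow> bool" where
  "sq_summable c \<longleftrightarrow> (\<lambda>n. (cmod (c n))\<^sup>2) summable_on UNIV"

lemma sq_summable_mult_abs_summable:
  assumes "sq_summable c" "sq_summable d" shows "(\<lambda>n. cmod (c n * d n)) summable_on S"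
proof -
  have "(\<lambda>n. (cmod (c n))\<^sup>2 + (cmod (d n))\<^sup>2) summable_on UNIV"
    using assms unfolding sq_summable_def by (rule summable_on_add)
  then have "(\<lambda>n. cmod (c n * d n)) summable_on UNIV"
  proof (rule summable_on_comparison_test)
    fix n
    show "cmod (c n * d n) \<le> (cmod (c n))\<^sup>2 + (cmod (d n))\<^sup>2"
      using sum_squares_bound[of "cmod (c n)" "cmod (d n)"] zero_le_power2[of "cmod (c n)"] zero_le_power2[of "cmod (d n)"]
      unfolding norm_mult by linarith
  qed auto
  then show ?thesis using summable_on_subset_banach by blast
qed

lemma sq_summable_mult_summable: "sq_summable c \<Longrightarrow> sq_summable d \<Longrightarrow> (\<lambda>n. c n * d n) summable_on S"
  using sq_summable_mult_abs_summable[of c d S] by (rule_tac abs_summable_summable)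

lemma sq_summable_fcoeff: "sq_integrable f \<Longrightarrow> sq_summable (fcoeff f)"
  unfolding sq_summable_def using parseval has_sum_imp_summable by blast

lemma sq_summable_mono: "sq_summable c \<Longrightarrow> (\<And>n. cmod (d n) \<le> cmod (c n)) \<Longrightarrow> sq_summable d"
  unfolding sq_summable_def by (rule summable_on_comparison_test[of "\<lambda>n. (cmod (c n))\<^sup>2"]) (auto intro!: power_mono)

lemma rmatpow_Suc_right: "rmatpow M (Suc j) = rmatpow M j ** map_matrix real_of_int M"
  by (simp add: rmatpow_def matpow_Suc_right map_matrix_of_int_mult)

text \<open>The matrix with rows (u, v) and (v, -u) is orthogonal.\<close>

lemma rotation_identity:
  fixes u v :: real and a b :: complex
  assumes "u\<^sup>2 + v\<^sup>2 = 1"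
  shows "(cmod (of_real u * a + of_real v * b))\<^sup>2 + (cmod (of_real v * a - of_real u * b))\<^sup>2 = (cmod a)\<^sup>2 + (cmod b)\<^sup>2"
proof -
  have "(cmod (of_real u * a + of_real v * b))\<^sup>2 + (cmod (of_real v * a - of_real u * b))\<^sup>2
     = (u\<^sup>2 + v\<^sup>2) * ((cmod a)\<^sup>2 + (cmod b)\<^sup>2)"
    unfolding cmod_power2 by (simp add: power2_eq_square algebra_simps)
  then show ?thesis using assms by simp
qed

section \<open>Cosets modulo powers of \<open>B\<close> and Parseval's identity on the finite
  quotient\<close>

context dyadic_dilation
begin

definition coset :: "nat \<Rightarrow> int^'d \<Rightarrow> (int^'d) set" where
  "coset j m = {n. n - m \<in> range ((*v) (matpow B j))}"

abbreviation S :: "nat \<Rightarrow> (int^'d) set" where "S \<equiv> power_reps B k0"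

lemmas S_reps = power_reps[OF dilB repsB]

lemma coset_UNIV: "(\<Union>m\<in>S j. coset j m) = UNIV"
  using coset_reps_ex[OF S_reps] by (auto simp: coset_def)

lemma coset_disjoint:
  assumes "m \<in> S j" "m' \<in> S j" "m \<noteq> m'" shows "coset j m \<inter> coset j m' = {}"
proof (rule ccontr)
  assume "coset j m \<inter> coset j m' \<noteq> {}"
  then obtain n where "n - m \<in> range ((*v) (matpow B j))" "n - m' \<in> range ((*v) (matpow B j))" by (auto simp: coset_def)
  then have "(n - m') - (n - m) \<in> range ((*v) (matpow B j))" by (metis range_mult_vec_diff)
  then show False using coset_reps_unique[OF S_reps assms(1,2)] assms(3) by simp
qed

lemma coset_split: "coset j m = coset (Suc j) m \<union> coset (Suc j) (m + matpow B j *v k0)"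
proof (intro equalityI subsetI)
  fix n assume "n \<in> coset j m"
  then obtain q where q: "n - m = matpow B j *v q" by (auto simp: coset_def)
  from range_B_cases[of q] show "n \<in> coset (Suc j) m \<union> coset (Suc j) (m + matpow B j *v k0)"
  proof
    assume "q \<in> range ((*v) B)"
    then show ?thesis using q by (auto simp: coset_def matpow_mult_vec_Suc_right)
  next
    assume "q - k0 \<in> range ((*v) B)"
    then obtain p where "q - k0 = B *v p" by blast
    then have "n - (m + matpow B j *v k0) = matpow B (Suc j) *v p"
      using q by (simp add: matpow_mult_vec_Suc_right matrix_vector_mult_diff_distrib algebra_simps flip: \<open>q - k0 = B *v p\<close>)
    then show ?thesis by (auto simp: coset_def)
  qed
next
  fix n assume "n \<in> coset (Suc j) m \<union> coset (Suc j) (m + matpow B j *v k0)"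
  then show "n \<in> coset j m"
  proof
    assume "n \<in> coset (Suc j) m"
    then show ?thesis unfolding coset_def using subsetD[OF range_matpow_Suc_subset] by blast
  next
    assume "n \<in> coset (Suc j) (m + matpow B j *v k0)"
    then have "n - (m + matpow B j *v k0) \<in> range ((*v) (matpow B j))"
      unfolding coset_def using subsetD[OF range_matpow_Suc_subset] by blast
    then have "n - (m + matpow B j *v k0) + matpow B j *v k0 \<in> range ((*v) (matpow B j))" by (metis range_mult_vec_add rangeI)
    then show ?thesis by (simp add: coset_def)
  qed
qed

lemma coset_split_disjoint: "coset (Suc j) m \<inter> coset (Suc j) (m + matpow B j *v k0) = {}"
proof (rule ccontr)
  assume "coset (Suc j) m \<inter> coset (Suc j) (m + matpow B j *v k0) \<noteq> {}"
  then obtain n where "n - m \<in> range ((*v) (matpow B (Suc j)))" "n - (m + matpow B j *v k0) \<in> range ((*v) (matpow B (Suc j)))"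
    by (auto simp: coset_def)
  then have "(n - m) - (n - (m + matpow B j *v k0)) \<in> range ((*v) (matpow B (Suc j)))" by (metis range_mult_vec_diff)
  then obtain p where "matpow B j *v k0 = matpow B j *v (B *v p)" by (auto simp: matpow_mult_vec_Suc_right)
  then have "k0 = B *v p" using inj_matpow[OF dilB] by (metis injD)
  then show False using k0_notin by blast
qed

lemma chi_coset: "n \<in> coset j m \<Longrightarrow> chi j n k = chi j m k"
  using chi_add1[of j m "n - m" k] by (simp add: coset_def chi_matpow1)

text \<open>B^(-(j+1)) B^j = B^(-1). For n = \<open>k0\<close> this yields the factor -1 that tells
  the two halves of a coset apart.\<close>

lemma chi_Suc_shift: "chi (Suc j) (matpow B j *v n) k = chi 1 n k"
proof -
  let ?w = "matrix_inv (rmatpow B 1) *v rvec n"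
  have "rmatpow B 1 = map_matrix real_of_int B" by (simp add: rmatpow_Suc[of B 0])
  then have "rmatpow B (Suc j) *v w = rmatpow B j *v (rmatpow B 1 *v w)" for w
    by (simp only: rmatpow_Suc_right matrix_vector_mul_assoc)
  then have "rmatpow B (Suc j) *v ?w = rmatpow B j *v (rmatpow B 1 *v ?w)" .
  also have "\<dots> = rvec (matpow B j *v n)" by (simp only: matrix_inv_rmatpow[OF dilB] rvec_matpow)
  finally have "matrix_inv (rmatpow B (Suc j)) *v rvec (matpow B j *v n) = ?w"
    using matrix_inv_rmatpow(2)[OF dilB] by metis
  then show ?thesis by (simp add: chi_def pairing_def)
qed

text \<open>The character is constant on each coset modulo B^j, so the series in n becomes a finite
  character sum of the sequence folded over cosets. Expanding the square,
  \<open>chi_orthogonality\<close> leaves only the diagonal, with the factor 2^j.\<close>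

lemma class_sum_parseval:
  assumes R: "coset_reps (matpow A j) R" and g: "(\<lambda>n. cmod (g n)) summable_on UNIV"
  shows "(\<Sum>k\<in>R. (cmod (infsum (\<lambda>n. g n * chi j n k) UNIV))\<^sup>2) = 2 ^ j * (\<Sum>m\<in>S j. (cmod (infsum g (coset j m)))\<^sup>2)"
proof -
  define U where "U m = infsum g (coset j m)" for m
  have sg: "(\<lambda>n. g n * chi j n k) summable_on T" for k T
    using summable_on_subset_banach[OF g, of T] by (rule_tac abs_summable_summable) (simp add: norm_mult)
  have "infsum (\<lambda>n. g n * chi j n k) UNIV = (\<Sum>m\<in>S j. U m * chi j m k)" for k
  proof -
    have "infsum (\<lambda>n. g n * chi j n k) UNIV = (\<Sum>m\<in>S j. infsum (\<lambda>n. g n * chi j n k) (coset j m))"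
      unfolding coset_UNIV[of j, symmetric] by (rule sum_infsum[symmetric]) (auto intro: sg dest: coset_disjoint)
    also have "\<dots> = (\<Sum>m\<in>S j. infsum (\<lambda>n. g n * chi j m k) (coset j m))"
      by (intro sum.cong refl infsum_cong) (simp add: chi_coset)
    finally show ?thesis by (simp add: infsum_cmult_left' U_def)
  qed
  then have "complex_of_real (\<Sum>k\<in>R. (cmod (infsum (\<lambda>n. g n * chi j n k) UNIV))\<^sup>2)
     = (\<Sum>k\<in>R. (\<Sum>m\<in>S j. U m * chi j m k) * cnj (\<Sum>m\<in>S j. U m * chi j m k))"
    by (simp add: complex_norm_square del: of_real_power)
  also have "\<dots> = (\<Sum>k\<in>R. \<Sum>m\<in>S j. \<Sum>m'\<in>S j. U m * cnj (U m') * chi j (m - m') k)"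
  proof (intro sum.cong refl)
    fix k
    have c: "chi j m k * cnj (chi j m' k) = chi j (m - m') k" for m m'
      using chi_add1[of j m "- m'" k] by (simp add: chi_minus1)
    show "(\<Sum>m\<in>S j. U m * chi j m k) * cnj (\<Sum>m\<in>S j. U m * chi j m k)
        = (\<Sum>m\<in>S j. \<Sum>m'\<in>S j. U m * cnj (U m') * chi j (m - m') k)"
      unfolding cnj_sum sum_product complex_cnj_mult c[symmetric] by (intro sum.cong refl) (simp add: mult_ac)
  qed
  also have "\<dots> = (\<Sum>m\<in>S j. \<Sum>m'\<in>S j. U m * cnj (U m') * (\<Sum>k\<in>R. chi j (m - m') k))"
    unfolding sum_distrib_left
    by (rule trans[OF sum.swap]) (rule sum.cong[OF refl], rule sum.swap)
  also have "\<dots> = (\<Sum>m\<in>S j. \<Sum>m'\<in>S j. if m' = m then 2 ^ j * (U m * cnj (U m)) else 0)"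
  proof (intro sum.cong refl)
    fix m m' assume m: "m \<in> S j" "m' \<in> S j"
    show "U m * cnj (U m') * (\<Sum>k\<in>R. chi j (m - m') k) = (if m' = m then 2 ^ j * (U m * cnj (U m)) else 0)"
      unfolding chi_orthogonality[OF R] using coset_reps_unique[OF S_reps m] by (auto simp: mult_ac)
  qed
  also have "\<dots> = complex_of_real (2 ^ j * (\<Sum>m\<in>S j. (cmod (U m))\<^sup>2))"
    by (simp add: complex_norm_square sum_distrib_left del: of_real_power) (simp add: of_real_power)
  finally show ?thesis unfolding of_real_eq_iff U_def .
qed

lemma sum_S_Suc: "(\<Sum>m\<in>S (Suc j). f m) = (\<Sum>m\<in>S j. f m + f (m + matpow B j *v k0))"
proof -
  have "(\<Sum>m\<in>S (Suc j). f m) = (\<Sum>(r, s)\<in>S j \<times> {0, k0}. f (r + matpow B j *v s))"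
    by (simp only: power_reps.simps sum.reindex[OF inj_on_power_reps_step[OF dilB repsB]])
      (simp add: comp_def case_prod_unfold)
  also have "\<dots> = (\<Sum>r\<in>S j. \<Sum>s\<in>{0, k0}. f (r + matpow B j *v s))" by (simp add: sum.cartesian_product)
  also have "\<dots> = (\<Sum>m\<in>S j. f m + f (m + matpow B j *v k0))" using k0_nonzero by simp
  finally show ?thesis .
qed

end

section \<open>Energies of the wavelet system\<close>

locale wavelet_system = scaling_sequences +
  fixes \<phi> \<psi> :: "nat \<Rightarrow> real^'a \<Rightarrow> complex"
  assumes phi: "scaling_functions \<nu> \<phi>" and psi: "wavelet_functions B k0 \<nu> \<phi> \<psi>"
begin

definition X :: "nat \<Rightarrow> int^'a \<Rightarrow> complex" where "X j n = of_real (xi_hat \<nu> j n)"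

lemma phi_L2T: "\<phi> j \<in> L2T" and psi_L2T: "\<psi> j \<in> L2T"
  using phi psi by (auto simp: scaling_functions_def wavelet_functions_def)

lemma fcoeff_phi: "fcoeff (\<phi> j) k = of_real (2 powr (- real j / 2)) * X j k"
  using phi by (simp add: scaling_functions_def X_def)

text \<open>The factor \<surd>2 of the mask raises the normalisation 2^(-(j+1)/2) of
  \<open>\<phi> (j + 1)\<close> to 2^(-j/2).\<close>

lemma fcoeff_psi:
  "fcoeff (\<psi> j) n = of_real (2 powr (- real j / 2)) *
     (chi (Suc j) n k0 * of_real (\<nu> (Suc j) (n + matpow B j *v k0)) * X (Suc j) n)"
proof -
  have "sqrt 2 * 2 powr (- real (j + 1) / 2) = 2 powr (- real j / 2)"
  proof -
    have "sqrt 2 * 2 powr (- real (j + 1) / 2) = 2 powr (1/2) * 2 powr (- real (j + 1) / 2)" by (simp add: powr_half_sqrt)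
    also have "\<dots> = 2 powr (1/2 + - real (j + 1) / 2)" by (rule powr_add[symmetric])
    also have "1/2 + - real (j + 1) / 2 = - real j / 2" by (simp add: field_simps)
    finally show ?thesis .
  qed
  then have s: "complex_of_real (sqrt 2) * of_real (2 powr (- real (j + 1) / 2)) = of_real (2 powr (- real j / 2))"
    unfolding of_real_mult[symmetric] of_real_eq_iff .
  have "fcoeff (\<psi> j) n = wavelet_mask B k0 \<nu> (j + 1) n * fcoeff (\<phi> (j + 1)) n"
    using psi by (auto simp: wavelet_functions_def)
  also have "wavelet_mask B k0 \<nu> (j + 1) n = chi (Suc j) n k0 * (of_real (sqrt 2) * of_real (\<nu> (Suc j) (n + matpow B j *v k0)))"
    unfolding wavelet_mask_def exp_unit_exp by (simp add: chi_def pairing_def scaling_mask_def)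
  finally show ?thesis unfolding fcoeff_phi s[symmetric] by (simp add: mult_ac)
qed

lemma sq_summable_X: "sq_summable (X j)"
proof -
  have "sq_summable (fcoeff (\<phi> j))" using phi_L2T by (intro sq_summable_fcoeff) (simp add: L2T_sq_integrable)
  then have "(\<lambda>n. (2 powr (- real j / 2))\<^sup>2 * (cmod (X j n))\<^sup>2) summable_on UNIV"
    unfolding sq_summable_def fcoeff_phi norm_mult by (simp add: power_mult_distrib)
  from summable_on_cmult_right[OF this, of "1 / (2 powr (- real j / 2))\<^sup>2"]
  show ?thesis unfolding sq_summable_def by simp
qed

lemma X_Suc: "X j n = of_real (\<nu> (Suc j) n) * X (Suc j) n"
  by (simp add: X_def xi_Suc[of j])

lemma nu_coset: "n \<in> coset (Suc j) m \<Longrightarrow> \<nu> (Suc j) n = \<nu> (Suc j) m"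
  using nu_periodic[of "Suc j" "n - m" m] by (simp add: coset_def)

definition T :: "(int^'a \<Rightarrow> complex) \<Rightarrow> nat \<Rightarrow> int^'a \<Rightarrow> complex" where
  "T c j m = infsum (\<lambda>n. c n * X j n) (coset j m)"

definition energy :: "(int^'a \<Rightarrow> complex) \<Rightarrow> nat \<Rightarrow> real" where
  "energy c j = (\<Sum>m\<in>S j. (cmod (T c j m))\<^sup>2)"

definition detail :: "(int^'a \<Rightarrow> complex) \<Rightarrow> nat \<Rightarrow> int^'a \<Rightarrow> complex" where
  "detail c j m = of_real (\<nu> (Suc j) (m + matpow B j *v k0)) * T c (Suc j) m
     - of_real (\<nu> (Suc j) m) * T c (Suc j) (m + matpow B j *v k0)"

lemma T_split:
  assumes c: "sq_summable c"
  shows "T c j m = of_real (\<nu> (Suc j) m) * T c (Suc j) m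
     + of_real (\<nu> (Suc j) (m + matpow B j *v k0)) * T c (Suc j) (m + matpow B j *v k0)"
proof -
  have u: "infsum (\<lambda>n. c n * X j n) (coset (Suc j) m') = of_real (\<nu> (Suc j) m') * T c (Suc j) m'" for m'
  proof -
    have "infsum (\<lambda>n. c n * X j n) (coset (Suc j) m') = infsum (\<lambda>n. of_real (\<nu> (Suc j) m') * (c n * X (Suc j) n)) (coset (Suc j) m')"
      by (intro infsum_cong) (simp add: X_Suc[of j] nu_coset)
    then show ?thesis by (simp only: infsum_cmult_right' T_def)
  qed
  show ?thesis unfolding T_def[of c j] coset_split[of j m]
    unfolding infsum_Un_disjoint[OF sq_summable_mult_summable[OF c sq_summable_X] sq_summable_mult_summable[OF c sq_summable_X] coset_split_disjoint] u ..
qed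

lemma energy_Suc:
  assumes c: "sq_summable c"
  shows "energy c (Suc j) = energy c j + (\<Sum>m\<in>S j. (cmod (detail c j m))\<^sup>2)"
proof -
  have "energy c (Suc j) = (\<Sum>m\<in>S j. (cmod (T c (Suc j) m))\<^sup>2 + (cmod (T c (Suc j) (m + matpow B j *v k0)))\<^sup>2)"
    unfolding energy_def by (rule sum_S_Suc)
  also have "\<dots> = (\<Sum>m\<in>S j. (cmod (T c j m))\<^sup>2 + (cmod (detail c j m))\<^sup>2)"
    by (intro sum.cong refl) (simp only: T_split[OF c, of j] detail_def rotation_identity[OF conjunct2[OF nu_pair]])
  finally show ?thesis by (simp add: energy_def sum.distrib)
qed

text \<open>In the inner product the shift by A^(-j) k appears as the factor
  \<open>chi j n k\<close>, so \<open>class_sum_parseval\<close> applies. Its factor 2^j cancels the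
  squared normalisation 2^(-j), and the sign of \<open>chi\<close> at B^j k0 produces the minus sign
  in \<open>detail\<close>.\<close>

lemma psi_energy:
  assumes f: "f \<in> L2T" and R: "coset_reps (matpow A j) R"
  shows "(\<Sum>k\<in>R. (cmod (innerT f (\<lambda>x. \<psi> j (x - matrix_inv (rmatpow A j) *v rvec k))))\<^sup>2)
    = (\<Sum>m\<in>S j. (cmod (detail (fcoeff f) j m))\<^sup>2)"
proof -
  let ?c = "fcoeff f"
  let ?a = "\<lambda>k. matrix_inv (rmatpow A j) *v rvec k"
  let ?t = "matpow B j *v k0"
  define g where "g n = ?c n * cnj (fcoeff (\<psi> j) n)" for n
  have sf: "sq_integrable f" "sq_integrable (\<psi> j)" using f psi_L2T by (auto simp: L2T_sq_integrable)
  have sp: "sq_summable (\<lambda>n. cnj (fcoeff (\<psi> j) n))" using sq_summable_fcoeff[OF sf(2)] by (simp add: sq_summable_def)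
  have gs: "(\<lambda>n. cmod (g n)) summable_on UNIV"
    unfolding g_def by (rule sq_summable_mult_abs_summable[OF sq_summable_fcoeff[OF sf(1)] sp])
  have "innerT f (\<lambda>x. \<psi> j (x - ?a k)) = infsum (\<lambda>n. g n * chi j n k) UNIV" for k
  proof -
    have sh: "(\<lambda>x. \<psi> j (x + - ?a k)) \<in> L2T" by (rule L2T_shift[OF psi_L2T])
    have "((\<lambda>n. ?c n * cnj (fcoeff (\<lambda>x. \<psi> j (x + - ?a k)) n)) has_sum innerT f (\<lambda>x. \<psi> j (x + - ?a k))) UNIV"
      using sh by (intro parseval_inner sf(1)) (simp add: L2T_sq_integrable)
    moreover have "?c n * cnj (fcoeff (\<lambda>x. \<psi> j (x + - ?a k)) n) = g n * chi j n k" for n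
    proof -
      have "cnj (wave n (- ?a k)) = chi j n k"
        by (simp add: wave_def cnj_unit_exp chi_def pairing_alt)
      then show ?thesis by (simp only: fcoeff_shift[OF psi_L2T] complex_cnj_mult g_def mult_ac)
    qed
    ultimately have "((\<lambda>n. g n * chi j n k) has_sum innerT f (\<lambda>x. \<psi> j (x + - ?a k))) UNIV" by simp
    then show ?thesis by (simp add: infsumI)
  qed
  then have "(\<Sum>k\<in>R. (cmod (innerT f (\<lambda>x. \<psi> j (x - ?a k))))\<^sup>2) = 2 ^ j * (\<Sum>m\<in>S j. (cmod (infsum g (coset j m)))\<^sup>2)"
    using class_sum_parseval[OF R gs] by simp
  also have "\<dots> = (\<Sum>m\<in>S j. (cmod (detail ?c j m))\<^sup>2)"
  proof -
    have p2: "2 ^ j * (2 powr (- real j / 2))\<^sup>2 = (1::real)"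
    proof -
      have "(2 powr (- real j / 2))\<^sup>2 = 2 powr (- real j)" by (simp add: powr_power)
      then show ?thesis by (simp add: powr_minus powr_realpow)
    qed
    have "2 ^ j * (cmod (infsum g (coset j m)))\<^sup>2 = (cmod (detail ?c j m))\<^sup>2" for m
    proof -
      \<comment> \<open>The constant value, on a coset of level j + 1, of the conjugated coefficient
        of \<open>\<psi> j\<close> without its factor \<open>X (Suc j)\<close>.\<close>
      let ?w = "\<lambda>m'. of_real (2 powr (- real j / 2)) * cnj (chi (Suc j) m' k0) * of_real (\<nu> (Suc j) (m' + ?t))"
      have per: "\<nu> (Suc j) (n + ?t) = \<nu> (Suc j) (m' + ?t)" if "n \<in> coset (Suc j) m'" for n m'
        using that by (intro nu_coset) (simp add: coset_def)
      have u: "infsum g (coset (Suc j) m') = ?w m' * T ?c (Suc j) m'" for m'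
      proof -
        have "infsum g (coset (Suc j) m') = infsum (\<lambda>n. ?w m' * (?c n * X (Suc j) n)) (coset (Suc j) m')"
          by (intro infsum_cong) (simp add: g_def fcoeff_psi chi_coset per X_def mult_ac)
        then show ?thesis by (simp only: infsum_cmult_right' T_def)
      qed
      have sg: "g summable_on Y" for Y
        using summable_on_subset_banach[OF gs] by (rule_tac abs_summable_summable) auto
      have "infsum g (coset j m) = ?w m * T ?c (Suc j) m + ?w (m + ?t) * T ?c (Suc j) (m + ?t)"
        unfolding coset_split[of j m] by (subst infsum_Un_disjoint[OF sg sg coset_split_disjoint]) (simp only: u)
      moreover have "chi (Suc j) (m + ?t) k0 = - chi (Suc j) m k0"
        unfolding chi_add1 chi_Suc_shift using chi_k0_cases[of k0] k0_notin by simp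
      moreover have "\<nu> (Suc j) (m + ?t + ?t) = \<nu> (Suc j) m"
        using nu_periodic[of "Suc j" "?t + ?t" m] matpow_k0_double by (simp add: add.assoc)
      ultimately have "infsum g (coset j m) = of_real (2 powr (- real j / 2)) * cnj (chi (Suc j) m k0) * detail ?c j m"
        unfolding detail_def by (simp add: algebra_simps)
      then have "(cmod (infsum g (coset j m)))\<^sup>2 = (2 powr (- real j / 2))\<^sup>2 * (cmod (detail ?c j m))\<^sup>2"
        by (simp add: norm_mult power_mult_distrib)
      then show ?thesis using p2 by (simp flip: mult.assoc)
    qed
    then show ?thesis by (simp add: sum_distrib_left)
  qed
  finally show ?thesis .
qed

lemma energy_0:
  assumes f: "f \<in> L2T" shows "(cmod (innerT f (\<phi> 0)))\<^sup>2 = energy (fcoeff f) 0"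
proof -
  have "((\<lambda>n. fcoeff f n * cnj (fcoeff (\<phi> 0) n)) has_sum innerT f (\<phi> 0)) UNIV"
    using f phi_L2T by (intro parseval_inner) (auto simp: L2T_sq_integrable)
  then have "innerT f (\<phi> 0) = infsum (\<lambda>n. fcoeff f n * X 0 n) UNIV"
    by (simp add: infsumI fcoeff_phi X_def)
  moreover have "coset 0 0 = UNIV" by (auto simp: coset_def)
  ultimately show ?thesis by (simp add: energy_def T_def)
qed

lemma energy_mono:
  assumes "sq_summable c" "i \<le> j" shows "energy c i \<le> energy c j"
  using assms(2)
proof (induction j rule: dec_induct)
  case (step n)
  have "0 \<le> (\<Sum>m\<in>S n. (cmod (detail c n m))\<^sup>2)" by (simp add: sum_nonneg)
  then show ?case using step.IH energy_Suc[OF assms(1), of n] by linarith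
qed simp

definition trunc :: "(int^'a) set \<Rightarrow> (int^'a \<Rightarrow> complex) \<Rightarrow> int^'a \<Rightarrow> complex" where
  "trunc K c n = (if n \<in> K then c n else 0)"

lemma sq_summable_trunc: "sq_summable c \<Longrightarrow> sq_summable (trunc K c)"
  by (erule sq_summable_mono) (simp add: trunc_def)

text \<open>For fixed n the Gaussian formula is valid from some level on, and its exponent tends to
  0.\<close>

lemma X_tendsto: "(\<lambda>j. X j n) \<longlonglongrightarrow> 1"
proof -
  obtain c where c: "c > 0" and g: "\<And>j k. j \<ge> 1 \<Longrightarrow> norm (rvec k) < c * (real j + 1) \<Longrightarrow>
        xi_hat \<nu> j k = exp (- (\<Lambda> * (norm (rvec k))\<^sup>2) / real j)"
    using xi_asymptotics by metis
  have "(\<lambda>j. exp (- (\<Lambda> * (norm (rvec n))\<^sup>2) / real j)) \<longlonglongrightarrow> exp 0"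
    by (intro tendsto_intros tendsto_divide_0[OF tendsto_const] filterlim_at_top_imp_at_infinity filterlim_real_sequentially)
  moreover have "\<forall>\<^sub>F j in sequentially. exp (- (\<Lambda> * (norm (rvec n))\<^sup>2) / real j) = xi_hat \<nu> j n"
  proof -
    obtain m :: nat where m: "norm (rvec n) / c < real m" using reals_Archimedean2 by blast
    show ?thesis using eventually_ge_at_top[of "max 1 m"]
    proof eventually_elim
      case (elim j)
      then have "norm (rvec n) / c < real j + 1" using m by linarith
      then have "norm (rvec n) < c * (real j + 1)" using c by (simp add: pos_divide_less_eq mult.commute)
      then show ?case using g[of j n] elim by simp
    qed
  qed
  ultimately have "(\<lambda>j. xi_hat \<nu> j n) \<longlonglongrightarrow> exp 0" by (rule Lim_transform_eventually)
  then show ?thesis unfolding X_def using tendsto_of_real[of _ "exp 0"] by fastforce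
qed

text \<open>For large j the difference lies both in the lattice of level j and in the image of the
  open box under B^j. Its preimage is an integer vector in the open box, hence 0.\<close>

lemma coset_separates:
  assumes "finite K"
  shows "\<forall>\<^sub>F j in sequentially. \<forall>n\<in>K. \<forall>n'\<in>K. n - n' \<in> range ((*v) (matpow B j)) \<longrightarrow> n = n'"
proof -
  obtain c where c: "c > 0" and e: "\<And>r x. norm x < c * (real r + 1) \<Longrightarrow>
     \<exists>y \<in> box (\<chi> i. -1/2) (\<chi> i. 1/2). x = rmatpow B r *v y"
    using dilation_matrix_expansion[OF dilB] by blast
  have p: "\<forall>\<^sub>F j in sequentially. n - n' \<in> range ((*v) (matpow B j)) \<longrightarrow> n = n'" for n n'
  proof -
    obtain m :: nat where m: "norm (rvec (n - n')) / c < real m" using reals_Archimedean2 by blast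
    show ?thesis using eventually_ge_at_top[of m]
    proof eventually_elim
      case (elim j)
      show ?case
      proof
        assume "n - n' \<in> range ((*v) (matpow B j))"
        then obtain q where q: "n - n' = matpow B j *v q" by blast
        have "norm (rvec (n - n')) / c < real j + 1" using m elim by linarith
        then have "norm (rvec (n - n')) < c * (real j + 1)" using c by (simp add: pos_divide_less_eq mult.commute)
        then obtain y where y: "y \<in> box (\<chi> i. -1/2) (\<chi> i. 1/2)" "rvec (n - n') = rmatpow B j *v y" using e by blast
        have "rmatpow B j *v rvec q = rmatpow B j *v y" using y(2) by (simp only: q rvec_matpow)
        then have "rvec q = y" using matrix_inv_rmatpow(2)[OF dilB] by metis
        then have "q \<in> intK B 0" using y(1) by (auto simp: intK_def)
        then show "n = n'" using q by (simp add: intK_0)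
      qed
    qed
  qed
  show ?thesis using assms p by (simp add: eventually_ball_finite_distrib)
qed

text \<open>As soon as the cosets separate \<open>K\<close>, each inner sum has at most one term, no
  interference remains, and the energy is a finite sum of |c(n) X j n|^2.\<close>

lemma energy_trunc_tendsto:
  assumes K: "finite K"
  shows "energy (trunc K c) \<longlonglongrightarrow> (\<Sum>n\<in>K. (cmod (c n))\<^sup>2)"
proof -
  have "(\<lambda>j. \<Sum>n\<in>K. (cmod (c n * X j n))\<^sup>2) \<longlonglongrightarrow> (\<Sum>n\<in>K. (cmod (c n * 1))\<^sup>2)"
    by (intro tendsto_intros X_tendsto)
  moreover have "\<forall>\<^sub>F j in sequentially. (\<Sum>n\<in>K. (cmod (c n * X j n))\<^sup>2) = energy (trunc K c) j"
    using coset_separates[OF K]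
  proof eventually_elim
    case (elim j)
    have t: "T (trunc K c) j m = (\<Sum>n\<in>K \<inter> coset j m. c n * X j n)" for m
    proof -
      have "T (trunc K c) j m = infsum (\<lambda>n. c n * X j n) (K \<inter> coset j m)"
        unfolding T_def by (rule infsum_cong_neutral) (auto simp: trunc_def)
      then show ?thesis using K by simp
    qed
    have sq: "(cmod (T (trunc K c) j m))\<^sup>2 = (\<Sum>n\<in>K \<inter> coset j m. (cmod (c n * X j n))\<^sup>2)" for m
    proof (cases "K \<inter> coset j m = {}")
      case True then show ?thesis by (simp add: t)
    next
      case False
      then obtain n where n: "n \<in> K" "n \<in> coset j m" by blast
      have "n' = n" if "n' \<in> K" "n' \<in> coset j m" for n'
      proof -
        have "(n' - m) - (n - m) \<in> range ((*v) (matpow B j))" using that n unfolding coset_def by (metis mem_Collect_eq range_mult_vec_diff)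
        then show ?thesis using elim that n by simp
      qed
      then have "K \<inter> coset j m = {n}" using n by blast
      then show ?thesis by (simp add: t)
    qed
    have "energy (trunc K c) j = (\<Sum>n\<in>(\<Union>m\<in>S j. K \<inter> coset j m). (cmod (c n * X j n))\<^sup>2)"
    proof -
      have "\<forall>m\<in>S j. \<forall>m'\<in>S j. m \<noteq> m' \<longrightarrow> (K \<inter> coset j m) \<inter> (K \<inter> coset j m') = {}"
        using coset_disjoint[of _ j] by blast
      then show ?thesis unfolding energy_def sq using K by (subst sum.UNION_disjoint) simp_all
    qed
    also have "(\<Union>m\<in>S j. K \<inter> coset j m) = K" using coset_UNIV[of j] by blast
    finally show ?case ..
  qed
  ultimately have "energy (trunc K c) \<longlonglongrightarrow> (\<Sum>n\<in>K. (cmod (c n * 1))\<^sup>2)" by (rule Lim_transform_eventually)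
  then show ?thesis by simp
qed

text \<open>For finitely supported sequences the energy increases to the squared norm, which
  therefore bounds it at every level. In general let the support grow at a fixed level, where only
  finitely many coset sums are involved.\<close>

lemma energy_le:
  assumes c: "sq_summable c" shows "energy c j \<le> infsum (\<lambda>n. (cmod (c n))\<^sup>2) UNIV"
proof -
  let ?E = "infsum (\<lambda>n. (cmod (c n))\<^sup>2) UNIV"
  let ?F = "finite_subsets_at_top (UNIV :: (int^'a) set)"
  have le: "energy (trunc K c) j \<le> ?E" if K: "finite K" for K
  proof -
    have "energy (trunc K c) j \<le> (\<Sum>n\<in>K. (cmod (c n))\<^sup>2)"
      by (rule LIMSEQ_le_const[OF energy_trunc_tendsto[OF K]]) (use energy_mono[OF sq_summable_trunc[OF c]] in blast)
    also have "\<dots> \<le> ?E" using c K unfolding sq_summable_def by (intro finite_sum_le_infsum) auto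
    finally show ?thesis .
  qed
  have t: "((\<lambda>K. T (trunc K c) j m) \<longlongrightarrow> T c j m) ?F" for m
  proof -
    define h where "h n = (if n \<in> coset j m then c n * X j n else 0)" for n
    have T: "T c j m = infsum h UNIV" unfolding T_def h_def by (rule infsum_cong_neutral) auto
    have "h summable_on UNIV"
    proof -
      have "(\<lambda>n. c n * X j n) summable_on coset j m" by (intro sq_summable_mult_summable c sq_summable_X)
      then show ?thesis unfolding h_def by (subst summable_on_cong_neutral[where T = "coset j m" and g = "\<lambda>n. c n * X j n"]) auto
    qed
    then have "(sum h \<longlongrightarrow> T c j m) ?F" unfolding T by (rule infsum_tendsto)
    moreover have "\<forall>\<^sub>F K in ?F. sum h K = T (trunc K c) j m"
    proof (rule eventually_finite_subsets_at_top_weakI)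
      fix K :: "(int^'a) set" assume K: "finite K"
      have "T (trunc K c) j m = infsum h K"
        unfolding T_def h_def by (rule infsum_cong_neutral) (auto simp: trunc_def)
      then show "sum h K = T (trunc K c) j m" using K by simp
    qed
    ultimately show ?thesis by (rule Lim_transform_eventually)
  qed
  have "((\<lambda>K. energy (trunc K c) j) \<longlongrightarrow> energy c j) ?F"
    unfolding energy_def by (intro tendsto_intros t)
  then show ?thesis
    by (rule tendsto_upperbound) (auto intro!: eventually_finite_subsets_at_top_weakI le)
qed

text \<open>The square root of the energy is a Euclidean norm, hence subadditive. The part supported
  in a finite set has the right limit by \<open>energy_trunc_tendsto\<close>, and the remainder is
  small at every level by \<open>energy_le\<close>.\<close>

lemma energy_tendsto:
  assumes c: "sq_summable c" shows "energy c \<longlonglongrightarrow> infsum (\<lambda>n. (cmod (c n))\<^sup>2) UNIV"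
proof -
  let ?a = "\<lambda>n. (cmod (c n))\<^sup>2"
  let ?E = "infsum ?a UNIV"
  let ?F = "finite_subsets_at_top (UNIV :: (int^'a) set)"
  have a: "?a summable_on UNIV" using c by (simp add: sq_summable_def)
  have "incseq (energy c)" using energy_mono[OF c] by (simp add: incseq_def)
  then obtain l where l: "energy c \<longlonglongrightarrow> l" "\<And>j. energy c j \<le> l"
    using incseq_convergent[of "energy c" ?E] energy_le[OF c] by metis
  have lE: "l \<le> ?E" by (rule LIMSEQ_le_const2[OF l(1)]) (use energy_le[OF c] in blast)
  have sq: "sqrt (energy d j) = L2_set (\<lambda>m. cmod (T d j m)) (S j)" for d j
    by (simp add: energy_def L2_set_def)
  have low: "sqrt (sum ?a K) \<le> sqrt l + sqrt (?E - sum ?a K)" if K: "finite K" for K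
  proof -
    let ?r = "trunc (- K) c"
    have r: "infsum (\<lambda>n. (cmod (?r n))\<^sup>2) UNIV = ?E - sum ?a K"
    proof -
      have "infsum (\<lambda>n. (cmod (?r n))\<^sup>2) UNIV = infsum ?a (- K)"
        by (rule infsum_cong_neutral) (auto simp: trunc_def)
      moreover have "?E = infsum ?a K + infsum ?a (- K)"
        using infsum_Un_disjoint[of ?a K "- K"] summable_on_subset_banach[OF a] by (simp add: Compl_partition)
      ultimately show ?thesis using K by simp
    qed
    have "sqrt (energy (trunc K c) j) \<le> sqrt l + sqrt (?E - sum ?a K)" for j
    proof -
      have T: "T (trunc K c) j m = T c j m - T ?r j m" for m
      proof -
        have "T c j m = infsum (\<lambda>n. trunc K c n * X j n + ?r n * X j n) (coset j m)"
          unfolding T_def by (intro infsum_cong) (simp add: trunc_def)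
        also have "\<dots> = T (trunc K c) j m + T ?r j m"
          unfolding T_def by (intro infsum_add sq_summable_mult_summable sq_summable_trunc c sq_summable_X)
        finally show ?thesis by simp
      qed
      have "sqrt (energy (trunc K c) j) \<le> L2_set (\<lambda>m. cmod (T c j m) + cmod (T ?r j m)) (S j)"
        unfolding sq T by (intro L2_set_mono norm_triangle_ineq4) auto
      also have "\<dots> \<le> sqrt (energy c j) + sqrt (energy ?r j)"
        unfolding sq by (rule L2_set_triangle_ineq)
      also have "\<dots> \<le> sqrt l + sqrt (?E - sum ?a K)"
        using l(2)[of j] energy_le[OF sq_summable_trunc[OF c], of "-K" j] r by (intro add_mono real_sqrt_le_mono) auto
      finally show ?thesis .
    qed
    moreover have "(\<lambda>j. sqrt (energy (trunc K c) j)) \<longlonglongrightarrow> sqrt (sum ?a K)"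
      by (intro tendsto_intros energy_trunc_tendsto K)
    ultimately show ?thesis by (meson LIMSEQ_le_const2)
  qed
  have "(sum ?a \<longlongrightarrow> ?E) ?F" by (rule infsum_tendsto[OF a])
  then have "((\<lambda>K. sqrt l + sqrt (?E - sum ?a K) - sqrt (sum ?a K)) \<longlongrightarrow> sqrt l + sqrt (?E - ?E) - sqrt ?E) ?F"
    by (intro tendsto_intros)
  then have "0 \<le> sqrt l + sqrt (?E - ?E) - sqrt ?E"
    by (rule tendsto_lowerbound) (auto intro!: eventually_finite_subsets_at_top_weakI low)
  then have "?E \<le> l" by simp
  then show ?thesis using l lE by simp
qed

theorem parseval_frame_Psi:
  assumes R: "\<And>j. coset_reps (matpow A j) (R j)"
  shows "parseval_frame (Psi_index R) (Psi_family A \<phi> \<psi>)"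
  unfolding parseval_frame_def
proof (intro conjI ballI)
  fix i assume "i \<in> Psi_index R"
  then show "Psi_family A \<phi> \<psi> i \<in> L2T"
    using phi_L2T L2T_shift[OF psi_L2T, of _ "- (matrix_inv (rmatpow A _) *v rvec _)"]
    by (auto simp: Psi_index_def)
next
  fix f assume f: "f \<in> (L2T :: (real^'a \<Rightarrow> complex) set)"
  let ?c = "fcoeff f"
  let ?g = "\<lambda>i. (cmod (innerT f (Psi_family A \<phi> \<psi> i)))\<^sup>2"
  let ?q = "\<lambda>j. \<Sum>m\<in>S j. (cmod (detail ?c j m))\<^sup>2"
  have c: "sq_summable ?c" using f by (intro sq_summable_fcoeff) (simp add: L2T_sq_integrable)
  have E: "infsum (\<lambda>n. (cmod (?c n))\<^sup>2) UNIV = (normT f)\<^sup>2"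
    using parseval f by (intro infsumI) (auto simp: L2T_sq_integrable)
  have "(\<Sum>i<n. ?q i) = energy ?c n - energy ?c 0" for n
    by (induction n) (simp_all add: energy_Suc[OF c])
  then have "?q sums ((normT f)\<^sup>2 - energy ?c 0)"
    unfolding sums_def using tendsto_diff[OF energy_tendsto[OF c] tendsto_const] by (simp add: E)
  \<comment> \<open>Nonnegativity turns the ordered limit of the telescoping sums into an unordered
    sum, the notion used in \<open>parseval_frame\<close>.\<close>
  then have q: "(?q has_sum ((normT f)\<^sup>2 - energy ?c 0)) UNIV"
    by (rule sums_nonneg_imp_has_sum) (simp add: sum_nonneg)
  have i: "((\<lambda>k. ?g (Some (j, k))) has_sum ?q j) (R j)" for j
    using psi_energy[OF f R[of j]] has_sum_finite[OF card_reps(1)[OF R[of j]], of "\<lambda>k. ?g (Some (j, k))"] by simp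
  have "((\<lambda>p. ?g (Some p)) has_sum ((normT f)\<^sup>2 - energy ?c 0)) (SIGMA j:UNIV. R j)"
  proof (rule has_sum_SigmaI[OF _ q])
    show "(\<lambda>p. ?g (Some p)) summable_on (SIGMA j:UNIV. R j)"
      by (rule summable_on_SigmaI[where g = ?q]) (use i has_sum_imp_summable[OF q] in auto)
  qed (rule i)
  then have "(?g has_sum ((normT f)\<^sup>2 - energy ?c 0)) (Some ` (SIGMA j:UNIV. R j))"
    by (subst has_sum_reindex) (auto simp: comp_def)
  moreover have "(?g has_sum energy ?c 0) {None}"
    using has_sum_finite[of "{None}" ?g] energy_0[OF f] by simp
  ultimately have "(?g has_sum (energy ?c 0 + ((normT f)\<^sup>2 - energy ?c 0))) ({None} \<union> Some ` (SIGMA j:UNIV. R j))"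
    by (intro has_sum_Un_disjoint) auto
  then show "(?g has_sum (normT f)\<^sup>2) (Psi_index R)" by (simp add: Psi_index_def)
qed

end

section \<open>Lattice sums and integrals\<close>

definition vfloor :: "real^'d \<Rightarrow> int^'d" where
  "vfloor x = (\<chi> i. \<lfloor>x $ i\<rfloor>)"

lemma vfloor_vimage: "vfloor -` {k} = {x. \<forall>i. real_of_int (k $ i) \<le> x $ i \<and> x $ i < real_of_int (k $ i) + 1}"
  by (auto simp: vfloor_def vec_eq_iff floor_eq_iff)

lemma vfloor_vimage_sets: "vfloor -` {k} \<in> sets (borel :: (real^'d) measure)"
  unfolding vfloor_vimage by measurable

lemma measurable_vfloor: "vfloor \<in> borel \<rightarrow>\<^sub>M count_space (UNIV :: (int^'d) set)"
  by (subst measurable_count_space_eq_countable) (auto simp: vfloor_vimage_sets)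

lemma emeasure_vfloor_vimage: "emeasure lborel (vfloor -` {k :: int^'d}) = 1"
proof -
  let ?a = "rvec k" and ?b = "rvec k + 1"
  have sub: "box ?a ?b \<subseteq> vfloor -` {k}" "vfloor -` {k} \<subseteq> cbox ?a ?b"
    unfolding vfloor_vimage by (auto simp: mem_box_cart rvec_def less_imp_le)
  have le: "\<And>b. b \<in> Basis \<Longrightarrow> ?a \<bullet> b \<le> ?b \<bullet> b"
    by (auto simp: Basis_vec_def inner_axis)
  have p: "(\<Prod>b\<in>Basis. (?b - ?a) \<bullet> b) = 1"
  proof -
    have "\<And>b :: real^'d. b \<in> Basis \<Longrightarrow> (?b - ?a) \<bullet> b = 1" by (auto simp: Basis_vec_def inner_axis)
    then show ?thesis by (intro prod.neutral) blast
  qed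
  have 1: "emeasure lborel (box ?a ?b) = 1" by (subst emeasure_lborel_box[OF le]) (assumption | simp only: p ennreal_1)+
  have 2: "emeasure lborel (cbox ?a ?b) = 1" by (subst emeasure_lborel_cbox[OF le]) (assumption | simp only: p ennreal_1)+
  show ?thesis
  proof (rule antisym)
    show "emeasure lborel (vfloor -` {k}) \<le> 1" using emeasure_mono[OF sub(2), of lborel] 2 by simp
    show "1 \<le> emeasure lborel (vfloor -` {k})"
      using emeasure_mono[OF sub(1), of lborel] 1 vfloor_vimage_sets[of k] by simp
  qed
qed

text \<open>Each unit cell has volume 1, so Lebesgue measure is pushed forward to counting measure.
  Lattice sums become integrals of step functions, to which dominated convergence applies.\<close>

lemma distr_vfloor: "distr lborel (count_space UNIV) vfloor = (count_space UNIV :: (int^'d) measure)"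
proof (rule measure_eqI_countable[of _ UNIV])
  fix k :: "int^'d"
  show "emeasure (distr lborel (count_space UNIV) vfloor) {k} = emeasure (count_space UNIV) {k}"
    by (subst emeasure_distr) (auto simp: measurable_vfloor emeasure_vfloor_vimage)
qed auto

lemma lattice_sum:
  fixes G :: "int^'d \<Rightarrow> real"
  assumes "integrable lborel (\<lambda>x. G (vfloor x))"
  shows "(\<lambda>k. norm (G k)) summable_on UNIV" and "(G has_sum integral\<^sup>L lborel (\<lambda>x. G (vfloor x))) UNIV"
proof -
  have m: "vfloor \<in> (lborel :: (real^'d) measure) \<rightarrow>\<^sub>M count_space UNIV" using measurable_vfloor by simp
  have "integrable (distr lborel (count_space UNIV) vfloor) G"
    using assms by (subst integrable_distr_eq[OF m]) auto
  then have i: "integrable (count_space UNIV) G" by (simp add: distr_vfloor)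
  then have sa: "Infinite_Set_Sum.abs_summable_on G UNIV" by (simp add: Infinite_Set_Sum.abs_summable_on_def)
  from sa show s: "(\<lambda>k. norm (G k)) summable_on UNIV" by (simp only: abs_summable_equivalent)
  have "integral\<^sup>L lborel (\<lambda>x. G (vfloor x)) = integral\<^sup>L (distr lborel (count_space UNIV) vfloor) G"
    by (rule integral_distr[OF m, symmetric]) auto
  also have "\<dots> = infsetsum G UNIV" by (simp add: distr_vfloor infsetsum_def)
  also have "\<dots> = infsum G UNIV" by (rule infsetsum_infsum[OF sa])
  finally show "(G has_sum integral\<^sup>L lborel (\<lambda>x. G (vfloor x))) UNIV"
    using has_sum_infsum[OF abs_summable_summable[OF s]] by simp
qed

lemma lborel_scale:
  fixes f :: "real^'d \<Rightarrow> real"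
  assumes c: "c > 0" and f: "f \<in> borel_measurable borel"
  shows "integral\<^sup>L lborel f = c ^ CARD('d) * integral\<^sup>L lborel (\<lambda>x. f (c *\<^sub>R x))"
    and "integrable lborel f \<longleftrightarrow> integrable lborel (\<lambda>x. f (c *\<^sub>R x))"
proof -
  have l: "(lborel :: (real^'d) measure) = density (distr lborel borel (\<lambda>x. 0 + c *\<^sub>R x)) (\<lambda>_. \<bar>c\<bar> ^ DIM(real^'d))"
    using c by (intro lborel_affine) auto
  have "integral\<^sup>L lborel f = integral\<^sup>L (density (distr lborel borel (\<lambda>x. c *\<^sub>R x)) (\<lambda>_. ennreal (c ^ CARD('d)))) f"
    by (subst l) (use c in simp)
  also have "\<dots> = c ^ CARD('d) * integral\<^sup>L lborel (\<lambda>x. f (c *\<^sub>R x))"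
    using f c by (simp add: integral_density integral_distr)
  finally show "integral\<^sup>L lborel f = c ^ CARD('d) * integral\<^sup>L lborel (\<lambda>x. f (c *\<^sub>R x))" .
  have "integrable lborel f \<longleftrightarrow> integrable (density (distr lborel borel (\<lambda>x. c *\<^sub>R x)) (\<lambda>_. ennreal (c ^ CARD('d)))) f"
    by (subst l) (use c in simp)
  also have "\<dots> \<longleftrightarrow> integrable lborel (\<lambda>x. f (c *\<^sub>R x))"
    using f c by (simp add: integrable_density integrable_distr_eq)
  finally show "integrable lborel f \<longleftrightarrow> integrable lborel (\<lambda>x. f (c *\<^sub>R x))" .
qed

text \<open>The norm dominates the mean of the absolute values of the coordinates, whence the rate
  c/d; the resulting bound is a product of one-dimensional integrals.\<close>

lemma integrable_exp_norm:
  assumes c: "c > 0" shows "integrable lborel (\<lambda>x :: real^'d. exp (- (c * norm x)))"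
proof -
  let ?d = "real CARD('d)"
  let ?f = "\<lambda>t :: real. exp (- (c / ?d) * \<bar>t\<bar>)"
  have "(\<integral>\<^sup>+t. ennreal (?f t) \<partial>lborel) < \<infinity>"
  proof -
    let ?b = "c / ?d"
    let ?g = "\<lambda>t. ennreal (exp (- ?b * t)) * indicator {0..} t"
    have b: "?b > 0" using c by simp
    have F: "(\<integral>\<^sup>+t. ?g t \<partial>lborel) = ennreal (0 - (- 1 / ?b * exp (- ?b * 0)))"
    proof (rule nn_integral_FTC_atLeast)
      fix t :: real
      show "DERIV (\<lambda>t. - 1 / ?b * exp (- ?b * t)) t :> exp (- ?b * t)"
        using b by (auto intro!: derivative_eq_intros simp: field_simps)
      have "filterlim (\<lambda>t :: real. ?b * t) at_top at_top" by (rule filterlim_tendsto_pos_mult_at_top[OF tendsto_const b filterlim_ident])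
      then have "((\<lambda>t. exp (- (?b * t))) \<longlongrightarrow> 0) at_top"
        by (intro filterlim_compose[OF exp_at_bot] filterlim_uminus_at_bot_at_top[THEN filterlim_compose])
      then have "((\<lambda>t. - 1 / ?b * exp (- (?b * t))) \<longlongrightarrow> - 1 / ?b * 0) at_top" by (intro tendsto_mult tendsto_const)
      then show "((\<lambda>t. - 1 / ?b * exp (- ?b * t)) \<longlongrightarrow> 0) at_top" by simp
    qed auto
    have "(\<integral>\<^sup>+t. ennreal (?f t) \<partial>lborel) \<le> (\<integral>\<^sup>+t. ?g t + ?g (- t) \<partial>lborel)"
      by (intro nn_integral_mono) (auto simp: indicator_def abs_if)
    also have "\<dots> = (\<integral>\<^sup>+t. ?g t \<partial>lborel) + (\<integral>\<^sup>+t. ?g (- t) \<partial>lborel)"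
      by (intro nn_integral_add) auto
    also have "(\<integral>\<^sup>+t. ?g (- t) \<partial>lborel) = (\<integral>\<^sup>+t. ?g t \<partial>lborel)"
      using nn_integral_real_affine[of ?g "-1" 0] by simp
    also have "(\<integral>\<^sup>+t. ?g t \<partial>lborel) + (\<integral>\<^sup>+t. ?g t \<partial>lborel) < \<infinity>" unfolding F by simp
    finally show ?thesis .
  qed
  then have fin: "(\<Prod>b\<in>(Basis :: (real^'d) set). (\<integral>\<^sup>+t. ennreal (?f t) \<partial>lborel)) < \<infinity>"
    by (simp add: power_less_top_ennreal)
  have E: "exp (- (c * norm x)) \<le> (\<Prod>b\<in>Basis. ?f (x \<bullet> b))" for x :: "real^'d"
  proof -
    have "(\<Sum>b\<in>Basis. \<bar>x \<bullet> b\<bar>) \<le> (\<Sum>b\<in>(Basis :: (real^'d) set). norm x)"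
      by (intro sum_mono Basis_le_norm)
    then have "(c / ?d) * (\<Sum>b\<in>Basis. \<bar>x \<bullet> b\<bar>) \<le> (c / ?d) * (?d * norm x)" using c by (intro mult_left_mono) auto
    then have "- (c * norm x) \<le> (\<Sum>b\<in>Basis. - (c / ?d) * \<bar>x \<bullet> b\<bar>)" by (simp add: sum_negf sum_distrib_left)
    then show ?thesis by (simp only: exp_sum[OF finite_Basis, symmetric] exp_le_cancel_iff)
  qed
  have "(\<integral>\<^sup>+x. ennreal (exp (- (c * norm (x :: real^'d)))) \<partial>lborel) \<le> (\<integral>\<^sup>+x. (\<Prod>b\<in>Basis. ennreal (?f ((x :: real^'d) \<bullet> b))) \<partial>lborel)"
  proof (rule nn_integral_mono)
    fix x :: "real^'d"
    have "ennreal (\<Prod>b\<in>Basis. ?f (x \<bullet> b)) = (\<Prod>b\<in>Basis. ennreal (?f (x \<bullet> b)))"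
      by (rule prod_ennreal[symmetric]) simp
    then show "ennreal (exp (- (c * norm x))) \<le> (\<Prod>b\<in>Basis. ennreal (?f (x \<bullet> b)))"
      using ennreal_leI[OF E[of x]] by (simp only:)
  qed
  also have "\<dots> = (\<Prod>b\<in>(Basis :: (real^'d) set). (\<integral>\<^sup>+t. ennreal (?f t) \<partial>lborel))"
    by (rule nn_integral_lborel_prod) auto
  finally show ?thesis using fin by (intro integrableI_bounded) auto
qed

text \<open>A single term of the exponential series bounds x^p by a multiple of exp (c x / 2), so
  half of the rate pays for the polynomial.\<close>

lemma poly_exp_bound:
  assumes c: "c > 0" shows "\<exists>C\<ge>0. \<forall>x\<ge>0. x ^ p * exp (- (c * x)) \<le> C * exp (- (c / 2 * x :: real))"
proof -
  have "x ^ p * exp (- (c * x)) \<le> (fact p * (2 / c) ^ p) * exp (- (c / 2 * x))" if x: "x \<ge> 0" for x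
  proof -
    have "(\<Sum>n\<in>{p}. (c / 2 * x) ^ n /\<^sub>R fact n) \<le> (\<Sum>n. (c / 2 * x) ^ n /\<^sub>R fact n)"
      by (rule sum_le_suminf[OF summable_exp_generic]) (use x c in auto)
    then have "(c / 2 * x) ^ p /\<^sub>R fact p \<le> exp (c / 2 * x)" by (simp only: exp_def sum.insert sum.empty finite.intros empty_iff simp_thms add_0_right)
    then have "inverse (fact p) * ((c / 2) ^ p * x ^ p) \<le> exp (c / 2 * x)" by (simp only: real_scaleR_def power_mult_distrib)
    then have "(fact p * (2 / c) ^ p) * (inverse (fact p) * ((c / 2) ^ p * x ^ p)) \<le> (fact p * (2 / c) ^ p) * exp (c / 2 * x)"
      using c by (intro mult_left_mono) auto
    moreover have "(fact p * (2 / c) ^ p) * (inverse (fact p) * ((c / 2) ^ p * x ^ p)) = (fact p * inverse (fact p)) * ((2 / c * (c / 2)) ^ p * x ^ p)"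
      by (simp only: power_mult_distrib mult_ac)
    ultimately have "x ^ p \<le> fact p * (2 / c) ^ p * exp (c / 2 * x)"
      using c by simp
    then have "x ^ p * exp (- (c * x)) \<le> fact p * (2 / c) ^ p * exp (c / 2 * x) * exp (- (c * x))"
      by (intro mult_right_mono) auto
    also have "\<dots> = (fact p * (2 / c) ^ p) * exp (- (c / 2 * x))"
      by (simp add: mult.assoc flip: exp_add)
    finally show ?thesis .
  qed
  then show ?thesis using c by (intro exI[of _ "fact p * (2 / c) ^ p"]) auto
qed

lemma norm_vfloor_scaled:
  fixes y :: "real^'d"
  assumes s: "s > 0" shows "norm (s *\<^sub>R rvec (vfloor ((1 / s) *\<^sub>R y)) - y) \<le> s * real CARD('d)"
proof -
  have "\<bar>(s *\<^sub>R rvec (vfloor ((1 / s) *\<^sub>R y)) - y) $ i\<bar> \<le> s" for i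
  proof -
    have "\<bar>real_of_int \<lfloor>y $ i / s\<rfloor> - y $ i / s\<bar> \<le> 1" by linarith
    then have "s * \<bar>real_of_int \<lfloor>y $ i / s\<rfloor> - y $ i / s\<bar> \<le> s * 1" using s by (intro mult_left_mono) auto
    moreover have "s * \<bar>real_of_int \<lfloor>y $ i / s\<rfloor> - y $ i / s\<bar> = \<bar>s * real_of_int \<lfloor>y $ i / s\<rfloor> - y $ i\<bar>"
    proof -
      have "s * (real_of_int \<lfloor>y $ i / s\<rfloor> - y $ i / s) = s * real_of_int \<lfloor>y $ i / s\<rfloor> - y $ i"
        using s by (simp add: field_simps)
      moreover have "s * \<bar>real_of_int \<lfloor>y $ i / s\<rfloor> - y $ i / s\<bar> = \<bar>s * (real_of_int \<lfloor>y $ i / s\<rfloor> - y $ i / s)\<bar>"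
        using s by (simp only: abs_mult abs_of_pos)
      ultimately show ?thesis by simp
    qed
    ultimately show ?thesis by (simp add: rvec_def vfloor_def)
  qed
  then have "(\<Sum>i\<in>UNIV. \<bar>(s *\<^sub>R rvec (vfloor ((1 / s) *\<^sub>R y)) - y) $ i\<bar>) \<le> (\<Sum>i\<in>(UNIV :: 'd set). s)" by (intro sum_mono)
  then show ?thesis using norm_le_l1_cart[of "s *\<^sub>R rvec (vfloor ((1 / s) *\<^sub>R y)) - y"] by (simp add: mult.commute)
qed

lemma vfloor_scaled_tendsto:
  fixes y :: "real^'d"
  assumes "\<And>n. s n > 0" "s \<longlonglongrightarrow> 0"
  shows "(\<lambda>n. s n *\<^sub>R rvec (vfloor ((1 / s n) *\<^sub>R y))) \<longlonglongrightarrow> y"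
proof -
  have "(\<lambda>n. s n * real CARD('d)) \<longlonglongrightarrow> 0" using tendsto_mult_left_zero[OF assms(2)] by simp
  then have "(\<lambda>n. s n *\<^sub>R rvec (vfloor ((1 / s n) *\<^sub>R y)) - y) \<longlonglongrightarrow> 0"
    by (rule Lim_null_comparison[rotated]) (simp add: norm_vfloor_scaled assms(1))
  then show ?thesis by (simp add: LIM_zero_iff)
qed

text \<open>s^d times the lattice sum is the integral of y \<mapsto> G n (vfloor (y / s)). The
  rescaled lattice point attached to y stays within M d of y, so the exponential bound in the
  lattice variable becomes an integrable bound in y, uniform in n.\<close>

theorem riemann_sum_limit:
  fixes G :: "nat \<Rightarrow> int^'d \<Rightarrow> real"
  assumes s: "\<And>n. s n > 0" "\<And>n. s n \<le> M" and c: "c > 0"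
    and bound: "\<And>n k. \<bar>G n k\<bar> \<le> C * exp (- (c * norm (s n *\<^sub>R rvec k)))"
    and g: "g \<in> borel_measurable borel"
    and lim: "AE y in lborel. (\<lambda>n. G n (vfloor ((1 / s n) *\<^sub>R y))) \<longlonglongrightarrow> g y"
  shows "\<And>n. (\<lambda>k. norm (G n k)) summable_on UNIV"
    and "(\<lambda>n. s n ^ CARD('d) * infsum (G n) UNIV) \<longlonglongrightarrow> integral\<^sup>L lborel g"
    and "integrable lborel g"
proof -
  let ?w = "\<lambda>y :: real^'d. C * exp (c * (M * real CARD('d))) * exp (- (c * norm y))"
  have m: "(\<lambda>y :: real^'d. G n (vfloor (a *\<^sub>R y))) \<in> borel_measurable borel" for n a
  proof -
    have "(\<lambda>y :: real^'d. a *\<^sub>R y) \<in> borel_measurable borel" by simp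
    then have "(\<lambda>y :: real^'d. vfloor (a *\<^sub>R y)) \<in> borel \<rightarrow>\<^sub>M count_space UNIV"
      using measurable_vfloor by (rule measurable_compose)
    then show ?thesis by (rule measurable_compose) simp
  qed
  have C: "C \<ge> 0" using bound[of 0 0] abs_ge_zero order_trans by fastforce
  have wi: "integrable lborel ?w" by (intro integrable_mult_right integrable_exp_norm c)
  have b: "\<bar>G n (vfloor ((1 / s n) *\<^sub>R y))\<bar> \<le> ?w y" for n y
  proof -
    let ?p = "s n *\<^sub>R rvec (vfloor ((1 / s n) *\<^sub>R y))"
    have "norm y \<le> norm ?p + norm (?p - y)" using norm_triangle_ineq4[of ?p "?p - y"] by simp
    also have "\<dots> \<le> norm ?p + M * real CARD('d)"
      using norm_vfloor_scaled[OF s(1)[of n], of y] mult_right_mono[OF s(2)[of n] of_nat_0_le_iff, of "CARD('d)"] by linarith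
    finally have "c * norm y \<le> c * (norm ?p + M * real CARD('d))" using c by (intro mult_left_mono) auto
    then have "exp (- (c * norm ?p)) \<le> exp (c * (M * real CARD('d))) * exp (- (c * norm y))"
      by (simp add: algebra_simps flip: exp_add)
    then have "C * exp (- (c * norm ?p)) \<le> C * (exp (c * (M * real CARD('d))) * exp (- (c * norm y)))"
      using C by (intro mult_left_mono) auto
    then show ?thesis using bound[of n "vfloor ((1 / s n) *\<^sub>R y)"] by (simp add: mult.assoc)
  qed
  have Gi: "integrable lborel (\<lambda>y. G n (vfloor ((1 / s n) *\<^sub>R y)))" for n
    by (rule Bochner_Integration.integrable_bound[OF wi]) (use m AE_I2[of lborel "\<lambda>y. norm (G n (vfloor ((1 / s n) *\<^sub>R y))) \<le> norm (?w y)"] order_trans[OF b abs_ge_self] in simp_all)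
  have m1: "(\<lambda>y :: real^'d. G n (vfloor y)) \<in> borel_measurable borel" for n
    using m[of n 1] by (simp only: scaleR_one)
  have sp: "1 / s n > 0" for n using s(1)[of n] by simp
  have Gi': "integrable lborel (\<lambda>y. G n (vfloor y))" for n
    using Gi[of n] lborel_scale(2)[OF sp m1, of n n] by blast
  show "(\<lambda>k. norm (G n k)) summable_on UNIV" for n by (rule lattice_sum(1)[OF Gi'])
  have e: "s n ^ CARD('d) * infsum (G n) UNIV = integral\<^sup>L lborel (\<lambda>y. G n (vfloor ((1 / s n) *\<^sub>R y)))" for n
  proof -
    have "infsum (G n) UNIV = integral\<^sup>L lborel (\<lambda>x. G n (vfloor x))" by (rule infsumI[OF lattice_sum(2)[OF Gi']])
    also have "\<dots> = (1 / s n) ^ CARD('d) * integral\<^sup>L lborel (\<lambda>y. G n (vfloor ((1 / s n) *\<^sub>R y)))"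
      by (rule lborel_scale(1)[OF sp m1])
    finally show ?thesis using s(1)[of n] by (simp add: power_divide)
  qed
  show "(\<lambda>n. s n ^ CARD('d) * infsum (G n) UNIV) \<longlonglongrightarrow> integral\<^sup>L lborel g"
    unfolding e
    by (rule integral_dominated_convergence[where w = ?w]) (use g m b wi lim in auto)
  show "integrable lborel g"
    by (rule integrable_dominated_convergence[where w = ?w and s = "\<lambda>n y. G n (vfloor ((1 / s n) *\<^sub>R y))"]) (use g m b wi lim in auto)
qed

section \<open>Gaussian moments\<close>

text \<open>The increment \<open>\<delta> n\<close> may be 0 for some n, so the difference quotient
  of exp is continued by its limit 1 and used through continuity at 0.\<close>

lemma exp_quotient_tendsto:
  fixes \<delta> s :: "nat \<Rightarrow> real"
  assumes "(\<lambda>n. \<delta> n / s n) \<longlonglongrightarrow> \<beta>" "s \<longlonglongrightarrow> 0" "\<And>n. s n \<noteq> 0"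
  shows "(\<lambda>n. (exp (\<delta> n) - 1) / s n) \<longlonglongrightarrow> \<beta>"
proof -
  define E where "E x = (if x = 0 then 1 else (exp x - 1) / x)" for x :: real
  have "((\<lambda>h. (exp (0 + h) - exp 0) / h) \<longlongrightarrow> exp 0) (at (0::real))"
    using DERIV_exp[of "0::real"] unfolding DERIV_def .
  then have "((\<lambda>h. (exp h - 1) / h) \<longlongrightarrow> 1) (at (0::real))" by simp
  then have "(E \<longlongrightarrow> 1) (at 0)"
    by (rule Lim_transform_eventually) (auto simp: E_def eventually_at_filter)
  then have E: "(E \<longlongrightarrow> E 0) (at 0)" by (simp add: E_def)
  have "(\<lambda>n. \<delta> n / s n * s n) \<longlonglongrightarrow> \<beta> * 0" by (intro tendsto_mult assms)
  then have d: "\<delta> \<longlonglongrightarrow> 0" using assms(3) by simp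
  have "(\<lambda>n. E (\<delta> n)) \<longlonglongrightarrow> E 0" using isCont_tendsto_compose[of 0 E] E d by (simp add: isCont_def)
  then have "(\<lambda>n. E (\<delta> n) * (\<delta> n / s n)) \<longlonglongrightarrow> 1 * \<beta>" by (intro tendsto_mult assms(1)) (simp add: E_def)
  moreover have "E (\<delta> n) * (\<delta> n / s n) = (exp (\<delta> n) - 1) / s n" for n by (simp add: E_def)
  ultimately show ?thesis by (simp only: mult_1)
qed

section \<open>Norm-preserving symmetries of Lebesgue measure\<close>

definition preserving :: "(real^'d \<Rightarrow> real^'d) \<Rightarrow> bool" where
  "preserving T \<longleftrightarrow> T \<in> borel_measurable borel \<and> distr lborel borel T = lborel \<and> (\<forall>x. norm (T x) = norm x)"

lemma integral_preserving:
  fixes f :: "real^'d \<Rightarrow> real"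
  assumes T: "preserving T" and f: "f \<in> borel_measurable borel"
  shows "integral\<^sup>L lborel (\<lambda>x. f (T x)) = integral\<^sup>L lborel f"
proof -
  have mT: "T \<in> lborel \<rightarrow>\<^sub>M borel" and d: "distr lborel borel T = lborel" using T by (auto simp: preserving_def)
  show ?thesis using integral_distr[OF mT f] by (simp add: d)
qed

definition vflip :: "'d \<Rightarrow> real^'d \<Rightarrow> real^'d" where
  "vflip i x = (\<chi> k. if k = i then - x $ k else x $ k)"

definition vswap :: "'d \<Rightarrow> 'd \<Rightarrow> real^'d \<Rightarrow> real^'d" where
  "vswap i j x = (\<chi> k. x $ Transposition.transpose i j k)"

lemma preserving_vflip: "preserving (vflip i)"
proof -
  let ?c = "\<lambda>b :: real^'a. if b = axis i 1 then -1 else 1 :: real"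
  have T: "(\<lambda>x :: real^'a. 0 + (\<Sum>b\<in>Basis. (?c b * (x \<bullet> b)) *\<^sub>R b)) = vflip i"
  proof (rule ext, subst vec_eq_iff, rule allI)
    fix x :: "real^'a" and k
    have b: "axis k 1 \<in> (Basis :: (real^'a) set)" by (auto simp: Basis_vec_def)
    have "(0 + (\<Sum>b\<in>Basis. (?c b * (x \<bullet> b)) *\<^sub>R b)) $ k = (\<Sum>b\<in>Basis. (?c b * (x \<bullet> b)) *\<^sub>R b) \<bullet> axis k 1"
      by (simp add: inner_axis)
    also have "\<dots> = ?c (axis k 1) * (x \<bullet> axis k 1)" using b by (simp only: inner_sum_left_Basis)
    finally show "(0 + (\<Sum>b\<in>Basis. (?c b * (x \<bullet> b)) *\<^sub>R b)) $ k = vflip i x $ k"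
      by (simp add: vflip_def inner_axis axis_eq_axis)
  qed
  have "(lborel :: (real^'a) measure) = density (distr lborel borel (vflip i)) (\<lambda>_. (\<Prod>b\<in>Basis. \<bar>?c b\<bar>))"
    unfolding T[symmetric] by (rule lborel_affine_euclidean) auto
  also have "(\<Prod>b\<in>(Basis :: (real^'a) set). \<bar>?c b\<bar>) = 1" by (intro prod.neutral) auto
  finally have "distr lborel borel (vflip i) = lborel" by (simp add: density_1)
  moreover have "vflip i \<in> borel_measurable borel"
    unfolding T[symmetric] by measurable
  moreover have "norm (vflip i x) = norm x" for x
    unfolding norm_vec_def by (rule arg_cong[of _ _ "\<lambda>f. L2_set f UNIV"]) (auto simp: vflip_def)
  ultimately show ?thesis by (simp add: preserving_def)
qed

lemma prod_Basis_cart: "(\<Prod>b\<in>Basis. x \<bullet> b) = (\<Prod>i\<in>UNIV. x $ i)" for x :: "real^'d"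
proof -
  have B: "(Basis :: (real^'d) set) = (\<lambda>i. axis i 1) ` UNIV" by (auto simp: Basis_vec_def)
  have inj: "inj (\<lambda>i :: 'd. axis i (1 :: real))" by (simp add: inj_def axis_eq_axis)
  show ?thesis unfolding B prod.reindex[OF inj] by (simp only: comp_def cart_eq_inner_axis)
qed

lemma preserving_vswap: "preserving (vswap i j)"
proof -
  let ?t = "Transposition.transpose i j"
  have cont: "continuous_on UNIV (vswap i j)" unfolding vswap_def by (intro continuous_intros)
  have m: "vswap i j \<in> borel_measurable borel" using cont by (rule borel_measurable_continuous_onI)
  have inv: "(\<forall>k. P (?t k)) \<longleftrightarrow> (\<forall>k. P k)" for P by (metis transpose_involutory)
  have pr: "(\<Prod>k\<in>UNIV. g (?t k)) = (\<Prod>k\<in>UNIV. g k)" for g :: "'a \<Rightarrow> real"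
    by (rule prod.reindex_bij_betw) (simp add: bij_swap_iff bij_transpose)
  have su: "(\<Sum>k\<in>UNIV. g (?t k)) = (\<Sum>k\<in>UNIV. g k)" for g :: "'a \<Rightarrow> real"
    by (rule sum.reindex_bij_betw) (simp add: bij_swap_iff bij_transpose)
  have "distr lborel borel (vswap i j) = lborel"
  proof (rule lborel_eqI[symmetric])
    fix l u :: "real^'a" assume lu: "\<And>b. b \<in> Basis \<Longrightarrow> l \<bullet> b \<le> u \<bullet> b"
    have ax: "axis k 1 \<in> (Basis :: (real^'a) set)" for k by (auto simp: Basis_vec_def)
    have "l $ k \<le> u $ k" for k using lu[OF ax, of k] by (simp add: inner_axis)
    then have lu': "\<And>b. b \<in> Basis \<Longrightarrow> vswap i j l \<bullet> b \<le> vswap i j u \<bullet> b"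
      by (auto simp: Basis_vec_def inner_axis vswap_def)
    have "vswap i j -` box l u = box (vswap i j l) (vswap i j u)"
    proof (rule set_eqI)
      fix x
      have "x \<in> vswap i j -` box l u \<longleftrightarrow> (\<forall>k. l $ k < x $ ?t k \<and> x $ ?t k < u $ k)"
        by (simp add: mem_box_cart vswap_def)
      also have "\<dots> \<longleftrightarrow> (\<forall>k. l $ ?t k < x $ ?t (?t k) \<and> x $ ?t (?t k) < u $ ?t k)"
        by (rule inv[of "\<lambda>k. l $ k < x $ ?t k \<and> x $ ?t k < u $ k", symmetric])
      finally show "x \<in> vswap i j -` box l u \<longleftrightarrow> x \<in> box (vswap i j l) (vswap i j u)"
        by (simp add: mem_box_cart vswap_def)
    qed
    then have "emeasure (distr lborel borel (vswap i j)) (box l u) = emeasure lborel (box (vswap i j l) (vswap i j u))"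
      using m by (subst emeasure_distr) auto
    also have "\<dots> = ennreal (\<Prod>b\<in>Basis. (vswap i j u - vswap i j l) \<bullet> b)" by (rule emeasure_lborel_box[OF lu'])
    also have "(\<Prod>b\<in>Basis. (vswap i j u - vswap i j l) \<bullet> b) = (\<Prod>b\<in>Basis. (u - l) \<bullet> b)"
      unfolding prod_Basis_cart using pr[of "\<lambda>k. (u - l) $ k"] by (simp add: vswap_def)
    finally show "emeasure (distr lborel borel (vswap i j)) (box l u) = (\<Prod>b\<in>Basis. (u - l) \<bullet> b)" .
  qed simp
  moreover have "norm (vswap i j x) = norm x" for x
    unfolding norm_vec_def L2_set_def using su[of "\<lambda>k. (norm (x $ k))\<^sup>2"] by (simp add: vswap_def)
  ultimately show ?thesis using m by (simp add: preserving_def)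
qed

text \<open>The left side is a quadratic form in v with matrix \<open>?K\<close>. Changing the sign
  of one coordinate makes its mixed entries vanish, swapping two coordinates makes its diagonal
  entries equal, and its trace is the radial integral.\<close>

lemma isotropy:
  fixes w :: "real \<Rightarrow> real" and v :: "real^'d"
  assumes w: "w \<in> borel_measurable borel" and i: "integrable lborel (\<lambda>x :: real^'d. (norm x)\<^sup>2 * w (norm x))"
  shows "integral\<^sup>L lborel (\<lambda>x. (v \<bullet> x)\<^sup>2 * w (norm x))
     = (norm v)\<^sup>2 / real CARD('d) * integral\<^sup>L lborel (\<lambda>x :: real^'d. (norm x)\<^sup>2 * w (norm x))"
proof -
  let ?J = "\<lambda>u :: real^'d. integral\<^sup>L lborel (\<lambda>x. (u \<bullet> x)\<^sup>2 * w (norm x))"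
  note [measurable] = w
  have int: "integrable lborel (\<lambda>x. (u \<bullet> x)\<^sup>2 * w (norm x))" for u :: "real^'d"
  proof (rule Bochner_Integration.integrable_bound)
    show "integrable lborel (\<lambda>x :: real^'d. (norm u)\<^sup>2 * ((norm x)\<^sup>2 * w (norm x)))" using i by simp
    show "AE x in lborel. norm ((u \<bullet> x)\<^sup>2 * w (norm x)) \<le> norm ((norm u)\<^sup>2 * ((norm x)\<^sup>2 * w (norm x)))"
    proof (rule AE_I2)
      fix x
      have "\<bar>u \<bullet> x\<bar> \<le> norm u * norm x" by (rule Cauchy_Schwarz_ineq2)
      then have "(u \<bullet> x)\<^sup>2 \<le> (norm u * norm x)\<^sup>2" by (metis abs_ge_zero power2_abs power_mono)
      then have "(u \<bullet> x)\<^sup>2 * \<bar>w (norm x)\<bar> \<le> (norm u * norm x)\<^sup>2 * \<bar>w (norm x)\<bar>" by (intro mult_right_mono) auto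
      then show "norm ((u \<bullet> x)\<^sup>2 * w (norm x)) \<le> norm ((norm u)\<^sup>2 * ((norm x)\<^sup>2 * w (norm x)))"
        by (simp add: abs_mult power_mult_distrib mult.assoc)
    qed
  qed measurable
  let ?K = "\<lambda>i j. integral\<^sup>L lborel (\<lambda>x :: real^'d. x $ i * x $ j * w (norm x))"
  have ax: "(axis i 1 :: real^'d) \<bullet> x = x $ i" for i x by (simp add: inner_axis')
  have intK: "integrable lborel (\<lambda>x :: real^'d. x $ i * x $ j * w (norm x))" for i j
  proof -
    have "x $ i * x $ j * w (norm x) = ((axis i 1 + axis j 1) \<bullet> x)\<^sup>2 * w (norm x) * (1/2)
      - (axis i 1 \<bullet> x)\<^sup>2 * w (norm x) * (1/2) - (axis j 1 \<bullet> x)\<^sup>2 * w (norm x) * (1/2)" for x :: "real^'d"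
      unfolding inner_add_left ax by (simp add: power2_eq_square algebra_simps)
    then show ?thesis using int by simp
  qed
  have K0: "?K i j = 0" if "i \<noteq> j" for i j
  proof -
    have "?K i j = integral\<^sup>L lborel (\<lambda>x :: real^'d. vflip i x $ i * vflip i x $ j * w (norm (vflip i x)))"
      by (rule integral_preserving[OF preserving_vflip, symmetric]) measurable
    also have "\<dots> = integral\<^sup>L lborel (\<lambda>x :: real^'d. - (x $ i * x $ j * w (norm x)))"
      using that preserving_vflip[of i] by (intro Bochner_Integration.integral_cong refl) (simp add: vflip_def preserving_def)
    finally show ?thesis by simp
  qed
  have K1: "?K i i = ?K j j" for i j
  proof -
    have "?K i i = integral\<^sup>L lborel (\<lambda>x :: real^'d. vswap i j x $ i * vswap i j x $ i * w (norm (vswap i j x)))"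
      by (rule integral_preserving[OF preserving_vswap, symmetric]) measurable
    also have "\<dots> = ?K j j"
      using preserving_vswap[of i j] by (intro Bochner_Integration.integral_cong refl) (simp add: vswap_def preserving_def)
    finally show ?thesis .
  qed
  \<comment> \<open>The index is arbitrary; by \<open>K1\<close> all of them give the same
    value.\<close>
  define \<kappa> where "\<kappa> = ?K undefined undefined"
  have K: "?K i j = (if i = j then \<kappa> else 0)" for i j using K0 K1 unfolding \<kappa>_def by metis
  have "?J v = integral\<^sup>L lborel (\<lambda>x. \<Sum>i\<in>UNIV. \<Sum>j\<in>UNIV. (v $ i * v $ j) * (x $ i * x $ j * w (norm x)))"
  proof (intro Bochner_Integration.integral_cong refl)
    fix x :: "real^'d"
    show "(v \<bullet> x)\<^sup>2 * w (norm x) = (\<Sum>i\<in>UNIV. \<Sum>j\<in>UNIV. (v $ i * v $ j) * (x $ i * x $ j * w (norm x)))"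
      unfolding power2_eq_square inner_vec_def inner_real_def sum_product
      unfolding sum_distrib_right by (intro sum.cong refl) (simp add: mult_ac)
  qed
  also have "\<dots> = (\<Sum>i\<in>UNIV. \<Sum>j\<in>UNIV. (v $ i * v $ j) * ?K i j)" using intK by simp
  also have "\<dots> = (\<Sum>i\<in>UNIV. (v $ i)\<^sup>2 * \<kappa>)"
    unfolding K by (intro sum.cong refl) (simp add: if_distrib[of "\<lambda>a. _ * a"] power2_eq_square cong: if_cong)
  also have "\<dots> = (norm v)\<^sup>2 * \<kappa>"
  proof -
    have "(norm v)\<^sup>2 = (\<Sum>i\<in>UNIV. (v $ i)\<^sup>2)" by (simp add: norm_vec_def L2_set_def sum_nonneg)
    then show ?thesis by (simp only: sum_distrib_right)
  qed
  finally have 1: "?J v = (norm v)\<^sup>2 * \<kappa>" .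
  have "integral\<^sup>L lborel (\<lambda>x :: real^'d. (norm x)\<^sup>2 * w (norm x)) = integral\<^sup>L lborel (\<lambda>x :: real^'d. \<Sum>i\<in>UNIV. x $ i * x $ i * w (norm x))"
    by (intro Bochner_Integration.integral_cong refl)
      (simp add: power2_norm_eq_inner inner_vec_def flip: sum_distrib_right)
  also have "\<dots> = real CARD('d) * \<kappa>" using intK by (simp add: K)
  finally show ?thesis unfolding 1 by simp
qed

lemma integral_odd:
  fixes f :: "real^'d \<Rightarrow> real"
  assumes "f \<in> borel_measurable borel" "\<And>x. f (- x) = - f x" shows "integral\<^sup>L lborel f = 0"
proof -
  have "(lborel :: (real^'d) measure) = density (distr lborel borel (\<lambda>x. 0 + (-1) *\<^sub>R x)) (\<lambda>_. ennreal (\<bar>-1\<bar> ^ DIM(real^'d)))"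
    by (rule lborel_affine) simp
  then have d: "distr lborel borel (\<lambda>x :: real^'d. - x) = lborel" by (simp add: density_1)
  have "integral\<^sup>L (distr lborel borel (\<lambda>x :: real^'d. - x)) f = integral\<^sup>L lborel (\<lambda>x. f (- x))"
    by (rule integral_distr[OF _ assms(1)]) simp
  then show ?thesis unfolding d by (simp add: assms(2))
qed

text \<open>The exponent -2 arises from squaring a Gaussian profile. No closed value is computed:
  the limits contain only quotients, for which the recursion and positivity of the moment of order 0
  are enough.\<close>

definition gmoment :: "'d::finite itself \<Rightarrow> nat \<Rightarrow> real" where
  "gmoment _ p = integral\<^sup>L lborel (\<lambda>x :: real^'d. norm x ^ p * exp (- 2 * (norm x)\<^sup>2))"

lemma gauss_le_exp: "exp (- (x\<^sup>2)) \<le> exp (1/4) * exp (- x)" for x :: real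
proof -
  have "0 \<le> (x - 1/2)\<^sup>2" by simp
  then have "x - 1/4 \<le> x\<^sup>2" by (simp add: power2_eq_square algebra_simps)
  then show ?thesis by (simp flip: exp_add)
qed

lemma integrable_gauss:
  assumes "b \<ge> 1" shows "integrable lborel (\<lambda>x :: real^'d. norm x ^ p * exp (- b * (norm x)\<^sup>2))"
proof -
  obtain C where C: "C \<ge> 0" "\<And>x. x \<ge> 0 \<Longrightarrow> x ^ p * exp (- (1 * x)) \<le> C * exp (- (1 / 2 * x :: real))"
    using poly_exp_bound[of 1 p] by auto
  show ?thesis
  proof (rule Bochner_Integration.integrable_bound)
    show "integrable lborel (\<lambda>x :: real^'d. (exp (1/4) * C) * exp (- (1/2 * norm x)))"
      by (intro integrable_mult_right integrable_exp_norm) simp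
    show "AE x :: real^'d in lborel. norm (norm x ^ p * exp (- b * (norm x)\<^sup>2)) \<le> norm ((exp (1/4) * C) * exp (- (1/2 * norm x)))"
    proof (rule AE_I2)
      fix x :: "real^'d"
      have "exp (- b * (norm x)\<^sup>2) \<le> exp (- ((norm x)\<^sup>2))" using assms by (simp add: mult_right_le_one_le mult_le_cancel_right1)
      also have "\<dots> \<le> exp (1/4) * exp (- norm x)" by (rule gauss_le_exp)
      finally have "norm x ^ p * exp (- b * (norm x)\<^sup>2) \<le> norm x ^ p * (exp (1/4) * exp (- norm x))" by (intro mult_left_mono) auto
      also have "\<dots> = exp (1/4) * (norm x ^ p * exp (- (1 * norm x)))" by simp
      also have "\<dots> \<le> exp (1/4) * (C * exp (- (1 / 2 * norm x)))" by (intro mult_left_mono C) auto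
      finally show "norm (norm x ^ p * exp (- b * (norm x)\<^sup>2)) \<le> norm ((exp (1/4) * C) * exp (- (1/2 * norm x)))"
        using C by (simp add: abs_mult)
    qed
  qed measurable
qed

lemma gmoment_pos: "gmoment TYPE('d::finite) 0 > 0"
proof -
  have i: "integrable lborel (\<lambda>x :: real^'d. exp (- 2 * (norm x)\<^sup>2))" using integrable_gauss[of 2 0] by simp
  have "0 \<le> gmoment TYPE('d) 0" unfolding gmoment_def by (intro integral_nonneg_AE) auto
  moreover have "gmoment TYPE('d) 0 \<noteq> 0"
  proof
    assume "gmoment TYPE('d) 0 = 0"
    then have "AE x :: real^'d in lborel. exp (- 2 * (norm x)\<^sup>2) = (0::real)"
      using integral_nonneg_eq_0_iff_AE[OF i] by (simp add: gmoment_def)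
    then have "ae_filter (lborel :: (real^'d) measure) = bot" by (simp add: trivial_limit_def)
    then show False by (simp add: ae_filter_eq_bot_iff)
  qed
  ultimately show ?thesis by simp
qed

text \<open>By scaling, l^(d+p) times the integral of norm^p exp (-2 l^2 norm^2) does not depend on
  l. Differentiating at l = 1, along l = 1 + 1/(n+1), gives -4 times the moment of order p + 2 from
  the integral and -(d + p) times the moment of order p from the power of l.\<close>

lemma gmoment_recursion:
  "gmoment TYPE('d::finite) (p + 2) = (real CARD('d) + real p) / 4 * gmoment TYPE('d) p"
proof -
  let ?d = "CARD('d)"
  define l where "l n = 1 + 1 / real (Suc n)" for n
  let ?t = "\<lambda>n. 1 / real (Suc n)"
  have t0: "?t \<longlonglongrightarrow> 0" using LIMSEQ_Suc[OF lim_1_over_n] by simp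
  have l1: "l \<longlonglongrightarrow> 1" unfolding l_def using tendsto_add[OF tendsto_const[of 1] t0] by simp
  have l: "l n \<ge> 1" "l n \<le> 2" for n by (auto simp: l_def)
  let ?g = "\<lambda>x :: real^'d. norm x ^ p * exp (- 2 * (norm x)\<^sup>2)"
  let ?h = "\<lambda>n (x :: real^'d). norm x ^ p * exp (- (2 * (l n)\<^sup>2) * (norm x)\<^sup>2)"
  have sc: "l n ^ (?d + p) * integral\<^sup>L lborel (?h n) = gmoment TYPE('d) p" for n
  proof -
    have "gmoment TYPE('d) p = l n ^ ?d * integral\<^sup>L lborel (\<lambda>x. ?g (l n *\<^sub>R x))"
      unfolding gmoment_def using l(1)[of n] by (intro lborel_scale(1)) auto
    also have "(\<lambda>x. ?g (l n *\<^sub>R x)) = (\<lambda>x. l n ^ p * ?h n x)"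
      using l(1)[of n] by (intro ext) (simp add: power_mult_distrib mult_ac)
    also have "integral\<^sup>L lborel (\<lambda>x. l n ^ p * ?h n x) = l n ^ p * integral\<^sup>L lborel (?h n)"
      by (rule integral_mult_right_zero)
    finally show ?thesis by (simp only: power_add mult.assoc)
  qed
  have hi: "integrable lborel (?h n)" for n
    using l(1)[of n] one_le_power[OF l(1)[of n], of 2] by (intro integrable_gauss) linarith
  have gi: "integrable lborel ?g" by (rule integrable_gauss) simp
  have lim1: "(\<lambda>n. integral\<^sup>L lborel (\<lambda>x. (?h n x - ?g x) / ?t n)) \<longlonglongrightarrow> integral\<^sup>L lborel (\<lambda>x :: real^'d. - 4 * (norm x ^ (p + 2) * exp (- 2 * (norm x)\<^sup>2)))"
  \<comment> \<open>The 6 bounds 2 (2 + t) for t at most 1, after 1 - exp (- a) \<le> a.\<close>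
  proof (rule integral_dominated_convergence[where w = "\<lambda>x. 6 * (norm x ^ (p + 2) * exp (- 2 * (norm x)\<^sup>2))"])
    show "integrable lborel (\<lambda>x :: real^'d. 6 * (norm x ^ (p + 2) * exp (- 2 * (norm x)\<^sup>2)))"
      by (intro integrable_mult_right integrable_gauss) simp
    have e: "(?h n x - ?g x) / ?t n = ?g x * ((exp (- (2 * ((l n)\<^sup>2 - 1) * (norm x)\<^sup>2)) - 1) / ?t n)" for n and x :: "real^'d"
    proof -
      have "exp (- (2 * (l n)\<^sup>2) * (norm x)\<^sup>2) = exp (- 2 * (norm x)\<^sup>2) * exp (- (2 * ((l n)\<^sup>2 - 1) * (norm x)\<^sup>2))"
        unfolding exp_add[symmetric] by (simp add: algebra_simps)
      then have "?h n x - ?g x = ?g x * (exp (- (2 * ((l n)\<^sup>2 - 1) * (norm x)\<^sup>2)) - 1)"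
        by (simp only: right_diff_distrib mult_1_right mult.assoc)
      then show ?thesis by (simp only: times_divide_eq_right)
    qed
    have ll: "((l n)\<^sup>2 - 1) / ?t n = 2 + ?t n" for n
    proof -
      have "(1 + t)\<^sup>2 - 1 = t * (2 + t)" for t :: real by (simp add: power2_eq_square algebra_simps)
      then show ?thesis unfolding l_def by simp
    qed
    show "AE x in lborel. (\<lambda>n. (?h n x - ?g x) / ?t n) \<longlonglongrightarrow> - 4 * (norm x ^ (p + 2) * exp (- 2 * (norm x)\<^sup>2))"
    proof (rule AE_I2)
      fix x :: "real^'d"
      have "(\<lambda>n. (- 2 * (norm x)\<^sup>2) * (2 + ?t n)) \<longlonglongrightarrow> (- 2 * (norm x)\<^sup>2) * (2 + 0)"
        by (intro tendsto_intros t0)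
      moreover have "(- 2 * (norm x)\<^sup>2) * (2 + ?t n) = (- (2 * ((l n)\<^sup>2 - 1) * (norm x)\<^sup>2)) / ?t n" for n
        unfolding ll[symmetric] by (simp add: algebra_simps)
      ultimately have "(\<lambda>n. (- (2 * ((l n)\<^sup>2 - 1) * (norm x)\<^sup>2)) / ?t n) \<longlonglongrightarrow> (- 2 * (norm x)\<^sup>2) * (2 + 0)"
        by (simp only:)
      moreover have "(- 2 * (norm x)\<^sup>2) * (2 + 0) = - 4 * (norm x)\<^sup>2" by simp
      ultimately have "(\<lambda>n. (- (2 * ((l n)\<^sup>2 - 1) * (norm x)\<^sup>2)) / ?t n) \<longlonglongrightarrow> - 4 * (norm x)\<^sup>2"
        by (simp only:)
      then have "(\<lambda>n. (exp (- (2 * ((l n)\<^sup>2 - 1) * (norm x)\<^sup>2)) - 1) / ?t n) \<longlonglongrightarrow> - 4 * (norm x)\<^sup>2"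
        by (rule exp_quotient_tendsto[OF _ t0]) simp
      then have lg: "(\<lambda>n. ?g x * ((exp (- (2 * ((l n)\<^sup>2 - 1) * (norm x)\<^sup>2)) - 1) / ?t n)) \<longlonglongrightarrow> ?g x * (- 4 * (norm x)\<^sup>2)"
        by (intro tendsto_mult tendsto_const)
      show "(\<lambda>n. (?h n x - ?g x) / ?t n) \<longlonglongrightarrow> - 4 * (norm x ^ (p + 2) * exp (- 2 * (norm x)\<^sup>2))"
      proof -
        have "?g x * (- 4 * (norm x)\<^sup>2) = - 4 * (norm x ^ (p + 2) * exp (- 2 * (norm x)\<^sup>2))"
          by (simp add: power_add power2_eq_square)
        then show ?thesis using lg unfolding e by (simp only:)
      qed
    qed
    show "AE x in lborel. norm ((?h n x - ?g x) / ?t n) \<le> 6 * (norm x ^ (p + 2) * exp (- 2 * (norm x)\<^sup>2))" for n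
    proof (rule AE_I2)
      fix x :: "real^'d"
      let ?a = "2 * ((l n)\<^sup>2 - 1) * (norm x)\<^sup>2"
      have a0: "?a \<ge> 0" using one_le_power[OF l(1)[of n], of 2] by simp
      have ex: "\<bar>exp (- ?a) - 1\<bar> \<le> ?a" using exp_ge_add_one_self[of "- ?a"] a0 by simp
      have "\<bar>(exp (- ?a) - 1) / ?t n\<bar> = \<bar>exp (- ?a) - 1\<bar> / ?t n" by (simp add: abs_mult)
      also have "\<dots> \<le> ?a / ?t n" using ex by (intro divide_right_mono) auto
      also have "?a / ?t n = 2 * (norm x)\<^sup>2 * (((l n)\<^sup>2 - 1) / ?t n)" by simp
      also have "\<dots> = 2 * (norm x)\<^sup>2 * (2 + ?t n)" unfolding ll ..
      also have "\<dots> \<le> 2 * (norm x)\<^sup>2 * 3" by (intro mult_left_mono) auto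
      finally have q: "\<bar>(exp (- ?a) - 1) / ?t n\<bar> \<le> 6 * (norm x)\<^sup>2" by simp
      have "norm ((?h n x - ?g x) / ?t n) = ?g x * \<bar>(exp (- ?a) - 1) / ?t n\<bar>"
        unfolding e by (simp only: real_norm_def abs_mult) simp
      also have "\<dots> \<le> ?g x * (6 * (norm x)\<^sup>2)" using q by (intro mult_left_mono) auto
      also have "\<dots> = 6 * (norm x ^ (p + 2) * exp (- 2 * (norm x)\<^sup>2))"
        by (simp add: power_add power2_eq_square)
      finally show "norm ((?h n x - ?g x) / ?t n) \<le> 6 * (norm x ^ (p + 2) * exp (- 2 * (norm x)\<^sup>2))" .
    qed
  qed measurable
  have eq: "integral\<^sup>L lborel (\<lambda>x. (?h n x - ?g x) / ?t n) = gmoment TYPE('d) p * ((inverse (l n) ^ (?d + p) - 1) / ?t n)" for n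
  proof -
    have "integral\<^sup>L lborel (?h n) = gmoment TYPE('d) p * inverse (l n) ^ (?d + p)"
      using sc[of n] l(1)[of n] by (simp add: field_simps power_inverse)
    moreover have "integral\<^sup>L lborel (\<lambda>x. (?h n x - ?g x) / ?t n) = (integral\<^sup>L lborel (?h n) - integral\<^sup>L lborel ?g) / ?t n"
      using hi gi by simp
    ultimately show ?thesis by (simp add: gmoment_def algebra_simps)
  qed
  have lim2: "(\<lambda>n. (inverse (l n) ^ (?d + p) - 1) / ?t n) \<longlonglongrightarrow> - (real ?d + real p)"
  proof -
    let ?u = "\<lambda>n. inverse (l n)"
    have "(?u n ^ (?d + p) - 1) / ?t n = - inverse (l n) * (\<Sum>i<?d + p. ?u n ^ i)" for n
    proof -
      have "?u n ^ (?d + p) - 1 = (?u n - 1) * (\<Sum>i<?d + p. ?u n ^ i)" by (rule power_diff_1_eq)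
      moreover have "(?u n - 1) / ?t n = - inverse (l n)" by (simp add: l_def field_simps)
      ultimately show ?thesis by (metis times_divide_eq_left)
    qed
    moreover have "(\<lambda>n. - inverse (l n) * (\<Sum>i<?d + p. ?u n ^ i)) \<longlonglongrightarrow> - inverse 1 * (\<Sum>i<?d + p. inverse 1 ^ i)"
      by (intro tendsto_intros l1) simp_all
    ultimately show ?thesis by simp
  qed
  have "gmoment TYPE('d) p * (- (real ?d + real p)) = integral\<^sup>L lborel (\<lambda>x :: real^'d. - 4 * (norm x ^ (p + 2) * exp (- 2 * (norm x)\<^sup>2)))"
    by (rule LIMSEQ_unique[OF tendsto_mult[OF tendsto_const lim2] lim1[unfolded eq]])
  also have "\<dots> = - 4 * gmoment TYPE('d) (p + 2)" unfolding gmoment_def by (rule integral_mult_right_zero)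
  finally have "gmoment TYPE('d) p * (real ?d + real p) = 4 * gmoment TYPE('d) (p + 2)"
    by (simp only: mult_minus_right mult_minus_left neg_equal_iff_equal)
  then have "gmoment TYPE('d) (p + 2) = gmoment TYPE('d) p * (real ?d + real p) / 4" by linarith
  then show ?thesis by (simp only: mult.commute times_divide_eq_left)
qed

section \<open>Limits of uncertainty products\<close>

text \<open>N^2 - a^2 = (N - a) (N + a) = s^2 Q (N + a) / 2. This makes the vanishing of the first
  factor explicit, and its s^2 cancels the s^(-2) of the variance.\<close>

lemma limit_of_uncertainty_ratio:
  fixes N a Q s M1 M2 :: "nat \<Rightarrow> real"
  assumes s: "s \<longlonglongrightarrow> 0" "\<And>n. s n > 0" and N: "N \<longlonglongrightarrow> H" "H > 0"
    and Q: "Q \<longlonglongrightarrow> K" and a: "\<And>n. a n = N n - (s n)\<^sup>2 * Q n / 2"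
    and M1: "M1 \<longlonglongrightarrow> m1" and M2: "M2 \<longlonglongrightarrow> m2"
  shows "(\<lambda>n. ((N n)\<^sup>2 / (a n)\<^sup>2 - 1) * ((M2 n / (s n)\<^sup>2) / N n - (M1 n / s n)\<^sup>2 / (N n)\<^sup>2))
      \<longlonglongrightarrow> K / H * (m2 / H - (m1 / H)\<^sup>2)"
    and "\<forall>\<^sub>F n in sequentially. a n \<noteq> 0"
proof -
  have "(\<lambda>n. N n - (s n)\<^sup>2 * Q n / 2) \<longlonglongrightarrow> H - 0\<^sup>2 * K / 2" by (intro tendsto_intros s N Q) simp
  moreover have "a = (\<lambda>n. N n - (s n)\<^sup>2 * Q n / 2)" using a by (rule ext)
  ultimately have a': "a \<longlonglongrightarrow> H" by simp
  have ev: "\<forall>\<^sub>F n in sequentially. a n > 0" "\<forall>\<^sub>F n in sequentially. N n > 0"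
    using order_tendstoD(1)[OF a' N(2)] order_tendstoD(1)[OF N] by auto
  then show "\<forall>\<^sub>F n in sequentially. a n \<noteq> 0" by (auto elim: eventually_mono)
  have "(\<lambda>n. (Q n / 2 * (N n + a n) / (a n)\<^sup>2) * (M2 n / N n - (M1 n)\<^sup>2 / (N n)\<^sup>2))
     \<longlonglongrightarrow> (K / 2 * (H + H) / H\<^sup>2) * (m2 / H - m1\<^sup>2 / H\<^sup>2)"
    using N(2) by (intro tendsto_intros Q N a' M1 M2) auto
  also have "(K / 2 * (H + H) / H\<^sup>2) * (m2 / H - m1\<^sup>2 / H\<^sup>2) = K / H * (m2 / H - (m1 / H)\<^sup>2)"
    using N(2) by (simp add: power2_eq_square)
  finally have l: "(\<lambda>n. (Q n / 2 * (N n + a n) / (a n)\<^sup>2) * (M2 n / N n - (M1 n)\<^sup>2 / (N n)\<^sup>2)) \<longlonglongrightarrow> K / H * (m2 / H - (m1 / H)\<^sup>2)" .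
  have "\<forall>\<^sub>F n in sequentially. (Q n / 2 * (N n + a n) / (a n)\<^sup>2) * (M2 n / N n - (M1 n)\<^sup>2 / (N n)\<^sup>2)
     = ((N n)\<^sup>2 / (a n)\<^sup>2 - 1) * ((M2 n / (s n)\<^sup>2) / N n - (M1 n / s n)\<^sup>2 / (N n)\<^sup>2)"
    using ev
  proof eventually_elim
    case (elim n)
    have "(N n)\<^sup>2 - (a n)\<^sup>2 = (s n)\<^sup>2 * (Q n / 2 * (N n + a n))"
      by (simp add: a power2_eq_square algebra_simps)
    moreover have "(N n)\<^sup>2 / (a n)\<^sup>2 - 1 = ((N n)\<^sup>2 - (a n)\<^sup>2) / (a n)\<^sup>2"
      using elim by (simp add: diff_divide_distrib)
    ultimately have "(N n)\<^sup>2 / (a n)\<^sup>2 - 1 = (s n)\<^sup>2 * (Q n / 2 * (N n + a n) / (a n)\<^sup>2)"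
      by (simp only: times_divide_eq_right)
    moreover have "(M2 n / (s n)\<^sup>2) / N n - (M1 n / s n)\<^sup>2 / (N n)\<^sup>2 = (M2 n / N n - (M1 n)\<^sup>2 / (N n)\<^sup>2) / (s n)\<^sup>2"
      by (simp add: power_divide diff_divide_distrib mult.commute)
    ultimately show ?case using s(2)[of n] by simp
  qed
  with l show "(\<lambda>n. ((N n)\<^sup>2 / (a n)\<^sup>2 - 1) * ((M2 n / (s n)\<^sup>2) / N n - (M1 n / s n)\<^sup>2 / (N n)\<^sup>2))
      \<longlonglongrightarrow> K / H * (m2 / H - (m1 / H)\<^sup>2)"
    by (rule Lim_transform_eventually)
qed

lemma has_sum_shift:
  assumes "((f :: int^'d \<Rightarrow> real) has_sum a) UNIV" shows "((\<lambda>k. f (k - L)) has_sum a) UNIV"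
proof -
  have "bij (\<lambda>k :: int^'d. k - L)" by (rule bij_betw_byWitness[of _ "\<lambda>k. k + L"]) auto
  then show ?thesis using has_sum_reindex_bij_betw[of "\<lambda>k. k - L" UNIV UNIV f a] assms by simp
qed

lemma correlation_identity:
  fixes r :: "int^'d \<Rightarrow> real"
  assumes sq: "(\<lambda>k. (r k)\<^sup>2) summable_on UNIV" and df: "(\<lambda>k. (r k - r (k - L))\<^sup>2) summable_on UNIV"
  shows "((\<lambda>k. r (k - L) * r k) has_sum (infsum (\<lambda>k. (r k)\<^sup>2) UNIV - infsum (\<lambda>k. (r k - r (k - L))\<^sup>2) UNIV / 2)) UNIV"
proof -
  have h: "((\<lambda>k. (r k)\<^sup>2) has_sum infsum (\<lambda>k. (r k)\<^sup>2) UNIV) UNIV" using sq by (rule has_sum_infsum)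
  have "((\<lambda>k. (1/2) * (r k)\<^sup>2 + (1/2) * (r (k - L))\<^sup>2 + (-1/2) * (r k - r (k - L))\<^sup>2) has_sum
     ((1/2) * infsum (\<lambda>k. (r k)\<^sup>2) UNIV + (1/2) * infsum (\<lambda>k. (r k)\<^sup>2) UNIV + (-1/2) * infsum (\<lambda>k. (r k - r (k - L))\<^sup>2) UNIV)) UNIV"
    by (intro has_sum_add has_sum_cmult_right h has_sum_infsum df has_sum_shift[where f = "\<lambda>k. (r k)\<^sup>2"])
  moreover have "(1/2) * (r k)\<^sup>2 + (1/2) * (r (k - L))\<^sup>2 + (-1/2) * (r k - r (k - L))\<^sup>2 = r (k - L) * r k" for k
    by (simp add: power2_eq_square algebra_simps)
  ultimately show ?thesis by simp
qed

text \<open>\<open>UP\<close> is invariant under scalar factors, so \<open>\<gamma>\<close> drops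
  out, and the phase only multiplies the correlation by the unimodular number
  \<open>\<omega> n\<close>. Four Riemann sums remain: the norm, the squared difference quotients,
  and the first two moments in direction \<open>L\<close>.\<close>

theorem UP_limit:
  fixes f :: "nat \<Rightarrow> real^'d \<Rightarrow> complex" and r :: "nat \<Rightarrow> int^'d \<Rightarrow> real" and L :: "int^'d"
    and phase :: "nat \<Rightarrow> int^'d \<Rightarrow> complex"
  assumes fL: "\<And>n. f n \<in> L2T" and fc: "\<And>n k. fcoeff (f n) k = of_real (\<gamma> n) * phase n k * of_real (r n k)"
    and \<gamma>: "\<And>n. \<gamma> n > 0" and ph: "\<And>n k. cmod (phase n k) = 1"
    and ph': "\<And>n k. phase n (k - L) * cnj (phase n k) = \<omega> n"
    and L: "L \<noteq> 0"
    and s: "\<And>n. s n > 0" "\<And>n. s n \<le> M" "s \<longlonglongrightarrow> 0" and c: "c > 0"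
    and rb: "\<And>n k. \<bar>r n k\<bar> \<le> C * exp (- (c * norm (s n *\<^sub>R rvec k)))"
    and db: "\<And>n k. \<bar>r n k - r n (k - L)\<bar> \<le> C * s n * exp (- (c * norm (s n *\<^sub>R rvec k)))"
    and h: "h \<in> borel_measurable borel" and D: "D \<in> borel_measurable borel"
    and hlim: "AE y in lborel. (\<lambda>n. r n (vfloor ((1 / s n) *\<^sub>R y))) \<longlonglongrightarrow> h y"
    and Dlim: "AE y in lborel. (\<lambda>n. (r n (vfloor ((1 / s n) *\<^sub>R y)) - r n (vfloor ((1 / s n) *\<^sub>R y) - L)) / s n) \<longlonglongrightarrow> D y"
    and pos: "integral\<^sup>L lborel (\<lambda>y. (h y)\<^sup>2) > 0"
  defines "H \<equiv> integral\<^sup>L lborel (\<lambda>y. (h y)\<^sup>2)" and "K \<equiv> integral\<^sup>L lborel (\<lambda>y. (D y)\<^sup>2)"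
    and "m1 \<equiv> integral\<^sup>L lborel (\<lambda>y. (rvec L \<bullet> y) * (h y)\<^sup>2)" and "m2 \<equiv> integral\<^sup>L lborel (\<lambda>y. (rvec L \<bullet> y)\<^sup>2 * (h y)\<^sup>2)"
  shows "\<forall>\<^sub>F n in sequentially. f n \<in> UP_domain L"
    and "(\<lambda>n. UP L (f n)) \<longlonglongrightarrow> 1 / norm (rvec L) ^ 4 * (K / H * (m2 / H - (m1 / H)\<^sup>2))"
proof -
  let ?d = "CARD('d)"
  let ?p = "\<lambda>n k. s n *\<^sub>R rvec k"
  have C: "C \<ge> 0" using rb[of 0 0] abs_ge_zero[of "r 0 0"] by simp
  have vlim: "(\<lambda>n. ?p n (vfloor ((1 / s n) *\<^sub>R y))) \<longlonglongrightarrow> y" for y :: "real^'d"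
    using s by (intro vfloor_scaled_tendsto) auto
  have poly: "\<exists>E. \<forall>x\<ge>0. x ^ q * exp (- (c * x)) \<le> E * exp (- (c / 2 * x))" for q
    using poly_exp_bound[OF c, of q] by blast
  \<comment> \<open>Riemann sums with a weight of polynomial growth in the scaled variable; half of
    the rate \<open>c\<close> absorbs the weight.\<close>
  have riem: "\<And>n. (\<lambda>k. norm (w (?p n k) * G n k)) summable_on UNIV"
    "(\<lambda>n. s n ^ ?d * infsum (\<lambda>k. w (?p n k) * G n k) UNIV) \<longlonglongrightarrow> integral\<^sup>L lborel (\<lambda>y. w y * g y)"
    if G: "\<And>n k. \<bar>G n k\<bar> \<le> E * exp (- (c * norm (?p n k)))" and g: "g \<in> borel_measurable borel"
      and lim: "AE y in lborel. (\<lambda>n. G n (vfloor ((1 / s n) *\<^sub>R y))) \<longlonglongrightarrow> g y"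
      and w: "continuous_on UNIV w" "\<And>y. \<bar>w y\<bar> \<le> B * norm y ^ q"
    for G E g and w :: "real^'d \<Rightarrow> real" and B q
  proof -
    obtain E' where E': "\<And>x. x \<ge> 0 \<Longrightarrow> x ^ q * exp (- (c * x)) \<le> E' * exp (- (c / 2 * x))" using poly by blast
    have E: "E \<ge> 0" using G[of 0 0] abs_ge_zero[of "G 0 0"] by simp
    obtain B' where B': "B' \<ge> 0" "\<And>y. \<bar>w y\<bar> \<le> B' * norm y ^ q"
    proof
      show "\<bar>w y\<bar> \<le> \<bar>B\<bar> * norm y ^ q" for y
        by (rule order_trans[OF w(2)]) (intro mult_right_mono, auto)
    qed simp
    have b: "\<bar>w (?p n k) * G n k\<bar> \<le> (B' * E * E') * exp (- (c / 2 * norm (?p n k)))" for n k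
    proof -
      have "\<bar>w (?p n k) * G n k\<bar> \<le> (B' * norm (?p n k) ^ q) * (E * exp (- (c * norm (?p n k))))"
        unfolding abs_mult by (intro mult_mono B' G) (use B'(1) in auto)
      also have "\<dots> = (B' * E) * (norm (?p n k) ^ q * exp (- (c * norm (?p n k))))" by simp
      also have "\<dots> \<le> (B' * E) * (E' * exp (- (c / 2 * norm (?p n k))))"
        using B'(1) E by (intro mult_left_mono E') auto
      finally show ?thesis by simp
    qed
    have l: "AE y in lborel. (\<lambda>n. w (?p n (vfloor ((1 / s n) *\<^sub>R y))) * G n (vfloor ((1 / s n) *\<^sub>R y))) \<longlonglongrightarrow> w y * g y"
      using lim
    proof eventually_elim
      case (elim y)
      have "(\<lambda>n. w (?p n (vfloor ((1 / s n) *\<^sub>R y)))) \<longlonglongrightarrow> w y"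
        using continuous_on_tendsto_compose[OF w(1) vlim[of y]] by simp
      then show ?case using elim by (rule tendsto_mult)
    qed
    have m: "(\<lambda>y. w y * g y) \<in> borel_measurable borel"
      using g borel_measurable_continuous_onI[OF w(1)] by simp
    have c2: "c / 2 > 0" using c by simp
    show "\<And>n. (\<lambda>k. norm (w (?p n k) * G n k)) summable_on UNIV"
      "(\<lambda>n. s n ^ ?d * infsum (\<lambda>k. w (?p n k) * G n k) UNIV) \<longlonglongrightarrow> integral\<^sup>L lborel (\<lambda>y. w y * g y)"
      using riemann_sum_limit[OF s(1,2) c2 b m l] by auto
  qed
  have r2b: "\<bar>(r n k)\<^sup>2\<bar> \<le> C\<^sup>2 * exp (- (c * norm (?p n k)))" for n k
  proof -
    have "\<bar>r n k\<bar>\<^sup>2 \<le> (C * exp (- (c * norm (?p n k))))\<^sup>2" by (intro power_mono rb) auto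
    also have "\<dots> = C\<^sup>2 * (exp (- (c * norm (?p n k))) * exp (- (c * norm (?p n k))))" by (simp add: power2_eq_square)
    also have "\<dots> \<le> C\<^sup>2 * (exp (- (c * norm (?p n k))) * 1)" using c by (intro mult_left_mono) auto
    finally show ?thesis by simp
  qed
  have d2b: "\<bar>((r n k - r n (k - L)) / s n)\<^sup>2\<bar> \<le> C\<^sup>2 * exp (- (c * norm (?p n k)))" for n k
  proof -
    have "\<bar>(r n k - r n (k - L)) / s n\<bar> \<le> C * exp (- (c * norm (?p n k)))"
      using db[of n k] s(1)[of n] by (simp add: abs_divide pos_divide_le_eq mult_ac)
    then have "\<bar>(r n k - r n (k - L)) / s n\<bar>\<^sup>2 \<le> (C * exp (- (c * norm (?p n k))))\<^sup>2" by (intro power_mono) auto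
    also have "\<dots> = C\<^sup>2 * (exp (- (c * norm (?p n k))) * exp (- (c * norm (?p n k))))" by (simp add: power2_eq_square)
    also have "\<dots> \<le> C\<^sup>2 * (exp (- (c * norm (?p n k))) * 1)" using c by (intro mult_left_mono) auto
    finally show ?thesis by (simp only: power2_abs abs_power2 mult_1_right)
  qed
  have h2: "AE y in lborel. (\<lambda>n. (r n (vfloor ((1 / s n) *\<^sub>R y)))\<^sup>2) \<longlonglongrightarrow> (h y)\<^sup>2"
    using hlim by eventually_elim (rule tendsto_power)
  have D2: "AE y in lborel. (\<lambda>n. ((r n (vfloor ((1 / s n) *\<^sub>R y)) - r n (vfloor ((1 / s n) *\<^sub>R y) - L)) / s n)\<^sup>2) \<longlonglongrightarrow> (D y)\<^sup>2"
    using Dlim by eventually_elim (rule tendsto_power)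
  have hm: "(\<lambda>y. (h y)\<^sup>2) \<in> borel_measurable borel" "(\<lambda>y. (D y)\<^sup>2) \<in> borel_measurable borel" using h D by auto
  have Lb: "\<bar>rvec L \<bullet> y\<bar> \<le> norm (rvec L) * norm y ^ 1" "\<bar>(rvec L \<bullet> y)\<^sup>2\<bar> \<le> (norm (rvec L))\<^sup>2 * norm y ^ 2" for y :: "real^'d"
  proof -
    show 1: "\<bar>rvec L \<bullet> y\<bar> \<le> norm (rvec L) * norm y ^ 1" using Cauchy_Schwarz_ineq2[of "rvec L" y] by simp
    have "\<bar>rvec L \<bullet> y\<bar>\<^sup>2 \<le> (norm (rvec L) * norm y)\<^sup>2" using 1 by (intro power_mono) auto
    then show "\<bar>(rvec L \<bullet> y)\<^sup>2\<bar> \<le> (norm (rvec L))\<^sup>2 * norm y ^ 2" by (simp add: power_mult_distrib)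
  qed
  have cont: "continuous_on UNIV (\<lambda>y :: real^'d. 1 :: real)" "continuous_on UNIV (\<lambda>y :: real^'d. rvec L \<bullet> y)"
     "continuous_on UNIV (\<lambda>y :: real^'d. (rvec L \<bullet> y)\<^sup>2)" "continuous_on UNIV (\<lambda>y :: real^'d. norm y)"
     "continuous_on UNIV (\<lambda>y :: real^'d. (norm y)\<^sup>2)"
    by (intro continuous_intros)+
  note RN = riem[OF r2b hm(1) h2 cont(1), of 1 0, simplified]
  note RQ = riem[OF d2b hm(2) D2 cont(1), of 1 0, simplified]
  note R1 = riem[OF r2b hm(1) h2 cont(2) Lb(1)]
  note R2 = riem[OF r2b hm(1) h2 cont(3) Lb(2)]
  define N where "N n = s n ^ ?d * infsum (\<lambda>k. (r n k)\<^sup>2) UNIV" for n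
  define Q where "Q n = s n ^ ?d * infsum (\<lambda>k. ((r n k - r n (k - L)) / s n)\<^sup>2) UNIV" for n
  \<comment> \<open>The moments are taken at the scaled points, so up to the common factor the true
    ones are M1 / s and M2 / s^2.\<close>
  define M1 where "M1 n = s n ^ ?d * infsum (\<lambda>k. (rvec L \<bullet> ?p n k) * (r n k)\<^sup>2) UNIV" for n
  define M2 where "M2 n = s n ^ ?d * infsum (\<lambda>k. (rvec L \<bullet> ?p n k)\<^sup>2 * (r n k)\<^sup>2) UNIV" for n
  define a where "a n = N n - (s n)\<^sup>2 * Q n / 2" for n
  have Nl: "N \<longlonglongrightarrow> H" unfolding N_def H_def using RN(2) by simp
  have Ql: "Q \<longlonglongrightarrow> K" unfolding Q_def K_def using RQ(2) by simp
  have M1l: "M1 \<longlonglongrightarrow> m1" unfolding M1_def m1_def by (rule R1(2))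
  have M2l: "M2 \<longlonglongrightarrow> m2" unfolding M2_def m2_def by (rule R2(2))
  have rs: "(\<lambda>k. (r n k)\<^sup>2) summable_on UNIV" for n using RN(1)[of n] by simp
  have ds: "(\<lambda>k. (r n k - r n (k - L))\<^sup>2) summable_on UNIV" for n
  proof -
    have "(\<lambda>k. (s n)\<^sup>2 * ((r n k - r n (k - L)) / s n)\<^sup>2) summable_on UNIV"
      using RQ(1)[of n] by (intro summable_on_cmult_right) simp
    then show ?thesis using s(1)[of n] by (simp add: power_divide)
  qed
  have Qs: "infsum (\<lambda>k. (r n k - r n (k - L))\<^sup>2) UNIV = (s n)\<^sup>2 * infsum (\<lambda>k. ((r n k - r n (k - L)) / s n)\<^sup>2) UNIV" for n
  proof -
    have "infsum (\<lambda>k. (s n)\<^sup>2 * ((r n k - r n (k - L)) / s n)\<^sup>2) UNIV = (s n)\<^sup>2 * infsum (\<lambda>k. ((r n k - r n (k - L)) / s n)\<^sup>2) UNIV"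
      by (rule infsum_cmult_right')
    then show ?thesis using s(1)[of n] by (simp add: power_divide)
  qed
  have cor: "((\<lambda>k. r n (k - L) * r n k) has_sum (a n / s n ^ ?d)) UNIV" for n
  proof -
    have "infsum (\<lambda>k. (r n k)\<^sup>2) UNIV - infsum (\<lambda>k. (r n k - r n (k - L))\<^sup>2) UNIV / 2 = a n / s n ^ ?d"
      unfolding Qs a_def N_def Q_def using s(1)[of n] by (simp add: field_simps)
    then show ?thesis using correlation_identity[OF rs ds, of n] by simp
  qed
  have cm: "(cmod (fcoeff (f n) k))\<^sup>2 = (\<gamma> n)\<^sup>2 * (r n k)\<^sup>2" for n k
    using \<gamma>[of n] by (simp add: fc norm_mult ph power_mult_distrib)
  \<comment> \<open>The weights norm and norm squared give the summability demanded by
    \<open>UP_fourier\<close> and the membership in \<open>H1T\<close>.\<close>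
  note R3 = riem(1)[of r C h norm 1 1, OF rb h hlim cont(4), simplified]
  note R4 = riem(1)[of "\<lambda>n k. (r n k)\<^sup>2" "C\<^sup>2" "\<lambda>y. (h y)\<^sup>2" "\<lambda>y. (norm y)\<^sup>2" 1 2, OF r2b hm(1) h2 cont(5), simplified]
  have sm: "(\<lambda>k. norm (rvec k) * cmod (fcoeff (f n) k)) summable_on UNIV" for n
  proof -
    have "(\<lambda>k. (\<gamma> n / s n) * (norm (s n *\<^sub>R rvec k) * \<bar>r n k\<bar>)) summable_on UNIV"
      using R3[of n] s(1)[of n] by (intro summable_on_cmult_right) (simp add: abs_mult)
    then show ?thesis using \<gamma>[of n] s(1)[of n] by (simp add: fc norm_mult ph mult_ac)
  qed
  have H1: "f n \<in> H1T" for n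
  proof -
    have "(\<lambda>k. ((\<gamma> n)\<^sup>2 / (s n)\<^sup>2) * ((norm (s n *\<^sub>R rvec k))\<^sup>2 * (r n k)\<^sup>2)) summable_on UNIV"
      using R4[of n] s(1)[of n] by (intro summable_on_cmult_right) (simp add: abs_mult power_mult_distrib)
    then have "(\<lambda>k. (norm (rvec k))\<^sup>2 * (cmod (fcoeff (f n) k))\<^sup>2) summable_on UNIV"
      using s(1)[of n] by (simp add: cm power_mult_distrib mult_ac)
    then show ?thesis using fL by (simp add: H1T_def)
  qed
  have om: "cmod (\<omega> n) = 1" for n using ph'[of n 0, symmetric] ph by (simp add: norm_mult)
  have A: "infsum (\<lambda>k. fcoeff (f n) (k - L) * cnj (fcoeff (f n) k)) UNIV = of_real ((\<gamma> n)\<^sup>2) * \<omega> n * of_real (a n / s n ^ ?d)" for n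
  proof (rule infsumI)
    have "((\<lambda>k. of_real ((\<gamma> n)\<^sup>2) * \<omega> n * of_real (r n (k - L) * r n k)) has_sum of_real ((\<gamma> n)\<^sup>2) * \<omega> n * of_real (a n / s n ^ ?d)) UNIV"
      by (intro has_sum_cmult_right has_sum_of_real cor)
    moreover have "of_real ((\<gamma> n)\<^sup>2) * \<omega> n * of_real (r n (k - L) * r n k) = fcoeff (f n) (k - L) * cnj (fcoeff (f n) k)" for k
      unfolding fc ph'[of n k, symmetric] by (simp add: power2_eq_square mult_ac)
    ultimately show "((\<lambda>k. fcoeff (f n) (k - L) * cnj (fcoeff (f n) k)) has_sum of_real ((\<gamma> n)\<^sup>2) * \<omega> n * of_real (a n / s n ^ ?d)) UNIV"
      by simp
  qed
  note lim = limit_of_uncertainty_ratio[OF s(3,1) Nl pos[folded H_def] Ql a_def M1l M2l]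
  have uf: "UP L (f n) = 1 / norm (rvec L) ^ 4 * (((N n)\<^sup>2 / (a n)\<^sup>2 - 1) * ((M2 n / (s n)\<^sup>2) / N n - (M1 n / s n)\<^sup>2 / (N n)\<^sup>2))" for n
  proof -
    let ?g = "(\<gamma> n)\<^sup>2 / s n ^ ?d"
    have g: "?g > 0" using \<gamma>[of n] s(1)[of n] by simp
    have i1: "infsum (\<lambda>k. (cmod (fcoeff (f n) k))\<^sup>2) UNIV = ?g * N n"
      unfolding cm infsum_cmult_right' N_def using s(1)[of n] by simp
    have i2: "infsum (\<lambda>k. (rvec L \<bullet> rvec k) * (cmod (fcoeff (f n) k))\<^sup>2) UNIV = ?g * (M1 n / s n)"
    proof -
      have "(\<lambda>k. (rvec L \<bullet> rvec k) * (cmod (fcoeff (f n) k))\<^sup>2) = (\<lambda>k. ((\<gamma> n)\<^sup>2 / s n) * ((rvec L \<bullet> ?p n k) * (r n k)\<^sup>2))"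
        using s(1)[of n] by (simp add: cm fun_eq_iff)
      then have "infsum (\<lambda>k. (rvec L \<bullet> rvec k) * (cmod (fcoeff (f n) k))\<^sup>2) UNIV = (\<gamma> n)\<^sup>2 / s n * infsum (\<lambda>k. (rvec L \<bullet> ?p n k) * (r n k)\<^sup>2) UNIV"
        by (simp only: infsum_cmult_right')
      moreover have "?g * (s n ^ ?d * I / s n) = (\<gamma> n)\<^sup>2 / s n * I" for I using s(1)[of n] by simp
      ultimately show ?thesis by (simp only: M1_def)
    qed
    have i3: "infsum (\<lambda>k. (rvec L \<bullet> rvec k)\<^sup>2 * (cmod (fcoeff (f n) k))\<^sup>2) UNIV = ?g * (M2 n / (s n)\<^sup>2)"
    proof -
      have "(\<lambda>k. (rvec L \<bullet> rvec k)\<^sup>2 * (cmod (fcoeff (f n) k))\<^sup>2) = (\<lambda>k. ((\<gamma> n)\<^sup>2 / (s n)\<^sup>2) * ((rvec L \<bullet> ?p n k)\<^sup>2 * (r n k)\<^sup>2))"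
        using s(1)[of n] by (simp add: cm fun_eq_iff power_mult_distrib)
      then have "infsum (\<lambda>k. (rvec L \<bullet> rvec k)\<^sup>2 * (cmod (fcoeff (f n) k))\<^sup>2) UNIV = (\<gamma> n)\<^sup>2 / (s n)\<^sup>2 * infsum (\<lambda>k. (rvec L \<bullet> ?p n k)\<^sup>2 * (r n k)\<^sup>2) UNIV"
        by (simp only: infsum_cmult_right')
      moreover have "?g * (s n ^ ?d * I / (s n)\<^sup>2) = (\<gamma> n)\<^sup>2 / (s n)\<^sup>2 * I" for I using s(1)[of n] by simp
      ultimately show ?thesis by (simp only: M2_def)
    qed
    have "cmod (of_real ((\<gamma> n)\<^sup>2) * \<omega> n * of_real (a n / s n ^ ?d)) = ?g * \<bar>a n\<bar>"
      using s(1)[of n] by (simp add: norm_mult norm_divide norm_power om)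
    then have i4: "(cmod (infsum (\<lambda>k. fcoeff (f n) (k - L) * cnj (fcoeff (f n) k)) UNIV))\<^sup>2 = (?g * a n)\<^sup>2"
      unfolding A by (simp only: power_mult_distrib power2_abs)
    have cancel: "(g * x)\<^sup>2 / (g * y)\<^sup>2 = x\<^sup>2 / y\<^sup>2" "(g * x) / (g * y) = x / y" if "g > 0" for g x y :: real
      using that by (simp_all add: power_mult_distrib)
    show ?thesis
      unfolding UP_fourier(1)[OF fL sm] i1 i2 i3 i4 cancel[OF g] by (simp only: mult.assoc)
  qed
  show "(\<lambda>n. UP L (f n)) \<longlonglongrightarrow> 1 / norm (rvec L) ^ 4 * (K / H * (m2 / H - (m1 / H)\<^sup>2))"
    unfolding uf by (intro tendsto_mult tendsto_const lim(1))
  show "\<forall>\<^sub>F n in sequentially. f n \<in> UP_domain L"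
    using lim(2)
  proof eventually_elim
    case (elim n)
    have "\<omega> n \<noteq> 0" using om[of n] by auto
    then have "innerT (opA L (f n)) (f n) \<noteq> 0"
      unfolding UP_fourier(2)[OF fL sm] A using elim \<gamma>[of n] s(1)[of n] by simp
    then show ?case using H1 by (simp add: UP_domain_def)
  qed
qed

section \<open>Gaussian profiles\<close>

lemma profile_decay: "x \<ge> 0 \<Longrightarrow> (1 + x) * exp (- (x\<^sup>2)) \<le> 2 * exp (1/4) * exp (- (1/2 * x))" for x :: real
proof -
  assume x: "x \<ge> 0"
  have "1 + x \<le> 2 * exp (x / 2)" using exp_ge_add_one_self[of "x / 2"] x by linarith
  then have "(1 + x) * exp (- (x\<^sup>2)) \<le> (2 * exp (x / 2)) * (exp (1/4) * exp (- x))"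
    by (intro mult_mono gauss_le_exp) (use x in auto)
  also have "\<dots> = 2 * exp (1/4) * (exp (x / 2) * exp (- x))" by simp
  also have "exp (x / 2) * exp (- x) = exp (- (1/2 * x))" by (simp flip: exp_add)
  finally show ?thesis .
qed

text \<open>Keeps half of the quadratic exponent, which is needed near the edge of the Gaussian
  region, where decay has to be expressed in the unscaled norm of k.\<close>

lemma profile_decay_sq: "(1 + x) * exp (- (x\<^sup>2)) \<le> 2 * exp (- (x\<^sup>2 / 2))" for x :: real
proof -
  have "0 \<le> (x - 1/2)\<^sup>2" by simp
  then have "1 + x \<le> 2 * (1 + x\<^sup>2 / 2)" by (simp add: power2_eq_square algebra_simps)
  also have "\<dots> \<le> 2 * exp (x\<^sup>2 / 2)" by (rule mult_left_mono[OF exp_ge_add_one_self]) simp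
  finally have "(1 + x) * exp (- (x\<^sup>2)) \<le> 2 * exp (x\<^sup>2 / 2) * exp (- (x\<^sup>2))" by (intro mult_right_mono) auto
  also have "\<dots> = 2 * exp (- (x\<^sup>2 / 2))" by (simp flip: exp_add)
  finally show ?thesis .
qed

lemma linear_exp_bound:
  fixes t :: real
  assumes "\<kappa> > 0" "l \<ge> 0" "t \<ge> 0"
  shows "(t + l) * exp (- (\<kappa> * t)) \<le> (l + 2 / \<kappa>) * exp (- (\<kappa> / 2 * t))"
proof -
  have e: "1 + \<kappa> / 2 * t \<le> exp (\<kappa> / 2 * t)" by (rule exp_ge_add_one_self)
  have t: "t \<le> 2 / \<kappa> * exp (\<kappa> / 2 * t)"
  proof -
    have "t = 2 / \<kappa> * (\<kappa> / 2 * t)" using assms by simp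
    also have "\<dots> \<le> 2 / \<kappa> * exp (\<kappa> / 2 * t)"
      by (rule mult_left_mono) (use e assms in linarith, use assms in simp)
    finally show ?thesis .
  qed
  have l: "l \<le> l * exp (\<kappa> / 2 * t)" using assms by (simp add: mult_le_cancel_left1)
  have "(t + l) * exp (- (\<kappa> * t)) \<le> ((l + 2 / \<kappa>) * exp (\<kappa> / 2 * t)) * exp (- (\<kappa> * t))"
    using t l by (intro mult_right_mono) (auto simp: distrib_right)
  also have "\<dots> = (l + 2 / \<kappa>) * exp (- (\<kappa> / 2 * t))" by (simp add: mult.assoc flip: exp_add)
  finally show ?thesis .
qed

text \<open>The factor |x - z| is retained because it supplies the power of \<open>s n\<close> in
  the difference bound. The Gaussian difference is estimated at the smaller radius m. The polynomial
  factors 1 + z and M + m are absorbed together by exp (m / 2), through 1 + m \<le> 4 exp (m / 4)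
  used twice, whence 32 = 2 * 4 * 4.\<close>

lemma gauss_difference:
  fixes x z a :: real
  assumes x: "0 \<le> x" "0 \<le> z" and a: "a \<ge> 0" "\<bar>x - z\<bar> \<le> a"
  shows "(1 + z) * \<bar>exp (- (x\<^sup>2)) - exp (- (z\<^sup>2))\<bar> \<le> (32 * exp (1/4) * (1 + a)\<^sup>2 * exp (a / 2)) * \<bar>x - z\<bar> * exp (- (1/2 * x))"
proof -
  define m where "m = min x z"
  define M where "M = max x z"
  have mM: "0 \<le> m" "m \<le> M" "M - m = \<bar>x - z\<bar>" "x \<le> m + a" "M \<le> m + a" "z \<le> M" using x a by (auto simp: m_def M_def)
  have "\<bar>exp (- (x\<^sup>2)) - exp (- (z\<^sup>2))\<bar> = exp (- (m\<^sup>2)) - exp (- (M\<^sup>2))"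
  proof (cases "x \<le> z")
    case True
    then have "x\<^sup>2 \<le> z\<^sup>2" using x by (intro power_mono) auto
    then show ?thesis using True by (simp add: m_def M_def)
  next
    case False
    then have "z\<^sup>2 \<le> x\<^sup>2" using x by (intro power_mono) auto
    then show ?thesis using False by (simp add: m_def M_def)
  qed
  also have "\<dots> = exp (- (m\<^sup>2)) * (1 - exp (- (M\<^sup>2 - m\<^sup>2)))" by (simp add: right_diff_distrib flip: exp_add)
  also have "\<dots> \<le> exp (- (m\<^sup>2)) * (M\<^sup>2 - m\<^sup>2)"
    by (rule mult_left_mono) (use exp_ge_add_one_self[of "- (M\<^sup>2 - m\<^sup>2)"] in linarith, simp)
  also have "M\<^sup>2 - m\<^sup>2 = \<bar>x - z\<bar> * (M + m)" unfolding mM(3)[symmetric] by (simp add: power2_eq_square algebra_simps)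
  finally have 1: "\<bar>exp (- (x\<^sup>2)) - exp (- (z\<^sup>2))\<bar> \<le> exp (- (m\<^sup>2)) * (\<bar>x - z\<bar> * (M + m))" .
  have b: "1 + z \<le> (1 + a) * (1 + m)" "M + m \<le> 2 * ((1 + a) * (1 + m))"
  proof -
    define q where "q = a * m"
    have ex: "(1 + a) * (1 + m) = 1 + a + m + q" by (simp add: q_def algebra_simps)
    have am: "0 \<le> q" using a mM by (simp add: q_def)
    show "1 + z \<le> (1 + a) * (1 + m)" unfolding ex using mM a am by linarith
    show "M + m \<le> 2 * ((1 + a) * (1 + m))" unfolding ex using mM(1,5) a(1) am by (simp add: distrib_left)
  qed
  have e4: "1 + m \<le> 4 * exp (m / 4)" using exp_ge_add_one_self[of "m / 4"] mM(1) by linarith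
  have "(1 + z) * \<bar>exp (- (x\<^sup>2)) - exp (- (z\<^sup>2))\<bar> \<le> (1 + z) * (exp (- (m\<^sup>2)) * (\<bar>x - z\<bar> * (M + m)))"
    using 1 x by (intro mult_left_mono) auto
  also have "\<dots> = exp (- (m\<^sup>2)) * \<bar>x - z\<bar> * ((1 + z) * (M + m))" by simp
  also have "\<dots> \<le> exp (- (m\<^sup>2)) * \<bar>x - z\<bar> * (((1 + a) * (1 + m)) * (2 * ((1 + a) * (1 + m))))"
    using b x mM a by (intro mult_left_mono mult_mono) auto
  also have "\<dots> \<le> exp (- (m\<^sup>2)) * \<bar>x - z\<bar> * (((1 + a) * (4 * exp (m / 4))) * (2 * ((1 + a) * (4 * exp (m / 4)))))"
    using e4 a mM by (intro mult_left_mono mult_mono) auto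
  also have "\<dots> = 32 * (1 + a)\<^sup>2 * \<bar>x - z\<bar> * (exp (m / 2) * exp (- (m\<^sup>2)))"
  proof -
    have "exp (m / 4) * exp (m / 4) = exp (m / 2)" by (simp flip: exp_add)
    then show ?thesis by (simp add: power2_eq_square mult_ac)
  qed
  also have "\<dots> \<le> 32 * (1 + a)\<^sup>2 * \<bar>x - z\<bar> * (exp (m / 2) * (exp (1/4) * exp (- m)))"
    using gauss_le_exp[of m] by (intro mult_left_mono) auto
  also have "exp (m / 2) * (exp (1/4) * exp (- m)) = exp (1/4) * exp (- (m / 2))" by (simp flip: exp_add)
  also have "32 * (1 + a)\<^sup>2 * \<bar>x - z\<bar> * (exp (1/4) * exp (- (m / 2))) \<le> 32 * (1 + a)\<^sup>2 * \<bar>x - z\<bar> * (exp (1/4) * (exp (a / 2) * exp (- (1/2 * x))))"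
  proof -
    have "exp (- (m / 2)) \<le> exp (a / 2) * exp (- (1/2 * x))" using mM by (simp flip: exp_add)
    then show ?thesis by (intro mult_left_mono) auto
  qed
  finally show ?thesis by (simp add: mult_ac)
qed

text \<open>\<open>r n\<close> are Fourier coefficients up to normalisation and phase, and \<open>u n\<close> is the radial factor in
  front of the Gaussian: the constant \<open>1\<close> for \<open>\<phi>\<close> and \<open>damp\<close> (see below) for \<open>\<psi>\<close>. \<open>U\<close> and \<open>V\<close> are the limits of
  \<open>u n\<close> and of its difference quotient in direction \<open>L\<close>.\<close>

locale gaussian_profile =
  fixes L :: "int^'d" and J :: "nat \<Rightarrow> real" and c1 \<kappa> E :: real
    and u :: "nat \<Rightarrow> real \<Rightarrow> real" and r :: "nat \<Rightarrow> int^'d \<Rightarrow> real" and s :: "nat \<Rightarrow> real"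
    and U :: "real \<Rightarrow> real" and V :: "real^'d \<Rightarrow> real"
  assumes L: "L \<noteq> 0" and J: "\<And>n. J n \<ge> 1" "filterlim J at_top sequentially"
    and c1: "c1 > 0" and \<kappa>: "\<kappa> > 0"
    and s_def: "\<And>n. s n = norm (rvec L) / sqrt (J n)"
    and u0: "\<And>n x. x \<ge> 0 \<Longrightarrow> 0 \<le> u n x \<and> u n x \<le> 1 + x"
    and u1: "\<And>n x z. x \<ge> 0 \<Longrightarrow> z \<ge> 0 \<Longrightarrow> \<bar>u n x - u n z\<bar> \<le> 2 * \<bar>x - z\<bar>"
    and core: "\<And>n k. norm (rvec k) < c1 * J n \<Longrightarrow> r n k = u n (norm (s n *\<^sub>R rvec k)) * exp (- ((norm (s n *\<^sub>R rvec k))\<^sup>2))"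
    and far: "\<And>n k. norm (rvec k) \<ge> c1 * J n \<Longrightarrow> \<bar>r n k\<bar> \<le> E * exp (- (\<kappa> * norm (rvec k)))"
    and U: "\<And>x y. (\<And>n. x n \<ge> 0) \<Longrightarrow> x \<longlonglongrightarrow> y \<Longrightarrow> (\<lambda>n. u n (x n)) \<longlonglongrightarrow> U y"
    and V: "\<And>p y. p \<longlonglongrightarrow> y \<Longrightarrow> y \<noteq> 0 \<Longrightarrow> (\<lambda>n. (u n (norm (p n)) - u n (norm (p n - s n *\<^sub>R rvec L))) / s n) \<longlonglongrightarrow> V y"
    and Um: "(\<lambda>y :: real^'d. U (norm y)) \<in> borel_measurable borel" and Vm: "V \<in> borel_measurable borel"
begin

abbreviation l :: real where "l \<equiv> norm (rvec L)"

lemma l_pos: "l > 0"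
  using L by (metis norm_eq_zero norm_ge_zero order_le_less rvec_0 rvec_inject)

lemma s_pos: "s n > 0" and s_le: "s n \<le> l" and s_sq: "(s n)\<^sup>2 = l\<^sup>2 / J n"
proof -
  have j: "sqrt (J n) \<ge> 1" using J(1)[of n] by simp
  show "s n > 0" using l_pos j by (simp add: s_def)
  show "s n \<le> l" using l_pos j by (simp add: s_def pos_divide_le_eq mult_le_cancel_left1)
  show "(s n)\<^sup>2 = l\<^sup>2 / J n" using J(1)[of n] by (simp add: s_def power_divide)
qed

lemma s_tendsto: "s \<longlonglongrightarrow> 0"
proof -
  have "filterlim (\<lambda>n. sqrt (J n)) at_top sequentially"
    using sqrt_at_top J(2) by (rule filterlim_compose)
  then have "(\<lambda>n. l / sqrt (J n)) \<longlonglongrightarrow> 0"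
    by (intro tendsto_divide_0[OF tendsto_const] filterlim_at_top_imp_at_infinity)
  moreover have "s = (\<lambda>n. l / sqrt (J n))" using s_def by (rule ext)
  ultimately show ?thesis by simp
qed

text \<open>The slower of the given far rate and the rate that the Gaussian itself attains at the
  edge of its region.\<close>

definition \<kappa>' :: real where "\<kappa>' = min \<kappa> (l\<^sup>2 * c1 / 2)"

definition E' :: real where "E' = \<bar>E\<bar> + 2 * exp (l\<^sup>2 * c1 / 2 * l)"

lemma kappa': "\<kappa>' > 0" "\<kappa>' \<le> \<kappa>" "\<kappa>' \<le> l\<^sup>2 * c1 / 2"
  using \<kappa> c1 l_pos by (auto simp: \<kappa>'_def)

text \<open>Extends the far bound inward by the length \<open>l\<close> of the shift. In a
  difference over \<open>L\<close> possibly only one of the two points leaves the Gaussian region,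
  and both must then satisfy the same bound.\<close>

lemma far':
  assumes k: "norm (rvec k) \<ge> c1 * J n - l" shows "\<bar>r n k\<bar> \<le> E' * exp (- (\<kappa>' * norm (rvec k)))"
proof (cases "norm (rvec k) < c1 * J n")
  case False
  then have "\<bar>r n k\<bar> \<le> E * exp (- (\<kappa> * norm (rvec k)))" by (intro far) simp
  also have "\<dots> \<le> E' * exp (- (\<kappa>' * norm (rvec k)))"
  proof (rule mult_mono)
    show "E \<le> E'" using exp_ge_zero[of "l\<^sup>2 * c1 / 2 * l"] unfolding E'_def by linarith
    show "0 \<le> E'" unfolding E'_def by simp
    show "exp (- (\<kappa> * norm (rvec k))) \<le> exp (- (\<kappa>' * norm (rvec k)))" using kappa' by (simp add: mult_right_mono)
  qed simp
  finally show ?thesis .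
next
  case True
  let ?t = "norm (rvec k)" let ?x = "norm (s n *\<^sub>R rvec k)"
  have x0: "?x \<ge> 0" by simp
  have "\<bar>r n k\<bar> = u n ?x * exp (- (?x\<^sup>2))" using u0[OF x0] unfolding core[OF True] by (simp add: abs_mult)
  also have "\<dots> \<le> (1 + ?x) * exp (- (?x\<^sup>2))" using u0[OF x0] by (intro mult_right_mono) auto
  also have "\<dots> \<le> 2 * exp (- (?x\<^sup>2 / 2))" by (rule profile_decay_sq)
  also have "\<dots> \<le> 2 * exp (l\<^sup>2 * c1 / 2 * (l - ?t))"
  proof -
    have x2: "?x\<^sup>2 = l\<^sup>2 * ?t\<^sup>2 / J n" by (simp add: power_mult_distrib s_sq)
    \<comment> \<open>From c1 J \<le> t + l, multiplied by t - l; a negative t - l makes the left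
      side nonpositive.\<close>
    have "c1 * (?t - l) * J n \<le> ?t\<^sup>2"
    proof -
      have "c1 * J n * (?t - l) \<le> ?t\<^sup>2"
      proof (cases "?t \<ge> l")
        case True
        then have "c1 * J n * (?t - l) \<le> (?t + l) * (?t - l)" using k by (intro mult_right_mono) auto
        also have "\<dots> = ?t\<^sup>2 - l\<^sup>2" by (simp add: power2_eq_square algebra_simps)
        finally show ?thesis using zero_le_power2[of l] by linarith
      next
        case False
        then have "c1 * J n * (?t - l) \<le> 0" using c1 J(1)[of n] by (intro mult_nonneg_nonpos) auto
        then show ?thesis using zero_le_power2[of ?t] by linarith
      qed
      then show ?thesis by (simp add: mult_ac)
    qed
    then have "c1 * (?t - l) \<le> ?t\<^sup>2 / J n" using J(1)[of n] by (simp add: pos_le_divide_eq)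
    then have "l\<^sup>2 * (c1 * (?t - l)) \<le> l\<^sup>2 * (?t\<^sup>2 / J n)" by (intro mult_left_mono) auto
    then have "l\<^sup>2 * c1 * (?t - l) \<le> ?x\<^sup>2" by (simp only: x2 mult.assoc times_divide_eq_right)
    then show ?thesis by (simp add: algebra_simps)
  qed
  also have "2 * exp (l\<^sup>2 * c1 / 2 * (l - ?t)) = 2 * exp (l\<^sup>2 * c1 / 2 * l) * exp (- (l\<^sup>2 * c1 / 2 * ?t))"
    by (simp add: right_diff_distrib flip: exp_add)
  also have "\<dots> \<le> E' * exp (- (\<kappa>' * ?t))"
  proof (rule mult_mono)
    have "\<kappa>' * ?t \<le> l\<^sup>2 * c1 / 2 * ?t" using kappa' by (intro mult_right_mono) auto
    then show "exp (- (l\<^sup>2 * c1 / 2 * ?t)) \<le> exp (- (\<kappa>' * ?t))" by simp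
  qed (auto simp: E'_def)
  finally show ?thesis .
qed

text \<open>The rate in the scaled variable: 1/2 from the core, and half of \<open>\<kappa>'\<close>
  divided by \<open>l\<close> from the far region, where \<open>s n \<le> l\<close>. The other half
  of \<open>\<kappa>'\<close> absorbs the factor t + l in \<open>r_diff_bound\<close>.\<close>

definition rate :: real where "rate = min (1/2) (\<kappa>' / (2 * l))"

lemma rate_pos: "rate > 0" using kappa' l_pos by (simp add: rate_def)

lemma rate_core: "exp (- (1/2 * norm p)) \<le> exp (- (rate * norm (p :: real^'d)))"
proof -
  have "rate * norm p \<le> 1/2 * norm p" by (intro mult_right_mono) (auto simp: rate_def)
  then show ?thesis by simp
qed

lemma rate_far: "exp (- (\<kappa>' / 2 * norm (rvec k))) \<le> exp (- (rate * norm (s n *\<^sub>R rvec k)))"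
proof -
  have "rate * norm (s n *\<^sub>R rvec k) = rate * s n * norm (rvec k)" using s_pos[of n] by simp
  also have "\<dots> \<le> (\<kappa>' / (2 * l)) * l * norm (rvec k)"
    using s_le[of n] s_pos[of n] kappa' l_pos by (intro mult_right_mono mult_mono) (auto simp: rate_def)
  also have "\<dots> = \<kappa>' / 2 * norm (rvec k)" using l_pos by simp
  finally show ?thesis by simp
qed

lemma r_bound: "\<exists>C. \<forall>n k. \<bar>r n k\<bar> \<le> C * exp (- (rate * norm (s n *\<^sub>R rvec k)))"
proof -
  have E0: "E' \<ge> 0" unfolding E'_def by simp
  have "\<bar>r n k\<bar> \<le> (2 * exp (1/4) + E') * exp (- (rate * norm (s n *\<^sub>R rvec k)))" for n k
  proof (cases "norm (rvec k) < c1 * J n")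
    case True
    let ?x = "norm (s n *\<^sub>R rvec k)"
    have x0: "?x \<ge> 0" by simp
    have "\<bar>r n k\<bar> = u n ?x * exp (- (?x\<^sup>2))" using u0[OF x0] unfolding core[OF True] by (simp add: abs_mult)
    also have "\<dots> \<le> (1 + ?x) * exp (- (?x\<^sup>2))" using u0[OF x0] by (intro mult_right_mono) auto
    also have "\<dots> \<le> 2 * exp (1/4) * exp (- (1/2 * ?x))" by (rule profile_decay[OF x0])
    also have "\<dots> \<le> (2 * exp (1/4) + E') * exp (- (rate * ?x))"
      by (rule mult_mono[OF _ rate_core]) (use E0 in auto)
    finally show ?thesis .
  next
    case False
    then have "\<bar>r n k\<bar> \<le> E' * exp (- (\<kappa>' * norm (rvec k)))" using l_pos by (intro far') linarith
    also have "\<dots> \<le> (2 * exp (1/4) + E') * exp (- (\<kappa>' / 2 * norm (rvec k)))"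
      using E0 kappa' by (intro mult_mono) (auto intro!: mult_right_mono)
    also have "\<dots> \<le> (2 * exp (1/4) + E') * exp (- (rate * norm (s n *\<^sub>R rvec k)))"
      by (rule mult_left_mono[OF rate_far]) (use E0 in auto)
    finally show ?thesis .
  qed
  then show ?thesis by blast
qed

lemma norm_shift: "\<bar>norm (s n *\<^sub>R rvec k) - norm (s n *\<^sub>R rvec (k - L))\<bar> \<le> s n * l"
proof -
  have "\<bar>norm (s n *\<^sub>R rvec k) - norm (s n *\<^sub>R rvec (k - L))\<bar> \<le> norm (s n *\<^sub>R rvec k - s n *\<^sub>R rvec (k - L))"
    by (rule norm_triangle_ineq3)
  also have "s n *\<^sub>R rvec k - s n *\<^sub>R rvec (k - L) = s n *\<^sub>R rvec L" by (simp add: rvec_diff algebra_simps)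
  finally show ?thesis using s_pos[of n] by simp
qed

text \<open>In the core a discrete product rule applies, and both differences are controlled by |x -
  z| \<le> s l. Elsewhere the difference itself gives no smallness, and the factor
  \<open>s n\<close> is extracted from the exponential decay.\<close>

lemma r_diff_bound: "\<exists>C. \<forall>n k. \<bar>r n k - r n (k - L)\<bar> \<le> C * s n * exp (- (rate * norm (s n *\<^sub>R rvec k)))"
proof -
  define C1 where "C1 = 2 * exp (1/4) + 32 * exp (1/4) * (1 + l\<^sup>2)\<^sup>2 * exp (l\<^sup>2 / 2)"
  define C2 where "C2 = E' * (1 + exp (\<kappa>' * l)) * ((l + 2 / \<kappa>') / (c1 * l))"
  have E0: "E' \<ge> 0" unfolding E'_def by simp
  have C0: "C1 \<ge> 0" "C2 \<ge> 0" using E0 kappa' l_pos c1 by (auto simp: C1_def C2_def)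
  have "\<bar>r n k - r n (k - L)\<bar> \<le> (C1 * l + C2) * s n * exp (- (rate * norm (s n *\<^sub>R rvec k)))" for n k
  proof (cases "norm (rvec k) < c1 * J n \<and> norm (rvec (k - L)) < c1 * J n")
    case True
    let ?x = "norm (s n *\<^sub>R rvec k)" and ?z = "norm (s n *\<^sub>R rvec (k - L))"
    have x0: "?x \<ge> 0" "?z \<ge> 0" by simp_all
    have xz: "\<bar>?x - ?z\<bar> \<le> s n * l" by (rule norm_shift)
    also have "\<dots> \<le> l\<^sup>2" using s_le[of n] l_pos by (simp add: power2_eq_square)
    finally have xz2: "\<bar>?x - ?z\<bar> \<le> l\<^sup>2" .
    have e: "exp (- (?x\<^sup>2)) \<le> exp (1/4) * exp (- (1/2 * ?x))"
      using gauss_le_exp[of ?x] x0 by (rule_tac order_trans) auto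
    have "r n k - r n (k - L) = (u n ?x - u n ?z) * exp (- (?x\<^sup>2)) + u n ?z * (exp (- (?x\<^sup>2)) - exp (- (?z\<^sup>2)))"
      using core True by (simp add: algebra_simps)
    then have "\<bar>r n k - r n (k - L)\<bar> \<le> \<bar>u n ?x - u n ?z\<bar> * exp (- (?x\<^sup>2)) + u n ?z * \<bar>exp (- (?x\<^sup>2)) - exp (- (?z\<^sup>2))\<bar>"
      using u0[OF x0(2), of n] abs_triangle_ineq[of "(u n ?x - u n ?z) * exp (- (?x\<^sup>2))" "u n ?z * (exp (- (?x\<^sup>2)) - exp (- (?z\<^sup>2)))"]
      by (simp only: abs_mult abs_exp_cancel abs_of_nonneg)
    also have "\<dots> \<le> (2 * \<bar>?x - ?z\<bar>) * (exp (1/4) * exp (- (1/2 * ?x))) + (1 + ?z) * \<bar>exp (- (?x\<^sup>2)) - exp (- (?z\<^sup>2))\<bar>"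
      using u0[OF x0(2), of n] by (intro add_mono mult_mono u1[OF x0] e) auto
    also have "\<dots> \<le> (2 * \<bar>?x - ?z\<bar>) * (exp (1/4) * exp (- (1/2 * ?x))) + (32 * exp (1/4) * (1 + l\<^sup>2)\<^sup>2 * exp (l\<^sup>2 / 2)) * \<bar>?x - ?z\<bar> * exp (- (1/2 * ?x))"
      by (rule add_left_mono[OF gauss_difference[OF x0 _ xz2]]) simp
    also have "\<dots> = C1 * \<bar>?x - ?z\<bar> * exp (- (1/2 * ?x))" by (simp add: C1_def algebra_simps)
    also have "\<dots> \<le> C1 * (s n * l) * exp (- (rate * ?x))"
      by (intro mult_mono rate_core xz) (use C0 s_pos[of n] l_pos in auto)
    also have "\<dots> \<le> (C1 * l + C2) * s n * exp (- (rate * ?x))"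
      using C0 s_pos[of n] by (intro mult_right_mono) (auto simp: distrib_right)
    finally show ?thesis .
  next
    case False
    let ?t = "norm (rvec k)"
    have tri: "\<bar>?t - norm (rvec (k - L))\<bar> \<le> l"
      using norm_triangle_ineq3[of "rvec k" "rvec (k - L)"] by (simp add: rvec_diff)
    then have f: "?t \<ge> c1 * J n - l" "norm (rvec (k - L)) \<ge> c1 * J n - l" using False l_pos by auto
    have "\<bar>r n k - r n (k - L)\<bar> \<le> E' * exp (- (\<kappa>' * ?t)) + E' * exp (- (\<kappa>' * norm (rvec (k - L))))"
      using far'[OF f(1)] far'[OF f(2)] by linarith
    also have "\<dots> \<le> E' * exp (- (\<kappa>' * ?t)) + E' * (exp (\<kappa>' * l) * exp (- (\<kappa>' * ?t)))"
    proof -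
      have "\<kappa>' * ?t \<le> \<kappa>' * (norm (rvec (k - L)) + l)" using tri kappa' by (intro mult_left_mono) auto
      then have "exp (- (\<kappa>' * norm (rvec (k - L)))) \<le> exp (\<kappa>' * l) * exp (- (\<kappa>' * ?t))"
        by (simp add: algebra_simps flip: exp_add)
      then show ?thesis using E0 by (intro add_left_mono mult_left_mono) auto
    qed
    also have "\<dots> = E' * (1 + exp (\<kappa>' * l)) * exp (- (\<kappa>' * ?t))" by (simp add: algebra_simps)
    \<comment> \<open>Here t + l is at least c1 J, hence at least c1 \<surd>J = c1 l / s, so that 1
      is at most s (t + l) / (c1 l).\<close>
    also have "\<dots> \<le> E' * (1 + exp (\<kappa>' * l)) * (s n * ((?t + l) / (c1 * l)) * exp (- (\<kappa>' * ?t)))"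
    proof -
      have "sqrt (J n) \<le> J n"
        using J(1)[of n] by (intro real_le_lsqrt) (auto simp: power2_eq_square mult_le_cancel_left1)
      also have "J n \<le> (?t + l) / c1" using f(1) c1 by (simp add: pos_le_divide_eq mult.commute)
      finally have "s n * sqrt (J n) / l \<le> s n * ((?t + l) / c1) / l" using s_pos[of n] l_pos by (intro divide_right_mono mult_left_mono) auto
      moreover have "s n * sqrt (J n) / l = 1" using J(1)[of n] l_pos by (simp add: s_def)
      ultimately have "1 \<le> s n * ((?t + l) / (c1 * l))" by simp
      then have "1 * exp (- (\<kappa>' * ?t)) \<le> s n * ((?t + l) / (c1 * l)) * exp (- (\<kappa>' * ?t))" by (intro mult_right_mono) auto
      then show ?thesis using E0 by (intro mult_left_mono) auto
    qed
    also have "\<dots> = E' * (1 + exp (\<kappa>' * l)) * s n / (c1 * l) * ((?t + l) * exp (- (\<kappa>' * ?t)))" by simp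
    also have "\<dots> \<le> E' * (1 + exp (\<kappa>' * l)) * s n / (c1 * l) * ((l + 2 / \<kappa>') * exp (- (\<kappa>' / 2 * ?t)))"
      using E0 s_pos[of n] c1 l_pos kappa' by (intro mult_left_mono linear_exp_bound) auto
    also have "\<dots> = C2 * s n * exp (- (\<kappa>' / 2 * ?t))" by (simp add: C2_def)
    also have "\<dots> \<le> (C1 * l + C2) * s n * exp (- (rate * norm (s n *\<^sub>R rvec k)))"
      by (intro mult_mono rate_far) (use C0 l_pos s_pos[of n] in auto)
    finally show ?thesis .
  qed
  then show ?thesis by blast
qed

definition h :: "real^'d \<Rightarrow> real" where "h y = U (norm y) * exp (- ((norm y)\<^sup>2))"

text \<open>The derivative of \<open>h\<close> in direction \<open>L\<close> by the product rule,
  with \<open>V\<close> standing for that of the radial factor.\<close>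

definition D :: "real^'d \<Rightarrow> real" where
  "D y = (V y - 2 * (rvec L \<bullet> y) * U (norm y)) * exp (- ((norm y)\<^sup>2))"

abbreviation pt :: "nat \<Rightarrow> real^'d \<Rightarrow> real^'d" where
  "pt n y \<equiv> s n *\<^sub>R rvec (vfloor ((1 / s n) *\<^sub>R y))"

lemma pt_tendsto: "(\<lambda>n. pt n y) \<longlonglongrightarrow> y"
  by (rule vfloor_scaled_tendsto[OF s_pos s_tendsto])

text \<open>For fixed y the lattice point has norm about norm y / s, at most of order \<surd>J,
  whereas the core has radius of order J. The summand \<open>l\<close> keeps the neighbour at
  distance \<open>L\<close> in the core as well.\<close>

lemma core_eventually: "\<forall>\<^sub>F n in sequentially. norm (rvec (vfloor ((1 / s n) *\<^sub>R (y :: real^'d)))) + l < c1 * J n"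
proof -
  have "(\<lambda>n. (norm (pt n y) + s n * l) * sqrt (J n) / (l * J n)) \<longlonglongrightarrow> 0"
  proof -
    have "(\<lambda>n. (norm (pt n y) + s n * l) / l\<^sup>2 * s n) \<longlonglongrightarrow> (norm y + 0 * l) / l\<^sup>2 * 0"
      using l_pos by (intro tendsto_intros pt_tendsto s_tendsto) auto
    moreover have "(norm (pt n y) + s n * l) / l\<^sup>2 * s n = (norm (pt n y) + s n * l) * sqrt (J n) / (l * J n)" for n
    proof -
      have "sqrt (J n) * sqrt (J n) = J n" using J(1)[of n] by simp
      moreover have "w \<noteq> 0 \<Longrightarrow> l / w = l * w / (w * w)" for w :: real by simp
      moreover have "sqrt (J n) \<noteq> 0" using J(1)[of n] by simp
      ultimately have "s n = l * sqrt (J n) / J n" by (metis s_def)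
      then show ?thesis using l_pos by (simp add: power2_eq_square)
    qed
    ultimately show ?thesis by simp
  qed
  then have "\<forall>\<^sub>F n in sequentially. (norm (pt n y) + s n * l) * sqrt (J n) / (l * J n) < c1"
    using c1 by (rule order_tendstoD)
  then show ?thesis
  proof eventually_elim
    case (elim n)
    have "(norm (pt n y) + s n * l) * sqrt (J n) / l = norm (rvec (vfloor ((1 / s n) *\<^sub>R y))) + l"
      using J(1)[of n] l_pos by (simp add: s_def field_simps)
    moreover have "(norm (pt n y) + s n * l) * sqrt (J n) / (l * J n) = (norm (pt n y) + s n * l) * sqrt (J n) / l / J n" by simp
    ultimately show ?case using elim J(1)[of n] by (simp add: pos_divide_less_eq)
  qed
qed

lemma h_limit: "(\<lambda>n. r n (vfloor ((1 / s n) *\<^sub>R y))) \<longlonglongrightarrow> h y"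
proof -
  have "(\<lambda>n. u n (norm (pt n y)) * exp (- ((norm (pt n y))\<^sup>2))) \<longlonglongrightarrow> h y"
    unfolding h_def by (intro tendsto_intros U pt_tendsto) auto
  moreover have "\<forall>\<^sub>F n in sequentially. u n (norm (pt n y)) * exp (- ((norm (pt n y))\<^sup>2)) = r n (vfloor ((1 / s n) *\<^sub>R y))"
    using core_eventually[of y]
  proof eventually_elim
    case (elim n)
    then have "norm (rvec (vfloor ((1 / s n) *\<^sub>R y))) < c1 * J n" using l_pos by linarith
    then show ?case by (rule core[symmetric])
  qed
  ultimately show ?thesis by (rule Lim_transform_eventually)
qed

text \<open>Product rule, with the Gaussian difference factored at the shifted point so that a
  quotient as in \<open>exp_quotient_tendsto\<close> appears. The origin is excluded because there
  the radial factor may fail to be differentiable.\<close>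

lemma D_limit:
  assumes y: "y \<noteq> 0"
  shows "(\<lambda>n. (r n (vfloor ((1 / s n) *\<^sub>R y)) - r n (vfloor ((1 / s n) *\<^sub>R y) - L)) / s n) \<longlonglongrightarrow> D y"
proof -
  let ?p = "\<lambda>n. pt n y" and ?q = "\<lambda>n. pt n y - s n *\<^sub>R rvec L"
  have q: "?q \<longlonglongrightarrow> y"
    using tendsto_diff[OF pt_tendsto[of y] tendsto_scaleR[OF s_tendsto tendsto_const[of "rvec L"]]] by simp
  have "(\<lambda>n. ((norm (?q n))\<^sup>2 - (norm (?p n))\<^sup>2) / s n) \<longlonglongrightarrow> - 2 * (rvec L \<bullet> y)"
  proof -
    have "(\<lambda>n. s n * l\<^sup>2 - 2 * (rvec L \<bullet> ?p n)) \<longlonglongrightarrow> 0 * l\<^sup>2 - 2 * (rvec L \<bullet> y)"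
      by (intro tendsto_intros s_tendsto pt_tendsto)
    moreover have "((norm (?q n))\<^sup>2 - (norm (?p n))\<^sup>2) / s n = s n * l\<^sup>2 - 2 * (rvec L \<bullet> ?p n)" for n
    proof -
      have "(norm (?q n))\<^sup>2 - (norm (?p n))\<^sup>2 = s n * (s n * l\<^sup>2 - 2 * (rvec L \<bullet> ?p n))"
        unfolding power2_norm_eq_inner by (simp add: inner_diff_left inner_diff_right inner_commute algebra_simps)
      then show ?thesis using s_pos[of n] by simp
    qed
    ultimately show ?thesis by simp
  qed
  from exp_quotient_tendsto[OF this s_tendsto] s_pos
  have e: "(\<lambda>n. (exp ((norm (?q n))\<^sup>2 - (norm (?p n))\<^sup>2) - 1) / s n) \<longlonglongrightarrow> - 2 * (rvec L \<bullet> y)" by (simp add: less_imp_neq[symmetric])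
  have "(\<lambda>n. (u n (norm (?p n)) - u n (norm (?q n))) / s n * exp (- ((norm (?p n))\<^sup>2))
     + u n (norm (?q n)) * (exp (- ((norm (?q n))\<^sup>2)) * ((exp ((norm (?q n))\<^sup>2 - (norm (?p n))\<^sup>2) - 1) / s n)))
     \<longlonglongrightarrow> V y * exp (- ((norm y)\<^sup>2)) + U (norm y) * (exp (- ((norm y)\<^sup>2)) * (- 2 * (rvec L \<bullet> y)))"
    by (intro tendsto_add tendsto_mult V[OF pt_tendsto y] e U tendsto_exp tendsto_minus tendsto_power tendsto_norm pt_tendsto q) auto
  also have "V y * exp (- ((norm y)\<^sup>2)) + U (norm y) * (exp (- ((norm y)\<^sup>2)) * (- 2 * (rvec L \<bullet> y))) = D y"
    by (simp add: D_def algebra_simps)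
  finally have lim: "(\<lambda>n. (u n (norm (?p n)) - u n (norm (?q n))) / s n * exp (- ((norm (?p n))\<^sup>2))
     + u n (norm (?q n)) * (exp (- ((norm (?q n))\<^sup>2)) * ((exp ((norm (?q n))\<^sup>2 - (norm (?p n))\<^sup>2) - 1) / s n))) \<longlonglongrightarrow> D y" .
  show ?thesis
  proof (rule Lim_transform_eventually[OF lim])
    show "\<forall>\<^sub>F n in sequentially. (u n (norm (?p n)) - u n (norm (?q n))) / s n * exp (- ((norm (?p n))\<^sup>2))
     + u n (norm (?q n)) * (exp (- ((norm (?q n))\<^sup>2)) * ((exp ((norm (?q n))\<^sup>2 - (norm (?p n))\<^sup>2) - 1) / s n))
     = (r n (vfloor ((1 / s n) *\<^sub>R y)) - r n (vfloor ((1 / s n) *\<^sub>R y) - L)) / s n"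
      using core_eventually[of y]
    proof eventually_elim
      case (elim n)
      let ?k = "vfloor ((1 / s n) *\<^sub>R y)"
      have "norm (rvec ?k) < c1 * J n" using elim l_pos by linarith
      then have 1: "r n ?k = u n (norm (?p n)) * exp (- ((norm (?p n))\<^sup>2))" by (rule core)
      have "norm (rvec (?k - L)) < c1 * J n" using elim norm_triangle_ineq4[of "rvec ?k" "rvec L"] by (simp add: rvec_diff)
      moreover have "s n *\<^sub>R rvec (?k - L) = ?q n" by (simp add: rvec_diff algebra_simps)
      ultimately have 2: "r n (?k - L) = u n (norm (?q n)) * exp (- ((norm (?q n))\<^sup>2))" using core[of "?k - L" n] by simp
      have "exp (- ((norm (?q n))\<^sup>2)) * exp ((norm (?q n))\<^sup>2 - (norm (?p n))\<^sup>2) = exp (- ((norm (?p n))\<^sup>2))"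
        by (simp flip: exp_add)
      then have 3: "exp (- ((norm (?q n))\<^sup>2)) * (exp ((norm (?q n))\<^sup>2 - (norm (?p n))\<^sup>2) - 1) = exp (- ((norm (?p n))\<^sup>2)) - exp (- ((norm (?q n))\<^sup>2))"
        by (simp only: right_diff_distrib mult_1_right)
      show ?case unfolding 1 2 times_divide_eq_right 3 times_divide_eq_left add_divide_distrib[symmetric]
        by (simp add: algebra_simps)
    qed
  qed
qed

text \<open>\<open>h\<close> is even, so the first moment vanishes and the variance reduces to m2 /
  H.\<close>

theorem profile_UP_limit:
  fixes f :: "nat \<Rightarrow> real^'d \<Rightarrow> complex" and phase :: "nat \<Rightarrow> int^'d \<Rightarrow> complex"
  assumes fL: "\<And>n. f n \<in> L2T" and fc: "\<And>n k. fcoeff (f n) k = of_real (\<gamma> n) * phase n k * of_real (r n k)"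
    and \<gamma>: "\<And>n. \<gamma> n > 0" and ph: "\<And>n k. cmod (phase n k) = 1"
    and ph': "\<And>n k. phase n (k - L) * cnj (phase n k) = \<omega> n"
    and H: "integral\<^sup>L lborel (\<lambda>y. (h y)\<^sup>2) = H" "H > 0" and K: "integral\<^sup>L lborel (\<lambda>y. (D y)\<^sup>2) = K"
    and m2: "integral\<^sup>L lborel (\<lambda>y. (rvec L \<bullet> y)\<^sup>2 * (h y)\<^sup>2) = m2"
  shows "\<forall>\<^sub>F n in sequentially. f n \<in> UP_domain L"
    and "(\<lambda>n. UP L (f n)) \<longlonglongrightarrow> 1 / l ^ 4 * (K / H * (m2 / H))"
proof -
  obtain C1 where C1: "\<And>n k. \<bar>r n k\<bar> \<le> C1 * exp (- (rate * norm (s n *\<^sub>R rvec k)))" using r_bound by blast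
  obtain C2 where C2: "\<And>n k. \<bar>r n k - r n (k - L)\<bar> \<le> C2 * s n * exp (- (rate * norm (s n *\<^sub>R rvec k)))" using r_diff_bound by blast
  let ?C = "max C1 C2"
  have b1: "\<bar>r n k\<bar> \<le> ?C * exp (- (rate * norm (s n *\<^sub>R rvec k)))" for n k
    by (rule order_trans[OF C1]) (intro mult_right_mono, auto)
  have b2: "\<bar>r n k - r n (k - L)\<bar> \<le> ?C * s n * exp (- (rate * norm (s n *\<^sub>R rvec k)))" for n k
    by (rule order_trans[OF C2]) (intro mult_right_mono, use s_pos[of n] in auto)
  have hm: "h \<in> borel_measurable borel" unfolding h_def using Um by measurable
  have Dm: "D \<in> borel_measurable borel" unfolding D_def using Um Vm by measurable
  have a: "AE y in lborel. (\<lambda>n. r n (vfloor ((1 / s n) *\<^sub>R y))) \<longlonglongrightarrow> h y" by (intro AE_I2 h_limit)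
  have b: "AE y in lborel. (\<lambda>n. (r n (vfloor ((1 / s n) *\<^sub>R y)) - r n (vfloor ((1 / s n) *\<^sub>R y) - L)) / s n) \<longlonglongrightarrow> D y"
    using AE_lborel_singleton[of "0 :: real^'d"] by eventually_elim (rule D_limit)
  have m1: "integral\<^sup>L lborel (\<lambda>y. (rvec L \<bullet> y) * (h y)\<^sup>2) = 0"
    by (rule integral_odd) (use hm in measurable, simp add: h_def)
  note lim = UP_limit[OF fL fc \<gamma> ph ph' L s_pos s_le s_tendsto rate_pos b1 b2 hm Dm a b, unfolded H K m1 m2, OF H(2)]
  show "\<forall>\<^sub>F n in sequentially. f n \<in> UP_domain L" by (rule lim(1))
  show "(\<lambda>n. UP L (f n)) \<longlonglongrightarrow> 1 / l ^ 4 * (K / H * (m2 / H))" using lim(2) by simp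
qed

end

context scaling_sequences
begin

text \<open>Between c j and c (j + 1) the Gaussian formula itself satisfies the exponential bound.
  The far regime may thus start exactly where the core of \<open>gaussian_profile\<close>
  ends.\<close>

lemma xi_far:
  obtains c where "c > 0"
    "\<And>j k. norm (rvec k) < c * (real j + 1) \<Longrightarrow> k \<in> intK B j"
    "\<And>j k. j \<ge> 1 \<Longrightarrow> norm (rvec k) < c * (real j + 1) \<Longrightarrow>
        xi_hat \<nu> j k = exp (- (\<Lambda> * (norm (rvec k))\<^sup>2) / real j)"
    "\<And>j k. j \<ge> 1 \<Longrightarrow> norm (rvec k) \<ge> c * real j \<Longrightarrow> xi_hat \<nu> j k \<le> exp (- (\<Lambda> * c * norm (rvec k)))"
proof -
  obtain c where c: "c > 0"
    and i: "\<And>j k. norm (rvec k) < c * (real j + 1) \<Longrightarrow> k \<in> intK B j"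
    and g: "\<And>j k. j \<ge> 1 \<Longrightarrow> norm (rvec k) < c * (real j + 1) \<Longrightarrow>
        xi_hat \<nu> j k = exp (- (\<Lambda> * (norm (rvec k))\<^sup>2) / real j)"
    and f: "\<And>j k. norm (rvec k) \<ge> c * (real j + 1) \<Longrightarrow> xi_hat \<nu> j k \<le> exp (- (\<Lambda> * c * norm (rvec k)))"
    using xi_asymptotics by blast
  have far: "xi_hat \<nu> j k \<le> exp (- (\<Lambda> * c * norm (rvec k)))" if j: "j \<ge> 1" and k: "norm (rvec k) \<ge> c * real j" for j k
  proof (cases "norm (rvec k) < c * (real j + 1)")
    case True
    have "(\<Lambda> * norm (rvec k)) * (c * real j) \<le> (\<Lambda> * norm (rvec k)) * norm (rvec k)" using k by (intro mult_left_mono) auto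
    then have "\<Lambda> * c * norm (rvec k) \<le> \<Lambda> * (norm (rvec k))\<^sup>2 / real j"
      using j by (simp add: pos_le_divide_eq power2_eq_square mult_ac)
    then show ?thesis using g[OF j True] by simp
  next
    case False then show ?thesis using f by simp
  qed
  show thesis using that[OF c i g far] .
qed

end

section \<open>Uncertainty products of the scaling functions\<close>

context wavelet_system
begin

text \<open>The radial factor is 1 and its difference quotient 0. The moments of orders 2 and 0 have
  ratio d / 4, so K / H is norm L^2 and m2 / H is norm L^2 / 4, whence 1/4. Indices start at 1
  because the Gaussian exponent contains 1/j.\<close>

lemma UP_phi_limit:
  shows "\<forall>\<^sub>F n in sequentially. \<phi> (Suc n) \<in> UP_domain L"
    and "(\<lambda>n. UP L (\<phi> (Suc n))) \<longlonglongrightarrow> 1 / 4"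
proof -
  let ?J = "\<lambda>n. real (Suc n)"
  let ?s = "\<lambda>n. norm (rvec L) / sqrt (?J n)"
  let ?r = "\<lambda>n. xi_hat \<nu> (Suc n)"
  let ?d = "real CARD('a)"
  obtain c where c: "c > 0"
    and g: "\<And>j k. j \<ge> 1 \<Longrightarrow> norm (rvec k) < c * (real j + 1) \<Longrightarrow>
        xi_hat \<nu> j k = exp (- (\<Lambda> * (norm (rvec k))\<^sup>2) / real j)"
    and far: "\<And>j k. j \<ge> 1 \<Longrightarrow> norm (rvec k) \<ge> c * real j \<Longrightarrow> xi_hat \<nu> j k \<le> exp (- (\<Lambda> * c * norm (rvec k)))"
    using xi_far by metis
  interpret p: gaussian_profile L ?J c "\<Lambda> * c" 1 "\<lambda>_ _. 1" ?r ?s "\<lambda>_. 1" "\<lambda>_. 0"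
  proof
    show "filterlim ?J at_top sequentially"
      by (rule filterlim_compose[OF filterlim_real_sequentially filterlim_Suc])
    show "\<Lambda> * c > 0" using c Lambda_pos by simp
    fix n and k :: "int^'a" assume "norm (rvec k) < c * ?J n"
    then have "norm (rvec k) < c * (real (Suc n) + 1)" using c by (simp add: distrib_left)
    then have "?r n k = exp (- (\<Lambda> * (norm (rvec k))\<^sup>2) / ?J n)" using g[of "Suc n" k] by simp
    then show "?r n k = 1 * exp (- ((norm (?s n *\<^sub>R rvec k))\<^sup>2))"
      by (simp add: power_mult_distrib power_divide)
  next
    fix n and k :: "int^'a" assume "norm (rvec k) \<ge> c * ?J n"
    then show "\<bar>?r n k\<bar> \<le> 1 * exp (- (\<Lambda> * c * norm (rvec k)))" using far[of "Suc n" k] xi_bounds(1)[of "Suc n" k] by simp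
  qed (use L_nonzero c in auto)
  have sq: "(exp (- q))\<^sup>2 = exp (- 2 * q)" for q :: real by (simp add: power2_eq_square flip: exp_add)
  have H: "integral\<^sup>L lborel (\<lambda>y. (p.h y)\<^sup>2) = gmoment TYPE('a) 0"
    by (simp add: p.h_def sq gmoment_def)
  have w: "(\<lambda>t :: real. exp (- 2 * t\<^sup>2)) \<in> borel_measurable borel" by measurable
  have i2: "integrable lborel (\<lambda>x :: real^'a. (norm x)\<^sup>2 * exp (- 2 * (norm x)\<^sup>2))"
    by (rule integrable_gauss) simp
  have iso: "integral\<^sup>L lborel (\<lambda>x. (rvec L \<bullet> x)\<^sup>2 * exp (- 2 * (norm x)\<^sup>2)) = \<Lambda> / ?d * gmoment TYPE('a) 2"
    using isotropy[OF w i2, of "rvec L"] by (simp add: gmoment_def)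
  have m2: "integral\<^sup>L lborel (\<lambda>y. (rvec L \<bullet> y)\<^sup>2 * (p.h y)\<^sup>2) = \<Lambda> / ?d * gmoment TYPE('a) 2"
    unfolding iso[symmetric] by (simp add: p.h_def sq)
  have K: "integral\<^sup>L lborel (\<lambda>y. (p.D y)\<^sup>2) = 4 * (\<Lambda> / ?d * gmoment TYPE('a) 2)"
  proof -
    have "(\<lambda>y. (p.D y)\<^sup>2) = (\<lambda>y. 4 * ((rvec L \<bullet> y)\<^sup>2 * exp (- 2 * (norm y)\<^sup>2)))"
      by (rule ext) (simp add: p.D_def power_mult_distrib sq)
    then show ?thesis unfolding iso[symmetric] by (simp only: integral_mult_right_zero)
  qed
  have gm2: "gmoment TYPE('a) 2 = ?d / 4 * gmoment TYPE('a) 0" using gmoment_recursion[of 0] by (simp add: numeral_2_eq_2)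
  have fc: "fcoeff (\<phi> (Suc n)) k = of_real (2 powr (- real (Suc n) / 2)) * 1 * of_real (?r n k)" for n k
    by (simp add: fcoeff_phi X_def)
  note lim = p.profile_UP_limit[OF phi_L2T fc _ _ _ H gmoment_pos K m2, where \<omega> = "\<lambda>_. 1"]
  show "\<forall>\<^sub>F n in sequentially. \<phi> (Suc n) \<in> UP_domain L" by (rule lim(1)) auto
  have val: "1 / l ^ 4 * ((4 * (l\<^sup>2 / D * (D / 4 * M))) / M * ((l\<^sup>2 / D * (D / 4 * M)) / M)) = 1 / 4"
    if "l > 0" "D > 0" "M > 0" for l D M :: real
    using that by (simp add: field_simps power2_eq_square power4_eq_xxxx)
  have lim2: "(\<lambda>n. UP L (\<phi> (Suc n))) \<longlonglongrightarrow> 1 / norm (rvec L) ^ 4 * ((4 * (\<Lambda> / ?d * gmoment TYPE('a) 2)) / gmoment TYPE('a) 0 * ((\<Lambda> / ?d * gmoment TYPE('a) 2) / gmoment TYPE('a) 0))"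
    by (rule lim(2)) auto
  have d: "?d > 0" by simp
  show "(\<lambda>n. UP L (\<phi> (Suc n))) \<longlonglongrightarrow> 1 / 4"
    using lim2 unfolding gm2 val[OF p.l_pos d gmoment_pos[where 'd = 'a]] .
qed

end

text \<open>The factor \<open>\<nu>\<^sub>j\<^sub>+\<^sub>1(k + B\<^sup>j k\<^sub>0) = \<surd>(1 - f\<^sub>j\<^sub>+\<^sub>1(k)\<^sup>2)\<close> in the variable \<open>x = \<parallel>L\<parallel> \<parallel>k\<parallel> / \<surd>(j + 1)\<close>,
  multiplied by \<open>\<surd>(j/2)\<close> so that it tends to \<open>x\<close>.\<close>

definition damp :: "real \<Rightarrow> real \<Rightarrow> real" where
  "damp j x = sqrt (j / 2 * (1 - exp (- 2 * x\<^sup>2 / j)))"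

lemma damp_sq: "j > 0 \<Longrightarrow> (damp j x)\<^sup>2 = j / 2 * (1 - exp (- 2 * x\<^sup>2 / j))"
  and damp_nonneg: "j > 0 \<Longrightarrow> 0 \<le> damp j x"
  by (simp_all add: damp_def)

lemma damp_le:
  assumes j: "j > 0" and x: "x \<ge> 0" shows "damp j x \<le> x"
proof -
  have "1 - exp (- 2 * x\<^sup>2 / j) \<le> 2 * x\<^sup>2 / j" using exp_ge_add_one_self[of "- 2 * x\<^sup>2 / j"] by linarith
  then have "j / 2 * (1 - exp (- 2 * x\<^sup>2 / j)) \<le> j / 2 * (2 * x\<^sup>2 / j)" using j by (intro mult_left_mono) auto
  also have "\<dots> = x\<^sup>2" using j by simp
  finally show ?thesis unfolding damp_def using x by (rule_tac real_le_lsqrt) auto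
qed

text \<open>From (1 + t) exp (- t) \<le> 1 with t = 2 x^2 / j. It bounds the denominator in the
  Lipschitz estimate from below.\<close>

lemma damp_ge:
  assumes j: "j > 0" and x: "x \<ge> 0" shows "x * exp (- x\<^sup>2 / j) \<le> damp j x"
proof -
  let ?t = "2 * x\<^sup>2 / j"
  have "?t * exp (- ?t) \<le> 1 - exp (- ?t)"
  proof -
    have "(1 + ?t) * exp (- ?t) \<le> exp ?t * exp (- ?t)" by (intro mult_right_mono exp_ge_add_one_self) auto
    then show ?thesis by (simp add: distrib_right flip: exp_add)
  qed
  then have "j / 2 * (?t * exp (- ?t)) \<le> j / 2 * (1 - exp (- ?t))" using j by (intro mult_left_mono) auto
  moreover have "j / 2 * (?t * exp (- ?t)) = (x * exp (- x\<^sup>2 / j))\<^sup>2"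
    using j by (simp add: power_mult_distrib power2_eq_square flip: exp_add)
  ultimately show ?thesis unfolding damp_def by (intro real_le_rsqrt) simp
qed

text \<open>A square root is delicate near 0, so two cases are separated. For x \<le> 2 z the
  difference of squares is divided by the sum, which is at least 2 z exp (- z^2 / j); an equal
  exponential in the numerator cancels it, so the constant is independent of j. For x > 2 z the
  bound damp x \<le> x already suffices.\<close>

lemma damp_lipschitz_aux:
  assumes j: "j > 0" and x: "0 \<le> z" "z \<le> x" shows "\<bar>damp j x - damp j z\<bar> \<le> 2 * (x - z)"
proof -
  have z2: "z\<^sup>2 \<le> x\<^sup>2" using x by (intro power_mono) auto
  have mono: "damp j z \<le> damp j x"
    unfolding damp_def using j z2 by (intro real_sqrt_le_mono mult_left_mono) (auto intro!: divide_right_mono)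
  have "damp j x - damp j z \<le> 2 * (x - z)"
  proof (cases "x \<le> 2 * z \<and> z < x")
    case True
    then have z: "z > 0" by linarith
    let ?e = "exp (- z\<^sup>2 / j)"
    have e: "0 < ?e" "?e \<le> 1" using j by auto
    have "(damp j x)\<^sup>2 - (damp j z)\<^sup>2 = j / 2 * (exp (- 2 * z\<^sup>2 / j) - exp (- 2 * x\<^sup>2 / j))"
      using j by (simp add: damp_sq algebra_simps)
    also have "exp (- 2 * z\<^sup>2 / j) - exp (- 2 * x\<^sup>2 / j) = exp (- 2 * z\<^sup>2 / j) * (1 - exp (- (2 * (x\<^sup>2 - z\<^sup>2) / j)))"
      by (simp add: right_diff_distrib diff_divide_distrib flip: exp_add)
    also have "j / 2 * \<dots> \<le> j / 2 * (exp (- 2 * z\<^sup>2 / j) * (2 * (x\<^sup>2 - z\<^sup>2) / j))"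
      using j exp_ge_add_one_self[of "- (2 * (x\<^sup>2 - z\<^sup>2) / j)"] by (intro mult_left_mono) (linarith, auto)
    also have "\<dots> = exp (- 2 * z\<^sup>2 / j) * (x\<^sup>2 - z\<^sup>2)" using j by simp
    also have "exp (- 2 * z\<^sup>2 / j) = ?e * ?e" by (simp flip: exp_add)
    also have "?e * ?e * (x\<^sup>2 - z\<^sup>2) \<le> ?e * 1 * (x\<^sup>2 - z\<^sup>2)" using e z2 by (intro mult_right_mono mult_left_mono) auto
    also have "\<dots> = ?e * ((x - z) * (x + z))" by (simp add: power2_eq_square algebra_simps)
    also have "\<dots> \<le> ?e * ((x - z) * (4 * z))" using True x e by (intro mult_left_mono) auto
    finally have 1: "(damp j x - damp j z) * (damp j x + damp j z) \<le> (2 * (x - z)) * (2 * (z * ?e))"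
      by (simp add: power2_eq_square algebra_simps)
    have 2: "2 * (z * ?e) \<le> damp j x + damp j z" using damp_ge[OF j x(1)] mono by linarith
    have "0 < 2 * (z * ?e)" using z e by simp
    show ?thesis
    proof (rule ccontr)
      assume "\<not> damp j x - damp j z \<le> 2 * (x - z)"
      then have "(2 * (x - z)) * (2 * (z * ?e)) < (damp j x - damp j z) * (damp j x + damp j z)"
        using 2 \<open>0 < 2 * (z * ?e)\<close> True by (intro mult_less_le_imp_less) auto
      then show False using 1 by linarith
    qed
  next
    case False
    then consider "x = z" | "2 * z < x" using x by linarith
    then show ?thesis
    proof cases
      case 2
      have "0 \<le> x" using x by linarith
      from damp_le[OF j this] damp_nonneg[OF j, of z] have "damp j x - damp j z \<le> x" by linarith
      also have "x \<le> 2 * (x - z)" using 2 by simp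
      finally show ?thesis .
    qed simp
  qed
  then show ?thesis using mono by simp
qed

lemma damp_lipschitz: "j > 0 \<Longrightarrow> x \<ge> 0 \<Longrightarrow> z \<ge> 0 \<Longrightarrow> \<bar>damp j x - damp j z\<bar> \<le> 2 * \<bar>x - z\<bar>"
  using damp_lipschitz_aux[of j z x] damp_lipschitz_aux[of j x z] by (cases "z \<le> x") (auto simp: abs_minus_commute)

lemma damp_tendsto:
  assumes "\<And>n. x n \<ge> 0" "x \<longlonglongrightarrow> y"
  shows "(\<lambda>n. damp (real (Suc n)) (x n)) \<longlonglongrightarrow> y"
proof -
  let ?s = "\<lambda>n. 2 / real (Suc n)"
  have t0: "?s \<longlonglongrightarrow> 0" using LIMSEQ_Suc[OF lim_const_over_n[of 2]] by simp
  have "(\<lambda>n. (- 2 * (x n)\<^sup>2 / real (Suc n)) / ?s n) \<longlonglongrightarrow> - (y\<^sup>2)"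
    using tendsto_minus[OF tendsto_power[OF assms(2), of 2]] by simp
  from exp_quotient_tendsto[OF this t0]
  have "(\<lambda>n. (exp (- 2 * (x n)\<^sup>2 / real (Suc n)) - 1) / ?s n) \<longlonglongrightarrow> - (y\<^sup>2)" by simp
  then have "(\<lambda>n. sqrt (- ((exp (- 2 * (x n)\<^sup>2 / real (Suc n)) - 1) / ?s n))) \<longlonglongrightarrow> sqrt (- (- (y\<^sup>2)))"
    by (intro tendsto_intros)
  moreover have "- ((exp (- 2 * (x n)\<^sup>2 / real (Suc n)) - 1) / ?s n) = real (Suc n) / 2 * (1 - exp (- 2 * (x n)\<^sup>2 / real (Suc n)))" for n
    by (simp add: field_simps)
  moreover have "y \<ge> 0" by (rule LIMSEQ_le_const[OF assms(2)]) (use assms(1) in auto)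
  ultimately have "(\<lambda>n. damp (real (Suc n)) (x n)) \<longlonglongrightarrow> sqrt (- (- (y\<^sup>2)))" and "y \<ge> 0"
    unfolding damp_def by (simp_all only:)
  then show ?thesis by simp
qed

text \<open>The difference of the squares is a difference of exponentials. It is divided by the sum
  of the two values, which tends to twice norm y; this is why y must be nonzero.\<close>

lemma damp_quotient_tendsto:
  fixes p :: "nat \<Rightarrow> real^'d" and v :: "real^'d"
  assumes p: "p \<longlonglongrightarrow> y" and y: "y \<noteq> 0" and s: "s \<longlonglongrightarrow> 0" "\<And>n. s n > 0"
  shows "(\<lambda>n. (damp (real (Suc n)) (norm (p n)) - damp (real (Suc n)) (norm (p n - s n *\<^sub>R v))) / s n) \<longlonglongrightarrow> (v \<bullet> y) / norm y"
proof -
  let ?q = "\<lambda>n. p n - s n *\<^sub>R v"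
  let ?a = "\<lambda>n. damp (real (Suc n)) (norm (p n))" and ?b = "\<lambda>n. damp (real (Suc n)) (norm (?q n))"
  let ?x = "\<lambda>n. (norm (p n))\<^sup>2" and ?z = "\<lambda>n. (norm (?q n))\<^sup>2"
  let ?t = "\<lambda>n. 2 * s n / real (Suc n)"
  have r0: "(\<lambda>n. 1 / real (Suc n)) \<longlonglongrightarrow> 0" using LIMSEQ_Suc[OF lim_1_over_n] by simp
  have q: "?q \<longlonglongrightarrow> y"
    using tendsto_diff[OF p tendsto_scaleR[OF s(1) tendsto_const[of v]]] by simp
  have ab: "?a \<longlonglongrightarrow> norm y" "?b \<longlonglongrightarrow> norm y"
    by (intro damp_tendsto tendsto_norm p q norm_ge_zero)+
  have d: "(\<lambda>n. (?x n - ?z n) / s n) \<longlonglongrightarrow> 2 * (v \<bullet> y)"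
  proof -
    have "(\<lambda>n. 2 * (v \<bullet> p n) - s n * (norm v)\<^sup>2) \<longlonglongrightarrow> 2 * (v \<bullet> y) - 0 * (norm v)\<^sup>2"
      by (intro tendsto_intros p s)
    moreover have "(?x n - ?z n) / s n = 2 * (v \<bullet> p n) - s n * (norm v)\<^sup>2" for n
    proof -
      have "?x n - ?z n = s n * (2 * (v \<bullet> p n) - s n * (norm v)\<^sup>2)"
        unfolding power2_norm_eq_inner by (simp add: inner_diff_left inner_diff_right inner_commute algebra_simps)
      then show ?thesis using s(2)[of n] by simp
    qed
    ultimately show ?thesis by simp
  qed
  have t0: "?t \<longlonglongrightarrow> 0"
    using tendsto_mult[OF tendsto_mult[OF tendsto_const[of 2] s(1)] r0] by simp
  have cancel: "(2 * a / real (Suc n)) / (2 * b / real (Suc n)) = a / b" for a b n by simp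
  have "(\<lambda>n. (2 * (?x n - ?z n) / real (Suc n)) / ?t n) \<longlonglongrightarrow> 2 * (v \<bullet> y)"
    using d by (simp only: cancel)
  from exp_quotient_tendsto[OF this t0]
  have e: "(\<lambda>n. (exp (2 * (?x n - ?z n) / real (Suc n)) - 1) / ?t n) \<longlonglongrightarrow> 2 * (v \<bullet> y)"
    using s(2) by (simp add: less_imp_neq[symmetric])
  have "(\<lambda>n. exp (- 2 * ?x n * (1 / real (Suc n))) * ((exp (2 * (?x n - ?z n) / real (Suc n)) - 1) / ?t n) / (?a n + ?b n))
     \<longlonglongrightarrow> exp (- 2 * (norm y)\<^sup>2 * 0) * (2 * (v \<bullet> y)) / (norm y + norm y)"
    using y by (intro tendsto_divide tendsto_mult e tendsto_exp tendsto_const tendsto_power tendsto_norm p r0 tendsto_add ab) auto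
  moreover have "exp (- 2 * ?x n * (1 / real (Suc n))) * ((exp (2 * (?x n - ?z n) / real (Suc n)) - 1) / ?t n) / (?a n + ?b n)
     = (?a n - ?b n) / s n" for n
  proof -
    let ?j = "real (Suc n)"
    have j: "?j > 0" by simp
    have ee: "exp (- 2 * ?x n * (1 / ?j)) * (exp (2 * (?x n - ?z n) / ?j) - 1) = exp (- 2 * ?z n / ?j) - exp (- 2 * ?x n / ?j)"
      by (simp add: right_diff_distrib diff_divide_distrib flip: exp_add)
    have sq: "(?a n)\<^sup>2 - (?b n)\<^sup>2 = ?j / 2 * (exp (- 2 * ?z n / ?j) - exp (- 2 * ?x n / ?j))"
      unfolding damp_sq[OF j] by (simp only: algebra_simps)
    have q: "a / (2 * b / c) = (c / 2 * a) / b" for a b c :: real by simp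
    have "exp (- 2 * ?x n * (1 / ?j)) * ((exp (2 * (?x n - ?z n) / ?j) - 1) / ?t n) = ((?a n)\<^sup>2 - (?b n)\<^sup>2) / s n"
      unfolding sq times_divide_eq_right[of "exp (- 2 * ?x n * (1 / ?j))"] ee by (rule q)
    also have "\<dots> = (?a n - ?b n) / s n * (?a n + ?b n)" by (simp add: power2_eq_square algebra_simps)
    finally show ?thesis using damp_nonneg[OF j, of "norm (p n)"] damp_nonneg[OF j, of "norm (?q n)"]
      by (cases "?a n + ?b n = 0") (simp_all add: add_nonneg_eq_0_iff del: of_nat_Suc)
  qed
  ultimately show ?thesis by simp
qed

section \<open>Uncertainty products of the wavelet functions\<close>

context wavelet_system
begin

text \<open>\<open>\<psi> (n + 1)\<close> is built from level n + 2: the Gaussian has parameter n +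
  2, and in the same scaled variable the mask factor has parameter n + 1, because its exponent
  carries (n + 2) (n + 1). The radial factor norm y gives K / H = norm L^2 (d^2 - 2 d + 4) / d^2 and
  m2 / H = norm L^2 (d + 2) / (4 d).\<close>

lemma UP_psi_limit:
  shows "\<forall>\<^sub>F n in sequentially. \<psi> (Suc n) \<in> UP_domain L"
    and "(\<lambda>n. UP L (\<psi> (Suc n))) \<longlonglongrightarrow>
        1 / 4 * ((real CARD('a) + 2) * ((real CARD('a))\<^sup>2 - 2 * real CARD('a) + 4) / (real CARD('a)) ^ 3)"
proof -
  let ?j = "\<lambda>n. real (Suc n)"
  let ?J = "\<lambda>n. real (Suc (Suc n))"
  let ?s = "\<lambda>n. norm (rvec L) / sqrt (?J n)"
  let ?shift = "\<lambda>n. matpow B (Suc n) *v k0"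
  \<comment> \<open>The factor \<surd>(j/2) undoes the decay of the mask factor, which is about x
    \<surd>(2/j); its inverse goes into the normalisation \<open>\<gamma>\<close>.\<close>
  let ?r = "\<lambda>n k. sqrt (?j n / 2) * (\<nu> (Suc (Suc n)) (k + ?shift n) * xi_hat \<nu> (Suc (Suc n)) k)"
  let ?d = "real CARD('a)"
  obtain c where c: "c > 0"
    and int: "\<And>j k. norm (rvec k) < c * (real j + 1) \<Longrightarrow> k \<in> intK B j"
    and g: "\<And>j k. j \<ge> 1 \<Longrightarrow> norm (rvec k) < c * (real j + 1) \<Longrightarrow>
        xi_hat \<nu> j k = exp (- (\<Lambda> * (norm (rvec k))\<^sup>2) / real j)"
    and far: "\<And>j k. j \<ge> 1 \<Longrightarrow> norm (rvec k) \<ge> c * real j \<Longrightarrow> xi_hat \<nu> j k \<le> exp (- (\<Lambda> * c * norm (rvec k)))"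
    using xi_far by metis
  have s0: "?s \<longlonglongrightarrow> 0"
  proof -
    have "filterlim (\<lambda>n. sqrt (?J n)) at_top sequentially"
      by (rule filterlim_compose[OF sqrt_at_top filterlim_compose[OF filterlim_real_sequentially filterlim_compose[OF filterlim_Suc filterlim_Suc]]])
    then show ?thesis by (intro tendsto_divide_0[OF tendsto_const] filterlim_at_top_imp_at_infinity)
  qed
  have lpos: "norm (rvec L) > 0" using Lambda_pos by simp
  have kc: "\<Lambda> * c > 0" using c Lambda_pos by simp
  \<comment> \<open>In the far region \<surd>(j/2) is at most norm k / c, and half of the rate
    \<Lambda> c absorbs norm k. This explains the far rate and constant supplied here.\<close>
  interpret p: gaussian_profile L ?J c "\<Lambda> * c / 2" "(1 / c) * (2 / (\<Lambda> * c))" "\<lambda>n. damp (?j n)" ?r ?s "\<lambda>x. x" "\<lambda>y. (rvec L \<bullet> y) / norm y"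
  proof
    show "filterlim ?J at_top sequentially"
      by (rule filterlim_compose[OF filterlim_real_sequentially filterlim_compose[OF filterlim_Suc filterlim_Suc]])
    show "\<Lambda> * c / 2 > 0" using kc by simp
    show "0 \<le> damp (?j n) x \<and> damp (?j n) x \<le> 1 + x" if "x \<ge> 0" for n x
      using damp_nonneg[of "?j n" x] damp_le[of "?j n" x] that by simp
    show "\<bar>damp (?j n) x - damp (?j n) z\<bar> \<le> 2 * \<bar>x - z\<bar>" if "x \<ge> 0" "z \<ge> 0" for n x z
      using that by (intro damp_lipschitz) auto
    show "(\<lambda>n. damp (?j n) (x n)) \<longlonglongrightarrow> y" if "\<And>n. x n \<ge> 0" "x \<longlonglongrightarrow> y" for x y
      by (rule damp_tendsto[OF that])
    show "(\<lambda>n. (damp (?j n) (norm (p n)) - damp (?j n) (norm (p n - ?s n *\<^sub>R rvec L))) / ?s n) \<longlonglongrightarrow> (rvec L \<bullet> y) / norm y"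
      if "p \<longlonglongrightarrow> y" "y \<noteq> 0" for p y
      using damp_quotient_tendsto[OF that s0] lpos by simp
    show "?r n k = damp (?j n) (norm (?s n *\<^sub>R rvec k)) * exp (- ((norm (?s n *\<^sub>R rvec k))\<^sup>2))"
      if k: "norm (rvec k) < c * ?J n" for n and k :: "int^'a"
    proof -
      have k1: "norm (rvec k) < c * (real (Suc n) + 1)" using k by (simp add: add.commute)
      have k2: "norm (rvec k) < c * (real (Suc (Suc n)) + 1)" using k c by (simp add: distrib_left)
      have x2: "(norm (?s n *\<^sub>R rvec k))\<^sup>2 = \<Lambda> * (norm (rvec k))\<^sup>2 / ?J n"
        by (simp add: power_mult_distrib power_divide)
      have xi: "xi_hat \<nu> (Suc (Suc n)) k = exp (- ((norm (?s n *\<^sub>R rvec k))\<^sup>2))"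
        unfolding x2 using g[OF _ k2] by simp
      have f: "(fseq L (Suc (Suc n)) k)\<^sup>2 = exp (- 2 * (norm (?s n *\<^sub>R rvec k))\<^sup>2 / ?j n)"
      proof -
        have "(fseq L (Suc (Suc n)) k)\<^sup>2 = exp (2 * (- (\<Lambda> * (norm (rvec k))\<^sup>2) / (?J n * ?j n)))"
          unfolding fseq_def exp_double by simp
        also have "2 * (- (\<Lambda> * (norm (rvec k))\<^sup>2) / (?J n * ?j n)) = - 2 * (norm (?s n *\<^sub>R rvec k))\<^sup>2 / ?j n"
          unfolding x2 by simp
        finally show ?thesis .
      qed
      have nu: "\<nu> (Suc (Suc n)) (k + ?shift n) = sqrt (1 - exp (- 2 * (norm (?s n *\<^sub>R rvec k))\<^sup>2 / ?j n))"
        using nu_shift[OF int[OF k1]] by (simp only: f)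
      show ?thesis unfolding xi nu damp_def real_sqrt_mult by simp
    qed
    show "\<bar>?r n k\<bar> \<le> (1 / c) * (2 / (\<Lambda> * c)) * exp (- (\<Lambda> * c / 2 * norm (rvec k)))"
      if k: "norm (rvec k) \<ge> c * ?J n" for n and k :: "int^'a"
    proof -
      let ?t = "norm (rvec k)"
      have b: "0 \<le> \<nu> (Suc (Suc n)) (k + ?shift n)" "\<nu> (Suc (Suc n)) (k + ?shift n) \<le> 1" using nu_bounds by auto
      have x: "0 \<le> xi_hat \<nu> (Suc (Suc n)) k" "xi_hat \<nu> (Suc (Suc n)) k \<le> exp (- (\<Lambda> * c * ?t))"
        using xi_bounds far[OF _ k] by auto
      have "sqrt (?j n / 2) \<le> ?t / c"
      proof -
        have "sqrt (?j n / 2) \<le> sqrt (?J n * ?J n)" by (intro real_sqrt_le_mono) (auto simp: field_simps)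
        also have "\<dots> \<le> ?t / c" using k c by (simp add: pos_le_divide_eq mult.commute)
        finally show ?thesis .
      qed
      then have "\<bar>?r n k\<bar> \<le> (?t / c) * (1 * exp (- (\<Lambda> * c * ?t)))"
        unfolding abs_mult using b x c by (intro mult_mono) auto
      also have "\<dots> = (1 / c) * ((?t + 0) * exp (- (\<Lambda> * c * ?t)))" by simp
      also have "\<dots> \<le> (1 / c) * ((0 + 2 / (\<Lambda> * c)) * exp (- (\<Lambda> * c / 2 * ?t)))"
        using c kc by (intro mult_left_mono linear_exp_bound) auto
      finally show ?thesis by (simp only: add_0 mult.assoc)
    qed
  qed (use L_nonzero c in auto)
  have sq: "(exp (- q))\<^sup>2 = exp (- 2 * q)" for q :: real by (simp add: power2_eq_square flip: exp_add)
  let ?m = "gmoment TYPE('a)"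
  have H: "integral\<^sup>L lborel (\<lambda>y. (p.h y)\<^sup>2) = ?m 2"
    by (simp add: p.h_def sq gmoment_def power_mult_distrib)
  have m2: "integral\<^sup>L lborel (\<lambda>y. (rvec L \<bullet> y)\<^sup>2 * (p.h y)\<^sup>2) = \<Lambda> / ?d * ?m 4"
  proof -
    have w: "(\<lambda>t :: real. t\<^sup>2 * exp (- 2 * t\<^sup>2)) \<in> borel_measurable borel" by measurable
    have i: "integrable lborel (\<lambda>x :: real^'a. (norm x)\<^sup>2 * ((norm x)\<^sup>2 * exp (- 2 * (norm x)\<^sup>2)))"
      using integrable_gauss[of 2 4, where 'd='a] by (simp add: power4_eq_xxxx power2_eq_square mult.assoc)
    have "integral\<^sup>L lborel (\<lambda>y. (rvec L \<bullet> y)\<^sup>2 * (p.h y)\<^sup>2) = integral\<^sup>L lborel (\<lambda>y. (rvec L \<bullet> y)\<^sup>2 * ((norm y)\<^sup>2 * exp (- 2 * (norm y)\<^sup>2)))"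
      by (simp add: p.h_def sq power_mult_distrib)
    also have "\<dots> = \<Lambda> / ?d * integral\<^sup>L lborel (\<lambda>x :: real^'a. (norm x)\<^sup>2 * ((norm x)\<^sup>2 * exp (- 2 * (norm x)\<^sup>2)))"
      by (rule isotropy[OF w i])
    also have "integral\<^sup>L lborel (\<lambda>x :: real^'a. (norm x)\<^sup>2 * ((norm x)\<^sup>2 * exp (- 2 * (norm x)\<^sup>2))) = ?m 4"
      by (simp add: gmoment_def power4_eq_xxxx power2_eq_square mult.assoc)
    finally show ?thesis .
  qed
  have K: "integral\<^sup>L lborel (\<lambda>y. (p.D y)\<^sup>2) = \<Lambda> / ?d * (?m 0 - 4 * ?m 2 + 4 * ?m 4)"
  proof -
    \<comment> \<open>\<open>p.D\<close> is <L, y> times a radial function, so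
      \<open>isotropy\<close> applies with a weight singular at the origin. Multiplied by t^2 this
      weight is almost everywhere the polynomial 1 - 4 t^2 + 4 t^4 times a Gaussian.\<close>
    define w :: "real \<Rightarrow> real" where "w t = (1 / t - 2 * t)\<^sup>2 * exp (- 2 * t\<^sup>2)" for t
    have w: "w \<in> borel_measurable borel" unfolding w_def by measurable
    let ?v = "\<lambda>x :: real^'a. norm x ^ 0 * exp (- 2 * (norm x)\<^sup>2) - 4 * (norm x ^ 2 * exp (- 2 * (norm x)\<^sup>2)) + 4 * (norm x ^ 4 * exp (- 2 * (norm x)\<^sup>2))"
    have ig: "integrable lborel (\<lambda>x :: real^'a. norm x ^ q * exp (- 2 * (norm x)\<^sup>2))" for q by (rule integrable_gauss) simp
    have iv: "integrable lborel ?v" by (intro Bochner_Integration.integrable_add Bochner_Integration.integrable_diff integrable_mult_right ig)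
    have ae: "AE x :: real^'a in lborel. ?v x = (norm x)\<^sup>2 * w (norm x)"
      using AE_lborel_singleton[of "0 :: real^'a"]
    proof eventually_elim
      case (elim x)
      have n: "norm x \<noteq> 0" using elim by simp
      have "(t\<^sup>2 * (1 / t - 2 * t)\<^sup>2) = 1 - 4 * t\<^sup>2 + 4 * t ^ 4" if "t \<noteq> 0" for t :: real
      proof -
        have "t\<^sup>2 * (1 / t - 2 * t)\<^sup>2 = (1 - 2 * t\<^sup>2)\<^sup>2"
          unfolding power_mult_distrib[symmetric] using that by (simp add: right_diff_distrib power2_eq_square)
        then show ?thesis by (simp add: power2_eq_square power4_eq_xxxx algebra_simps)
      qed
      note sq = this[OF n]
      show ?case unfolding w_def mult.assoc[symmetric] sq by (simp add: distrib_right left_diff_distrib)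
    qed
    have wm: "(\<lambda>x :: real^'a. (norm x)\<^sup>2 * w (norm x)) \<in> borel_measurable lborel" using w by measurable
    have vm: "?v \<in> borel_measurable lborel" using iv by (rule borel_measurable_integrable)
    have i: "integrable lborel (\<lambda>x :: real^'a. (norm x)\<^sup>2 * w (norm x))"
      using integrable_cong_AE[OF vm wm ae] iv by blast
    have "integral\<^sup>L lborel (\<lambda>y. (p.D y)\<^sup>2) = integral\<^sup>L lborel (\<lambda>y. (rvec L \<bullet> y)\<^sup>2 * w (norm y))"
    proof (intro Bochner_Integration.integral_cong refl)
      fix y :: "real^'a"
      have "p.D y = (rvec L \<bullet> y) * (1 / norm y - 2 * norm y) * exp (- ((norm y)\<^sup>2))"
        by (simp add: p.D_def algebra_simps)
      then show "(p.D y)\<^sup>2 = (rvec L \<bullet> y)\<^sup>2 * w (norm y)" by (simp only: power_mult_distrib sq w_def mult.assoc)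
    qed
    also have "\<dots> = \<Lambda> / ?d * integral\<^sup>L lborel (\<lambda>x :: real^'a. (norm x)\<^sup>2 * w (norm x))" by (rule isotropy[OF w i])
    also have "integral\<^sup>L lborel (\<lambda>x :: real^'a. (norm x)\<^sup>2 * w (norm x)) = integral\<^sup>L lborel ?v"
      by (rule integral_cong_AE[OF vm wm ae, symmetric])
    also have "\<dots> = ?m 0 - 4 * ?m 2 + 4 * ?m 4"
      by (simp only: gmoment_def Bochner_Integration.integral_add Bochner_Integration.integral_diff integrable_mult_right ig
        Bochner_Integration.integrable_add Bochner_Integration.integrable_diff integral_mult_right_zero)
    finally show ?thesis .
  qed
  have gm2: "?m 2 = ?d / 4 * ?m 0" using gmoment_recursion[of 0, where 'd='a] by (simp add: numeral_2_eq_2)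
  have gm4: "?m 4 = (?d + 2) / 4 * (?d / 4 * ?m 0)" using gmoment_recursion[of 2, where 'd='a] unfolding gm2 by simp
  have pos: "?m 0 > 0" by (rule gmoment_pos)
  have d: "?d > 0" by simp
  have Hpos: "?m 2 > 0" unfolding gm2 using pos d by simp
  have fc: "fcoeff (\<psi> (Suc n)) k = of_real (2 powr (- real (Suc n) / 2) / sqrt (?j n / 2)) * chi (Suc (Suc n)) k k0 * of_real (?r n k)" for n k
  proof -
    have "sqrt (?j n / 2) \<noteq> 0" by simp
    then have "complex_of_real (2 powr (- real (Suc n) / 2)) = of_real (2 powr (- real (Suc n) / 2) / sqrt (?j n / 2)) * of_real (sqrt (?j n / 2))"
      unfolding of_real_mult[symmetric] by simp
    then show ?thesis unfolding fcoeff_psi X_def of_real_mult by (simp only: mult_ac)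
  qed
  have ph: "chi (Suc (Suc n)) (k - L) k0 * cnj (chi (Suc (Suc n)) k k0) = chi (Suc (Suc n)) (- L) k0" for n k
  proof -
    have "chi (Suc (Suc n)) (- L) k0 = chi (Suc (Suc n)) ((k - L) + (- k)) k0" by simp
    then show ?thesis by (simp only: chi_add1 chi_minus1)
  qed
  have gpos: "2 powr (- real (Suc n) / 2) / sqrt (?j n / 2) > 0" for n by simp
  note lim = p.profile_UP_limit[OF psi_L2T fc gpos norm_chi ph H Hpos K m2]
  show "\<forall>\<^sub>F n in sequentially. \<psi> (Suc n) \<in> UP_domain L" by (rule lim(1))
  have val: "1 / l ^ 4 * ((l\<^sup>2 / D * (M - 4 * (D / 4 * M) + 4 * ((D + 2) / 4 * (D / 4 * M)))) / (D / 4 * M) * ((l\<^sup>2 / D * ((D + 2) / 4 * (D / 4 * M))) / (D / 4 * M)))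
      = 1 / 4 * ((D + 2) * (D\<^sup>2 - 2 * D + 4) / D ^ 3)" if "l > 0" "D > 0" "M > 0" for l D M :: real
    using that by (simp add: field_simps power2_eq_square power3_eq_cube power4_eq_xxxx)
  show "(\<lambda>n. UP L (\<psi> (Suc n))) \<longlonglongrightarrow> 1 / 4 * ((?d + 2) * (?d\<^sup>2 - 2 * ?d + 4) / ?d ^ 3)"
    using lim(2) unfolding gm4 gm2 val[OF lpos d pos] .
qed

end

theorem theorem6:
  fixes A :: "int^'d^'d" and L k0 :: "int^'d"
    and \<nu> :: "nat \<Rightarrow> int^'d \<Rightarrow> real"
    and \<phi> \<psi> :: "nat \<Rightarrow> real^'d \<Rightarrow> complex"
    and R :: "nat \<Rightarrow> (int^'d) set"
  assumes "L \<noteq> 0"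
    and "dilation_matrix A" and "det A = 2"
    and "coset_reps A {0, k0}"
    and "scaling_seq (transpose A) L k0 \<nu>"
    and "scaling_functions \<nu> \<phi>"
    and "wavelet_functions (transpose A) k0 \<nu> \<phi> \<psi>"
    and "\<And>j. coset_reps (matpow A j) (R j)"
  shows "parseval_frame (Psi_index R) (Psi_family A \<phi> \<psi>)
    \<and> (\<forall>\<^sub>F j in sequentially. \<phi> j \<in> UP_domain L)
    \<and> (\<lambda>j. UP L (\<phi> j)) \<longlonglongrightarrow> 1 / 4
    \<and> (\<forall>\<^sub>F j in sequentially. \<psi> j \<in> UP_domain L)
    \<and> (\<lambda>j. UP L (\<psi> j)) \<longlonglongrightarrow>
        1 / 4 * ((real CARD('d) + 2) * ((real CARD('d))\<^sup>2 - 2 * real CARD('d) + 4)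
                 / (real CARD('d)) ^ 3)"
proof -
  interpret wavelet_system A "transpose A" k0 L \<nu> \<phi> \<psi>
    by unfold_locales (use assms scaling_seq_k0_notin in blast)+
  \<comment> \<open>The limits were obtained for the indices n + 1; both kinds of statement are
    stable under this shift.\<close>
  have ev: "(\<forall>\<^sub>F j in sequentially. P j) \<longleftrightarrow> (\<forall>\<^sub>F j in sequentially. P (Suc j))" for P
    by (rule eventually_sequentially_Suc[symmetric])
  show ?thesis
    using parseval_frame_Psi[OF assms(8)] UP_phi_limit UP_psi_limit
    unfolding ev[of "\<lambda>j. \<phi> j \<in> UP_domain L"] ev[of "\<lambda>j. \<psi> j \<in> UP_domain L"]
    by (intro conjI) (auto dest: LIMSEQ_imp_Suc)
qed

end
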